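(* (a) Let $n\ge 1$ and $\mathfrak g=\mathfrak{gl}(n|n)$ (type $A(n-1|n-1)$). The sum $\sum_{w\in T'}w(Re^{\hat\rho})$ is a well-defined element of $\mathcal R$ and $$\hat R\,e^{\hat\rho}\cdot f(q,e^{\mathrm{str}})=\sum_{w\in T'}w(Re^{\hat\rho}),\qquad f(q,e^{\mathrm{str}})=\frac{\prod_{k=1}^{\infty}\bigl(1-(-1)^nq^ke^{\mathrm{str}}\bigr)\cdot\prod_{k=1}^{\infty}\bigl(1-(-1)^nq^ke^{-\mathrm{str}}\bigr)}{\prod_{k=1}^{\infty}(1-q^k)^2}.$$ (b) Let $n\ge 1$ and $\mathfrak g=D(n+1|n)$, or let $\mathfrak g=D(2,1,a)$. The sum $\sum_{w\in T'}w(Re^{\hat\rho})$ is a well-defined element of $\mathcal R$ and $$\hat R\,e^{\hat\rho}\cdot f(q)=\sum_{w\in T'}w(Re^{\hat\rho}),\qquad f(q)=\prod_{k=1}^{\infty}(1-q^k)^{-1}.$$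
   Context: Root systems. For $\mathfrak g=\mathfrak{gl}(n|n)$, $\mathfrak h^*$ has basis $\varepsilon_1,\dots,\varepsilon_n,\delta_1,\dots,\delta_n$; the even roots are $\Delta_0=\{\varepsilon_i-\varepsilon_j\}_{i\ne j}\sqcup\{\delta_i-\delta_j\}_{i\neq j}$, the odd roots are $\Delta_1=\{\pm(\varepsilon_i-\delta_j)\}_{1\le i,j\le n}$, $\operatorname{rank}\mathfrak g=2n$, and $\mathrm{str}=\sum_{i=1}^n(\varepsilon_i-\delta_i)$ (the restriction of the supertrace to $\mathfrak h$). For $\mathfrak g=D(n+1|n)=\mathfrak{osp}(2n+2|2n)$, $\mathfrak h^*$ has basis $\varepsilon_1,\dots,\varepsilon_{n+1},\delta_1,\dots,\delta_n$; $\Delta_0=\{\pm\varepsilon_i\pm\varepsilon_j\}_{i<j}\sqcup\bigl(\{\pm\delta_s\pm\delta_t\}_{s<t}\cup\{\pm2\delta_s\}\bigr)$, $\Delta_1=\{\pm\varepsilon_i\pm\delta_s\}$, $\operatorname{rank}\mathfrak g=2n+1$. The bilinear form on $\mathfrak h^*$ is given by $-(\varepsilon_i,\varepsilon_j)=(\delta_i,\delta_j)=\delta_{ij}$, $(\varepsilon_i,\delta_j)=0$. The root datum of $D(2,1,a)$ is identified with that of $D(2|1)$, and for $D(2,1,a)$ all objects below are those of $D(2|1)$. Fix a set of positive roots $\Delta_+$ of $\mathfrak g$, with $\Delta_{+0}=\Delta_+\cap\Delta_0$, $\Delta_{+1}=\Delta_+\cap\Delta_1$, $\Delta=\Delta_0\cup\Delta_1$.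 Let $\delta$ be the minimal imaginary root of the non-twisted affinization $\hat{\mathfrak g}$ of $\mathfrak g$ (orthogonal to $\mathfrak h^*$ and to itself), $q=e^{-\delta}$, and let $\hat\Delta_+=\Delta_+\cup\{\alpha+k\delta:\alpha\in\Delta,k\ge1\}\cup\{k\delta:k\ge1\}$ be the positive roots of $\hat{\mathfrak g}$. Set $\hat Q^+=\sum_{\mu\in\hat\Delta_+}\mathbb Z_{\ge0}\mu$. The (affine) Weyl denominators are $R=R_0/R_1$, $\hat R=\hat R_0/\hat R_1$ with $$R_0=\prod_{\alpha\in\Delta_{+0}}(1-e^{-\alpha}),\quad \hat R_0=R_0\prod_{k\ge1}(1-q^k)^{\operatorname{rank}\mathfrak g}\prod_{\alpha\in\Delta_0}(1-q^ke^{-\alpha}),$$ $$R_1=\prod_{\alpha\in\Delta_{+1}}(1+e^{-\alpha}),\quad \hat R_1=R_1\prod_{k\ge1}\prod_{\alpha\in\Delta_1}(1+q^ke^{-\alpha}).$$ In these cases (zero dual Coxeter number) $\hat\rho=\rho=\frac12\bigl(\sum_{\alpha\in\Delta_{+0}}\alpha-\sum_{\alpha\in\Delta_{+1}}\alpha\bigr)$. The group $T'$. For $D(n+1|n)$ let $\Delta'=\{\pm\delta_s\pm\delta_t\}_{s<t}\cup\{\pm2\delta_s\}$ (type $C_n$); for $\mathfrak{gl}(n|n)$ let $\Delta'$ be either one of the two components $\{\delta_i-\delta_j\}$, $\{\varepsilon_i-\varepsilon_j\}$ of $\Delta_0$. $T'$ is the translation group of the affine Weyl group $\hat W'=W'\ltimes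 T'$ of $\Delta'$. Explicitly $T'=\{t_\mu:\mu\in M\}$, where $t_\mu(\lambda)=\lambda-(\lambda,\mu)\delta$ for $\lambda\in\mathfrak h^*\oplus\mathbb C\delta$, with $M=\bigoplus_{i=1}^n\mathbb Z\delta_i$ for $D(n+1|n)$, and $M=\sum_i\mathbb Z(\delta_i-\delta_{i+1})$ (resp. $\sum_i\mathbb Z(\varepsilon_i-\varepsilon_{i+1})$) for $\mathfrak{gl}(n|n)$ with $\Delta'=\{\delta_i-\delta_j\}$ (resp. $\{\varepsilon_i-\varepsilon_j\}$). The algebra $\mathcal R$: it consists of the formal sums $\sum_{\nu}b_\nu e^\nu$ ($b_\nu\in\mathbb Q$, $\nu\in\hat{\mathfrak h}^*$, the dual of the Cartan subalgebra of $\hat{\mathfrak g}$) whose support lies in a finite union of sets $\lambda-\hat Q^+$, with the natural multiplication $e^\mu e^\nu=e^{\mu+\nu}$. All (infinite) products above and their inverses are expanded in $\mathcal R$ by geometric series in $e^{-\gamma}$, $\gamma\in\hat\Delta_+$; for $w\in T'$, $w(Re^{\hat\rho})$ is $e^{w\hat\rho}\prod_{\alpha\in\Delta_{+0}}(1-e^{-w\alpha})\prod_{\beta\in\Delta_{+1}}(1+e^{-w\beta})^{-1}$ expanded in $\mathcal R$, where if $w\beta\in-\hat\Delta_+$ one uses $(1+e^{-w\beta})^{-1}=e^{w\beta}(1+e^{w\beta})^{-1}$. The infinite sum over $T'$ being well-defined means that each coefficient receives only finitely many nonzero contributions. *)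

theory Defs
  imports Complex_Main "HOL-Algebra.Ring" "HOL-Library.Function_Algebras"
begin

section \<open>Weights\<close>

text \<open>
  A weight is given by its coordinates with respect to the basis
  \<open>\<epsilon>\<^sub>1, \<epsilon>\<^sub>2, \<dots>, \<delta>\<^sub>1, \<delta>\<^sub>2, \<dots>, \<delta>, \<Lambda>\<^sub>0\<close>, where \<open>\<delta>\<close> is the minimal imaginary root and
  \<open>\<Lambda>\<^sub>0\<close> completes the basis of the dual of the Cartan subalgebra of the affinization.
  Addition of weights and of formal sums is the pointwise one of \<^theory>\<open>HOL-Library.Function_Algebras\<close>;
  the pointwise product of that theory plays no role.
\<close>

datatype coord = CEps nat | CDlt nat | CImag | CLevel

type_synonym weight = "coord \<Rightarrow> complex"

definition unit_weight :: "coord \<Rightarrow> weight" where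
  "unit_weight c = (\<lambda>i. if i = c then 1 else 0)"

abbreviation eps :: "nat \<Rightarrow> weight" where "eps i \<equiv> unit_weight (CEps i)"
abbreviation dlt :: "nat \<Rightarrow> weight" where "dlt i \<equiv> unit_weight (CDlt i)"
abbreviation im_root :: weight where "im_root \<equiv> unit_weight CImag"

definition scl :: "'b::times \<Rightarrow> ('a \<Rightarrow> 'b) \<Rightarrow> 'a \<Rightarrow> 'b" where
  "scl c v = (\<lambda>i. c * v i)"


section \<open>Root data\<close>

text \<open>
  \<open>GL n\<close> is \<open>gl(n|n)\<close>, \<open>OSP n\<close> is \<open>D(n+1|n) = osp(2n+2|2n)\<close> and \<open>D21 a\<close> is \<open>D(2,1,a)\<close>,
  whose root datum is identified with that of \<open>D(2|1)\<close>.
\<close>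

datatype superalgebra = GL nat | OSP nat | D21 complex

fun eps_dim :: "superalgebra \<Rightarrow> nat" where
  "eps_dim (GL n) = n"
| "eps_dim (OSP n) = n + 1"
| "eps_dim (D21 a) = 2"

fun dlt_dim :: "superalgebra \<Rightarrow> nat" where
  "dlt_dim (GL n) = n"
| "dlt_dim (OSP n) = n"
| "dlt_dim (D21 a) = 1"

fun rank :: "superalgebra \<Rightarrow> nat" where
  "rank (GL n) = 2 * n"
| "rank (OSP n) = 2 * n + 1"
| "rank (D21 a) = 3"

definition even_roots_OSP :: "nat \<Rightarrow> weight set" where
  "even_roots_OSP n =
     {scl s (eps i) + scl t (eps j) | s t i j.
        s \<in> {1, -1} \<and> t \<in> {1, -1} \<and> i \<in> {1..n+1} \<and> j \<in> {1..n+1} \<and> i < j} \<union>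
     ({scl s (dlt i) + scl t (dlt j) | s t i j.
        s \<in> {1, -1} \<and> t \<in> {1, -1} \<and> i \<in> {1..n} \<and> j \<in> {1..n} \<and> i < j} \<union>
      {scl s (scl 2 (dlt i)) | s i. s \<in> {1, -1} \<and> i \<in> {1..n}})"

definition odd_roots_OSP :: "nat \<Rightarrow> weight set" where
  "odd_roots_OSP n =
     {scl s (eps i) + scl t (dlt j) | s t i j.
        s \<in> {1, -1} \<and> t \<in> {1, -1} \<and> i \<in> {1..n+1} \<and> j \<in> {1..n}}"

fun even_roots :: "superalgebra \<Rightarrow> weight set" where
  "even_roots (GL n) =
     {eps i - eps j | i j. i \<in> {1..n} \<and> j \<in> {1..n} \<and> i \<noteq> j} \<union>
     {dlt i - dlt j | i j. i \<in> {1..n} \<and> j \<in> {1..n} \<and> i \<noteq> j}"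
| "even_roots (OSP n) = even_roots_OSP n"
| "even_roots (D21 a) = even_roots_OSP 1"

fun odd_roots :: "superalgebra \<Rightarrow> weight set" where
  "odd_roots (GL n) =
     {scl s (eps i - dlt j) | s i j. s \<in> {1, -1} \<and> i \<in> {1..n} \<and> j \<in> {1..n}}"
| "odd_roots (OSP n) = odd_roots_OSP n"
| "odd_roots (D21 a) = odd_roots_OSP 1"

definition roots :: "superalgebra \<Rightarrow> weight set" where
  "roots g = even_roots g \<union> odd_roots g"

text \<open>The restriction of the supertrace to the Cartan subalgebra of \<open>gl(n|n)\<close>.\<close>

definition str :: "nat \<Rightarrow> weight" where
  "str n = (\<Sum>i\<in>{1..n}. eps i - dlt i)"

text \<open>
  The form on the span of the \<open>\<epsilon>\<^sub>i\<close>, \<open>\<delta>\<^sub>j\<close> and \<open>\<delta>\<close>, with \<open>\<delta>\<close> in its radical. The \<open>\<Lambda>\<^sub>0\<close>-coordinate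
  is ignored, so on weights of nonzero level this is not the usual invariant form;
  it is only applied to weights of level zero.
\<close>

definition form :: "superalgebra \<Rightarrow> weight \<Rightarrow> weight \<Rightarrow> complex" where
  "form g l m = (\<Sum>i\<in>{1..dlt_dim g}. l (CDlt i) * m (CDlt i))
              - (\<Sum>i\<in>{1..eps_dim g}. l (CEps i) * m (CEps i))"

text \<open>
  A set of positive roots is cut out by an element \<open>h\<close> of the real Cartan subalgebra
  (given by its dual coordinates) on which no root vanishes.
\<close>

definition pairing :: "superalgebra \<Rightarrow> (coord \<Rightarrow> real) \<Rightarrow> weight \<Rightarrow> real" where
  "pairing g h l = (\<Sum>i\<in>{1..eps_dim g}. h (CEps i) * Re (l (CEps i)))
                 + (\<Sum>i\<in>{1..dlt_dim g}. h (CDlt i) * Re (l (CDlt i)))"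

definition positive_root_set :: "superalgebra \<Rightarrow> weight set \<Rightarrow> bool" where
  "positive_root_set g P \<longleftrightarrow>
     (\<exists>h. (\<forall>\<alpha>\<in>roots g. pairing g h \<alpha> \<noteq> 0) \<and> P = {\<alpha> \<in> roots g. pairing g h \<alpha> > 0})"

definition pos_even :: "superalgebra \<Rightarrow> weight set \<Rightarrow> weight set" where
  "pos_even g P = P \<inter> even_roots g"

definition pos_odd :: "superalgebra \<Rightarrow> weight set \<Rightarrow> weight set" where
  "pos_odd g P = P \<inter> odd_roots g"

text \<open>The dual Coxeter number is zero, so this is also the affine Weyl vector.\<close>

definition rho :: "superalgebra \<Rightarrow> weight set \<Rightarrow> weight" where
  "rho g P = scl (1/2) ((\<Sum>\<alpha>\<in>pos_even g P. \<alpha>) - (\<Sum>\<alpha>\<in>pos_odd g P. \<alpha>))"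

abbreviation kdelta :: "nat \<Rightarrow> weight" where
  "kdelta k \<equiv> scl (of_nat k) im_root"

definition aff_pos :: "superalgebra \<Rightarrow> weight set \<Rightarrow> weight set" where
  "aff_pos g P = P \<union> {\<alpha> + kdelta k | \<alpha> k. \<alpha> \<in> roots g \<and> k \<ge> 1}
                   \<union> {kdelta k | k. k \<ge> 1}"

definition aff_Q_plus :: "superalgebra \<Rightarrow> weight set \<Rightarrow> weight set" where
  "aff_Q_plus g P =
     {\<Sum>\<gamma>\<in>S. scl (of_nat (c \<gamma>)) \<gamma> | S (c :: weight \<Rightarrow> nat). finite S \<and> S \<subseteq> aff_pos g P}"


section \<open>The translation groups\<close>

definition transl :: "superalgebra \<Rightarrow> weight \<Rightarrow> weight \<Rightarrow> weight" where
  "transl g \<mu> l = l - scl (form g l \<mu>) im_root"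

definition lattice_OSP :: "nat \<Rightarrow> weight set" where
  "lattice_OSP n = {\<Sum>i\<in>{1..n}. scl (of_int (c i)) (dlt i) | c :: nat \<Rightarrow> int. True}"

definition lattice_GL_dlt :: "nat \<Rightarrow> weight set" where
  "lattice_GL_dlt n =
     {\<Sum>i\<in>{1..<n}. scl (of_int (c i)) (dlt i - dlt (i+1)) | c :: nat \<Rightarrow> int. True}"

definition lattice_GL_eps :: "nat \<Rightarrow> weight set" where
  "lattice_GL_eps n =
     {\<Sum>i\<in>{1..<n}. scl (of_int (c i)) (eps i - eps (i+1)) | c :: nat \<Rightarrow> int. True}"

text \<open>The possible groups \<open>T'\<close>: for \<open>gl(n|n)\<close> there is one for each component of the even roots.\<close>

fun transl_groups :: "superalgebra \<Rightarrow> (weight \<Rightarrow> weight) set set" where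
  "transl_groups (GL n) = {transl (GL n) ` lattice_GL_dlt n, transl (GL n) ` lattice_GL_eps n}"
| "transl_groups (OSP n) = {transl (OSP n) ` lattice_OSP n}"
| "transl_groups (D21 a) = {transl (D21 a) ` lattice_OSP 1}"


section \<open>The algebra of formal sums\<close>

text \<open>The formal sum of the \<open>b \<nu> e\<^sup>\<nu>\<close> is represented by its coefficient function \<open>b\<close>.\<close>

type_synonym fsum = "weight \<Rightarrow> rat"

definition aff_weights :: "superalgebra \<Rightarrow> weight set" where
  "aff_weights g = {l. (\<forall>i. i \<notin> {1..eps_dim g} \<longrightarrow> l (CEps i) = 0) \<and>
                       (\<forall>i. i \<notin> {1..dlt_dim g} \<longrightarrow> l (CDlt i) = 0)}"

definition fexp :: "weight \<Rightarrow> fsum" where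
  "fexp l = (\<lambda>\<nu>. if \<nu> = l then 1 else 0)"

text \<open>The index set below is finite whenever both factors belong to the algebra.\<close>

definition fmult :: "fsum \<Rightarrow> fsum \<Rightarrow> fsum" where
  "fmult a b = (\<lambda>\<nu>. \<Sum>\<mu> | a \<mu> \<noteq> 0 \<and> b (\<nu> - \<mu>) \<noteq> 0. a \<mu> * b (\<nu> - \<mu>))"

definition fsum_ring :: "superalgebra \<Rightarrow> weight set \<Rightarrow> fsum ring" where
  "fsum_ring g P =
     \<lparr>carrier = {b. \<exists>L. finite L \<and> L \<subseteq> aff_weights g \<and>
                    {\<nu>. b \<nu> \<noteq> 0} \<subseteq> (\<Union>l\<in>L. {l - \<gamma> | \<gamma>. \<gamma> \<in> aff_Q_plus g P})},
      monoid.mult = fmult,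
      one = fexp 0,
      zero = (\<lambda>_. 0),
      add = (\<lambda>a b \<nu>. a \<nu> + b \<nu>)\<rparr>"

text \<open>The product of \<open>F k\<close> over \<open>k \<ge> 1\<close>: each coefficient is the eventual value of that
  coefficient in the partial products.\<close>

definition inf_prod :: "superalgebra \<Rightarrow> weight set \<Rightarrow> (nat \<Rightarrow> fsum) \<Rightarrow> fsum" where
  "inf_prod g P F =
     (\<lambda>\<nu>. THE c. \<forall>\<^sub>F N in sequentially. (\<Otimes>\<^bsub>fsum_ring g P\<^esub>k\<in>{1..N}. F k) \<nu> = c)"

text \<open>\<open>geom c \<gamma>\<close> is the geometric series of \<open>(1 - c e\<^sup>-\<^sup>\<gamma>)\<^sup>-\<^sup>1\<close> in \<open>e\<^sup>-\<^sup>\<gamma>\<close>, for \<open>\<gamma> \<noteq> 0\<close>.\<close>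

definition geom :: "rat \<Rightarrow> weight \<Rightarrow> fsum" where
  "geom c \<gamma> = (\<lambda>\<nu>. \<Sum>k | \<nu> = - scl (of_nat k) \<gamma>. c ^ k)"

text \<open>The expansion of \<open>(1 + e\<^sup>-\<^sup>\<gamma>)\<^sup>-\<^sup>1\<close>; if \<open>-\<gamma>\<close> is a positive affine root, it is that of
  \<open>e\<^sup>\<gamma> (1 + e\<^sup>\<gamma>)\<^sup>-\<^sup>1\<close>.\<close>

definition inv_one_plus :: "superalgebra \<Rightarrow> weight set \<Rightarrow> weight \<Rightarrow> fsum" where
  "inv_one_plus g P \<gamma> =
     (if \<gamma> \<in> aff_pos g P then geom (-1) \<gamma> else fexp \<gamma> \<otimes>\<^bsub>fsum_ring g P\<^esub> geom (-1) (- \<gamma>))"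


section \<open>Denominators\<close>

text \<open>Here \<open>q\<^sup>k\<close> is \<open>fexp (- kdelta k)\<close>.\<close>

definition den_R0 :: "superalgebra \<Rightarrow> weight set \<Rightarrow> fsum" where
  "den_R0 g P = (\<Otimes>\<^bsub>fsum_ring g P\<^esub>\<alpha>\<in>pos_even g P. fexp 0 - fexp (- \<alpha>))"

definition den_R1_inv :: "superalgebra \<Rightarrow> weight set \<Rightarrow> fsum" where
  "den_R1_inv g P = (\<Otimes>\<^bsub>fsum_ring g P\<^esub>\<alpha>\<in>pos_odd g P. geom (-1) \<alpha>)"

definition aff_den_R0 :: "superalgebra \<Rightarrow> weight set \<Rightarrow> fsum" where
  "aff_den_R0 g P =
     den_R0 g P \<otimes>\<^bsub>fsum_ring g P\<^esub>
     inf_prod g P (\<lambda>k.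
       (fexp 0 - fexp (- kdelta k)) [^]\<^bsub>fsum_ring g P\<^esub> rank g
       \<otimes>\<^bsub>fsum_ring g P\<^esub>
       (\<Otimes>\<^bsub>fsum_ring g P\<^esub>\<alpha>\<in>even_roots g. fexp 0 - fexp (- (\<alpha> + kdelta k))))"

definition aff_den_R1_inv :: "superalgebra \<Rightarrow> weight set \<Rightarrow> fsum" where
  "aff_den_R1_inv g P =
     den_R1_inv g P \<otimes>\<^bsub>fsum_ring g P\<^esub>
     inf_prod g P (\<lambda>k. \<Otimes>\<^bsub>fsum_ring g P\<^esub>\<alpha>\<in>odd_roots g. geom (-1) (\<alpha> + kdelta k))"

definition aff_den :: "superalgebra \<Rightarrow> weight set \<Rightarrow> fsum" where
  "aff_den g P = aff_den_R0 g P \<otimes>\<^bsub>fsum_ring g P\<^esub> aff_den_R1_inv g P"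

text \<open>\<open>w (R e\<^sup>\<rho>)\<close> for a translation \<open>w\<close>\<close>

definition transl_den :: "superalgebra \<Rightarrow> weight set \<Rightarrow> (weight \<Rightarrow> weight) \<Rightarrow> fsum" where
  "transl_den g P w =
     fexp (w (rho g P))
     \<otimes>\<^bsub>fsum_ring g P\<^esub> (\<Otimes>\<^bsub>fsum_ring g P\<^esub>\<alpha>\<in>pos_even g P. fexp 0 - fexp (- w \<alpha>))
     \<otimes>\<^bsub>fsum_ring g P\<^esub> (\<Otimes>\<^bsub>fsum_ring g P\<^esub>\<beta>\<in>pos_odd g P. inv_one_plus g P (w \<beta>))"

text \<open>Coefficientwise sums; meaningful if \<open>coeff_finite\<close> holds.\<close>

definition coeff_finite :: "'i set \<Rightarrow> ('i \<Rightarrow> fsum) \<Rightarrow> bool" where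
  "coeff_finite I F \<longleftrightarrow> (\<forall>\<nu>. finite {i \<in> I. F i \<nu> \<noteq> 0})"

definition coeff_sum :: "'i set \<Rightarrow> ('i \<Rightarrow> fsum) \<Rightarrow> fsum" where
  "coeff_sum I F = (\<lambda>\<nu>. \<Sum>i | i \<in> I \<and> F i \<nu> \<noteq> 0. F i \<nu>)"

fun f_factor :: "superalgebra \<Rightarrow> weight set \<Rightarrow> fsum" where
  "f_factor (GL n) P =
     inf_prod (GL n) P (\<lambda>k. fexp 0 - scl ((-1) ^ n) (fexp (str n - kdelta k)))
     \<otimes>\<^bsub>fsum_ring (GL n) P\<^esub>
     inf_prod (GL n) P (\<lambda>k. fexp 0 - scl ((-1) ^ n) (fexp (- str n - kdelta k)))
     \<otimes>\<^bsub>fsum_ring (GL n) P\<^esub>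
     inf_prod (GL n) P (\<lambda>k. geom 1 (kdelta k) [^]\<^bsub>fsum_ring (GL n) P\<^esub> (2::nat))"
| "f_factor (OSP n) P = inf_prod (OSP n) P (\<lambda>k. geom 1 (kdelta k))"
| "f_factor (D21 a) P = inf_prod (D21 a) P (\<lambda>k. geom 1 (kdelta k))"

definition denominator_identity ::
    "superalgebra \<Rightarrow> weight set \<Rightarrow> (weight \<Rightarrow> weight) set \<Rightarrow> bool" where
  "denominator_identity g P T \<longleftrightarrow>
     (\<forall>w\<in>T. transl_den g P w \<in> carrier (fsum_ring g P)) \<and>
     coeff_finite T (transl_den g P) \<and>
     coeff_sum T (transl_den g P) \<in> carrier (fsum_ring g P) \<and>
     aff_den g P \<otimes>\<^bsub>fsum_ring g P\<^esub> fexp (rho g P) \<otimes>\<^bsub>fsum_ring g P\<^esub> f_factor g P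
       = coeff_sum T (transl_den g P)"

end

theory Submission
  imports Defs "HOL-Analysis.Analysis" "HOL-Real_Asymp.Real_Asymp" "Jordan_Normal_Form.Determinant"
begin

text \<open>
  Both sides of the identity are formal sums, and they are compared through their values at
  sufficiently many characters. Choose an additive height function \<open>H\<close> on weights that is positive on
  the positive affine roots and takes integrally independent values on the coordinate weights
  (\<open>generic_perturbation\<close>, \<open>datum_exists\<close>). For every \<open>s \<ge> 1\<close>, sending \<open>e\<^sup>\<nu>\<close> to \<open>exp (s H \<nu>)\<close>
  turns each factor of the denominators into an absolutely convergent series, and this evaluation is
  multiplicative and commutes with the infinite product and with the sum over translations
  (\<open>good_fmult\<close>, \<open>inf_prod_good\<close>, \<open>coeff_sum_ev\<close>). Because \<open>H\<close> is injective on the weights that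
  occur, letting \<open>s\<close> tend to infinity isolates the leading term, so a formal sum that evaluates to
  zero for all \<open>s\<close> is zero (\<open>ev_injective\<close>). It remains to prove an identity of convergent series.

  Up to a sign independent of the translation, the evaluation of \<open>w (R e\<^sup>\<rho>)\<close> is the quotient of a
  product of hyperbolic sines of the even roots by a product of hyperbolic cosines of the odd roots.
  A translation multiplies the variables of one family by powers of \<open>q\<close>. The growth exponent of such a
  term decreases linearly in the size of the translation, because each index occurs in more odd
  than even roots (\<open>mm_growth\<close>); this gives the convergence of the sum, both formally and
  numerically (\<open>transl_sum\<close>).

  For \<open>gl(n|n)\<close> the quotient is a Cauchy determinant with entries \<open>1 / (1 - c\<^sub>i / b\<^sub>j)\<close>. Inserting
  a factor \<open>u\<close> to the power of the total translation, the sum over all translations becomes the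
  determinant of the Kronecker functions \<open>theta (u x) / (theta u theta x)\<close> at \<open>x = c\<^sub>i / b\<^sub>j\<close>
  (\<open>kronecker\<close>), which the elliptic Cauchy determinant of Frobenius evaluates as a product
  (\<open>frobenius\<close>). Extracting the coefficient of \<open>u\<^sup>0\<close> yields the sum over the translations of total
  degree zero (\<open>sum_zero_translations\<close>); the factor \<open>theta (u A)\<close> in the product is what produces the factor
  \<open>f(q, e\<^sup>s\<^sup>t\<^sup>r)\<close>. For \<open>D(n+1|n)\<close> the quotient is again a Cauchy determinant, whose entries depend on
  one row variable each, so that the sum over the full lattice can be taken inside the rows. The
  entries are summed by the case \<open>n = 2\<close> of the previous formula, and the resulting determinant is of
  Cauchy type because theta functions of degree two span a plane (\<open>theta_rank_two\<close>,
  \<open>sum_all_translations\<close>).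
\<close>

hide_const (open) Infinite_Set_Sum.abs_summable_on
no_notation Infinite_Set_Sum.abs_summable_on (infix "abs'_summable'_on" 50)

lemma
  fixes f :: "'i \<Rightarrow> 'a \<Rightarrow> 'b::{topological_comm_monoid_add, t2_space}"
  assumes "finite A" "\<And>i. i \<in> A \<Longrightarrow> f i summable_on B"
  shows infsum_sum_finite: "(\<Sum>\<^sub>\<infinity>x\<in>B. \<Sum>i\<in>A. f i x) = (\<Sum>i\<in>A. \<Sum>\<^sub>\<infinity>x\<in>B. f i x)"
    and summable_on_sum_finite: "(\<lambda>x. \<Sum>i\<in>A. f i x) summable_on B"
proof -
  have "(\<Sum>\<^sub>\<infinity>x\<in>B. \<Sum>i\<in>A. f i x) = (\<Sum>i\<in>A. \<Sum>\<^sub>\<infinity>x\<in>B. f i x) \<and> (\<lambda>x. \<Sum>i\<in>A. f i x) summable_on B"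
    using assms
  proof (induction A rule: finite_induct)
    case (insert i A)
    then have IH: "(\<Sum>\<^sub>\<infinity>x\<in>B. \<Sum>i\<in>A. f i x) = (\<Sum>i\<in>A. \<Sum>\<^sub>\<infinity>x\<in>B. f i x)" "(\<lambda>x. \<Sum>i\<in>A. f i x) summable_on B" "f i summable_on B"
      by auto
    then show ?case using insert(1,2) by (simp add: infsum_add summable_on_add)
  qed simp
  then show "(\<Sum>\<^sub>\<infinity>x\<in>B. \<Sum>i\<in>A. f i x) = (\<Sum>i\<in>A. \<Sum>\<^sub>\<infinity>x\<in>B. f i x)" "(\<lambda>x. \<Sum>i\<in>A. f i x) summable_on B"
    by auto
qed

lemma summable_on_int:
  fixes f :: "int \<Rightarrow> real"
  assumes "\<And>m. f m \<ge> 0" "summable (\<lambda>n. f (int n))" "summable (\<lambda>n. f (- int n))"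
  shows "f summable_on UNIV"
proof -
  have "(\<lambda>n. f (int n)) summable_on UNIV" "(\<lambda>n. f (- int n)) summable_on UNIV"
    using assms by (simp_all add: summable_on_UNIV_nonneg_real_iff)
  moreover have "(\<lambda>n. f (int n)) summable_on UNIV \<longleftrightarrow> f summable_on {0..}"
    by (rule summable_on_reindex_bij_witness[where i=nat and j=int]) auto
  moreover have "(\<lambda>n. f (- int n)) summable_on UNIV \<longleftrightarrow> f summable_on {..0}"
    by (rule summable_on_reindex_bij_witness[where i="\<lambda>m. nat (- m)" and j="\<lambda>n. - int n"]) auto
  ultimately have "f summable_on {0..} \<union> {..0}" by (intro summable_on_union) auto
  then show ?thesis by (rule back_subst[where P="\<lambda>A. _ summable_on A"]) auto
qed

lemma summable_on_int_bound:
  fixes f :: "int \<Rightarrow> 'a::banach"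
  assumes "0 \<le> r" "r < 1" "\<And>m. norm (f m) \<le> K * r ^ nat \<bar>m\<bar>"
  shows "(\<lambda>m. norm (f m)) summable_on UNIV"
proof (rule summable_on_int)
  have s: "summable (\<lambda>n. K * r ^ n)" using assms by (intro summable_mult summable_geometric) auto
  show "summable (\<lambda>n. norm (f (int n)))"
    by (rule summable_comparison_test'[OF s]) (use assms(3)[of "int _"] in auto)
  show "summable (\<lambda>n. norm (f (- int n)))"
    by (rule summable_comparison_test'[OF s]) (use assms(3)[of "- int _"] in auto)
qed auto

text \<open>
  The discrete substitute for the contour integral of a power.
\<close>

lemma sum_roots_of_unity:
  fixes d :: int
  assumes "M > 0"
  shows "(\<Sum>k<M. (cis (2 * pi / real M) ^ k) powi d) = (if int M dvd d then of_nat M else 0)"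
proof -
  let ?w = "cis (2 * pi / real M) powi d"
  have w: "?w = cis (2 * pi * (of_int d / real M))"
    by (simp add: cis_power_int mult_ac)
  have 1: "(cis (2 * pi / real M) ^ k) powi d = ?w ^ k" for k
    by (metis mult.commute power_int_mult power_int_of_nat)
  show ?thesis
  proof (cases "int M dvd d")
    case True
    then obtain e where "d = int M * e" by blast
    then have "?w = 1" using w assms by (simp add: cis_multiple_2pi)
    then show ?thesis using True 1 by simp
  next
    case False
    have "?w \<noteq> 1"
    proof
      assume "?w = 1"
      then have "cos (2 * pi * (of_int d / real M)) = 1" using w
        by (metis cis.simps(1) one_complex.simps(1))
      then obtain x::int where "2 * pi * (of_int d / real M) = of_int x * 2 * pi"
        using cos_one_2pi_int by blast
      then have "of_int d = real_of_int (x * int M)" using assms by (simp add: field_simps)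
      then have "d = x * int M" by linarith
      then show False using False by simp
    qed
    moreover have "?w ^ M = 1"
      using assms w by (simp add: Complex.DeMoivre cis_multiple_2pi)
    ultimately show ?thesis using False by (simp add: 1 geometric_sum)
  qed
qed

text \<open>
  An annulus of convergence determines the coefficients; they are recovered by averaging over roots of
  unity, which avoids contour integrals.
\<close>

lemma laurent_unique:
  fixes c :: "int \<Rightarrow> complex"
  assumes r: "r > 0" and sm: "(\<lambda>m. norm (c m) * r powi m) summable_on UNIV"
    and z: "\<And>u. norm u = r \<Longrightarrow> (\<Sum>\<^sub>\<infinity>m. c m * u powi m) = 0"
  shows "c j = 0"
proof (rule ccontr)
  assume "c j \<noteq> 0"
  define b where "b m = c m * of_real (r powi m)" for m
  have nb: "norm (b m) = norm (c m) * r powi m" for m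
    using r by (simp add: b_def norm_mult norm_power_int)
  have smb: "(\<lambda>m. norm (b m)) summable_on A" for A
    using sm nb by (metis (no_types, lifting) summable_on_cong summable_on_subset_banach top_greatest)
  have smb': "b summable_on A" for A using smb[of A] by (rule abs_summable_summable)
  have bj: "norm (b j) > 0" using \<open>c j \<noteq> 0\<close> r by (simp add: b_def)
  define S where "S = (\<Sum>\<^sub>\<infinity>m. norm (b m))"
  obtain F where F: "finite F" "dist (sum (\<lambda>m. norm (b m)) F) S \<le> norm (b j) / 2"
    using infsum_finite_approximation[of "\<lambda>m. norm (b m)" UNIV "norm (b j) / 2"] smb bj S_def by auto
  define M where "M = Suc (nat (\<Sum>m\<in>F. \<bar>m - j\<bar>))"
  have MF: "m \<in> F \<Longrightarrow> \<bar>m - j\<bar> < int M" for m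
    unfolding M_def using member_le_sum[of m F "\<lambda>m. \<bar>m-j\<bar>"] F by fastforce
  have M0: "M > 0" by (simp add: M_def)
  define D where "D = {m. int M dvd m - j}"
  let ?w = "cis (2 * pi / real M)"
  have ev: "(\<Sum>\<^sub>\<infinity>m. b m * (?w ^ k) powi (m - j)) = 0" for k
  proof -
    have "(\<Sum>\<^sub>\<infinity>m. b m * (?w ^ k) powi (m - j)) = (\<Sum>\<^sub>\<infinity>m. (?w ^ k) powi (- j) * (c m * (of_real r * ?w ^ k) powi m))"
      by (rule infsum_cong) (auto simp: b_def power_int_mult_distrib power_int_add power_int_diff power_int_minus field_simps)
    also have "\<dots> = (?w ^ k) powi (- j) * (\<Sum>\<^sub>\<infinity>m. c m * (of_real r * ?w ^ k) powi m)"
      by (rule infsum_cmult_right')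
    also have "(\<Sum>\<^sub>\<infinity>m. c m * (of_real r * ?w ^ k) powi m) = 0"
      using r by (intro z) (simp add: norm_mult norm_power)
    finally show ?thesis by simp
  qed
  have sm2: "(\<lambda>m. b m * (?w ^ k) powi (m - j)) summable_on UNIV" for k
    by (rule abs_summable_summable) (use smb[of UNIV] in \<open>simp add: norm_mult norm_power_int norm_power\<close>)
  have "0 = (\<Sum>k<M. \<Sum>\<^sub>\<infinity>m. b m * (?w ^ k) powi (m - j))" by (simp add: ev)
  also have "\<dots> = (\<Sum>\<^sub>\<infinity>m. \<Sum>k<M. b m * (?w ^ k) powi (m - j))"
    using sm2 by (subst infsum_sum_finite) auto
  also have "\<dots> = (\<Sum>\<^sub>\<infinity>m. b m * (if m \<in> D then of_nat M else 0))"
    by (intro infsum_cong) (simp add: sum_distrib_left[symmetric] sum_roots_of_unity[OF M0] D_def)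
  also have "\<dots> = (\<Sum>\<^sub>\<infinity>m\<in>D. b m * of_nat M)"
    by (rule infsum_cong_neutral) auto
  also have "\<dots> = (\<Sum>\<^sub>\<infinity>m\<in>D. b m) * of_nat M" by (rule infsum_cmult_left')
  finally have "(\<Sum>\<^sub>\<infinity>m\<in>D. b m) = 0" using M0 by simp
  moreover have "D = insert j (D - {j})" by (auto simp: D_def)
  ultimately have "0 = (\<Sum>\<^sub>\<infinity>m\<in>insert j (D - {j}). b m)" by simp
  also have "\<dots> = b j + (\<Sum>\<^sub>\<infinity>m\<in>D-{j}. b m)" using smb' by (intro infsum_insert) auto
  finally have "norm (b j) = norm (\<Sum>\<^sub>\<infinity>m\<in>D-{j}. b m)"
    by (metis add_eq_0_iff norm_minus_cancel)
  also have "\<dots> \<le> (\<Sum>\<^sub>\<infinity>m\<in>D-{j}. norm (b m))"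
    using smb by (rule norm_infsum_bound)
  also have "\<dots> \<le> (\<Sum>\<^sub>\<infinity>m\<in>UNIV-F. norm (b m))"
  proof (rule infsum_mono2)
    show "D - {j} \<subseteq> UNIV - F"
    proof
      fix m assume m: "m \<in> D - {j}"
      then have "int M \<le> \<bar>m - j\<bar>" using dvd_imp_le_int[of "m-j" "int M"] by (auto simp: D_def)
      then show "m \<in> UNIV - F" using MF by force
    qed
  qed (use smb in auto)
  also have "\<dots> = S - sum (\<lambda>m. norm (b m)) F"
    unfolding S_def using F smb by (subst infsum_Diff) auto
  also have "\<dots> \<le> norm (b j) / 2" using F(2) unfolding dist_real_def by linarith
  finally show False using bj by simp
qed


section \<open>Theta functions\<close>

primrec euler_coeff :: "complex \<Rightarrow> nat \<Rightarrow> complex" where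
  "euler_coeff q 0 = 1"
| "euler_coeff q (Suc n) = - (q ^ n) / (1 - q ^ Suc n) * euler_coeff q n"

definition poch :: "complex \<Rightarrow> complex \<Rightarrow> complex" where
  "poch q z = (\<Sum>n. euler_coeff q n * z ^ n)"

definition theta :: "complex \<Rightarrow> complex \<Rightarrow> complex" where
  "theta q z = poch q z * poch q (q / z)"

text \<open>
  The theta function without its factor \<open>1 - z\<close>; this is the part contributed by the
  imaginary shifts of a real root and its negative.
\<close>

definition theta_reg :: "complex \<Rightarrow> complex \<Rightarrow> complex" where
  "theta_reg q z = poch q (q * z) * poch q (q / z)"

locale nome =
  fixes q :: complex
  assumes q0: "q \<noteq> 0" and q1: "norm q < 1"
begin

lemma pow_neq_1: "q ^ Suc n \<noteq> 1"
proof
  assume "q ^ Suc n = 1"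
  then have "norm q ^ Suc n = 1" by (metis norm_one norm_power)
  moreover have "norm q ^ Suc n < 1" using q1 q0 by (intro power_Suc_less_one) auto
  ultimately show False by simp
qed

lemma powi_neq_1: "m \<noteq> 0 \<Longrightarrow> q powi m \<noteq> 1"
proof (cases "m > 0")
  case True
  then obtain n where "m = int (Suc n)" by (metis gr0_implies_Suc zero_less_imp_eq_int)
  then show ?thesis using pow_neq_1[of n] by (metis power_int_of_nat)
next
  case False
  assume "m \<noteq> 0"
  with False obtain n where "-m = int (Suc n)" by (metis gr0_implies_Suc linorder_neqE_linordered_idom neg_0_less_iff_less zero_less_imp_eq_int)
  then have "q powi (-m) \<noteq> 1" using pow_neq_1[of n] by (metis power_int_of_nat)
  then show ?thesis by (simp add: power_int_minus)
qed

lemma euler_summable: "summable (\<lambda>n. norm (euler_coeff q n * z ^ n))"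
proof -
  have "(\<lambda>n. norm q ^ n * norm z / (1 - norm q)) \<longlonglongrightarrow> 0 * norm z / (1 - norm q)"
    using q1 by (intro tendsto_intros LIMSEQ_power_zero) auto
  then have "eventually (\<lambda>n. norm q ^ n * norm z / (1 - norm q) < 1/2) sequentially"
    by (intro order_tendstoD) auto
  then obtain N where N: "\<And>n. n \<ge> N \<Longrightarrow> norm q ^ n * norm z / (1 - norm q) < 1/2"
    by (auto simp: eventually_sequentially)
  show ?thesis
  proof (rule summable_ratio_test[of "1/2" N])
    fix n assume n: "n \<ge> N"
    have "norm q ^ Suc n \<le> norm q" using q1 power_decreasing[of 1 "Suc n" "norm q"] by simp
    then have "1 - norm q \<le> 1 - norm (q ^ Suc n)" by (simp add: norm_power norm_mult)
    also have "\<dots> \<le> norm (1 - q ^ Suc n)" by (metis norm_one norm_triangle_ineq2)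
    finally have d: "1 - norm q \<le> norm (1 - q ^ Suc n)" .
    have "norm (q ^ n / (1 - q ^ Suc n) * z) = norm q ^ n * norm z / norm (1 - q ^ Suc n)"
      by (simp add: norm_mult norm_divide norm_power)
    also have "\<dots> \<le> norm q ^ n * norm z / (1 - norm q)"
      using d q1 by (intro divide_left_mono mult_pos_pos) auto
    also have "\<dots> \<le> 1/2" using N[OF n] by simp
    finally have "norm (q ^ n / (1 - q ^ Suc n) * z) \<le> 1/2" .
    then have "norm (q ^ n / (1 - q ^ Suc n) * z) * norm (euler_coeff q n * z ^ n) \<le> 1/2 * norm (euler_coeff q n * z ^ n)"
      by (rule mult_right_mono) simp
    then show "norm (norm (euler_coeff q (Suc n) * z ^ Suc n)) \<le> 1/2 * norm (norm (euler_coeff q n * z ^ n))"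
      by (simp add: norm_mult norm_divide norm_power mult_ac)
  qed simp
qed

lemma poch_rec: "poch q z = (1 - z) * poch q (q * z)"
proof -
  let ?e = "euler_coeff q"
  have s: "summable (\<lambda>n. ?e n * w ^ n)" for w
    using euler_summable by (rule summable_norm_cancel)
  have c: "?e n * z ^ n = ?e n * (q * z) ^ n - (if n = 0 then 0 else z * (?e (n-1) * (q * z) ^ (n-1)))" for n
  proof (cases n)
    case (Suc k)
    have "?e (Suc k) * (1 - q ^ Suc k) = - (q ^ k) * ?e k" using pow_neq_1[of k] by (simp add: field_simps)
    then have "?e (Suc k) * (1 - q ^ Suc k) * z ^ Suc k = - (q ^ k) * ?e k * z ^ Suc k" by simp
    then show ?thesis unfolding Suc by (simp add: algebra_simps power_mult_distrib del: euler_coeff.simps)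
  qed simp
  have t: "(\<lambda>n. if n = 0 then 0 else z * (?e (n-1) * (q * z) ^ (n-1))) sums (z * poch q (q * z))"
    using sums_Suc_iff[of "\<lambda>n. if n = 0 then 0 else z * (?e (n-1) * (q * z) ^ (n-1))" "z * poch q (q * z)"]
      sums_mult[OF summable_sums[OF s[of "q * z"]], of z] by (simp add: poch_def)
  have "(\<lambda>n. ?e n * z ^ n) sums (poch q (q * z) - z * poch q (q * z))"
    by (subst c) (intro sums_diff t, simp add: poch_def summable_sums s)
  then show ?thesis unfolding poch_def[of q z] by (simp add: sums_iff algebra_simps)
qed

lemma poch_0: "poch q 0 = 1"
  unfolding poch_def by (subst powser_zero) simp

lemma poch_cont: "isCont (poch q) z"
  unfolding poch_def
  by (rule isCont_powser_converges_everywhere) (rule summable_norm_cancel[OF euler_summable])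

lemma continuous_poch [continuous_intros]:
  "continuous_on A f \<Longrightarrow> continuous_on A (\<lambda>x. poch q (f x))"
  by (rule continuous_on_compose2[of UNIV "poch q"]) (auto simp: continuous_on_eq_continuous_at poch_cont)

lemma tendsto_poch [tendsto_intros]:
  "(f \<longlongrightarrow> l) F \<Longrightarrow> ((\<lambda>x. poch q (f x)) \<longlongrightarrow> poch q l) F"
  using isCont_tendsto_compose[OF poch_cont] .

lemma poch_split: "poch q z = (\<Prod>k<N. 1 - q ^ k * z) * poch q (q ^ N * z)"
proof (induction N)
  case (Suc N)
  then show ?case using poch_rec[of "q ^ N * z"] by (simp add: mult_ac)
qed simp

lemma poch_tail: "(\<lambda>N. poch q (q ^ N * z)) \<longlonglongrightarrow> 1"
proof -
  have "(\<lambda>N. poch q (q ^ N * z)) \<longlonglongrightarrow> poch q (0 * z)"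
    using q1 by (intro tendsto_intros LIMSEQ_power_zero)
  then show ?thesis by (simp add: poch_0)
qed

lemma poch_lim: "(\<lambda>N. \<Prod>k<N. 1 - q ^ k * z) \<longlonglongrightarrow> poch q z"
proof -
  have "eventually (\<lambda>N. poch q (q ^ N * z) \<noteq> 0) sequentially"
    using poch_tail[of z] by (rule tendsto_imp_eventually_ne) simp
  moreover have "(\<lambda>N. poch q z / poch q (q ^ N * z)) \<longlonglongrightarrow> poch q z / 1"
    by (intro tendsto_intros poch_tail) simp
  moreover have "poch q z / poch q (q ^ N * z) = (\<Prod>k<N. 1 - q ^ k * z)" if "poch q (q ^ N * z) \<noteq> 0" for N
    using poch_split[of z N] that by simp
  ultimately have ev: "eventually (\<lambda>N. poch q z / poch q (q ^ N * z) = (\<Prod>k<N. 1 - q ^ k * z)) sequentially"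
    and lim: "(\<lambda>N. poch q z / poch q (q ^ N * z)) \<longlonglongrightarrow> poch q z"
    by (auto elim: eventually_mono)
  show ?thesis by (rule Lim_transform_eventually[OF lim ev])
qed

lemma poch_lim_q: "(\<lambda>N. \<Prod>k=1..N. 1 - q ^ k * z) \<longlonglongrightarrow> poch q (q * z)"
proof -
  have "(\<Prod>k=1..N. 1 - q ^ k * z) = (\<Prod>k<N. 1 - q ^ k * (q * z))" for N
    by (rule prod.reindex_bij_witness[of _ Suc "\<lambda>k. k - 1"]) (auto simp: gr0_conv_Suc Suc_le_eq)
  then show ?thesis using poch_lim by simp
qed

lemma poch_nz:
  assumes "\<And>k. q ^ k * z \<noteq> 1" shows "poch q z \<noteq> 0"
proof -
  have "eventually (\<lambda>N. poch q (q ^ N * z) \<noteq> 0) sequentially"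
    using poch_tail[of z] by (rule tendsto_imp_eventually_ne) simp
  then obtain N where "poch q (q ^ N * z) \<noteq> 0" by (auto simp: eventually_sequentially)
  then show ?thesis using assms by (subst poch_split[of _ N]) auto
qed

lemma poch_q_nz: "poch q q \<noteq> 0"
  using pow_neq_1 by (intro poch_nz) (simp add: mult.commute)

lemma theta_reg: "theta q z = (1 - z) * theta_reg q z"
  unfolding theta_def theta_reg_def by (subst poch_rec) simp

lemma theta_reg': 
  assumes "z \<noteq> 0" shows "theta q (q * z) = (1 - 1 / z) * theta_reg q z"
proof -
  have "poch q (1 / z) = (1 - 1 / z) * poch q (q * (1 / z))" by (rule poch_rec)
  then show ?thesis using q0 assms by (simp add: theta_def theta_reg_def)
qed

lemma theta_reg_inverse: "theta_reg q (1 / z) = theta_reg q z"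
  by (simp add: theta_reg_def)

lemma theta_shift: "z \<noteq> 0 \<Longrightarrow> theta q (q * z) = - theta q z / z"
  by (subst theta_reg') (auto simp: theta_reg field_simps)

lemma theta_reg_nz:
  assumes "z \<noteq> 0" "\<And>k::int. k \<noteq> 0 \<Longrightarrow> q powi k \<noteq> z" shows "theta_reg q z \<noteq> 0"
proof -
  have "poch q (q * z) \<noteq> 0"
  proof (rule poch_nz)
    fix k show "q ^ k * (q * z) \<noteq> 1"
    proof
      assume "q ^ k * (q * z) = 1"
      then have "q powi (- int (Suc k)) = z"
        unfolding power_int_minus power_int_of_nat using q0 assms(1) by (simp add: field_simps)
      then show False using assms(2)[of "- int (Suc k)"] by simp
    qed
  qed
  moreover have "poch q (q / z) \<noteq> 0"
  proof (rule poch_nz)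
    fix k show "q ^ k * (q / z) \<noteq> 1"
    proof
      assume "q ^ k * (q / z) = 1"
      then have "q powi (int (Suc k)) = z"
        unfolding power_int_of_nat using q0 assms(1) by (simp add: field_simps)
      then show False using assms(2)[of "int (Suc k)"] by simp
    qed
  qed
  ultimately show ?thesis by (simp add: theta_reg_def)
qed

lemma theta_nz:
  assumes "z \<noteq> 0" "\<And>k::int. q powi k \<noteq> z" shows "theta q z \<noteq> 0"
  using theta_reg_nz[of z] assms assms(2)[of 0] by (auto simp: theta_reg)

end

subsection \<open>Convolution\<close>

lemma norm_summable_product:
  fixes f :: "'i \<Rightarrow> complex" and g :: "'j \<Rightarrow> complex"
  assumes f: "(\<lambda>x. norm (f x)) summable_on A" and g: "(\<lambda>y. norm (g y)) summable_on B"
  shows "(\<lambda>p. norm (f (fst p) * g (snd p))) summable_on A \<times> B"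
    and "(\<Sum>\<^sub>\<infinity>p\<in>A\<times>B. f (fst p) * g (snd p)) = (\<Sum>\<^sub>\<infinity>x\<in>A. f x) * (\<Sum>\<^sub>\<infinity>y\<in>B. g y)"
proof -
  show 1: "(\<lambda>p. norm (f (fst p) * g (snd p))) summable_on A \<times> B"
    by (rule Infinite_Sum.abs_summable_on_Sigma_iff[THEN iffD2])
       (use f g in \<open>auto simp: norm_mult infsum_cmult_right' infsum_nonneg abs_mult intro!: summable_on_cmult_right summable_on_cmult_left\<close>)
  have "(\<Sum>\<^sub>\<infinity>p\<in>A\<times>B. f (fst p) * g (snd p)) = (\<Sum>\<^sub>\<infinity>x\<in>A. \<Sum>\<^sub>\<infinity>y\<in>B. f x * g y)"
    using infsum_Sigma_banach[OF abs_summable_summable[OF 1]] by simp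
  then show "(\<Sum>\<^sub>\<infinity>p\<in>A\<times>B. f (fst p) * g (snd p)) = (\<Sum>\<^sub>\<infinity>x\<in>A. f x) * (\<Sum>\<^sub>\<infinity>y\<in>B. g y)"
    by (simp add: infsum_cmult_right' infsum_cmult_left')
qed

lemma convolution:
  fixes f g :: "'g::ab_group_add \<Rightarrow> complex"
  assumes f: "(\<lambda>x. norm (f x)) summable_on UNIV" and g: "(\<lambda>x. norm (g x)) summable_on UNIV"
  shows convolution_pointwise: "\<And>m. (\<lambda>k. norm (f k * g (m - k))) summable_on UNIV"
    and convolution_abs: "(\<lambda>m. \<Sum>\<^sub>\<infinity>k. norm (f k * g (m - k))) summable_on UNIV"
      "(\<Sum>\<^sub>\<infinity>m. \<Sum>\<^sub>\<infinity>k. norm (f k * g (m - k))) = (\<Sum>\<^sub>\<infinity>k. norm (f k)) * (\<Sum>\<^sub>\<infinity>k. norm (g k))"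
    and convolution_summable: "(\<lambda>m. norm (\<Sum>\<^sub>\<infinity>k. f k * g (m - k))) summable_on UNIV"
    and convolution_infsum: "(\<Sum>\<^sub>\<infinity>m. \<Sum>\<^sub>\<infinity>k. f k * g (m - k)) = (\<Sum>\<^sub>\<infinity>k. f k) * (\<Sum>\<^sub>\<infinity>k. g k)"
proof -
  note P = norm_summable_product[OF f g]
  have R: "(\<lambda>p. h (f (snd p) * g (fst p - snd p))) summable_on UNIV \<longleftrightarrow> (\<lambda>p. h (f (fst p) * g (snd p))) summable_on UNIV \<times> UNIV"
    "(\<Sum>\<^sub>\<infinity>p. h (f (snd p) * g (fst p - snd p))) = (\<Sum>\<^sub>\<infinity>p\<in>UNIV\<times>UNIV. h (f (fst p) * g (snd p)))"
    for h :: "complex \<Rightarrow> 'b::banach"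
    by (rule summable_on_reindex_bij_witness[where i="\<lambda>(k,l). (k + l, k)" and j="\<lambda>(m,k). (k, m - k)"]
        infsum_reindex_bij_witness[where i="\<lambda>(k,l). (k + l, k)" and j="\<lambda>(m,k). (k, m - k)"]; auto)+
  have S: "(\<lambda>p. norm (f (snd p) * g (fst p - snd p))) summable_on UNIV \<times> UNIV"
    using P(1) R(1)[of norm] by simp
  have "\<forall>m\<in>UNIV. (\<lambda>k. norm (f k * g (m - k))) summable_on UNIV"
    and S2: "(\<lambda>m. norm (\<Sum>\<^sub>\<infinity>k. norm (f k * g (m - k)))) summable_on UNIV"
    using Infinite_Sum.abs_summable_on_Sigma_iff[THEN iffD1, OF S] by auto
  then show pt: "\<And>m. (\<lambda>k. norm (f k * g (m - k))) summable_on UNIV" by auto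
  show S3: "(\<lambda>m. \<Sum>\<^sub>\<infinity>k. norm (f k * g (m - k))) summable_on UNIV"
    using S2 by (simp add: infsum_nonneg)
  show "(\<lambda>m. norm (\<Sum>\<^sub>\<infinity>k. f k * g (m - k))) summable_on UNIV"
    by (rule summable_on_comparison_test[OF S3]) (auto intro!: norm_infsum_bound pt)
  have "(\<Sum>\<^sub>\<infinity>m. \<Sum>\<^sub>\<infinity>k. f k * g (m - k)) = (\<Sum>\<^sub>\<infinity>p\<in>UNIV\<times>UNIV. f (snd p) * g (fst p - snd p))"
    using infsum_Sigma_banach[OF abs_summable_summable[OF S]] by simp
  also have "\<dots> = (\<Sum>\<^sub>\<infinity>k. f k) * (\<Sum>\<^sub>\<infinity>k. g k)" using P(2) R(2)[of "\<lambda>x. x"] by simp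
  finally show "(\<Sum>\<^sub>\<infinity>m. \<Sum>\<^sub>\<infinity>k. f k * g (m - k)) = (\<Sum>\<^sub>\<infinity>k. f k) * (\<Sum>\<^sub>\<infinity>k. g k)" .
  have "(\<Sum>\<^sub>\<infinity>m. \<Sum>\<^sub>\<infinity>k. norm (f k * g (m - k))) = (\<Sum>\<^sub>\<infinity>p\<in>UNIV\<times>UNIV. norm (f (snd p) * g (fst p - snd p)))"
    using infsum_Sigma_banach[OF S] by simp
  also have "\<dots> = (\<Sum>\<^sub>\<infinity>p\<in>UNIV\<times>UNIV. norm (f (fst p) * g (snd p)))" using R(2)[of norm] by simp
  also have "\<dots> = (\<Sum>\<^sub>\<infinity>x. \<Sum>\<^sub>\<infinity>y. norm (f x * g y))"
    using infsum_Sigma_banach[OF P(1)] by simp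
  finally show "(\<Sum>\<^sub>\<infinity>m. \<Sum>\<^sub>\<infinity>k. norm (f k * g (m - k))) = (\<Sum>\<^sub>\<infinity>k. norm (f k)) * (\<Sum>\<^sub>\<infinity>k. norm (g k))"
    by (simp add: norm_mult infsum_cmult_right' infsum_cmult_left')
qed

subsection \<open>Laurent series\<close>

definition laurent_summable :: "(int \<Rightarrow> complex) \<Rightarrow> complex \<Rightarrow> bool" where
  "laurent_summable c u \<longleftrightarrow> (\<lambda>m. norm (c m * u powi m)) summable_on UNIV"

definition laurent :: "(int \<Rightarrow> complex) \<Rightarrow> complex \<Rightarrow> complex" where
  "laurent c u = (\<Sum>\<^sub>\<infinity>m. c m * u powi m)"

lemma laurent_mult:
  assumes "u \<noteq> 0" "laurent_summable a u" "laurent_summable b u"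
  shows "laurent_summable (\<lambda>m. \<Sum>\<^sub>\<infinity>k. a k * b (m - k)) u"
    and "laurent (\<lambda>m. \<Sum>\<^sub>\<infinity>k. a k * b (m - k)) u = laurent a u * laurent b u"
proof -
  have e: "(\<Sum>\<^sub>\<infinity>k. (a k * u powi k) * (b (m - k) * u powi (m - k))) = (\<Sum>\<^sub>\<infinity>k. a k * b (m - k)) * u powi m" for m
    using assms(1) by (subst infsum_cmult_left'[symmetric], intro infsum_cong) (simp add: power_int_diff)
  show "laurent_summable (\<lambda>m. \<Sum>\<^sub>\<infinity>k. a k * b (m - k)) u"
    "laurent (\<lambda>m. \<Sum>\<^sub>\<infinity>k. a k * b (m - k)) u = laurent a u * laurent b u"
    using convolution_summable[OF assms(2,3)[unfolded laurent_summable_def]]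
      convolution_infsum[OF assms(2,3)[unfolded laurent_summable_def]]
    unfolding e laurent_summable_def laurent_def by simp_all
qed

lemma laurent_shift:
  assumes "u \<noteq> 0" "laurent_summable a u"
  shows "laurent_summable (\<lambda>m. a (m + j)) u" "laurent (\<lambda>m. a (m + j)) u = laurent a u / u powi j"
proof -
  have e: "norm (a (m + j) * u powi m) = norm (a (m + j) * u powi (m + j)) / norm (u powi j)" for m
    using assms(1) by (simp add: power_int_add norm_mult)
  have "(\<lambda>m. norm (a (m + j) * u powi (m + j))) summable_on UNIV \<longleftrightarrow> (\<lambda>m. norm (a m * u powi m)) summable_on UNIV"
    by (rule summable_on_reindex_bij_witness[where i="\<lambda>m. m - j" and j="\<lambda>m. m + j"]) auto
  then have "(\<lambda>m. norm (a (m + j) * u powi (m + j)) / norm (u powi j)) summable_on UNIV"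
    using assms(2) by (simp add: laurent_summable_def summable_on_cmult_left divide_inverse)
  then show "laurent_summable (\<lambda>m. a (m + j)) u"
    unfolding laurent_summable_def e .
  have "laurent (\<lambda>m. a (m + j)) u = (\<Sum>\<^sub>\<infinity>m. (a (m + j) * u powi (m + j)) * (1 / u powi j))"
    unfolding laurent_def by (intro infsum_cong) (use assms(1) in \<open>simp add: power_int_add\<close>)
  also have "\<dots> = (\<Sum>\<^sub>\<infinity>m. a (m + j) * u powi (m + j)) * (1 / u powi j)" by (rule infsum_cmult_left')
  also have "(\<Sum>\<^sub>\<infinity>m. a (m + j) * u powi (m + j)) = laurent a u"
    unfolding laurent_def by (rule infsum_reindex_bij_witness[where i="\<lambda>m. m - j" and j="\<lambda>m. m + j"]) auto
  finally show "laurent (\<lambda>m. a (m + j)) u = laurent a u / u powi j" by simp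
qed

lemma laurent_linear:
  assumes "laurent_summable a u" "laurent_summable b u"
  shows "laurent_summable (\<lambda>m. a m + k * b m) u" "laurent (\<lambda>m. a m + k * b m) u = laurent a u + k * laurent b u"
proof -
  have e: "(a m + k * b m) * u powi m = a m * u powi m + k * (b m * u powi m)" for m by (simp add: algebra_simps)
  have s: "(\<lambda>m. norm (a m * u powi m) + norm k * norm (b m * u powi m)) summable_on UNIV"
    using assms by (auto simp: laurent_summable_def intro!: summable_on_add summable_on_cmult_right)
  show "laurent_summable (\<lambda>m. a m + k * b m) u"
    unfolding laurent_summable_def e by (rule summable_on_comparison_test[OF s]) (auto intro: norm_triangle_le simp: norm_mult)
  show "laurent (\<lambda>m. a m + k * b m) u = laurent a u + k * laurent b u"
    unfolding laurent_def e using assms[unfolded laurent_summable_def, THEN abs_summable_summable]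
    by (simp add: infsum_add infsum_cmult_right' summable_on_cmult_right)
qed

lemma laurent_eqI:
  assumes "r > 0" "\<And>u. norm u = r \<Longrightarrow> laurent_summable a u" "\<And>u. norm u = r \<Longrightarrow> laurent_summable b u"
    "\<And>u. norm u = r \<Longrightarrow> laurent a u = laurent b u"
  shows "a = b"
proof
  fix j
  have ru: "norm (complex_of_real r) = r" using assms(1) by simp
  have "a j + (-1) * b j = 0"
  proof (rule laurent_unique[OF assms(1)])
    show "(\<lambda>m. norm (a m + (-1) * b m) * r powi m) summable_on UNIV"
      using laurent_linear(1)[OF assms(2,3)[OF ru], of "-1"] assms(1) 
      by (simp add: laurent_summable_def norm_mult norm_power_int)
    show "(\<Sum>\<^sub>\<infinity>m. (a m + (-1) * b m) * u powi m) = 0" if "norm u = r" for u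
      using laurent_linear(2)[OF assms(2,3)[OF that], of "-1"] assms(4)[OF that] by (simp add: laurent_def)
  qed
  then show "a j = b j" by simp
qed


context nome
begin

subsection \<open>The triple product\<close>

definition tri :: "int \<Rightarrow> complex" where
  "tri m = (-1) powi m * q powi (m * (m - 1) div 2)"

lemma tri_rec: "tri (m + 1) = - (q powi m) * tri m"
proof -
  have "(m + 1) * (m + 1 - 1) = m * (m - 1) + m * 2" by (simp add: algebra_simps)
  then have "(m + 1) * (m + 1 - 1) div 2 = m * (m - 1) div 2 + m" by simp
  then show ?thesis using q0 by (simp add: tri_def power_int_add)
qed

lemma tri_0: "tri 0 = 1" by (simp add: tri_def)

lemma int_ratio_summable:
  fixes c :: "int \<Rightarrow> complex"
  assumes r: "r > 0" and rec: "\<And>m. norm (c (m + 1)) = norm q powi (p * m) * K * norm (c m)" and K: "K > 0" and p: "p > 0"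
  shows "(\<lambda>m. norm (c m)) summable_on UNIV"
proof (rule summable_on_int)
  have z: "(\<lambda>n. norm q ^ n * L) \<longlonglongrightarrow> 0" for L
    using LIMSEQ_power_zero[of "norm q"] q1 by (intro tendsto_mult_left_zero) auto
  have ex: "\<exists>N. \<forall>n\<ge>N. norm q ^ n * L < 1/2" for L
    using order_tendstoD(2)[OF z[of L], of "1/2"] by (auto simp: eventually_sequentially)
  have le: "norm q powi (p * int n) \<le> norm q ^ n" for n
  proof -
    have "norm q powi (p * int n) = norm q ^ (nat p * n)"
      using p by (simp add: power_int_def nat_mult_distrib)
    also have "\<dots> \<le> norm q ^ n" using p q1 by (intro power_decreasing) auto
    finally show ?thesis .
  qed
  obtain N where N: "\<And>n. n \<ge> N \<Longrightarrow> norm q ^ n * K < 1/2" using ex by blast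
  show "summable (\<lambda>n. norm (c (int n)))"
  proof (rule summable_ratio_test[of "1/2" N])
    fix n assume "n \<ge> N"
    have "norm q powi (p * int n) * K \<le> norm q ^ n * K" using le K by (intro mult_right_mono) auto
    then have "norm q powi (p * int n) * K \<le> 1/2" using N[OF \<open>n \<ge> N\<close>] by linarith
    then have "norm q powi (p * int n) * K * norm (c (int n)) \<le> 1/2 * norm (c (int n))" by (rule mult_right_mono) simp
    moreover have "norm (c (int (Suc n))) = norm q powi (p * int n) * K * norm (c (int n))"
      using rec[of "int n"] by (simp add: add.commute)
    ultimately show "norm (norm (c (int (Suc n)))) \<le> 1/2 * norm (norm (c (int n)))"
      by (metis abs_norm_cancel real_norm_def)
  qed simp
  obtain N where N: "\<And>n. n \<ge> N \<Longrightarrow> norm q ^ n * (1 / K) < 1/2" using ex by blast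
  show "summable (\<lambda>n. norm (c (- int n)))"
  proof (rule summable_ratio_test[of "1/2" N])
    fix n assume "n \<ge> N"
    have e: "norm (c (- int (Suc n))) = norm q powi (p * int (Suc n)) * (1 / K) * norm (c (- int n))"
    proof -
      have "- int (Suc n) + 1 = - int n" by simp
      then have "norm (c (- int n)) = norm q powi (- (p * int (Suc n))) * K * norm (c (- int (Suc n)))"
        using rec[of "- int (Suc n)"] by (simp only: mult_minus_right)
      then show ?thesis using K q0 by (simp add: power_int_minus field_simps del: of_nat_Suc)
    qed
    have "norm q powi (p * int (Suc n)) * (1 / K) \<le> norm q ^ Suc n * (1 / K)" using le[of "Suc n"] K by (intro mult_right_mono) auto
    then have "norm q powi (p * int (Suc n)) * (1 / K) \<le> 1/2" using N[of "Suc n"] \<open>n \<ge> N\<close> by linarith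
    then have "norm q powi (p * int (Suc n)) * (1 / K) * norm (c (- int n)) \<le> 1/2 * norm (c (- int n))" by (rule mult_right_mono) simp
    then show "norm (norm (c (- int (Suc n)))) \<le> 1/2 * norm (norm (c (- int n)))"
      using e K by simp
  qed simp
qed auto

lemma tri_summable: "u \<noteq> 0 \<Longrightarrow> laurent_summable tri u"
  unfolding laurent_summable_def
  by (rule int_ratio_summable[where r=1 and p=1 and K="norm u"])
     (auto simp: tri_rec norm_mult norm_power_int power_int_add q0)

lemma theta_laurent_exists:
  obtains c where "\<And>u. u \<noteq> 0 \<Longrightarrow> laurent_summable c u" "\<And>u. u \<noteq> 0 \<Longrightarrow> laurent c u = theta q u"
proof -
  define a where "a m = (if m \<ge> 0 then euler_coeff q (nat m) else 0)" for m
  define b where "b m = (if m \<le> 0 then euler_coeff q (nat (-m)) * q ^ nat (-m) else 0)" for m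
  have sN: "(\<lambda>n. norm (euler_coeff q n * z ^ n)) summable_on UNIV" for z
    using euler_summable by (simp add: summable_on_UNIV_nonneg_real_iff)
  have iN: "(\<Sum>\<^sub>\<infinity>n. euler_coeff q n * z ^ n) = poch q z" for z
    unfolding poch_def by (rule sums_unique[OF has_sum_imp_sums[OF has_sum_infsum[OF abs_summable_summable[OF sN]]]])
  have a: "laurent_summable a u" "laurent a u = poch q u" if "u \<noteq> 0" for u
  proof -
    have "(\<lambda>m. norm (a m * u powi m)) summable_on {0..} \<longleftrightarrow> (\<lambda>n. norm (euler_coeff q n * u ^ n)) summable_on UNIV"
      by (rule summable_on_reindex_bij_witness[where i=int and j=nat]) (auto simp: a_def power_int_def)
    moreover have "(\<lambda>m. norm (a m * u powi m)) summable_on {0..} \<longleftrightarrow> (\<lambda>m. norm (a m * u powi m)) summable_on UNIV"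
      by (rule summable_on_cong_neutral) (auto simp: a_def)
    ultimately show "laurent_summable a u" using sN by (simp add: laurent_summable_def)
    have "laurent a u = (\<Sum>\<^sub>\<infinity>m\<in>{0..}. a m * u powi m)" unfolding laurent_def
      by (rule infsum_cong_neutral) (auto simp: a_def)
    also have "\<dots> = (\<Sum>\<^sub>\<infinity>n. euler_coeff q n * u ^ n)"
      by (rule infsum_reindex_bij_witness[where i=int and j=nat]) (auto simp: a_def power_int_def)
    finally show "laurent a u = poch q u" using iN by simp
  qed
  have b: "laurent_summable b u" "laurent b u = poch q (q / u)" if "u \<noteq> 0" for u
  proof -
    have e: "euler_coeff q (nat (- m)) * (q / u) ^ nat (- m) = b m * u powi m" if "m \<le> 0" for m
      using that by (auto simp: b_def power_int_def power_mult_distrib divide_inverse power_inverse)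
    have "(\<lambda>m. norm (b m * u powi m)) summable_on {..0} \<longleftrightarrow> (\<lambda>n. norm (euler_coeff q n * (q/u) ^ n)) summable_on UNIV"
      by (rule summable_on_reindex_bij_witness[where i="\<lambda>n. - int n" and j="\<lambda>m. nat (- m)"]) (auto simp: e)
    moreover have "(\<lambda>m. norm (b m * u powi m)) summable_on {..0} \<longleftrightarrow> (\<lambda>m. norm (b m * u powi m)) summable_on UNIV"
      by (rule summable_on_cong_neutral) (auto simp: b_def)
    ultimately show "laurent_summable b u" using sN by (simp add: laurent_summable_def)
    have "laurent b u = (\<Sum>\<^sub>\<infinity>m\<in>{..0}. b m * u powi m)" unfolding laurent_def
      by (rule infsum_cong_neutral) (auto simp: b_def)
    also have "\<dots> = (\<Sum>\<^sub>\<infinity>n. euler_coeff q n * (q/u) ^ n)"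
      by (rule infsum_reindex_bij_witness[where i="\<lambda>n. - int n" and j="\<lambda>m. nat (- m)"]) (auto simp: e)
    finally show "laurent b u = poch q (q/u)" using iN by simp
  qed
  show thesis
    by (rule that[of "\<lambda>m. \<Sum>\<^sub>\<infinity>k. a k * b (m - k)"]) (auto simp: laurent_mult a b theta_def)
qed

text \<open>
  The functional equation of theta under \<open>z \<mapsto> q z\<close> determines its Laurent
  coefficients up to a common factor.
\<close>

lemma theta_laurent:
  obtains C where "C \<noteq> 0" "\<And>u. u \<noteq> 0 \<Longrightarrow> theta q u = C * laurent tri u"
proof -
  obtain c where c: "\<And>u. u \<noteq> 0 \<Longrightarrow> laurent_summable c u" "\<And>u. u \<noteq> 0 \<Longrightarrow> laurent c u = theta q u"
    using theta_laurent_exists by blast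
  have q: "laurent_summable (\<lambda>m. q powi m * c m) u" "laurent (\<lambda>m. q powi m * c m) u = laurent c (q * u)" if "u \<noteq> 0" for u
    using c(1)[of "q * u"] that q0 by (simp_all add: laurent_summable_def laurent_def power_int_mult_distrib mult_ac)
  have "(\<lambda>m. q powi m * c m) = (\<lambda>m. 0 + (-1) * c (m + 1))"
  proof (rule laurent_eqI[of 1])
    fix u :: complex assume "norm u = 1"
    then have u: "u \<noteq> 0" by auto
    have z: "laurent_summable (\<lambda>_. 0) u" "laurent (\<lambda>_. 0) u = 0" by (simp_all add: laurent_summable_def laurent_def)
    show "laurent_summable (\<lambda>m. q powi m * c m) u" using q u by auto
    show "laurent_summable (\<lambda>m. 0 + (-1) * c (m + 1)) u" using laurent_linear(1)[OF z(1) laurent_shift(1)[OF u c(1)[OF u]]] .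
    show "laurent (\<lambda>m. q powi m * c m) u = laurent (\<lambda>m. 0 + (-1) * c (m + 1)) u"
      using laurent_linear(2)[OF z(1) laurent_shift(1)[OF u c(1)[OF u]], of "-1" 1] u q0 
      by (simp add: q c theta_shift z laurent_shift)
  qed simp
  then have "q powi m * c m = 0 + (-1) * c (m + 1)" for m by (rule fun_cong)
  then have rec: "c (m + 1) = - (q powi m) * c m" for m by simp
  have eq: "c m = c 0 * tri m" for m
  proof (induction m rule: int_induct[of _ 0])
    case base show ?case by (simp add: tri_0)
  next
    case (step1 i) then show ?case by (simp add: rec tri_rec)
  next
    case (step2 i) 
    then show ?case using rec[of "i - 1"] tri_rec[of "i - 1"] q0 by simp
  qed
  have th: "theta q u = c 0 * laurent tri u" if "u \<noteq> 0" for u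
    unfolding c(2)[OF that, symmetric] laurent_def
    by (subst eq) (simp add: mult.assoc infsum_cmult_right')
  have "theta q (-1) \<noteq> 0"
  proof (rule theta_nz)
    fix k :: int show "q powi k \<noteq> -1"
    proof
      assume a: "q powi k = -1"
      then have "q powi (2 * k) = 1" by (simp add: power_int_mult mult.commute power2_eq_square)
      then have "k = 0" using powi_neq_1[of "2 * k"] by auto
      then show False using a by simp
    qed
  qed simp
  then have "c 0 \<noteq> 0" using th[of "-1"] by auto
  then show thesis using that th by blast
qed

end

definition three_term :: "(complex \<Rightarrow> complex) \<Rightarrow> complex \<Rightarrow> bool" where
  "three_term T u \<longleftrightarrow> (\<forall>b b' c c'. b \<noteq> 0 \<longrightarrow> b' \<noteq> 0 \<longrightarrow> c \<noteq> 0 \<longrightarrow> c' \<noteq> 0 \<longrightarrow>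
     T (u * (c / b)) * T (u * (c' / b')) * T (c / b') * T (c' / b)
     - T (u * (c / b')) * T (u * (c' / b)) * T (c / b) * T (c' / b')
     = c' / b' * T (c / c') * T (b' / b) * T u * T (u * (c / b) * (c' / b')))"

context nome
begin

subsection \<open>The three-term relation\<close>

text \<open>
  In the product of the two Laurent series the terms whose indices have an even sum and those whose
  indices have an odd sum separate; the two halves are the products of the two basis functions.
\<close>

lemma theta_rank_two:
  "\<exists>f g. \<forall>x y. x \<noteq> 0 \<longrightarrow> y \<noteq> 0 \<longrightarrow> theta q (x * y) * theta q (x / y) = x * (g x * f y - f x * g y)"
proof -
  define f where "f y = (\<Sum>\<^sub>\<infinity>l::int. q powi (l * l) * y powi (2 * l))" for y
  define g where "g y = (\<Sum>\<^sub>\<infinity>l::int. q powi (l * l + l) * y powi (2 * l + 1))" for y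
  have sf: "(\<lambda>l::int. norm (q powi (l * l) * y powi (2 * l))) summable_on UNIV" if "y \<noteq> 0" for y
  proof (rule int_ratio_summable[where r=1 and p=2 and K="norm (q * y^2)"])
    fix m :: int
    have "q powi ((m + 1) * (m + 1)) * y powi (2 * (m + 1)) = q powi (m*m + 2*m + 1) * y powi (2 * m + 2)"
      by (simp add: algebra_simps)
    also have "\<dots> = q powi (2 * m) * (q * y^2) * (q powi (m * m) * y powi (2 * m))"
      using that q0 by (simp add: power_int_add)
    finally show "norm (q powi ((m + 1) * (m + 1)) * y powi (2 * (m + 1))) = norm q powi (2 * m) * norm (q * y^2) * norm (q powi (m * m) * y powi (2 * m))"
      by (simp add: norm_mult norm_power_int norm_power)
  qed (use that q0 in auto)
  have sg: "(\<lambda>l::int. norm (q powi (l * l + l) * y powi (2 * l + 1))) summable_on UNIV" if "y \<noteq> 0" for y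
  proof (rule int_ratio_summable[where r=1 and p=2 and K="norm (q^2 * y^2)"])
    fix m :: int
    have "(m + 1) * (m + 1) + (m + 1) = (m * m + m) + (2 * m + 2)" "2 * (m + 1) + 1 = (2 * m + 1) + 2"
      by (simp_all add: algebra_simps)
    then have "q powi ((m + 1) * (m + 1) + (m + 1)) * y powi (2 * (m + 1) + 1)
        = (q powi (m * m + m) * (q powi (2 * m) * q powi 2)) * (y powi (2 * m + 1) * y powi 2)"
      using that q0 by (metis power_int_add)
    also have "\<dots> = q powi (2 * m) * (q^2 * y^2) * (q powi (m * m + m) * y powi (2 * m + 1))"
      by (simp add: mult_ac)
    finally show "norm (q powi ((m + 1) * (m + 1) + (m + 1)) * y powi (2 * (m + 1) + 1)) = norm q powi (2 * m) * norm (q^2 * y^2) * norm (q powi (m * m + m) * y powi (2 * m + 1))"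
      by (simp add: norm_mult norm_power_int norm_power)
  qed (use that q0 in auto)
  have half: "2 * a = 2 * b \<Longrightarrow> a = b" for a b :: int by simp
  have qadd: "q powi a * q powi b = q powi (a + b)" for a b using q0 by (simp add: power_int_add)
  have T: "2 * (m * (m - 1) div 2) = m * (m - 1)" for m :: int by simp
  have main: "laurent tri (x * y) * laurent tri (x / y) = x * (g x * f y - f x * g y)" if "x \<noteq> 0" "y \<noteq> 0" for x y
  proof -
    have shift: "q powi ((l + 1) * (l + 1) - (l + 1)) * x powi (2 * (l + 1)) = q powi (l * l + l) * x powi (2 * l + 1) * x" for l
    proof -
      have "(l + 1) * (l + 1) - (l + 1) = l * l + l" "2 * (l + 1) = (2 * l + 1) + 1" by (simp_all add: algebra_simps)
      moreover have "x powi ((2 * l + 1) + 1) = x powi (2 * l + 1) * x" using that by (subst power_int_add) auto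
      ultimately show ?thesis by (simp only: mult.assoc)
    qed
    have bij1: "bij_betw (\<lambda>l::int. l + 1) UNIV UNIV" by (rule bij_betw_byWitness[where f'="\<lambda>l. l - 1"]) auto
    define t where "t p = (tri (fst p) * (x * y) powi (fst p)) * (tri (snd p) * (x / y) powi (snd p))" for p
    have s1: "(\<lambda>m. norm (tri m * (x * y) powi m)) summable_on UNIV" "(\<lambda>m. norm (tri m * (x / y) powi m)) summable_on UNIV"
      using tri_summable that by (auto simp: laurent_summable_def)
    note P = norm_summable_product[OF s1, folded t_def]
    have st: "t summable_on A" for A
      using summable_on_subset_banach[OF abs_summable_summable[OF P(1)]] by simp
    have xy_powi: "(x * y) powi m * (x / y) powi n = x powi (m + n) * y powi (m - n)" for m n
      using that by (simp add: power_int_mult_distrib power_int_divide_distrib power_int_add power_int_diff)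
    have t_eq: "t (m, n) = ((-1) powi m * (-1) powi n) * (q powi (m * (m - 1) div 2) * q powi (n * (n - 1) div 2))
        * ((x * y) powi m * (x / y) powi n)" for m n
      unfolding t_def tri_def fst_conv snd_conv by (simp only: mult_ac)
    define E where "E = {p :: int \<times> int. even (fst p + snd p)}"
    have "laurent tri (x * y) * laurent tri (x / y) = infsum t (E \<union> - E)"
      using P(2) by (simp add: laurent_def)
    also have "\<dots> = infsum t E + infsum t (- E)"
      by (rule infsum_Un_disjoint) (use st in auto)
    also have "infsum t E = (\<Sum>\<^sub>\<infinity>p\<in>UNIV\<times>UNIV. (q powi (fst p * fst p - fst p) * x powi (2 * fst p)) * (q powi (snd p * snd p) * y powi (2 * snd p)))"
    proof -
      have te: "t (k + l, k - l) = (q powi (k * k - k) * x powi (2 * k)) * (q powi (l * l) * y powi (2 * l))" for k l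
      proof -
        have "2 * ((k + l) * (k + l - 1) div 2 + (k - l) * (k - l - 1) div 2) = 2 * (k * k - k + l * l)"
          unfolding distrib_left T by (simp add: algebra_simps)
        then have "(k + l) * (k + l - 1) div 2 + (k - l) * (k - l - 1) div 2 = k * k - k + l * l" by (rule half)
        moreover have "(-1 :: complex) powi (k + l) * (-1) powi (k - l) = 1"
        proof -
          have "(-1 :: complex) powi (k + l) * (-1) powi (k - l) = (-1) powi ((k + l) + (k - l))"
            by (rule power_int_add[symmetric]) simp
          also have "(k + l) + (k - l) = 2 * k" by simp
          finally show ?thesis by (simp add: power_int_mult)
        qed
        moreover have "(x * y) powi (k + l) * (x / y) powi (k - l) = x powi (2 * k) * y powi (2 * l)"
          unfolding xy_powi by simp
        ultimately have "t (k + l, k - l) = 1 * (q powi (k * k - k) * q powi (l * l)) * (x powi (2 * k) * y powi (2 * l))"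
          by (simp only: t_eq qadd)
        then show ?thesis by (simp only: mult_ac mult_1)
      qed
      have "E = (\<lambda>(k,l). (k + l, k - l)) ` UNIV"
      proof (rule Set.set_eqI, rule iffI)
        fix p assume "p \<in> E"
        moreover obtain m n where mn: "p = (m, n)" by (cases p)
        ultimately have "even (m + n)" by (simp add: E_def)
        then obtain k where "m + n = 2 * k" by (rule evenE)
        then have "p = (\<lambda>(k,l). (k + l, k - l)) (k, k - n)" using mn by simp
        then show "p \<in> (\<lambda>(k,l). (k + l, k - l)) ` UNIV" by blast
      qed (auto simp: E_def)
      moreover have "inj (\<lambda>(k::int,l). (k + l, k - l))" by (auto simp: inj_def)
      ultimately show ?thesis by (auto simp: infsum_reindex te intro!: infsum_cong)
    qed
    also have "\<dots> = (\<Sum>\<^sub>\<infinity>k::int. q powi (k * k - k) * x powi (2 * k)) * f y"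
      unfolding f_def
    proof (rule norm_summable_product(2))
      have "(\<lambda>l. norm (q powi (l * l + l) * x powi (2 * l + 1)) * norm x) summable_on UNIV"
        using sg[OF that(1)] by (rule summable_on_cmult_left)
      then have "(\<lambda>l. norm (q powi ((l + 1) * (l + 1) - (l + 1)) * x powi (2 * (l + 1)))) summable_on UNIV"
        by (simp only: shift norm_mult)
      then show "(\<lambda>k::int. norm (q powi (k * k - k) * x powi (2 * k))) summable_on UNIV"
        by (subst summable_on_reindex_bij_betw[OF bij1, symmetric])
    qed (rule sf[OF that(2)])
    also have "(\<Sum>\<^sub>\<infinity>k::int. q powi (k * k - k) * x powi (2 * k)) = (\<Sum>\<^sub>\<infinity>l::int. (q powi (l * l + l) * x powi (2 * l + 1)) * x)"
      unfolding shift[symmetric] by (rule infsum_reindex_bij_betw[OF bij1, symmetric])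
    also have "\<dots> = g x * x" unfolding g_def by (rule infsum_cmult_left')
    also have "infsum t (- E) = (\<Sum>\<^sub>\<infinity>p\<in>UNIV\<times>UNIV. (- x) * ((q powi (fst p * fst p) * x powi (2 * fst p)) * (q powi (snd p * snd p + snd p) * y powi (2 * snd p + 1))))"
    proof -
      have te: "t (k + l + 1, k - l) = (- x) * ((q powi (k * k) * x powi (2 * k)) * (q powi (l * l + l) * y powi (2 * l + 1)))" for k l
      proof -
        have "2 * ((k + l + 1) * (k + l + 1 - 1) div 2 + (k - l) * (k - l - 1) div 2) = 2 * (k * k + (l * l + l))"
          unfolding distrib_left T by (simp add: algebra_simps)
        then have "(k + l + 1) * (k + l + 1 - 1) div 2 + (k - l) * (k - l - 1) div 2 = k * k + (l * l + l)" by (rule half)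
        moreover have "(-1 :: complex) powi (k + l + 1) * (-1) powi (k - l) = -1"
        proof -
          have "(-1 :: complex) powi (k + l + 1) * (-1) powi (k - l) = (-1) powi ((k + l + 1) + (k - l))"
            by (rule power_int_add[symmetric]) simp
          also have "(k + l + 1) + (k - l) = 2 * k + 1" by simp
          finally show ?thesis by (simp add: power_int_add power_int_mult)
        qed
        moreover have "(x * y) powi (k + l + 1) * (x / y) powi (k - l) = x * x powi (2 * k) * y powi (2 * l + 1)"
        proof -
          have "(k + l + 1) + (k - l) = 1 + 2 * k" "(k + l + 1) - (k - l) = 2 * l + 1" by simp_all
          moreover have "x powi (1 + 2 * k) = x * x powi (2 * k)" using that by (subst power_int_add) auto
          ultimately show ?thesis by (simp only: xy_powi)
        qed
        ultimately have "t (k + l + 1, k - l) = (- 1) * (q powi (k * k) * q powi (l * l + l)) * (x * x powi (2 * k) * y powi (2 * l + 1))"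
          by (simp only: t_eq qadd)
        then show ?thesis by (simp add: mult_ac)
      qed
      have "- E = (\<lambda>(k,l). (k + l + 1, k - l)) ` UNIV"
      proof (rule Set.set_eqI, rule iffI)
        fix p assume "p \<in> - E"
        moreover obtain m n where mn: "p = (m, n)" by (cases p)
        ultimately have "odd (m + n)" by (simp add: E_def)
        then obtain k where "m + n = 2 * k + 1" by (rule oddE)
        then have "p = (\<lambda>(k,l). (k + l + 1, k - l)) (k, k - n)" using mn by simp
        then show "p \<in> (\<lambda>(k,l). (k + l + 1, k - l)) ` UNIV" by blast
      qed (auto simp: E_def)
      moreover have "inj (\<lambda>(k::int,l). (k + l + 1, k - l))" by (auto simp: inj_def)
      ultimately show ?thesis by (auto simp: infsum_reindex te intro!: infsum_cong)
    qed
    also have "\<dots> = (- x) * (f x * g y)"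
      unfolding infsum_cmult_right' f_def g_def by (subst norm_summable_product(2)[OF sf sg]) (use that in auto)
    finally show ?thesis by (simp add: algebra_simps)
  qed
  obtain C where C: "\<And>u. u \<noteq> 0 \<Longrightarrow> theta q u = C * laurent tri u" using theta_laurent by blast
  show ?thesis
  proof (rule exI[of _ "\<lambda>x. C * C * f x"], rule exI[of _ g], intro allI impI)
    fix x y :: complex assume "x \<noteq> 0" "y \<noteq> 0"
    then have "theta q (x * y) * theta q (x / y) = C * C * (laurent tri (x * y) * laurent tri (x / y))"
      by (simp add: C)
    also have "\<dots> = C * C * (x * (g x * f y - f x * g y))"
      using main \<open>x \<noteq> 0\<close> \<open>y \<noteq> 0\<close> by simp
    also have "\<dots> = x * (g x * (C * C * f y) - C * C * f x * g y)" by (simp add: algebra_simps)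
    finally show "theta q (x * y) * theta q (x / y) = x * (g x * (C * C * f y) - C * C * f x * g y)" .
  qed
qed

text \<open>
  An identity between two-by-two minors of a rank two function, the Pluecker relation, is all that
  remains once the plane of theta functions of degree two is known.
\<close>

lemma theta_three_term:
  assumes "u \<noteq> 0" shows "three_term (theta q) u"
  unfolding three_term_def
proof (intro allI impI)
  fix b b' c c' :: complex assume nz: "b \<noteq> 0" "b' \<noteq> 0" "c \<noteq> 0" "c' \<noteq> 0"
  obtain f g where fg: "\<And>x y. x \<noteq> 0 \<Longrightarrow> y \<noteq> 0 \<Longrightarrow> theta q (x * y) * theta q (x / y) = x * (g x * f y - f x * g y)"
    using theta_rank_two by blast
  define B where "B x y = g x * f y - f x * g y" for x y
  have th: "theta q s * theta q t = x * B x y" if "x \<noteq> 0" "y \<noteq> 0" "s = x * y" "t = x / y" for s t x y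
    using fg that by (simp add: B_def)
  define \<beta> where "\<beta> = csqrt b"
  define \<beta>' where "\<beta>' = csqrt b'"
  define \<gamma> where "\<gamma> = csqrt c"
  define \<gamma>' where "\<gamma>' = csqrt c'"
  have e: "b = \<beta>^2" "b' = \<beta>'^2" "c = \<gamma>^2" "c' = \<gamma>'^2" by (auto simp: \<beta>_def \<beta>'_def \<gamma>_def \<gamma>'_def)
  have nz': "\<beta> \<noteq> 0" "\<beta>' \<noteq> 0" "\<gamma> \<noteq> 0" "\<gamma>' \<noteq> 0" using nz unfolding e by auto
  define x where "x = u * \<gamma> * \<gamma>' / (\<beta> * \<beta>')"
  define y where "y = \<gamma> * \<beta>' / (\<gamma>' * \<beta>)"
  define v where "v = \<gamma> * \<beta> / (\<gamma>' * \<beta>')"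
  define w where "w = \<gamma> * \<gamma>' / (\<beta> * \<beta>')"
  note d = x_def y_def v_def w_def e power2_eq_square
  have xyvw: "x \<noteq> 0" "y \<noteq> 0" "v \<noteq> 0" "w \<noteq> 0" using nz' assms by (auto simp: x_def y_def v_def w_def)
  have 1: "theta q (u * (c / b)) * theta q (u * (c' / b')) = x * B x y"
    by (rule th) (use xyvw nz' assms in \<open>simp_all add: d field_simps\<close>)
  have 2: "theta q (c / b') * theta q (c' / b) = w * B w v"
    by (rule th) (use xyvw nz' assms in \<open>simp_all add: d field_simps\<close>)
  have 3: "theta q (u * (c / b')) * theta q (u * (c' / b)) = x * B x v"
    by (rule th) (use xyvw nz' assms in \<open>simp_all add: d field_simps\<close>)
  have 4: "theta q (c / b) * theta q (c' / b') = w * B w y"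
    by (rule th) (use xyvw nz' assms in \<open>simp_all add: d field_simps\<close>)
  have 5: "theta q (u * (c / b) * (c' / b')) * theta q u = x * B x w"
    by (rule th) (use xyvw nz' assms in \<open>simp_all add: d field_simps\<close>)
  have 6: "theta q (c / c') * theta q (b' / b) = y * B y v"
    by (rule th) (use xyvw nz' assms in \<open>simp_all add: d field_simps\<close>)
  have w: "w = y * (c' / b')" using nz' by (auto simp: d)
  have pl: "B x y * B w v - B x v * B w y = B x w * B y v" by (simp add: B_def algebra_simps)
  have "theta q (u * (c / b)) * theta q (u * (c' / b')) * theta q (c / b') * theta q (c' / b)
     - theta q (u * (c / b')) * theta q (u * (c' / b)) * theta q (c / b) * theta q (c' / b')
     = (x * B x y) * (w * B w v) - (x * B x v) * (w * B w y)"
    unfolding 1[symmetric] 2[symmetric] 3[symmetric] 4[symmetric] by (simp add: mult_ac)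
  also have "\<dots> = x * w * (B x w * B y v)" unfolding pl[symmetric] by (simp add: algebra_simps)
  also have "\<dots> = c' / b' * (y * B y v) * (x * B x w)" unfolding w by simp
  also have "\<dots> = c' / b' * theta q (c / c') * theta q (b' / b) * theta q u * theta q (u * (c / b) * (c' / b'))"
    unfolding 5[symmetric] 6[symmetric] by (simp add: mult_ac)
  finally show "theta q (u * (c / b)) * theta q (u * (c' / b')) * theta q (c / b') * theta q (c' / b)
     - theta q (u * (c / b')) * theta q (u * (c' / b)) * theta q (c / b) * theta q (c' / b')
     = c' / b' * theta q (c / c') * theta q (b' / b) * theta q u * theta q (u * (c / b) * (c' / b'))" .
qed

end

subsection \<open>The Kronecker series\<close>

definition phi :: "complex \<Rightarrow> complex" where
  "phi z = 1 / (1 - z)"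

lemma laurent_split:
  assumes "laurent_summable c u" "u \<noteq> 0"
  shows "laurent c u = (\<Sum>n. c (int n) * u ^ n) + (\<Sum>n. c (- int n - 1) * (1 / u) ^ n) / u"
proof -
  let ?f = "\<lambda>m. c m * u powi m"
  have s: "?f summable_on A" for A
    using summable_on_subset_banach[OF abs_summable_summable[OF assms(1)[unfolded laurent_summable_def]]] by simp
  have 1: "bij_betw int UNIV {0..}" by (rule bij_betw_byWitness[where f'=nat]) auto
  have 2: "bij_betw (\<lambda>n. - int n - 1) UNIV {..<0}" by (rule bij_betw_byWitness[where f'="\<lambda>m. nat (- m - 1)"]) auto
  have "laurent c u = infsum ?f ({0..} \<union> {..<0})"
    unfolding laurent_def by (rule arg_cong[where f="infsum ?f"]) auto
  also have "\<dots> = infsum ?f {0..} + infsum ?f {..<0}"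
    by (rule infsum_Un_disjoint) (use s in auto)
  also have "infsum ?f {0..} = (\<Sum>\<^sub>\<infinity>n. c (int n) * u ^ n)"
    using infsum_reindex_bij_betw[OF 1, of ?f] by simp
  also have "\<dots> = (\<Sum>n. c (int n) * u ^ n)"
  proof -
    have "(\<lambda>n. c (int n) * u ^ n) summable_on UNIV"
      using summable_on_reindex_bij_betw[OF 1, of ?f] s by simp
    then show ?thesis by (rule sums_unique[OF has_sum_imp_sums[OF has_sum_infsum]])
  qed
  also have "infsum ?f {..<0} = (\<Sum>\<^sub>\<infinity>n. ?f (- int n - 1))"
    using infsum_reindex_bij_betw[OF 2, of ?f] by simp
  also have "\<dots> = (\<Sum>n. ?f (- int n - 1))"
  proof -
    have "(\<lambda>n. ?f (- int n - 1)) summable_on UNIV"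
      using summable_on_reindex_bij_betw[OF 2, of ?f] s by simp
    then show ?thesis by (rule sums_unique[OF has_sum_imp_sums[OF has_sum_infsum]])
  qed
  also have "\<dots> = (\<Sum>n. (c (- int n - 1) * (1 / u) ^ n) / u)"
  proof -
    have "u powi (- int n - 1) = (1 / u) ^ n / u" for n
      using assms(2) by (simp add: power_int_diff power_int_minus power_one_over divide_inverse power_inverse)
    then show ?thesis by simp
  qed
  also have "\<dots> = (\<Sum>n. c (- int n - 1) * (1 / u) ^ n) / u"
  proof (rule suminf_divide)
    have "(\<lambda>n. ?f (- int n - 1)) summable_on UNIV"
      using summable_on_reindex_bij_betw[OF 2, of ?f] s by simp
    then have "summable (\<lambda>n. ?f (- int n - 1))" by (rule summable_on_imp_summable)
    then have "summable (\<lambda>n. ?f (- int n - 1) * u)" by (rule summable_mult2)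
    moreover have "?f (- int n - 1) * u = c (- int n - 1) * (1 / u) ^ n" for n
      using assms(2) by (simp add: power_int_diff power_int_minus power_one_over divide_inverse power_inverse)
    ultimately show "summable (\<lambda>n. c (- int n - 1) * (1 / u) ^ n)" by simp
  qed
  finally show ?thesis .
qed

context nome
begin

text \<open>
  Points away from the zeros of theta.
\<close>

definition regular :: "complex \<Rightarrow> bool" where
  "regular a \<longleftrightarrow> a \<noteq> 0 \<and> (\<forall>k::int. q powi k \<noteq> a)"

lemma regular_powi: "regular a \<Longrightarrow> q powi m * a \<noteq> 1"
proof
  assume "regular a" "q powi m * a = 1"
  then have "a = q powi (- m)" using q0 by (simp add: power_int_minus field_simps)
  then show False using \<open>regular a\<close> unfolding regular_def by metis
qed

lemma regular_theta: "regular a \<Longrightarrow> theta q a \<noteq> 0"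
  by (rule theta_nz) (auto simp: regular_def)

lemma regular_annulus: "norm q < norm u \<Longrightarrow> norm u < 1 \<Longrightarrow> regular u"
  unfolding regular_def
proof (intro conjI allI notI)
  fix k :: int assume u: "norm q < norm u" "norm u < 1" "q powi k = u"
  then have n: "norm q powi k = norm u" by (metis norm_power_int)
  show False
  proof (cases "k \<le> 0")
    case True
    have "norm q powi (-k) \<le> 1"
      using True q1 by (simp add: power_int_def power_le_one)
    then have "norm q powi k \<ge> 1" using q0 by (simp add: power_int_minus field_simps)
    then show False using n u by simp
  next
    case False
    then have "norm q powi k \<le> norm q" using q1 q0 power_decreasing[of 1 "nat k" "norm q"] by (simp add: power_int_def)
    then show False using n u by simp
  qed
next
  assume "norm q < norm u" "u = 0" then show False by simp
qed

lemma phi_bound: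
  assumes "regular a"
  obtains K where "K > 0" "\<And>n. norm (phi (q powi int n * a)) \<le> K" "\<And>n. norm (phi (q powi (- int n) * a)) \<le> K * norm q ^ n"
proof -
  have z: "(\<lambda>n. q ^ n) \<longlonglongrightarrow> 0" using q1 by (rule LIMSEQ_power_zero)
  have "(\<lambda>n. phi (q ^ n * a)) \<longlonglongrightarrow> 1 / (1 - 0 * a)"
    unfolding phi_def by (intro tendsto_intros z) auto
  then have "Bseq (\<lambda>n. phi (q ^ n * a))" by (meson convergentI convergent_imp_Bseq)
  then obtain K1 where K1: "\<And>n. norm (phi (q ^ n * a)) \<le> K1" by (auto simp: Bseq_def)
  have a0: "a \<noteq> 0" using assms by (simp add: regular_def)
  have "(\<lambda>n. 1 / (q ^ n - a)) \<longlonglongrightarrow> 1 / (0 - a)"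
    by (intro tendsto_intros z) (use a0 in auto)
  then have "Bseq (\<lambda>n. 1 / (q ^ n - a))" by (meson convergentI convergent_imp_Bseq)
  then obtain K2 where K2: "\<And>n. norm (1 / (q ^ n - a)) \<le> K2" by (auto simp: Bseq_def)
  define K where "K = max 1 (max K1 K2)"
  show thesis
  proof (rule that[of K])
    show "K > 0" by (simp add: K_def)
    show "norm (phi (q powi int n * a)) \<le> K" for n using K1[of n] by (simp add: K_def)
    have "phi (q powi (- int n) * a) = 1 / (q ^ n - a) * q ^ n" for n
    proof -
      have "q ^ n - a \<noteq> 0" using regular_powi[OF assms, of "- int n"] q0 by (auto simp: power_int_minus field_simps)
      then show ?thesis unfolding phi_def using q0 regular_powi[OF assms, of "- int n"] by (simp add: power_int_minus field_simps)
    qed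
    then have "norm (phi (q powi (- int n) * a)) = norm (1 / (q ^ n - a)) * norm q ^ n" for n
      by (simp only: norm_mult norm_power)
    moreover have "norm (1 / (q ^ n - a)) * norm q ^ n \<le> K * norm q ^ n" for n
      using K2[of n] unfolding K_def by (intro mult_right_mono) auto
    ultimately show "norm (phi (q powi (- int n) * a)) \<le> K * norm q ^ n" for n by metis
  qed
qed

lemma phi_bounded:
  assumes "regular a"
  obtains K where "K > 0" "\<And>m::int. norm (phi (q powi m * a)) \<le> K"
proof -
  obtain K where K: "K > 0" "\<And>n. norm (phi (q powi int n * a)) \<le> K" "\<And>n. norm (phi (q powi (- int n) * a)) \<le> K * norm q ^ n"
    using phi_bound[OF assms] by blast
  have "norm (phi (q powi m * a)) \<le> K" for m :: int
  proof (cases "m \<ge> 0")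
    case True then show ?thesis using K(2)[of "nat m"] by simp
  next
    case False 
    have "K * norm q ^ nat (- m) \<le> K" using K(1) q1 by (simp add: power_le_one)
    then show ?thesis using K(3)[of "nat (- m)"] False by simp
  qed
  with K(1) that show thesis by blast
qed

lemma kronecker_summable:
  assumes "regular a" "norm q < norm u" "norm u < 1"
  shows "laurent_summable (\<lambda>m. phi (q powi m * a)) u"
  unfolding laurent_summable_def
proof (rule summable_on_int)
  obtain K where K: "K > 0" "\<And>n. norm (phi (q powi int n * a)) \<le> K" "\<And>n. norm (phi (q powi (- int n) * a)) \<le> K * norm q ^ n"
    using phi_bound[OF assms(1)] by blast
  have u0: "norm u > 0" using assms(2) by (metis norm_ge_zero le_less_trans)
  have "summable (\<lambda>n. K * norm u ^ n)" using assms by (intro summable_mult summable_geometric) auto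
  then show "summable (\<lambda>n. norm (phi (q powi int n * a) * u powi int n))"
    by (rule summable_comparison_test') (use K(2) in \<open>auto simp: norm_mult norm_power mult_right_mono\<close>)
  have "summable (\<lambda>n. K * (norm q / norm u) ^ n)" using assms u0 by (intro summable_mult summable_geometric) auto
  then show "summable (\<lambda>n. norm (phi (q powi (- int n) * a) * u powi (- int n)))"
  proof (rule summable_comparison_test')
    fix n :: nat
    have "norm (phi (q powi (- int n) * a)) * inverse (norm u ^ n) \<le> K * norm q ^ n * inverse (norm u ^ n)"
      using K(3)[of n] by (intro mult_right_mono) auto
    then show "norm (norm (phi (q powi (- int n) * a) * u powi (- int n))) \<le> K * (norm q / norm u) ^ n"
      by (simp add: norm_mult norm_power_int power_int_minus norm_inverse norm_power power_divide divide_inverse power_inverse power_mult_distrib)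
  qed
qed auto

lemma kronecker_aux:
  assumes "regular a"
  obtains g where "\<And>u. norm q < norm u \<Longrightarrow> norm u < 1 \<Longrightarrow> theta q u * laurent (\<lambda>m. phi (q powi m * a)) u = g * theta q (u * a)"
proof -
  define g where "g N = (\<Sum>\<^sub>\<infinity>k. tri k * phi (q powi (N - k) * a))" for N
  have gf: "g = (\<lambda>N. \<Sum>\<^sub>\<infinity>k. tri k * phi (q powi (N - k) * a))" by (rule ext) (rule g_def)
  obtain C where C: "C \<noteq> 0" "\<And>u. u \<noteq> 0 \<Longrightarrow> theta q u = C * laurent tri u" using theta_laurent by blast
  obtain K where K: "K > 0" "\<And>m::int. norm (phi (q powi m * a)) \<le> K" using phi_bounded[OF assms] by blast
  have a0: "a \<noteq> 0" using assms by (simp add: regular_def)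
  have st: "(\<lambda>k. norm (tri k)) summable_on UNIV" using tri_summable[of 1] by (simp add: laurent_summable_def)
  have sm: "(\<lambda>k. tri k * phi (q powi (N - k) * a)) summable_on UNIV" for N
  proof (rule abs_summable_summable, rule summable_on_comparison_test)
    show "(\<lambda>k. norm (tri k) * K) summable_on UNIV" using st by (rule summable_on_cmult_left)
    show "norm (tri k * phi (q powi (N - k) * a)) \<le> norm (tri k) * K" for k
      using K by (simp add: norm_mult mult_left_mono)
  qed auto
  have sq: "(\<lambda>k. tri k * q powi k) summable_on UNIV"
    using abs_summable_summable[OF tri_summable[OF q0, unfolded laurent_summable_def]] .
  have "theta q q = 0" using q0 poch_rec[of 1] by (simp add: theta_def)
  then have zero: "(\<Sum>\<^sub>\<infinity>k. tri k * q powi k) = 0" using C q0 by (simp add: laurent_def)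
  have bij: "bij_betw (\<lambda>l::int. l + 1) UNIV UNIV" by (rule bij_betw_byWitness[where f'="\<lambda>l. l - 1"]) auto
  have rec: "g (N + 1) = - (q powi N) * a * g N" for N
  proof -
    have "g (N + 1) = (\<Sum>\<^sub>\<infinity>k. tri (k + 1) * phi (q powi ((N + 1) - (k + 1)) * a))"
      unfolding g_def by (rule infsum_reindex_bij_betw[OF bij, symmetric])
    also have "\<dots> = (\<Sum>\<^sub>\<infinity>k. - (tri k * q powi k) + - (q powi N * a) * (tri k * phi (q powi (N - k) * a)))"
    proof (rule infsum_cong)
      fix k
      let ?z = "q powi (N - k) * a"
      have z: "?z \<noteq> 1" by (rule regular_powi[OF assms])
      have e: "q powi N * a = q powi k * ?z" using q0 by (simp add: power_int_diff)
      have h: "q powi k * phi ?z = q powi k + q powi k * ?z * phi ?z"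
        using z by (simp add: phi_def field_simps)
      have "- (q powi k) * tri k * phi ?z = - tri k * (q powi k * phi ?z)" by simp
      also have "\<dots> = - tri k * (q powi k + q powi k * ?z * phi ?z)" by (simp only: h)
      also have "\<dots> = - (tri k * q powi k) + - (q powi k * ?z) * (tri k * phi ?z)"
        by (simp add: algebra_simps)
      finally have "- (q powi k) * tri k * phi ?z = - (tri k * q powi k) + - (q powi k * ?z) * (tri k * phi ?z)" .
      then show "tri (k + 1) * phi (q powi ((N + 1) - (k + 1)) * a) = - (tri k * q powi k) + - (q powi N * a) * (tri k * phi ?z)"
        unfolding e by (simp add: tri_rec)
    qed
    also have "\<dots> = - (\<Sum>\<^sub>\<infinity>k. tri k * q powi k) + - (q powi N * a) * g N"
      unfolding g_def using sm sq by (subst infsum_add) (auto simp: infsum_uminus infsum_cmult_right' summable_on_uminus summable_on_cmult_right)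
    finally show ?thesis using zero by simp
  qed
  have eq: "g m = g 0 * (tri m * a powi m)" for m
  proof (induction m rule: int_induct[of _ 0])
    case base show ?case by (simp add: tri_0)
  next
    case (step1 i) then show ?case using a0 by (simp add: rec tri_rec power_int_add)
  next
    case (step2 i) 
    have r: "g i = - (q powi (i - 1)) * a * g (i - 1)" using rec[of "i - 1"] by simp
    have t: "tri i = - (q powi (i - 1)) * tri (i - 1)" using tri_rec[of "i - 1"] by simp
    have p: "a powi i = a powi (i - 1) * a" using a0 power_int_add[of a "i - 1" 1] by simp
    have "q powi (i - 1) * a * (g (i - 1) - g 0 * (tri (i - 1) * a powi (i - 1))) = 0"
      using step2(2) unfolding r t p by (simp add: algebra_simps)
    then show ?case using q0 a0 by simp
  qed
  show thesis
  proof (rule that[of "g 0"])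
    fix u :: complex assume u: "norm q < norm u" "norm u < 1"
    then have u0: "u \<noteq> 0" by auto
    have "laurent tri u * laurent (\<lambda>m. phi (q powi m * a)) u = laurent g u"
      using laurent_mult(2)[OF u0 tri_summable[OF u0] kronecker_summable[OF assms u]] unfolding gf by simp
    also have "\<dots> = (\<Sum>\<^sub>\<infinity>m. g 0 * (tri m * (u * a) powi m))"
      unfolding laurent_def by (subst eq) (simp add: power_int_mult_distrib mult_ac)
    also have "\<dots> = g 0 * laurent tri (u * a)"
      unfolding laurent_def by (rule infsum_cmult_right')
    finally show "theta q u * laurent (\<lambda>m. phi (q powi m * a)) u = g 0 * theta q (u * a)"
      using C u0 a0 by simp
  qed
qed

text \<open>
  The bilateral geometric series is compared with the quotient of theta functions through the
  coefficients of its Laurent expansion in an annulus.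
\<close>

lemma kronecker:
  assumes "regular a" "norm q < norm u" "norm u < 1"
  shows "laurent (\<lambda>m. phi (q powi m * a)) u = (poch q q)\<^sup>2 * theta q (u * a) / (theta q u * theta q a)"
proof -
  obtain g where g: "\<And>u. norm q < norm u \<Longrightarrow> norm u < 1 \<Longrightarrow> theta q u * laurent (\<lambda>m. phi (q powi m * a)) u = g * theta q (u * a)"
    using kronecker_aux[OF assms(1)] by blast
  define F where "F m = phi (q powi m * a)" for m
  define D where "D m = F m + (-1) * F (m + -1)" for m
  have D: "laurent_summable D u" "laurent D u = (1 - u) * laurent F u" if "norm q < norm u" "norm u < 1" for u
  proof -
    have u0: "u \<noteq> 0" using that by auto
    have s: "laurent_summable F u" unfolding F_def by (rule kronecker_summable[OF assms(1) that])
    note l = laurent_linear[OF s laurent_shift(1)[OF u0 s], of "-1" "-1", folded D_def]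
    show "laurent_summable D u" by (rule l(1))
    show "laurent D u = (1 - u) * laurent F u"
      using l(2) laurent_shift(2)[OF u0 s, of "-1"] u0 by (simp add: power_int_minus field_simps)
  qed
  obtain K where K: "K > 0" "\<And>n. norm (phi (q powi int n * a)) \<le> K" "\<And>n. norm (phi (q powi (- int n) * a)) \<le> K * norm q ^ n"
    using phi_bound[OF assms(1)] by blast
  obtain L where L: "L > 0" "\<And>m::int. norm (phi (q powi m * a)) \<le> L" using phi_bounded[OF assms(1)] by blast
  define M where "M = norm a * norm (1 - 1 / q) * (L * L) + 2 * K"
  have Dp: "norm (D (int n)) \<le> M * norm q ^ n" for n
  proof -
    have z: "q powi int n * a \<noteq> 1" "q powi (int n - 1) * a \<noteq> 1" using regular_powi[OF assms(1)] by blast+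
    have "q powi int n * a - q powi (int n - 1) * a = q ^ n * a * (1 - 1 / q)"
      using q0 by (simp add: power_int_diff field_simps)
    moreover have "1 / (1 - x) + (-1) * (1 / (1 - w)) = (x - w) * (1 / (1 - x) * (1 / (1 - w)))" if "x \<noteq> 1" "w \<noteq> 1" for x w :: complex
      using that by (simp add: field_simps)
    ultimately have "D (int n) = q ^ n * a * (1 - 1 / q) * (phi (q powi int n * a) * phi (q powi (int n - 1) * a))"
      using z unfolding D_def F_def phi_def by (metis uminus_add_conv_diff add.commute)
    then have "norm (D (int n)) = norm q ^ n * (norm a * norm (1 - 1 / q) * (norm (phi (q powi int n * a)) * norm (phi (q powi (int n - 1) * a))))"
      by (simp only: norm_mult norm_power mult_ac)
    also have "\<dots> \<le> norm q ^ n * (norm a * norm (1 - 1 / q) * (L * L))"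
      using L(2)[of "int n"] L(2)[of "int n - 1"] L(1) by (intro mult_left_mono mult_mono) (simp_all del: power_int_of_nat)
    also have "\<dots> \<le> norm q ^ n * M" using K(1) by (intro mult_left_mono) (auto simp: M_def)
    finally show ?thesis by (simp add: mult.commute)
  qed
  have Dn: "norm (D (- int n - 1)) \<le> M * norm q ^ n" for n
  proof -
    have e: "norm (F (- int m)) \<le> K * norm q ^ n" if "n \<le> m" for m
    proof -
      have "K * norm q ^ m \<le> K * norm q ^ n" using K(1) q1 that by (intro mult_left_mono power_decreasing) auto
      then show ?thesis using K(3)[of m] by (simp add: F_def)
    qed
    have "D m = F m - F (m - 1)" for m by (simp add: D_def)
    moreover have "- int n - 1 = - int (n + 1)" "- int (n + 1) - 1 = - int (n + 2)" by simp_all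
    ultimately have "D (- int n - 1) = F (- int (n + 1)) - F (- int (n + 2))" by (simp only:)
    then have "norm (D (- int n - 1)) \<le> norm (F (- int (n + 1))) + norm (F (- int (n + 2)))"
      using norm_triangle_ineq4[of "F (- int (n + 1))" "F (- int (n + 2))"] by (simp only:)
    also have "\<dots> \<le> K * norm q ^ n + K * norm q ^ n" by (intro add_mono e) auto
    also have "\<dots> \<le> M * norm q ^ n" using K(1) L(1)
      by (simp add: M_def algebra_simps)
    finally show ?thesis .
  qed
  define P where "P z = (\<Sum>n. D (int n) * z ^ n)" for z :: complex
  define N where "N z = (\<Sum>n. D (- int n - 1) * z ^ n)" for z :: complex
  have cont: "isCont (\<lambda>z. \<Sum>n. c n * z ^ n) (1::complex)" if c: "\<And>n. norm (c n) \<le> M * norm q ^ n" for c :: "nat \<Rightarrow> complex"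
  proof (rule isCont_powser)
    define r where "r = (1 + norm q) / 2"
    have r: "norm q < r" "r < 1" "r > 0" using q1 by (auto simp: r_def add_pos_nonneg)
    show "norm (1::complex) < norm (complex_of_real (1 / r))" using r unfolding norm_of_real by simp
    have "summable (\<lambda>n. M * (norm q / r) ^ n)" using r by (intro summable_mult summable_geometric) auto
    then show "summable (\<lambda>n. c n * complex_of_real (1 / r) ^ n)"
    proof (rule summable_comparison_test')
      fix n :: nat
      have "norm (c n) * (1 / r) ^ n \<le> M * norm q ^ n * (1 / r) ^ n" using c r by (intro mult_right_mono) auto
      then show "norm (c n * complex_of_real (1 / r) ^ n) \<le> M * (norm q / r) ^ n"
        using r by (simp add: norm_mult norm_power norm_divide power_divide)
    qed
  qed
  have cP: "isCont P 1" unfolding P_def by (rule cont[OF Dp])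
  have cN: "isCont N 1" unfolding N_def by (rule cont[OF Dn])
  define v where "v j = complex_of_real (1 - (1 - norm q) / (real j + 2))" for j
  have v1: "v \<longlonglongrightarrow> 1"
  proof -
    have "(\<lambda>j. 1 - (1 - norm q) / (real j + 2)) \<longlonglongrightarrow> 1" by real_asymp
    then have "(\<lambda>j. complex_of_real (1 - (1 - norm q) / (real j + 2))) \<longlonglongrightarrow> complex_of_real 1" by (rule tendsto_of_real)
    then show ?thesis unfolding v_def by simp
  qed
  have va: "norm q < norm (v j)" "norm (v j) < 1" for j
  proof -
    have "(1 - norm q) / (real j + 2) < (1 - norm q) / 1" using q1 by (intro divide_strict_left_mono) auto
    then have "(1 - norm q) / (real j + 2) < 1 - norm q" by simp
    moreover have "(1 - norm q) / (real j + 2) > 0" using q1 by simp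
    ultimately have "norm q < 1 - (1 - norm q) / (real j + 2)" "1 - (1 - norm q) / (real j + 2) < 1" by auto
    moreover have "norm (v j) = 1 - (1 - norm q) / (real j + 2)"
      unfolding v_def norm_of_real using calculation norm_ge_zero[of q] by linarith
    ultimately show "norm q < norm (v j)" "norm (v j) < 1" by auto
  qed
  have eq: "theta_reg q (v j) * (P (v j) + N (1 / v j) / v j) = g * theta q (v j * a)" for j
  proof -
    have v0: "v j \<noteq> 0" using va(1)[of j] by auto
    have "P (v j) + N (1 / v j) / v j = (1 - v j) * laurent F (v j)"
      using laurent_split[OF D(1)[OF va] v0] D(2)[OF va] unfolding P_def N_def by simp
    then have "theta_reg q (v j) * (P (v j) + N (1 / v j) / v j) = theta q (v j) * laurent F (v j)"
      by (simp add: theta_reg)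
    then show ?thesis using g[OF va] unfolding F_def by simp
  qed
  have a0: "a \<noteq> 0" using assms(1) by (simp add: regular_def)
  have "(\<lambda>j. theta_reg q (v j) * (P (v j) + N (1 / v j) / v j)) \<longlonglongrightarrow> theta_reg q 1 * (P 1 + N 1 / 1)"
    unfolding theta_reg_def
    by (intro tendsto_intros v1 isCont_tendsto_compose[OF cP] isCont_tendsto_compose[OF cN] tendsto_eq_intros(1))
       (use tendsto_divide[OF tendsto_const v1, of 1] in auto)
  moreover have "(\<lambda>j. g * theta q (v j * a)) \<longlonglongrightarrow> g * theta q (1 * a)"
    unfolding theta_def by (intro tendsto_intros v1) (use a0 in auto)
  ultimately have lim: "theta_reg q 1 * (P 1 + N 1) = g * theta q a"
    unfolding eq using LIMSEQ_unique by fastforce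
  have z: "(\<lambda>n. q ^ n) \<longlonglongrightarrow> 0" using q1 by (rule LIMSEQ_power_zero)
  have P1: "P 1 = 1 - phi (a / q)"
  proof -
    have "(\<lambda>n. phi (q ^ n * (a / q))) \<longlonglongrightarrow> 1 / (1 - 0 * (a / q))"
      unfolding phi_def by (intro tendsto_intros z) auto
    then have "(\<lambda>n. phi (q ^ Suc n * (a / q)) - phi (q ^ n * (a / q))) sums (1 / (1 - 0 * (a / q)) - phi (q ^ 0 * (a / q)))"
      by (rule telescope_sums)
    moreover have "phi (q ^ Suc n * (a / q)) - phi (q ^ n * (a / q)) = D (int n) * 1 ^ n" for n
    proof -
      have "q ^ Suc n * (a / q) = q powi int n * a" "q ^ n * (a / q) = q powi (int n + -1) * a"
        using q0 by (simp_all add: power_int_diff)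
      then show ?thesis unfolding D_def F_def by simp
    qed
    ultimately show ?thesis unfolding P_def by (simp add: sums_iff)
  qed
  have N1: "N 1 = phi (a / q)"
  proof -
    have "(\<lambda>n. K * norm q ^ Suc n) \<longlonglongrightarrow> K * 0"
      using q1 by (intro tendsto_intros LIMSEQ_Suc LIMSEQ_power_zero) auto
    then have k0: "(\<lambda>n. K * norm q ^ Suc n) \<longlonglongrightarrow> 0" by simp
    have "\<forall>n. norm (F (- int (Suc n))) \<le> K * norm q ^ Suc n" unfolding F_def using K(3) by blast
    then have "(\<lambda>n. F (- int (Suc n))) \<longlonglongrightarrow> 0"
      by (intro Lim_null_comparison[OF always_eventually k0])
    then have "(\<lambda>n. F (- int (Suc n)) - F (- int (Suc (Suc n)))) sums (F (- int (Suc 0)) - 0)"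
      by (rule telescope_sums')
    moreover have "F (- int (Suc n)) - F (- int (Suc (Suc n))) = D (- int n - 1) * 1 ^ n" for n
    proof -
      have "- int (Suc n) = - int n - 1" "- int (Suc (Suc n)) = (- int n - 1) + -1" by simp_all
      then have "F (- int (Suc n)) = F (- int n - 1)" "F (- int (Suc (Suc n))) = F ((- int n - 1) + -1)" by (simp_all only:)
      then show ?thesis unfolding D_def by (simp only: mult_minus1 power_one mult_1_right add_uminus_conv_diff)
    qed
    moreover have "F (- int (Suc 0)) = phi (a / q)" unfolding F_def by (simp add: power_int_minus field_simps)
    ultimately show ?thesis unfolding N_def by (simp add: sums_iff)
  qed
  have "g * theta q a = (poch q q)\<^sup>2"
    unfolding lim[symmetric] P1 N1 by (simp add: theta_reg_def power2_eq_square)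
  then have "g = (poch q q)\<^sup>2 / theta q a" using regular_theta[OF assms(1)] by (simp add: field_simps)
  then show ?thesis
    using g[OF assms(2,3)] regular_theta[OF assms(1)] regular_theta[OF regular_annulus[OF assms(2,3)]]
    by (simp add: field_simps)
qed

end

section \<open>Determinants\<close>

definition ndet :: "nat \<Rightarrow> (nat \<Rightarrow> nat \<Rightarrow> 'a::comm_ring_1) \<Rightarrow> 'a" where
  "ndet n M = det (mat n n (\<lambda>(i,j). M i j))"

lemma ndet_leibniz: "ndet n M = (\<Sum>p | p permutes {0..<n}. signof p * (\<Prod>i=0..<n. M i (p i)))"
proof -
  have "(\<Prod>i=0..<n. mat n n (\<lambda>(i,j). M i j) $$ (i, p i)) = (\<Prod>i=0..<n. M i (p i))" if "p permutes {0..<n}" for p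
    using permutes_in_image[OF that] by (intro prod.cong) (auto simp: index_mat)
  then show ?thesis unfolding ndet_def by (subst det_def'[of _ n]) (auto intro!: sum.cong)
qed

lemma ndet_0: "ndet 0 M = 1" by (simp add: ndet_def)

lemma ndet_cong: "(\<And>i j. i < n \<Longrightarrow> j < n \<Longrightarrow> M i j = N i j) \<Longrightarrow> ndet n M = ndet n N"
  unfolding ndet_def by (rule arg_cong[where f=det]) (auto intro!: eq_matI)

lemma ndet_scale: "ndet n (\<lambda>i j. x i * y j * M i j) = (\<Prod>i<n. x i) * (\<Prod>j<n. y j) * ndet n M"
proof -
  have "signof p * (\<Prod>i=0..<n. x i * y (p i) * M i (p i)) = (\<Prod>i<n. x i) * (\<Prod>j<n. y j) * (signof p * (\<Prod>i=0..<n. M i (p i)))"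
    if "p permutes {0..<n}" for p
  proof -
    have "(\<Prod>i=0..<n. y (p i)) = (\<Prod>j<n. y j)"
      using prod.permute[OF that, of y] by (simp add: o_def atLeast0LessThan)
    then show ?thesis by (simp add: prod.distrib atLeast0LessThan mult_ac)
  qed
  then show ?thesis unfolding ndet_leibniz by (simp add: sum_distrib_left)
qed

text \<open>
  One step of Gaussian elimination; every Cauchy type determinant below is proved by induction along it.
\<close>

lemma ndet_schur:
  fixes M :: "nat \<Rightarrow> nat \<Rightarrow> 'a::field"
  assumes "M n n \<noteq> 0"
  shows "ndet (Suc n) M = M n n * ndet n (\<lambda>i j. M i j - M i n * M n j / M n n)"
proof -
  let ?A = "mat (Suc n) (Suc n) (\<lambda>(i,j). M i j)"
  define L where "L = mat (Suc n) (Suc n) (\<lambda>(i,j). if i = j then 1 else if j = n then - M i n / M n n else 0)"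
  define B where "B = four_block_mat (mat n n (\<lambda>(i,j). M i j - M i n * M n j / M n n)) (0\<^sub>m n 1) (mat 1 n (\<lambda>(i,j). M n j)) (mat 1 1 (\<lambda>_. M n n))"
  have dL: "det L = 1"
  proof -
    have "upper_triangular L" by (auto simp: L_def)
    then have "det L = prod_list (diag_mat L)" by (rule det_upper_triangular[of _ "Suc n"]) (simp add: L_def)
    also have "diag_mat L = map (\<lambda>_. 1) [0..<Suc n]" unfolding diag_mat_def by (rule map_cong) (auto simp: L_def)
    finally show ?thesis by (simp add: map_replicate_const del: upt_Suc)
  qed
  have "L * ?A = B"
  proof (rule eq_matI)
    fix i j assume "i < dim_row B" "j < dim_col B"
    then have ij: "i < Suc n" "j < Suc n" by (auto simp: B_def)
    have "(L * ?A) $$ (i, j) = (\<Sum>k=0..<Suc n. L $$ (i,k) * M k j)"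
      using ij by (simp add: L_def scalar_prod_def del: sum.op_ivl_Suc)
    also have "\<dots> = (\<Sum>k=0..<n. L $$ (i,k) * M k j) + L $$ (i,n) * M n j" by simp
    also have "(\<Sum>k=0..<n. L $$ (i,k) * M k j) = (\<Sum>k=0..<n. if i = k then M k j else 0)"
      using ij by (intro sum.cong) (auto simp: L_def)
    also have "\<dots> = (if i < n then M i j else 0)" by (simp add: sum.delta')
    finally have e: "(L * ?A) $$ (i, j) = (if i < n then M i j else 0) + L $$ (i,n) * M n j" .
    show "(L * ?A) $$ (i, j) = B $$ (i, j)"
      unfolding e B_def using ij assms by (auto simp: L_def less_Suc_eq)
  qed (auto simp: L_def B_def)
  then have "det ?A = det B" using det_mult[of L "Suc n" ?A] dL by (simp add: L_def)
  also have "det B = det (mat n n (\<lambda>(i,j). M i j - M i n * M n j / M n n)) * det (mat 1 1 (\<lambda>_. M n n))"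
    unfolding B_def by (rule det_four_block_mat_upper_right_zero_col) auto
  also have "det (mat 1 1 (\<lambda>_. M n n)) = M n n" by (subst det_single) auto
  finally show ?thesis unfolding ndet_def by (simp only: mult.commute)
qed

text \<open>
  The product side of the Frobenius determinant, for an odd function \<open>T\<close> in
  multiplicative notation.
\<close>

definition frob :: "(complex \<Rightarrow> complex) \<Rightarrow> nat \<Rightarrow> (nat \<Rightarrow> complex) \<Rightarrow> (nat \<Rightarrow> complex) \<Rightarrow> complex" where
  "frob T n c b = (\<Prod>i<n. 1 / T (c i / b i)) *
     (\<Prod>k<n. \<Prod>i<k. (T (c i / c k) * T (b k / b i)) / (T (c i / b k) * T (c k / b i)))"

text \<open>
  The elliptic Cauchy determinant. The only property of the function \<open>T\<close> that enters is
  its three-term relation, so the same statement covers both theta and its rational degeneration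
  \<open>1 - z\<close>.
\<close>

lemma frobenius:
  assumes V: "\<And>v. V v \<Longrightarrow> three_term T v" "\<And>v k. V v \<Longrightarrow> V (v * (c k / b k))"
    and nz: "\<And>i. c i \<noteq> 0" "\<And>i. b i \<noteq> 0" "\<And>i j. i < n \<Longrightarrow> j < n \<Longrightarrow> T (c i / b j) \<noteq> 0"
    and u: "V u" "\<And>k. k \<le> n \<Longrightarrow> T (u * (\<Prod>i\<in>{k..<n}. c i / b i)) \<noteq> 0"
  shows "ndet n (\<lambda>i j. T (u * (c i / b j)) / (T u * T (c i / b j))) =
    T (u * (\<Prod>i<n. c i / b i)) / T u * (\<Prod>k<n. (c k / b k) ^ k) * frob T n c b"
  using nz(3) u
proof (induction n arbitrary: u)
  case 0
  then show ?case using "0.prems"(3)[of 0] by (simp add: ndet_0 frob_def)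
next
  case (Suc n)
  let ?M = "\<lambda>i j. T (u * (c i / b j)) / (T u * T (c i / b j))"
  define v where "v = u * (c n / b n)"
  have uv: "u * (\<Prod>i\<in>{k..<Suc n}. c i / b i) = v * (\<Prod>i\<in>{k..<n}. c i / b i)" if "k \<le> n" for k
    using that by (simp add: v_def)
  have T0: "T u \<noteq> 0" using Suc.prems(3)[of "Suc n"] by simp
  have T1: "T v \<noteq> 0" using Suc.prems(3)[of n] by (simp add: v_def)
  have Ta: "T (c i / b j) \<noteq> 0" if "i \<le> n" "j \<le> n" for i j using Suc.prems(1) that by simp
  define x where "x i = (c n / b n) * T (c i / c n) / T (c i / b n)" for i
  define y where "y j = T (b n / b j) / T (c n / b j)" for j
  have Mnn: "?M n n \<noteq> 0" using T0 T1 Ta by (simp add: v_def)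
  have step: "?M i j - ?M i n * ?M n j / ?M n n = x i * y j * (T (v * (c i / b j)) / (T v * T (c i / b j)))" if "i < n" "j < n" for i j
  proof -
    have "T (u * (c i / b j)) * T v * T (c i / b n) * T (c n / b j)
     - T (u * (c i / b n)) * T (u * (c n / b j)) * T (c i / b j) * T (c n / b n)
     = c n / b n * T (c i / c n) * T (b n / b j) * T u * T (u * (c i / b j) * (c n / b n))"
      using V(1)[OF Suc.prems(2)] nz(1,2) unfolding three_term_def v_def by blast
    moreover have "u * (c i / b j) * (c n / b n) = v * (c i / b j)" by (simp add: v_def mult_ac)
    ultimately have tt: "T (u * (c i / b j)) * T v * T (c i / b n) * T (c n / b j)
     - T (u * (c i / b n)) * T (u * (c n / b j)) * T (c i / b j) * T (c n / b n)
     = c n / b n * T (c i / c n) * T (b n / b j) * T u * T (v * (c i / b j))" by simp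
    have gen: "X / (t * a) - X1 / (t * a1) * (X2 / (t * a2)) / (w / (t * d)) = (X * w * a1 * a2 - X1 * X2 * a * d) / (t * a * a1 * a2 * w)"
      if "t \<noteq> 0" "a \<noteq> 0" "a1 \<noteq> 0" "a2 \<noteq> 0" "d \<noteq> 0" "w \<noteq> 0" for X t a X1 a1 X2 a2 w d :: complex
      using that by (simp add: field_simps)
    have "?M i j - ?M i n * ?M n j / ?M n n = (T (u * (c i / b j)) * T v * T (c i / b n) * T (c n / b j)
     - T (u * (c i / b n)) * T (u * (c n / b j)) * T (c i / b j) * T (c n / b n)) / (T u * T (c i / b j) * T (c i / b n) * T (c n / b j) * T v)"
      unfolding v_def[symmetric] by (rule gen) (use T0 T1 Ta that in auto)
    then show ?thesis unfolding tt x_def y_def using T0 by (simp add: mult_ac)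
  qed
  have "ndet (Suc n) ?M = ?M n n * ndet n (\<lambda>i j. ?M i j - ?M i n * ?M n j / ?M n n)"
    by (rule ndet_schur) (rule Mnn)
  also have "ndet n (\<lambda>i j. ?M i j - ?M i n * ?M n j / ?M n n) = ndet n (\<lambda>i j. x i * y j * (T (v * (c i / b j)) / (T v * T (c i / b j))))"
    by (rule ndet_cong) (rule step)
  also have "\<dots> = (\<Prod>i<n. x i) * (\<Prod>j<n. y j) * ndet n (\<lambda>i j. T (v * (c i / b j)) / (T v * T (c i / b j)))"
    by (rule ndet_scale)
  also have "ndet n (\<lambda>i j. T (v * (c i / b j)) / (T v * T (c i / b j))) =
      T (v * (\<Prod>i<n. c i / b i)) / T v * (\<Prod>k<n. (c k / b k) ^ k) * frob T n c b"
  proof (rule Suc.IH)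
    show "V v" unfolding v_def by (rule V(2)[OF Suc.prems(2)])
    show "T (v * (\<Prod>i\<in>{k..<n}. c i / b i)) \<noteq> 0" if "k \<le> n" for k
      using Suc.prems(3)[of k] uv[OF that] that by simp
  qed (use Suc.prems(1) in auto)
  also have "v * (\<Prod>i<n. c i / b i) = u * (\<Prod>i<Suc n. c i / b i)" by (simp add: v_def)
  also have "?M n n = T v / (T u * T (c n / b n))" by (simp add: v_def)
  also have "(\<Prod>i<n. x i) * (\<Prod>j<n. y j) = (c n / b n) ^ n * (\<Prod>i<n. (T (c i / c n) * T (b n / b i)) / (T (c i / b n) * T (c n / b i)))"
  proof -
    have "(\<Prod>i<n. x i) * (\<Prod>j<n. y j) = (\<Prod>i<n. (c n / b n) * ((T (c i / c n) * T (b n / b i)) / (T (c i / b n) * T (c n / b i))))"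
      unfolding prod.distrib[symmetric] by (rule prod.cong) (simp_all add: x_def y_def mult_ac)
    then show ?thesis by (simp only: prod.distrib prod_constant card_lessThan)
  qed
  also have "T v / (T u * T (c n / b n)) * ((c n / b n) ^ n * (\<Prod>i<n. (T (c i / c n) * T (b n / b i)) / (T (c i / b n) * T (c n / b i))) *
      (T (u * (\<Prod>i<Suc n. c i / b i)) / T v * (\<Prod>k<n. (c k / b k) ^ k) * frob T n c b))
    = T (u * (\<Prod>i<Suc n. c i / b i)) / T u * (\<Prod>k<Suc n. (c k / b k) ^ k) * frob T (Suc n) c b"
    using T1 by (simp add: frob_def mult_ac)
  finally show ?case .
qed

text \<open>
  Only the two-by-two minors of the array of denominators matter, which makes the statement applicable
  to any rank two function of the two variables.
\<close>

lemma cauchy_det: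
  fixes pr pp rr :: "nat \<Rightarrow> nat \<Rightarrow> 'a::field"
  assumes pl: "\<And>i k j l. i < n \<Longrightarrow> k < n \<Longrightarrow> j < n \<Longrightarrow> l < n \<Longrightarrow> pr i l * pr k j - pr k l * pr i j = pp i k * rr l j"
    and nz: "\<And>i j. i < n \<Longrightarrow> j < n \<Longrightarrow> pr i j \<noteq> 0"
  shows "ndet n (\<lambda>i j. 1 / pr i j) = (\<Prod>i<n. 1 / pr i i) * (\<Prod>k<n. \<Prod>i<k. pp i k * rr k i / (pr i k * pr k i))"
  using pl nz
proof (induction n)
  case 0 show ?case by (simp add: ndet_0)
next
  case (Suc n)
  have nz: "pr i j \<noteq> 0" if "i \<le> n" "j \<le> n" for i j by (rule Suc.prems(2)) (use that in auto)
  have step: "1 / pr i j - (1 / pr i n) * (1 / pr n j) / (1 / pr n n) = (pp i n / pr i n) * (rr n j / pr n j) * (1 / pr i j)"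
    if "i < n" "j < n" for i j
  proof -
    have e: "pr i n * pr n j - pr n n * pr i j = pp i n * rr n j"
      by (rule Suc.prems(1)) (use that in auto)
    have "1 / pr i j - (1 / pr i n) * (1 / pr n j) / (1 / pr n n) = (pr i n * pr n j - pr n n * pr i j) / (pr i n * pr n j * pr i j)"
      using nz[of i n] nz[of n j] nz[of i j] nz[of n n] that by (simp add: field_simps)
    then show ?thesis unfolding e by simp
  qed
  have "ndet (Suc n) (\<lambda>i j. 1 / pr i j) = 1 / pr n n * ndet n (\<lambda>i j. 1 / pr i j - (1 / pr i n) * (1 / pr n j) / (1 / pr n n))"
    by (rule ndet_schur) (use nz in auto)
  also have "ndet n (\<lambda>i j. 1 / pr i j - (1 / pr i n) * (1 / pr n j) / (1 / pr n n)) = ndet n (\<lambda>i j. (pp i n / pr i n) * (rr n j / pr n j) * (1 / pr i j))"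
    by (rule ndet_cong) (rule step)
  also have "\<dots> = (\<Prod>i<n. pp i n / pr i n) * (\<Prod>j<n. rr n j / pr n j) * ndet n (\<lambda>i j. 1 / pr i j)"
    by (rule ndet_scale)
  also have "ndet n (\<lambda>i j. 1 / pr i j) = (\<Prod>i<n. 1 / pr i i) * (\<Prod>k<n. \<Prod>i<k. pp i k * rr k i / (pr i k * pr k i))"
    by (rule Suc.IH) (rule Suc.prems; simp)+
  also have "(\<Prod>i<n. pp i n / pr i n) * (\<Prod>j<n. rr n j / pr n j) = (\<Prod>i<n. pp i n * rr n i / (pr i n * pr n i))"
    by (simp add: prod.distrib[symmetric])
  finally show ?case by (simp add: mult_ac)
qed

lemma fibre_sum:
  fixes h :: "'i \<Rightarrow> complex" and s :: "'i \<Rightarrow> int"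
  assumes "(\<lambda>m. norm (h m)) summable_on I"
  shows "(\<lambda>N. norm (\<Sum>\<^sub>\<infinity>m\<in>{m\<in>I. s m = N}. h m)) summable_on UNIV"
    "(\<Sum>\<^sub>\<infinity>N. \<Sum>\<^sub>\<infinity>m\<in>{m\<in>I. s m = N}. h m) = (\<Sum>\<^sub>\<infinity>m\<in>I. h m)"
proof -
  let ?S = "Sigma (UNIV::int set) (\<lambda>N. {m\<in>I. s m = N})"
  have bij: "bij_betw snd ?S I" by (rule bij_betw_byWitness[where f'="\<lambda>m. (s m, m)"]) auto
  have S: "(\<lambda>p. norm (h (snd p))) summable_on ?S"
    using summable_on_reindex_bij_betw[OF bij, of "\<lambda>m. norm (h m)"] assms by simp
  note A = Infinite_Sum.abs_summable_on_Sigma_iff[THEN iffD1, OF S]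
  have A2: "(\<lambda>N. \<Sum>\<^sub>\<infinity>m\<in>{m\<in>I. s m = N}. norm (h m)) summable_on UNIV"
    using A by (simp add: infsum_nonneg)
  show "(\<lambda>N. norm (\<Sum>\<^sub>\<infinity>m\<in>{m\<in>I. s m = N}. h m)) summable_on UNIV"
    by (rule summable_on_comparison_test[OF A2]) (use A in \<open>auto intro!: norm_infsum_bound\<close>)
  have "(\<Sum>\<^sub>\<infinity>N. \<Sum>\<^sub>\<infinity>m\<in>{m\<in>I. s m = N}. h m) = (\<Sum>\<^sub>\<infinity>p\<in>?S. h (snd p))"
    using infsum_Sigma_banach[OF abs_summable_summable[OF S]] by simp
  also have "\<dots> = (\<Sum>\<^sub>\<infinity>m\<in>I. h m)"
    by (rule infsum_reindex_bij_betw[OF bij])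
  finally show "(\<Sum>\<^sub>\<infinity>N. \<Sum>\<^sub>\<infinity>m\<in>{m\<in>I. s m = N}. h m) = (\<Sum>\<^sub>\<infinity>m\<in>I. h m)" .
qed

section \<open>The identity of functions of type A\<close>

lemma three_term_rational: "three_term (\<lambda>z. 1 - z) u"
  unfolding three_term_def
proof (intro allI impI)
  fix b b' c c' :: complex assume nz: "b \<noteq> 0" "b' \<noteq> 0" "c \<noteq> 0" "c' \<noteq> 0"
  define x y where "x = c / b" and "y = c' / b'"
  define z w where "z = c / b'" and "w = c' / b"
  have xy: "x * y = z * w" by (simp add: x_def y_def z_def w_def)
  have 1: "y * (1 - c / c') * (1 - b' / b) = y - z - w + x"
    using nz by (simp add: x_def y_def z_def w_def field_simps)
  have "(1 - u * x) * (1 - u * y) * (1 - z) * (1 - w) - (1 - u * z) * (1 - u * w) * (1 - x) * (1 - y)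
     = (y - z - w + x) * (1 - u) * (1 - u * (x * y))"
  proof -
    have A: "(1 - v * x) * (1 - v * y) = 1 - v * (x + y) + v * v * (x * y)" for v by (simp add: algebra_simps)
    have B: "(1 - v * z) * (1 - v * w) = 1 - v * (z + w) + v * v * (x * y)" for v unfolding xy by (simp add: algebra_simps)
    have "(1 - u * x) * (1 - u * y) * (1 - z) * (1 - w) - (1 - u * z) * (1 - u * w) * (1 - x) * (1 - y)
      = ((1 - u * x) * (1 - u * y)) * ((1 - 1 * z) * (1 - 1 * w)) - ((1 - u * z) * (1 - u * w)) * ((1 - 1 * x) * (1 - 1 * y))"
      by (simp add: mult.assoc)
    also have "\<dots> = (y - z - w + x) * (1 - u) * (1 - u * (x * y))"
      unfolding A B by (simp add: algebra_simps)
    finally show ?thesis .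
  qed
  then show "(1 - u * (c / b)) * (1 - u * (c' / b')) * (1 - c / b') * (1 - c' / b)
     - (1 - u * (c / b')) * (1 - u * (c' / b)) * (1 - c / b) * (1 - c' / b')
     = c' / b' * (1 - c / c') * (1 - b' / b) * (1 - u) * (1 - u * (c / b) * (c' / b'))"
    unfolding x_def[symmetric] y_def[symmetric] z_def[symmetric] w_def[symmetric] 1 by (simp add: mult.assoc)
qed

context nome
begin

text \<open>
  The factor by which theta functions replace the differences in a Cauchy determinant.
\<close>

definition wfac :: "nat \<Rightarrow> (nat \<Rightarrow> complex) \<Rightarrow> (nat \<Rightarrow> complex) \<Rightarrow> complex" where
  "wfac n c b = (\<Prod>k<n. \<Prod>i<k. theta_reg q (c i / c k) * theta_reg q (b k / b i)) /
     (\<Prod>i<n. \<Prod>j<n. theta_reg q (c i / b j))"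

lemma prod_square_split:
  fixes f :: "nat \<Rightarrow> nat \<Rightarrow> 'a::comm_monoid_mult"
  shows "(\<Prod>i<n. \<Prod>j<n. f i j) = (\<Prod>i<n. f i i) * (\<Prod>k<n. \<Prod>i<k. f i k * f k i)"
proof (induction n)
  case (Suc n)
  have "(\<Prod>i<Suc n. \<Prod>j<Suc n. f i j) = (\<Prod>i<n. (\<Prod>j<n. f i j) * f i n) * ((\<Prod>j<n. f n j) * f n n)" by simp
  also have "\<dots> = (\<Prod>i<n. \<Prod>j<n. f i j) * (\<Prod>i<n. f i n * f n i) * f n n" by (simp add: prod.distrib mult_ac)
  finally show ?case unfolding Suc by (simp add: mult_ac)
qed simp

lemma frob_theta: "frob (theta q) n c b = frob (\<lambda>z. 1 - z) n c b * wfac n c b"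
  unfolding frob_def wfac_def prod_square_split[of _ n] theta_reg prod.distrib prod_dividef
  by (simp add: prod.distrib prod_dividef mult_ac)

text \<open>
  The rational degeneration of the Frobenius determinant at \<open>u = 0\<close>.
\<close>

lemma ndet_phi:
  assumes "\<And>i. c i \<noteq> 0" "\<And>i. b i \<noteq> 0" "\<And>i j. i < n \<Longrightarrow> j < n \<Longrightarrow> c i / b j \<noteq> 1"
  shows "ndet n (\<lambda>i j. phi (c i / b j)) = (\<Prod>k<n. (c k / b k) ^ k) * frob (\<lambda>z. 1 - z) n c b"
  using frobenius[of "\<lambda>v. v = 0" "\<lambda>z. 1 - z" c b n 0] assms
  by (auto simp: three_term_rational phi_def)

lemma phi_sum_all:
  assumes nz: "\<And>i. c i \<noteq> 0" "\<And>i. b i \<noteq> 0"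
    and reg: "\<And>i j. i < n \<Longrightarrow> j < n \<Longrightarrow> regular (c i / b j)"
    and u: "norm q < norm u" "norm u < 1"
  shows "(\<lambda>m. norm (ndet n (\<lambda>i j. phi (q powi (m i) * (c i / b j))) * u powi (\<Sum>i<n. m i))) summable_on (PiE {0..<n} (\<lambda>_. UNIV))"
    "(\<Sum>\<^sub>\<infinity>m\<in>PiE {0..<n} (\<lambda>_. UNIV). ndet n (\<lambda>i j. phi (q powi (m i) * (c i / b j))) * u powi (\<Sum>i<n. m i))
      = ndet n (\<lambda>i j. laurent (\<lambda>m. phi (q powi m * (c i / b j))) u)"
proof -
  let ?I = "PiE {0..<n} (\<lambda>_. UNIV) :: (nat \<Rightarrow> int) set"
  define f where "f p i m = phi (q powi m * (c i / b (p i))) * u powi m" for p :: "nat \<Rightarrow> nat" and i m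
  have u0: "u \<noteq> 0" using u by auto
  have e: "ndet n (\<lambda>i j. phi (q powi (m i) * (c i / b j))) * u powi (\<Sum>i<n. m i)
     = (\<Sum>p | p permutes {0..<n}. signof p * (\<Prod>i\<in>{0..<n}. f p i (m i)))" for m
  proof -
    have "u powi (\<Sum>i<n. m i) = (\<Prod>i\<in>{0..<n}. u powi (m i))"
      unfolding atLeast0LessThan by (induction n) (use u0 in \<open>simp_all add: power_int_add\<close>)
    then show ?thesis unfolding ndet_leibniz f_def
      by (simp add: sum_distrib_right prod.distrib mult.assoc)
  qed
  have s1: "(\<lambda>m. norm (f p i m)) summable_on UNIV" if "p permutes {0..<n}" "i \<in> {0..<n}" for p i
  proof -
    have "p i < n" using permutes_in_image[OF that(1), of i] that(2) by simp
    then show ?thesis using kronecker_summable[OF reg u] that(2) by (simp add: f_def laurent_summable_def)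
  qed
  have s2: "(\<lambda>m. norm (\<Prod>i\<in>{0..<n}. f p i (m i))) summable_on ?I" if "p permutes {0..<n}" for p
    using abs_summable_on_prod_PiE[of "{0..<n}" "\<lambda>_. UNIV" "f p"] s1[OF that]
    unfolding abs_summable_equivalent[symmetric] by auto
  have s3: "(\<lambda>m. norm (signof p * (\<Prod>i\<in>{0..<n}. f p i (m i)))) summable_on ?I" if "p permutes {0..<n}" for p
    using summable_on_cmult_right[OF s2[OF that], of "norm (signof p :: complex)"] by (simp add: norm_mult)
  have fin: "finite {p. p permutes {0..<n}}" by (rule finite_permutations) simp
  have s4: "(\<lambda>m. \<Sum>p | p permutes {0..<n}. norm (signof p * (\<Prod>i\<in>{0..<n}. f p i (m i)))) summable_on ?I"
    using s3 fin by (intro summable_on_sum_finite) auto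
  show "(\<lambda>m. norm (ndet n (\<lambda>i j. phi (q powi (m i) * (c i / b j))) * u powi (\<Sum>i<n. m i))) summable_on ?I"
    unfolding e by (rule summable_on_comparison_test[OF s4]) (auto intro: norm_sum)
  have "(\<Sum>\<^sub>\<infinity>m\<in>?I. ndet n (\<lambda>i j. phi (q powi (m i) * (c i / b j))) * u powi (\<Sum>i<n. m i))
     = (\<Sum>p | p permutes {0..<n}. \<Sum>\<^sub>\<infinity>m\<in>?I. signof p * (\<Prod>i\<in>{0..<n}. f p i (m i)))"
    unfolding e by (rule infsum_sum_finite[OF fin]) (use abs_summable_summable[OF s3] in auto)
  also have "\<dots> = (\<Sum>p | p permutes {0..<n}. signof p * (\<Prod>i\<in>{0..<n}. \<Sum>\<^sub>\<infinity>m. f p i m))"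
  proof (rule sum.cong)
    fix p assume "p \<in> {p. p permutes {0..<n}}"
    then have p: "p permutes {0..<n}" by simp
    show "(\<Sum>\<^sub>\<infinity>m\<in>?I. signof p * (\<Prod>i\<in>{0..<n}. f p i (m i))) = signof p * (\<Prod>i\<in>{0..<n}. \<Sum>\<^sub>\<infinity>m. f p i m)"
      using infsum_prod_PiE_abs[of "{0..<n}" "f p" "\<lambda>_. UNIV"] s1[OF p] by (simp add: infsum_cmult_right')
  qed simp
  also have "\<dots> = ndet n (\<lambda>i j. laurent (\<lambda>m. phi (q powi m * (c i / b j))) u)"
    unfolding ndet_leibniz f_def laurent_def ..
  finally show "(\<Sum>\<^sub>\<infinity>m\<in>?I. ndet n (\<lambda>i j. phi (q powi (m i) * (c i / b j))) * u powi (\<Sum>i<n. m i))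
      = ndet n (\<lambda>i j. laurent (\<lambda>m. phi (q powi m * (c i / b j))) u)" .
qed

lemma good_radius:
  assumes "finite S" "\<And>x. x \<in> S \<Longrightarrow> x \<noteq> 0"
  obtains r where "norm q < r" "r < 1" "\<And>u x. norm u = r \<Longrightarrow> x \<in> S \<Longrightarrow> regular (u * x)"
proof -
  define B where "B = (\<Union>x\<in>S. range (\<lambda>k::int. norm q powi k / norm x))"
  have "countable B" unfolding B_def by (rule countable_UN) (use assms(1) in \<open>auto intro: countable_finite\<close>)
  moreover have "uncountable {norm q<..<1}" using q1 by (rule uncountable_open_interval[THEN iffD2])
  ultimately obtain r where r: "r \<in> {norm q<..<1}" "r \<notin> B" by (meson countable_subset subsetI)
  show thesis
  proof (rule that[of r])
    fix u x :: complex assume u: "norm u = r" and x: "x \<in> S"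
    have "u \<noteq> 0" using u r norm_ge_zero[of q] by auto
    moreover have "q powi k \<noteq> u * x" for k
    proof
      assume "q powi k = u * x"
      then have "norm q powi k = r * norm x" using u by (metis norm_mult norm_power_int)
      then have "r = norm q powi k / norm x" using assms(2)[OF x] by simp
      then show False using r x by (auto simp: B_def)
    qed
    ultimately show "regular (u * x)" using assms(2)[OF x] by (simp add: regular_def)
  qed (use r in auto)
qed

text \<open>
  The generating function in \<open>u\<close> of the sums over translations of fixed total degree is a
  determinant of Kronecker functions. Both it and its product form have Laurent expansions in an
  annulus, and the coefficients of \<open>u\<^sup>0\<close> are compared.
\<close>

theorem sum_zero_translations:
  assumes n: "n \<ge> 1" and nz: "\<And>i. c i \<noteq> 0" "\<And>i. b i \<noteq> 0"
    and reg: "\<And>i j. i < n \<Longrightarrow> j < n \<Longrightarrow> regular (c i / b j)"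
    and regA: "regular (\<Prod>i<n. c i / b i)"
  shows "(\<Sum>\<^sub>\<infinity>m\<in>{m \<in> PiE {0..<n} (\<lambda>_. UNIV). (\<Sum>i<n. m i) = 0}. ndet n (\<lambda>i j. phi (q powi (m i) * (c i / b j))))
    = ndet n (\<lambda>i j. phi (c i / b j)) * (poch q q ^ 2) ^ (n - 1) * theta_reg q (\<Prod>i<n. c i / b i) * wfac n c b"
proof -
  let ?I = "PiE {0..<n} (\<lambda>_. UNIV) :: (nat \<Rightarrow> int) set"
  define A where "A = (\<Prod>i<n. c i / b i)"
  define D where "D m = ndet n (\<lambda>i j. phi (q powi (m i) * (c i / b j)))" for m
  define C where "C N = (\<Sum>\<^sub>\<infinity>m\<in>{m \<in> ?I. (\<Sum>i<n. m i) = N}. D m)" for N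
  define E where "E = ndet n (\<lambda>i j. phi (c i / b j)) * (poch q q ^ 2) ^ (n - 1) * theta q A * wfac n c b"
  define S where "S = (\<lambda>k. \<Prod>i\<in>{k..<n}. c i / b i) ` {..n}"
  have S0: "x \<noteq> 0" if "x \<in> S" for x using that nz by (auto simp: S_def)
  obtain r where r: "norm q < r" "r < 1" "\<And>u x. norm u = r \<Longrightarrow> x \<in> S \<Longrightarrow> regular (u * x)"
    using good_radius[of S] S0 by (auto simp: S_def)
  have r0: "r > 0" using r(1) norm_ge_zero[of q] by linarith
  have fr: "(\<Prod>k<n. (c k / b k) ^ k) * frob (theta q) n c b = ndet n (\<lambda>i j. phi (c i / b j)) * wfac n c b"
  proof -
    have "c i / b j \<noteq> 1" if "i < n" "j < n" for i j
      using regular_powi[OF reg[OF that], of 0] by auto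
    then show ?thesis unfolding frob_theta using ndet_phi[of c b n, OF nz] by simp
  qed
  have "C = (\<lambda>N. E * phi (q powi N * A))"
  proof (rule laurent_eqI[OF r0])
    fix u :: complex assume u: "norm u = r"
    then have u0: "u \<noteq> 0" and ua: "norm q < norm u" "norm u < 1" using r0 r by auto
    have e: "(\<Sum>\<^sub>\<infinity>m\<in>{m \<in> ?I. (\<Sum>i<n. m i) = N}. D m * u powi (\<Sum>i<n. m i)) = C N * u powi N" for N
    proof -
      have "(\<Sum>\<^sub>\<infinity>m\<in>{m \<in> ?I. (\<Sum>i<n. m i) = N}. D m * u powi (\<Sum>i<n. m i)) = (\<Sum>\<^sub>\<infinity>m\<in>{m \<in> ?I. (\<Sum>i<n. m i) = N}. D m * u powi N)"
        by (rule infsum_cong) auto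
      then show ?thesis unfolding C_def by (simp add: infsum_cmult_left')
    qed
    have ps: "(\<lambda>m. norm (D m * u powi (\<Sum>i<n. m i))) summable_on ?I"
      "(\<Sum>\<^sub>\<infinity>m\<in>?I. D m * u powi (\<Sum>i<n. m i)) = ndet n (\<lambda>i j. laurent (\<lambda>m. phi (q powi m * (c i / b j))) u)"
      unfolding D_def using phi_sum_all[of c b n u, OF nz reg ua] by blast+
    have fs: "(\<lambda>N. norm (C N * u powi N)) summable_on UNIV"
      "(\<Sum>\<^sub>\<infinity>N. C N * u powi N) = (\<Sum>\<^sub>\<infinity>m\<in>?I. D m * u powi (\<Sum>i<n. m i))"
      using fibre_sum[OF ps(1), where s="\<lambda>m. \<Sum>i<n. m i"] by (simp_all only: e)
    show "laurent_summable C u" unfolding laurent_summable_def by (rule fs(1))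
    have sA: "laurent_summable (\<lambda>N. phi (q powi N * A)) u"
      by (rule kronecker_summable[OF regA[folded A_def] ua])
    have z: "laurent_summable (\<lambda>_. 0) u" "laurent (\<lambda>_. 0) u = 0" by (simp_all add: laurent_summable_def laurent_def)
    show "laurent_summable (\<lambda>N. E * phi (q powi N * A)) u" using laurent_linear(1)[OF z(1) sA, of E] by simp
    have "laurent C u = ndet n (\<lambda>i j. laurent (\<lambda>m. phi (q powi m * (c i / b j))) u)"
      unfolding laurent_def[of C] fs(2) ps(2) ..
    also have "\<dots> = ndet n (\<lambda>i j. poch q q ^ 2 * 1 * (theta q (u * (c i / b j)) / (theta q u * theta q (c i / b j))))"
    proof (rule ndet_cong)
      fix i j assume "i < n" "j < n"
      then have "laurent (\<lambda>m. phi (q powi m * (c i / b j))) u = poch q q ^ 2 * theta q (u * (c i / b j)) / (theta q u * theta q (c i / b j))"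
        by (intro kronecker[OF reg ua])
      then show "laurent (\<lambda>m. phi (q powi m * (c i / b j))) u = poch q q ^ 2 * 1 * (theta q (u * (c i / b j)) / (theta q u * theta q (c i / b j)))"
        by (simp only: mult_1_right times_divide_eq_right)
    qed
    also have "\<dots> = (poch q q ^ 2) ^ n * ndet n (\<lambda>i j. theta q (u * (c i / b j)) / (theta q u * theta q (c i / b j)))"
      by (subst ndet_scale) simp
    also have "ndet n (\<lambda>i j. theta q (u * (c i / b j)) / (theta q u * theta q (c i / b j)))
       = theta q (u * A) / theta q u * (\<Prod>k<n. (c k / b k) ^ k) * frob (theta q) n c b"
      unfolding A_def
    proof (rule frobenius[where V="\<lambda>v. v \<noteq> 0"])
      show "theta q (u * (\<Prod>i\<in>{k..<n}. c i / b i)) \<noteq> 0" if "k \<le> n" for k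
        using that by (intro regular_theta r(3)[OF u]) (auto simp: S_def)
    qed (use theta_three_term nz reg regular_theta u0 in auto)
    also have "(poch q q ^ 2) ^ n * (theta q (u * A) / theta q u * (\<Prod>k<n. (c k / b k) ^ k) * frob (theta q) n c b)
      = (poch q q ^ 2) ^ n * (theta q (u * A) / theta q u) * ((\<Prod>k<n. (c k / b k) ^ k) * frob (theta q) n c b)"
      by (simp only: mult.assoc)
    also note fr
    finally have 1: "laurent C u = (poch q q ^ 2) ^ n * (theta q (u * A) / theta q u) * (ndet n (\<lambda>i j. phi (c i / b j)) * wfac n c b)" .
    have "laurent (\<lambda>N. E * phi (q powi N * A)) u = E * laurent (\<lambda>N. phi (q powi N * A)) u"
      using laurent_linear(2)[OF z(1) sA, of E] z by simp
    also have "\<dots> = E * (poch q q ^ 2 * theta q (u * A) / (theta q u * theta q A))"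
      by (simp add: kronecker[OF regA[folded A_def] ua])
    also have "\<dots> = (poch q q ^ 2) ^ Suc (n - 1) * (theta q (u * A) / theta q u) * (ndet n (\<lambda>i j. phi (c i / b j)) * wfac n c b)"
      using regular_theta[OF regA[folded A_def]] unfolding E_def by (simp add: field_simps)
    finally show "laurent C u = laurent (\<lambda>N. E * phi (q powi N * A)) u" using 1 n by simp
  qed
  then have "C 0 = E * phi (q powi 0 * A)" by (rule fun_cong)
  moreover have "A \<noteq> 1" using regular_powi[OF regA, of 0] by (simp add: A_def)
  ultimately have "C 0 = ndet n (\<lambda>i j. phi (c i / b j)) * (poch q q ^ 2) ^ (n - 1) * theta_reg q A * wfac n c b"
    unfolding E_def theta_reg phi_def by simp
  then show ?thesis unfolding C_def D_def A_def .
qed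

end

section \<open>The identity of functions of type D\<close>

lemma ndet_infsum:
  fixes f :: "nat \<Rightarrow> nat \<Rightarrow> int \<Rightarrow> complex"
  assumes "\<And>i j. i < n \<Longrightarrow> j < n \<Longrightarrow> (\<lambda>m. norm (f i j m)) summable_on UNIV"
  shows "(\<Sum>\<^sub>\<infinity>m\<in>PiE {0..<n} (\<lambda>_. UNIV). ndet n (\<lambda>i j. f i j (m i))) = ndet n (\<lambda>i j. \<Sum>\<^sub>\<infinity>m. f i j m)"
proof -
  let ?I = "PiE {0..<n} (\<lambda>_. UNIV) :: (nat \<Rightarrow> int) set"
  have s1: "(\<lambda>m. norm (f i (p i) m)) summable_on UNIV" if "p permutes {0..<n}" "i \<in> {0..<n}" for p i
    using permutes_in_image[OF that(1), of i] that(2) by (intro assms) auto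
  have s2: "(\<lambda>m. norm (\<Prod>i\<in>{0..<n}. f i (p i) (m i))) summable_on ?I" if "p permutes {0..<n}" for p
    using abs_summable_on_prod_PiE[of "{0..<n}" "\<lambda>_. UNIV" "\<lambda>i. f i (p i)"] s1[OF that]
    unfolding abs_summable_equivalent[symmetric] by auto
  have fin: "finite {p. p permutes {0..<n}}" by (rule finite_permutations) simp
  have "(\<Sum>\<^sub>\<infinity>m\<in>?I. ndet n (\<lambda>i j. f i j (m i))) = (\<Sum>p | p permutes {0..<n}. \<Sum>\<^sub>\<infinity>m\<in>?I. signof p * (\<Prod>i\<in>{0..<n}. f i (p i) (m i)))"
    unfolding ndet_leibniz
  proof (rule infsum_sum_finite[OF fin])
    fix p assume "p \<in> {p. p permutes {0..<n}}"
    then show "(\<lambda>m. signof p * (\<Prod>i\<in>{0..<n}. f i (p i) (m i))) summable_on ?I"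
      using abs_summable_summable[OF s2[of p]] by (intro summable_on_cmult_right) auto
  qed
  also have "\<dots> = (\<Sum>p | p permutes {0..<n}. signof p * (\<Prod>i\<in>{0..<n}. \<Sum>\<^sub>\<infinity>m. f i (p i) m))"
  proof (rule sum.cong)
    fix p assume "p \<in> {p. p permutes {0..<n}}"
    then have p: "p permutes {0..<n}" by simp
    show "(\<Sum>\<^sub>\<infinity>m\<in>?I. signof p * (\<Prod>i\<in>{0..<n}. f i (p i) (m i))) = signof p * (\<Prod>i\<in>{0..<n}. \<Sum>\<^sub>\<infinity>m. f i (p i) m)"
      using infsum_prod_PiE_abs[of "{0..<n}" "\<lambda>i. f i (p i)" "\<lambda>_. UNIV"] s1[OF p] by (simp add: infsum_cmult_right')
  qed simp
  finally show ?thesis unfolding ndet_leibniz .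
qed

definition dif :: "complex \<Rightarrow> complex \<Rightarrow> complex \<Rightarrow> complex" where
  "dif x x0 y = phi (- y / x) + phi (- (x * y)) - phi (- y / x0) - phi (- (x0 * y))"

definition tr :: "complex \<Rightarrow> complex" where "tr x = x + 1 / x"

lemma dif_eq:
  assumes "x \<noteq> 0" "x0 \<noteq> 0" "y \<noteq> 0" "- y / x \<noteq> 1" "- (x * y) \<noteq> 1" "- y / x0 \<noteq> 1" "- (x0 * y) \<noteq> 1"
  shows "dif x x0 y = (tr x - tr x0) * (y - 1 / y) / (tr x0 + tr y) * (1 / (tr x + tr y))"
    "tr x + tr y \<noteq> 0" "tr x0 + tr y \<noteq> 0"
proof -
  have e: "x * (tr x + tr y) = (1 + x * y) * (1 + y / x) * (x / y)" if "x \<noteq> 0" for x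
    using that assms(3) by (simp add: tr_def field_simps)
  have f: "1 + y / x \<noteq> 0" "1 + x * y \<noteq> 0" if "- y / x \<noteq> 1" "- (x * y) \<noteq> 1" for x
    using that by (auto simp: add_eq_0_iff)
  show n1: "tr x + tr y \<noteq> 0" using e[OF assms(1)] f[OF assms(4,5)] assms(1,3) by auto
  show n2: "tr x0 + tr y \<noteq> 0" using e[OF assms(2)] f[OF assms(6,7)] assms(2,3) by auto
  have h: "phi (- y / x) + phi (- (x * y)) = (2 / y + tr x) / (tr x + tr y)" if x: "x \<noteq> 0" "- y / x \<noteq> 1" "- (x * y) \<noteq> 1" for x
  proof -
    note f = f[OF x(2,3)]
    have "phi (- y / x) + phi (- (x * y)) = 1 / (1 + y / x) + 1 / (1 + x * y)" by (simp add: phi_def)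
    also have "\<dots> = (2 + y / x + x * y) / ((1 + x * y) * (1 + y / x))"
      using f by (simp add: add_frac_eq algebra_simps)
    also have "2 + y / x + x * y = y * (2 / y + tr x)" using assms(3) x(1) by (simp add: tr_def field_simps)
    also have "(1 + x * y) * (1 + y / x) = y * (tr x + tr y)" using x(1) assms(3) by (simp add: tr_def field_simps)
    finally show ?thesis using assms(3) by simp
  qed
  have "dif x x0 y = (2 / y + tr x) / (tr x + tr y) - (2 / y + tr x0) / (tr x0 + tr y)"
    using h[OF assms(1,4,5)] h[OF assms(2,6,7)] unfolding dif_def by (simp add: algebra_simps)
  also have "\<dots> = ((2 / y + tr x) * (tr x0 + tr y) - (2 / y + tr x0) * (tr x + tr y)) / ((tr x0 + tr y) * (tr x + tr y))"
    using n1 n2 by (simp add: diff_frac_eq mult.commute)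
  also have "(2 / y + tr x) * (tr x0 + tr y) - (2 / y + tr x0) * (tr x + tr y) = (tr x - tr x0) * (tr y - 2 / y)"
  proof -
    have "(w + a) * (b + c) - (w + b) * (a + c) = (a - b) * (c - w)" for a b c w :: complex by (simp add: algebra_simps)
    then show ?thesis .
  qed
  also have "tr y - 2 / y = y - 1 / y" by (simp add: tr_def)
  finally show "dif x x0 y = (tr x - tr x0) * (y - 1 / y) / (tr x0 + tr y) * (1 / (tr x + tr y))" by simp
qed

context nome
begin

lemma regular_shift:
  assumes "regular a" shows "regular (q powi m * a)"
  unfolding regular_def
proof (intro conjI allI notI)
  assume "q powi m * a = 0" then show False using q0 assms by (auto simp: regular_def)
next
  fix k assume "q powi k = q powi m * a"
  then have "a = q powi (k - m)" using q0 by (simp add: power_int_diff field_simps)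
  then show False using assms unfolding regular_def by metis
qed

lemma regular_inverse:
  assumes "regular a" shows "regular (1 / a)"
  unfolding regular_def
proof (intro conjI allI notI)
  assume "1 / a = 0" then show False using assms by (auto simp: regular_def)
next
  fix k assume "q powi k = 1 / a"
  then have "a = q powi (- k)" using q0 assms by (simp add: power_int_minus field_simps regular_def)
  then show False using assms unfolding regular_def by metis
qed

lemma regular_theta_reg: "regular a \<Longrightarrow> theta_reg q a \<noteq> 0"
  by (rule theta_reg_nz) (auto simp: regular_def)

lemma dif_summable:
  assumes "regular (- y / x)" "regular (- (x * y))" "regular (- y / x0)" "regular (- (x0 * y))"
  shows "(\<lambda>k::int. norm (dif x x0 (q powi k * y))) summable_on UNIV"
proof -
  have main: "\<exists>K. K > 0 \<and> (\<forall>n. norm (phi (q powi int n * a) - 1) \<le> K * norm q ^ n) \<and> (\<forall>n. norm (phi (q powi (- int n) * a)) \<le> K * norm q ^ n)"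
    if a: "regular a" for a
  proof -
    obtain K where K: "K > 0" "\<And>n. norm (phi (q powi int n * a)) \<le> K" "\<And>n. norm (phi (q powi (- int n) * a)) \<le> K * norm q ^ n"
      using phi_bound[OF a] by blast
    define L where "L = K + norm a * K"
    have "norm (phi (q powi int n * a) - 1) \<le> L * norm q ^ n" for n
    proof -
      have "phi (q powi int n * a) - 1 = q ^ n * (a * phi (q powi int n * a))"
        using regular_powi[OF a, of "int n"] by (simp add: phi_def field_simps)
      then have "norm (phi (q powi int n * a) - 1) = norm q ^ n * (norm a * norm (phi (q powi int n * a)))"
        by (simp only: norm_mult norm_power)
      also have "\<dots> \<le> norm q ^ n * (norm a * K)" using K(2)[of n] by (intro mult_left_mono) auto
      also have "\<dots> \<le> norm q ^ n * L" using K(1) by (intro mult_left_mono) (auto simp: L_def)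
      finally show ?thesis by (simp add: mult.commute)
    qed
    moreover have "norm (phi (q powi (- int n) * a)) \<le> L * norm q ^ n" for n
    proof -
      have "K * norm q ^ n \<le> L * norm q ^ n" using K(1) by (intro mult_right_mono) (auto simp: L_def)
      then show ?thesis using K(3)[of n] by linarith
    qed
    moreover have "L > 0" using K(1) by (simp add: L_def add_pos_nonneg)
    ultimately show ?thesis by blast
  qed
  obtain K1 where K1: "\<And>n. norm (phi (q powi int n * (- y / x)) - 1) \<le> K1 * norm q ^ n" "\<And>n. norm (phi (q powi (- int n) * (- y / x))) \<le> K1 * norm q ^ n"
    using main[OF assms(1)] by blast
  obtain K2 where K2: "\<And>n. norm (phi (q powi int n * (- (x * y))) - 1) \<le> K2 * norm q ^ n" "\<And>n. norm (phi (q powi (- int n) * (- (x * y)))) \<le> K2 * norm q ^ n"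
    using main[OF assms(2)] by blast
  obtain K3 where K3: "\<And>n. norm (phi (q powi int n * (- y / x0)) - 1) \<le> K3 * norm q ^ n" "\<And>n. norm (phi (q powi (- int n) * (- y / x0))) \<le> K3 * norm q ^ n"
    using main[OF assms(3)] by blast
  obtain K4 where K4: "\<And>n. norm (phi (q powi int n * (- (x0 * y))) - 1) \<le> K4 * norm q ^ n" "\<And>n. norm (phi (q powi (- int n) * (- (x0 * y)))) \<le> K4 * norm q ^ n"
    using main[OF assms(4)] by blast
  have d: "dif x x0 (q powi k * y) = phi (q powi k * (- y / x)) + phi (q powi k * (- (x * y))) - phi (q powi k * (- y / x0)) - phi (q powi k * (- (x0 * y)))" for k
    by (simp add: dif_def mult_ac)
  have tri: "norm (a + b - c - d) \<le> norm a + norm b + norm c + norm d" for a b c d :: complex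
    using norm_triangle_ineq4[of "a + b - c" d] norm_triangle_ineq4[of "a + b" c] norm_triangle_ineq[of a b] by linarith
  have s: "summable (\<lambda>n. (K1 + K2 + K3 + K4) * norm q ^ n)" using q1 by (intro summable_mult summable_geometric) simp
  show ?thesis
  proof (rule summable_on_int)
    show "summable (\<lambda>n. norm (dif x x0 (q powi (int n) * y)))"
    proof (rule summable_comparison_test'[OF s])
      fix n
      have "norm (dif x x0 (q powi (int n) * y)) \<le> norm (phi (q powi int n * (- y / x)) - 1) + norm (phi (q powi int n * (- (x * y))) - 1)
         + norm (phi (q powi int n * (- y / x0)) - 1) + norm (phi (q powi int n * (- (x0 * y))) - 1)"
        using tri[of "phi (q powi int n * (- y / x)) - 1" "phi (q powi int n * (- (x * y))) - 1" "phi (q powi int n * (- y / x0)) - 1" "phi (q powi int n * (- (x0 * y))) - 1"]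
        unfolding d by (simp add: algebra_simps)
      also have "\<dots> \<le> (K1 + K2 + K3 + K4) * norm q ^ n"
        unfolding distrib_right by (intro add_mono K1 K2 K3 K4)
      finally show "norm (norm (dif x x0 (q powi (int n) * y))) \<le> (K1 + K2 + K3 + K4) * norm q ^ n" by simp
    qed
    show "summable (\<lambda>n. norm (dif x x0 (q powi (- int n) * y)))"
    proof (rule summable_comparison_test'[OF s])
      fix n
      have "norm (dif x x0 (q powi (- int n) * y)) \<le> norm (phi (q powi (- int n) * (- y / x))) + norm (phi (q powi (- int n) * (- (x * y))))
         + norm (phi (q powi (- int n) * (- y / x0))) + norm (phi (q powi (- int n) * (- (x0 * y))))"
        unfolding d by (rule tri)
      also have "\<dots> \<le> (K1 + K2 + K3 + K4) * norm q ^ n"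
        unfolding distrib_right by (intro add_mono K1 K2 K3 K4)
      finally show "norm (norm (dif x x0 (q powi (- int n) * y))) \<le> (K1 + K2 + K3 + K4) * norm q ^ n" by simp
    qed
  qed simp
qed

lemma ndet_2: "ndet 2 M = M 0 0 * M 1 1 - M 0 1 * M (Suc 0) 0" for M :: "nat \<Rightarrow> nat \<Rightarrow> complex"
proof -
  have i: "{0..<2::nat} = {0, Suc 0}" by auto
  have p: "{p. p permutes {0, Suc 0}} = {id, Transposition.transpose 0 (Suc 0)}"
    unfolding permutes_doubleton_iff by auto
  have "id (0::nat) \<noteq> Transposition.transpose 0 (Suc 0) 0" by simp
  then have "(id :: nat \<Rightarrow> nat) \<noteq> Transposition.transpose 0 (Suc 0)" by metis
  then show ?thesis unfolding ndet_leibniz i p by (simp add: sign_swap_id sign_id)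
qed

text \<open>
  Each summand is, up to a constant, a two-by-two determinant, because \<open>phi X phi Y\<close> with
  \<open>X Y = A\<close> fixed is linear in \<open>phi X\<close> and \<open>phi Y\<close>. So the sum
  over one integer is the case \<open>n = 2\<close> of the sum over translations of total degree zero.
\<close>

lemma dif_infsum:
  assumes nz: "x \<noteq> 0" "x0 \<noteq> 0" "y \<noteq> 0"
    and reg: "regular (- y / x)" "regular (- (x * y))" "regular (- y / x0)" "regular (- (x0 * y))" "regular (x * x0)"
  shows "(\<Sum>\<^sub>\<infinity>k::int. dif x x0 (q powi k * y)) = dif x x0 y * (poch q q ^ 2 * theta_reg q (x * x0) * theta_reg q (x / x0) * theta_reg q (y * y)
     / (theta_reg q (- y / x) * theta_reg q (- (x * y)) * theta_reg q (- y / x0) * theta_reg q (- (x0 * y))))"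
proof -
  define c where "c i = (if i = 0 then - y else - 1 / y)" for i :: nat
  define b where "b i = (if i = 0 then x else x0)" for i :: nat
  define A where "A = 1 / (x * x0)"
  have inv: "1 / (- y * z) = - 1 / y / z" for z by simp
  have r1: "regular (- 1 / y / x)" using regular_inverse[OF reg(2)] by (simp add: mult.commute)
  have r2: "regular (- 1 / y / x0)" using regular_inverse[OF reg(4)] by (simp add: mult.commute)
  have rA: "regular A" unfolding A_def by (rule regular_inverse[OF reg(5)])
  have AA: "(\<Prod>i<2. c i / b i) = A" using nz by (simp add: c_def b_def A_def numeral_2_eq_2)
  have A1: "A \<noteq> 1" using regular_powi[OF rA, of 0] by simp
  have pp: "phi X * phi Y = phi A * (phi X - phi (1 / Y))" if "X * Y = A" "X \<noteq> 1" "Y \<noteq> 1" "Y \<noteq> 0" for X Y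
  proof -
    have i: "phi (1 / Y) = 1 - phi Y" using that by (simp add: phi_def field_simps)
    have g: "1 / a + 1 / b - 1 = (1 - (1 - a) * (1 - b)) / (a * b)" if "a \<noteq> 0" "b \<noteq> 0" for a b :: complex
      using that by (simp add: field_simps)
    have "1 / (1 - X) + 1 / (1 - Y) - 1 = (1 - X * Y) / ((1 - X) * (1 - Y))"
      using g[of "1 - X" "1 - Y"] that by simp
    then have "phi X + phi Y - 1 = (1 - A) * (phi X * phi Y)" using that by (simp add: phi_def)
    then have "phi X - (1 - phi Y) = (1 - A) * (phi X * phi Y)" by (simp add: algebra_simps)
    then show ?thesis unfolding i phi_def[of A] using A1 by simp
  qed
  have det: "ndet 2 (\<lambda>i j. phi (q powi (m i) * (c i / b j))) = phi A * dif x x0 (q powi k * y)" if m: "m 0 = k" "m (Suc 0) = - k" for m k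
  proof -
    have XY: "q powi k * (- y / z) * (q powi (- k) * (- 1 / y / z')) = 1 / (z * z')" for z z'
    proof -
      have "q powi k * q powi (- k) = 1" using q0 by (simp add: power_int_minus)
      moreover have "q powi k * (- y / z) * (q powi (- k) * (- 1 / y / z')) = q powi k * q powi (- k) * (- y / z * (- 1 / y / z'))"
        by (simp only: mult_ac)
      moreover have "- y / z * (- 1 / y / z') = 1 / (z * z')" using nz by simp
      ultimately show ?thesis by (simp only: mult_1)
    qed
    have P1: "phi (q powi k * (- y / x)) * phi (q powi (- k) * (- 1 / y / x0)) = phi A * (phi (q powi k * (- y / x)) - phi (1 / (q powi (- k) * (- 1 / y / x0))))"
      by (rule pp) (use nz q0 XY regular_powi[OF reg(1)] regular_powi[OF r2] in \<open>simp_all only: A_def, simp_all\<close>)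
    have P2: "phi (q powi k * (- y / x0)) * phi (q powi (- k) * (- 1 / y / x)) = phi A * (phi (q powi k * (- y / x0)) - phi (1 / (q powi (- k) * (- 1 / y / x))))"
      by (rule pp) (use nz q0 XY regular_powi[OF reg(3)] regular_powi[OF r1] in \<open>simp_all only: A_def mult.commute[of x x0], simp_all\<close>)
    have e: "1 / (q powi (- k) * (- 1 / y / z)) = - (z * (q powi k * y))" for z
      using q0 nz by (simp add: power_int_minus field_simps)
    have e2: "q powi k * (- y / z) = - (q powi k * y) / z" for z by simp
    have "ndet 2 (\<lambda>i j. phi (q powi (m i) * (c i / b j))) = phi (q powi k * (- y / x)) * phi (q powi (- k) * (- 1 / y / x0)) - phi (q powi k * (- y / x0)) * phi (q powi (- k) * (- 1 / y / x))"
      unfolding ndet_2 using m by (simp add: c_def b_def)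
    then have "ndet 2 (\<lambda>i j. phi (q powi (m i) * (c i / b j))) = phi A * (phi (q powi k * (- y / x)) - phi (- (x0 * (q powi k * y)))) - phi A * (phi (q powi k * (- y / x0)) - phi (- (x * (q powi k * y))))"
      unfolding P1 P2 unfolding e .
    then show ?thesis unfolding e2 dif_def by (simp only: algebra_simps)
  qed
  let ?I = "{m \<in> PiE {0..<2} (\<lambda>_. UNIV). (\<Sum>i<2. m i) = 0} :: (nat \<Rightarrow> int) set"
  have bij: "bij_betw (\<lambda>k::int. \<lambda>i\<in>{0..<2::nat}. if i = 0 then k else - k) UNIV ?I"
  proof (rule bij_betw_byWitness[where f'="\<lambda>m. m 0"])
    show "\<forall>m\<in>?I. (\<lambda>i\<in>{0..<2::nat}. if i = 0 then m 0 else - m 0) = m"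
    proof
      fix m :: "nat \<Rightarrow> int" assume m: "m \<in> ?I"
      then have "m 0 + m (Suc 0) = 0" by (simp add: numeral_2_eq_2)
      then have m1: "m (Suc 0) = - m 0" by simp
      show "(\<lambda>i\<in>{0..<2::nat}. if i = 0 then m 0 else - m 0) = m"
      proof
        fix i show "(\<lambda>i\<in>{0..<2::nat}. if i = 0 then m 0 else - m 0) i = m i"
        proof (cases "i < 2")
          case True then have "i = 0 \<or> i = Suc 0" by auto
          then show ?thesis using m1 by auto
        next
          case False then show ?thesis using m by (auto simp: PiE_def extensional_def)
        qed
      qed
    qed
  qed (auto simp: numeral_2_eq_2)
  have "(\<Sum>\<^sub>\<infinity>m\<in>?I. ndet 2 (\<lambda>i j. phi (q powi (m i) * (c i / b j)))) = (\<Sum>\<^sub>\<infinity>k. phi A * dif x x0 (q powi k * y))"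
    unfolding infsum_reindex_bij_betw[OF bij, symmetric] by (rule infsum_cong) (rule det; simp)
  also have "\<dots> = phi A * (\<Sum>\<^sub>\<infinity>k. dif x x0 (q powi k * y))" by (rule infsum_cmult_right')
  finally have L: "(\<Sum>\<^sub>\<infinity>m\<in>?I. ndet 2 (\<lambda>i j. phi (q powi (m i) * (c i / b j)))) = phi A * (\<Sum>\<^sub>\<infinity>k. dif x x0 (q powi k * y))" .
  have "ndet 2 (\<lambda>i j. phi (q powi ((\<lambda>_. 0) i) * (c i / b j))) = phi A * dif x x0 (q powi 0 * y)" by (rule det) auto
  then have M: "ndet 2 (\<lambda>i j. phi (c i / b j)) = phi A * dif x x0 y" by simp
  have w: "wfac 2 c b = theta_reg q (y * y) * theta_reg q (x / x0)
     / (theta_reg q (- y / x) * theta_reg q (- (x * y)) * theta_reg q (- y / x0) * theta_reg q (- (x0 * y)))"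
  proof -
    have "theta_reg q (- 1 / y / z) = theta_reg q (- (z * y))" for z
      using theta_reg_inverse[of "- (z * y)"] by (simp add: mult.commute)
    moreover have "c 0 / c 1 = y * y" using nz by (simp add: c_def)
    moreover have "theta_reg q (x0 / x) = theta_reg q (x / x0)" using theta_reg_inverse[of "x / x0"] by simp
    ultimately show ?thesis unfolding wfac_def by (simp add: numeral_2_eq_2 c_def b_def mult_ac)
  qed
  have "(\<Sum>\<^sub>\<infinity>m\<in>?I. ndet 2 (\<lambda>i j. phi (q powi (m i) * (c i / b j))))
    = ndet 2 (\<lambda>i j. phi (c i / b j)) * (poch q q ^ 2) ^ (2 - 1) * theta_reg q (\<Prod>i<2. c i / b i) * wfac 2 c b"
  proof (rule sum_zero_translations)
    show "regular (c i / b j)" if "i < 2" "j < 2" for i j using reg r1 r2 by (simp add: c_def b_def)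
    show "regular (\<Prod>i<2. c i / b i)" unfolding AA by (rule rA)
  qed (use nz in \<open>auto simp: c_def b_def\<close>)
  moreover have "theta_reg q A = theta_reg q (x * x0)" unfolding A_def by (rule theta_reg_inverse)
  moreover have "phi A \<noteq> 0" using A1 by (simp add: phi_def)

  ultimately show ?thesis unfolding L M AA w by (simp add: divide_inverse mult_ac)
qed

text \<open>
  The value of the denominator of \<open>D(n+1|n)\<close> up to sign, with \<open>x0\<close> the first
  of the \<open>n + 1\<close> variables of the \<open>\<epsilon>\<close>.
\<close>

definition nb :: "nat \<Rightarrow> complex \<Rightarrow> (nat \<Rightarrow> complex) \<Rightarrow> (nat \<Rightarrow> complex) \<Rightarrow> complex" where
  "nb n x0 z y = (\<Prod>i<n. (y i - 1 / y i) / (tr x0 + tr (y i))) * (\<Prod>j<n. tr (z j) - tr x0) *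
     ((\<Prod>i<n. 1 / (tr (z i) + tr (y i))) * (\<Prod>k<n. \<Prod>i<k. (tr (y k) - tr (y i)) * (tr (z k) - tr (z i)) / ((tr (z k) + tr (y i)) * (tr (z i) + tr (y k)))))"

text \<open>
  The determinant of the entries \<open>dif\<close> is of Cauchy type, and so is the determinant of
  their sums over \<open>q\<close>-shifts; the quotient of the two product formulas is the asserted
  factor.
\<close>

theorem sum_all_translations:
  assumes nz: "x0 \<noteq> 0" "\<And>i. z i \<noteq> 0" "\<And>i. y i \<noteq> 0"
    and reg: "\<And>i j. i < n \<Longrightarrow> j < n \<Longrightarrow> regular (- y i / z j)" "\<And>i j. i < n \<Longrightarrow> j < n \<Longrightarrow> regular (- (z j * y i))"
      "\<And>i. i < n \<Longrightarrow> regular (- y i / x0)" "\<And>i. i < n \<Longrightarrow> regular (- (x0 * y i))" "\<And>j. j < n \<Longrightarrow> regular (z j * x0)"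
  shows "(\<Sum>\<^sub>\<infinity>m\<in>PiE {0..<n} (\<lambda>_. UNIV). nb n x0 z (\<lambda>i. q powi (m i) * y i)) = nb n x0 z y *
    ((\<Prod>i<n. poch q q ^ 2 * theta_reg q (y i * y i) / (theta_reg q (- y i / x0) * theta_reg q (- (x0 * y i)))) *
     (\<Prod>j<n. theta_reg q (z j * x0) * theta_reg q (z j / x0)) *
     ((\<Prod>i<n. 1 / (theta_reg q (- y i / z i) * theta_reg q (- (z i * y i)))) *
      (\<Prod>k<n. \<Prod>i<k. theta_reg q (y k * y i) * theta_reg q (y k / y i) * theta_reg q (z k * z i) * theta_reg q (z k / z i)
         / (theta_reg q (- y i / z k) * theta_reg q (- (z k * y i)) * theta_reg q (- y k / z i) * theta_reg q (- (z i * y k))))))"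
proof -
  have n1: "a \<noteq> 1" if "regular a" for a using regular_powi[OF that, of 0] by simp
  define w where "w = (\<lambda>(m::nat \<Rightarrow> int) i. q powi (m i) * y i)"
  have wnz: "w m i \<noteq> 0" for m i using nz q0 by (simp add: w_def)
  have wreg: "regular (- w m i / z j)" "regular (- (z j * w m i))" "regular (- w m i / x0)" "regular (- (x0 * w m i))" if "i < n" "j < n" for m i j
    using regular_shift[OF reg(1)[OF that], of "m i"] regular_shift[OF reg(2)[OF that], of "m i"]
      regular_shift[OF reg(3)[OF that(1)], of "m i"] regular_shift[OF reg(4)[OF that(1)], of "m i"]
    by (simp_all add: w_def mult_ac)
  have D: "dif (z j) x0 (w m i) = ((w m i - 1 / w m i) / (tr x0 + tr (w m i))) * (tr (z j) - tr x0) * (1 / (tr (z j) + tr (w m i)))"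
     "tr (z j) + tr (w m i) \<noteq> 0" if "i < n" "j < n" for m i j
    using dif_eq[of "z j" x0 "w m i", OF nz(2) nz(1) wnz n1[OF wreg(1)[OF that]] n1[OF wreg(2)[OF that]] n1[OF wreg(3)[OF that]] n1[OF wreg(4)[OF that]]]
    by (simp_all add: mult_ac)
  have nbd: "ndet n (\<lambda>i j. dif (z j) x0 (w m i)) = nb n x0 z (w m)" for m
  proof -
    have "ndet n (\<lambda>i j. dif (z j) x0 (w m i)) = ndet n (\<lambda>i j. ((w m i - 1 / w m i) / (tr x0 + tr (w m i))) * (tr (z j) - tr x0) * (1 / (tr (z j) + tr (w m i))))"
      by (rule ndet_cong) (rule D)
    also have "\<dots> = (\<Prod>i<n. (w m i - 1 / w m i) / (tr x0 + tr (w m i))) * (\<Prod>j<n. tr (z j) - tr x0) * ndet n (\<lambda>i j. 1 / (tr (z j) + tr (w m i)))"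
      by (rule ndet_scale)
    also have "ndet n (\<lambda>i j. 1 / (tr (z j) + tr (w m i))) = (\<Prod>i<n. 1 / (tr (z i) + tr (w m i))) * (\<Prod>k<n. \<Prod>i<k. (tr (w m k) - tr (w m i)) * (tr (z k) - tr (z i)) / ((tr (z k) + tr (w m i)) * (tr (z i) + tr (w m k))))"
      by (rule cauchy_det) (auto simp: D(2) algebra_simps)
    finally show ?thesis unfolding nb_def .
  qed
  have w0: "w (\<lambda>_. 0) = y" by (rule ext) (simp add: w_def)
  have yreg: "regular (- y i / z j)" "regular (- (z j * y i))" "regular (- y i / x0)" "regular (- (x0 * y i))" if "i < n" "j < n" for i j
    using reg that by auto
  obtain f g where fg: "\<And>x y. x \<noteq> 0 \<Longrightarrow> y \<noteq> 0 \<Longrightarrow> theta q (x * y) * theta q (x / y) = x * (g x * f y - f x * g y)"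
    using theta_rank_two by blast
  define B where "B x y = g x * f y - f x * g y" for x y
  have B: "B u v = (tr u - tr v) * (theta_reg q (u * v) * theta_reg q (u / v))" if "u \<noteq> 0" "v \<noteq> 0" for u v
  proof -
    have "u * B u v = (1 - u * v) * (1 - u / v) * (theta_reg q (u * v) * theta_reg q (u / v))"
      using fg[OF that] by (simp add: B_def theta_reg mult_ac)
    also have "(1 - u * v) * (1 - u / v) = u * (tr u - tr v)" using that by (simp add: tr_def field_simps)
    finally show ?thesis using that by simp
  qed
  have trm: "tr (- v) = - tr v" for v by (simp add: tr_def)
  define pr where "pr i j = (tr (z j) + tr (y i)) * (theta_reg q (- y i / z j) * theta_reg q (- (z j * y i)))" for i j
  have prB: "pr i j = B (z j) (- y i)" for i j
  proof -
    have "theta_reg q (z j / - y i) = theta_reg q (- y i / z j)" using theta_reg_inverse[of "- y i / z j"] by simp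
    then show ?thesis unfolding pr_def using B[of "z j" "- y i"] nz by (simp add: trm mult_ac)
  qed
  have pr0: "pr i j \<noteq> 0" if "i < n" "j < n" for i j
  proof -
    have "theta_reg q (- y i / z j) \<noteq> 0" "theta_reg q (- (z j * y i)) \<noteq> 0"
      by (rule regular_theta_reg[OF reg(1)[OF that]], rule regular_theta_reg[OF reg(2)[OF that]])
    then show ?thesis unfolding pr_def using D(2)[OF that, of "\<lambda>_. 0"] unfolding w0 by simp
  qed
  have "(\<Sum>\<^sub>\<infinity>m\<in>PiE {0..<n} (\<lambda>_. UNIV). nb n x0 z (\<lambda>i. q powi (m i) * y i)) = (\<Sum>\<^sub>\<infinity>m\<in>PiE {0..<n} (\<lambda>_. UNIV). ndet n (\<lambda>i j. dif (z j) x0 (q powi (m i) * y i)))"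
    using nbd unfolding w_def by simp
  also have "\<dots> = ndet n (\<lambda>i j. \<Sum>\<^sub>\<infinity>k. dif (z j) x0 (q powi k * y i))"
    by (rule ndet_infsum) (intro dif_summable yreg; assumption)
  also have "\<dots> = ndet n (\<lambda>i j. ((y i - 1 / y i) / (tr x0 + tr (y i)) * (poch q q ^ 2 * theta_reg q (y i * y i) / (theta_reg q (- y i / x0) * theta_reg q (- (x0 * y i)))))
     * ((tr (z j) - tr x0) * (theta_reg q (z j * x0) * theta_reg q (z j / x0))) * (1 / pr i j))"
  proof (rule ndet_cong)
    fix i j assume ij: "i < n" "j < n"
    have "(\<Sum>\<^sub>\<infinity>k. dif (z j) x0 (q powi k * y i)) = dif (z j) x0 (y i) * (poch q q ^ 2 * theta_reg q (z j * x0) * theta_reg q (z j / x0) * theta_reg q (y i * y i)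
     / (theta_reg q (- y i / z j) * theta_reg q (- (z j * y i)) * theta_reg q (- y i / x0) * theta_reg q (- (x0 * y i))))"
      by (rule dif_infsum) (use nz reg ij in auto)
    also have "dif (z j) x0 (y i) = ((y i - 1 / y i) / (tr x0 + tr (y i))) * (tr (z j) - tr x0) * (1 / (tr (z j) + tr (y i)))"
      using D(1)[OF ij, of "\<lambda>_. 0"] unfolding w0 .
    finally show "(\<Sum>\<^sub>\<infinity>k. dif (z j) x0 (q powi k * y i)) = ((y i - 1 / y i) / (tr x0 + tr (y i)) * (poch q q ^ 2 * theta_reg q (y i * y i) / (theta_reg q (- y i / x0) * theta_reg q (- (x0 * y i)))))
     * ((tr (z j) - tr x0) * (theta_reg q (z j * x0) * theta_reg q (z j / x0))) * (1 / pr i j)"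
      unfolding pr_def by (simp add: mult_ac)
  qed
  also have "\<dots> = (\<Prod>i<n. (y i - 1 / y i) / (tr x0 + tr (y i)) * (poch q q ^ 2 * theta_reg q (y i * y i) / (theta_reg q (- y i / x0) * theta_reg q (- (x0 * y i)))))
     * (\<Prod>j<n. (tr (z j) - tr x0) * (theta_reg q (z j * x0) * theta_reg q (z j / x0))) * ndet n (\<lambda>i j. 1 / pr i j)"
    by (rule ndet_scale)
  also have "ndet n (\<lambda>i j. 1 / pr i j) = (\<Prod>i<n. 1 / pr i i) * (\<Prod>k<n. \<Prod>i<k. B (- y i) (- y k) * B (z k) (z i) / (pr i k * pr k i))"
  proof (rule cauchy_det)
    show "pr i l * pr k j - pr k l * pr i j = B (- y i) (- y k) * B (z l) (z j)" for i k j l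
      unfolding prB by (simp add: B_def algebra_simps)
  qed (rule pr0)
  also have "(\<Prod>k<n. \<Prod>i<k. B (- y i) (- y k) * B (z k) (z i) / (pr i k * pr k i)) = 
     (\<Prod>k<n. \<Prod>i<k. (tr (y k) - tr (y i)) * (tr (z k) - tr (z i)) / ((tr (z k) + tr (y i)) * (tr (z i) + tr (y k))))
     * (\<Prod>k<n. \<Prod>i<k. theta_reg q (y k * y i) * theta_reg q (y k / y i) * theta_reg q (z k * z i) * theta_reg q (z k / z i)
         / (theta_reg q (- y i / z k) * theta_reg q (- (z k * y i)) * theta_reg q (- y k / z i) * theta_reg q (- (z i * y k))))"
    unfolding prod.distrib[symmetric]
  proof (intro prod.cong refl)
    fix k i
    have "theta_reg q (- y i / - y k) = theta_reg q (y k / y i)" using theta_reg_inverse[of "y k / y i"] by simp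
    then have "B (- y i) (- y k) = (tr (y k) - tr (y i)) * (theta_reg q (y k * y i) * theta_reg q (y k / y i))"
      using B[of "- y i" "- y k"] nz by (simp add: trm mult.commute)
    moreover have "B (z k) (z i) = (tr (z k) - tr (z i)) * (theta_reg q (z k * z i) * theta_reg q (z k / z i))"
      by (rule B) (use nz in auto)
    ultimately show "B (- y i) (- y k) * B (z k) (z i) / (pr i k * pr k i) = (tr (y k) - tr (y i)) * (tr (z k) - tr (z i)) / ((tr (z k) + tr (y i)) * (tr (z i) + tr (y k)))
     * (theta_reg q (y k * y i) * theta_reg q (y k / y i) * theta_reg q (z k * z i) * theta_reg q (z k / z i)
         / (theta_reg q (- y i / z k) * theta_reg q (- (z k * y i)) * theta_reg q (- y k / z i) * theta_reg q (- (z i * y k))))"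
      unfolding pr_def by (simp add: mult_ac)
  qed
  finally show ?thesis unfolding nb_def pr_def by (simp add: prod.distrib prod_dividef mult_ac)
qed

end

section \<open>The algebra of formal sums\<close>

lemma scl_of_nat_Suc: "scl (of_nat (Suc k)) v = (v :: weight) + scl (of_nat k) v"
  by (rule ext) (simp add: scl_def algebra_simps)

lemma scl_zero: "scl 0 v = (0 :: weight)" by (rule ext) (simp add: scl_def)

locale height =
  fixes g :: superalgebra and P :: "weight set" and H :: "weight \<Rightarrow> real"
  assumes H_add: "H (a + b) = H a + H b"
    and H_pos: "\<gamma> \<in> aff_pos g P \<Longrightarrow> H \<gamma> > 0"
    and H_fin: "finite {\<gamma> \<in> aff_pos g P. H \<gamma> \<le> B}"
begin

abbreviation "R \<equiv> fsum_ring g P"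
abbreviation "Q \<equiv> aff_Q_plus g P"

lemma H_0: "H 0 = 0" using H_add[of 0 0] by simp
lemma H_uminus: "H (- a) = - H a" using H_add[of a "- a"] H_0 by simp
lemma H_diff: "H (a - b) = H a - H b" using H_add[of a "- b"] H_uminus[of b] by simp
lemma H_scl: "H (scl (of_nat k) a) = of_nat k * H a"
proof (induction k)
  case 0 show ?case unfolding of_nat_0 scl_zero H_0 by simp
next
  case (Suc k) show ?case unfolding scl_of_nat_Suc H_add Suc by (simp add: algebra_simps)
qed
lemma H_sum: "H (sum f A) = (\<Sum>x\<in>A. H (f x))"
  by (induction A rule: infinite_finite_induct) (simp_all only: sum.infinite sum.empty sum.insert H_0 H_add not_False_eq_True)

lemma Q_0: "0 \<in> Q"
  unfolding aff_Q_plus_def by (rule CollectI, rule exI[of _ "{}"]) simp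

lemma Q_gen: "\<gamma> \<in> aff_pos g P \<Longrightarrow> \<gamma> \<in> Q"
  unfolding aff_Q_plus_def
  by (rule CollectI, rule exI[of _ "{\<gamma>}"], rule exI[of _ "\<lambda>_. 1"]) (simp add: scl_def)

lemma Q_add:
  assumes "a \<in> Q" "b \<in> Q" shows "a + b \<in> Q"
proof -
  obtain S c where S: "a = (\<Sum>\<gamma>\<in>S. scl (of_nat (c \<gamma> :: nat)) \<gamma>)" "finite S" "S \<subseteq> aff_pos g P"
    using assms(1) unfolding aff_Q_plus_def by blast
  obtain T d where T: "b = (\<Sum>\<gamma>\<in>T. scl (of_nat (d \<gamma> :: nat)) \<gamma>)" "finite T" "T \<subseteq> aff_pos g P"
    using assms(2) unfolding aff_Q_plus_def by blast
  define c' where "c' \<gamma> = (if \<gamma> \<in> S then c \<gamma> else 0)" for \<gamma>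
  define d' where "d' \<gamma> = (if \<gamma> \<in> T then d \<gamma> else 0)" for \<gamma>
  have a: "a = (\<Sum>\<gamma>\<in>S \<union> T. scl (of_nat (c' \<gamma>)) \<gamma>)"
    unfolding S(1) using S T by (intro sum.mono_neutral_cong_left) (auto simp: c'_def scl_zero)
  have b: "b = (\<Sum>\<gamma>\<in>S \<union> T. scl (of_nat (d' \<gamma>)) \<gamma>)"
    unfolding T(1) using S T by (intro sum.mono_neutral_cong_left) (auto simp: d'_def scl_zero)
  have "scl (of_nat (c' \<gamma> + d' \<gamma>)) \<gamma> = scl (of_nat (c' \<gamma>)) \<gamma> + scl (of_nat (d' \<gamma>)) \<gamma>" for \<gamma> :: weight
    by (rule ext) (simp add: scl_def algebra_simps)
  then have "a + b = (\<Sum>\<gamma>\<in>S \<union> T. scl (of_nat (c' \<gamma> + d' \<gamma>)) \<gamma>)"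
    unfolding a b by (simp add: sum.distrib)
  moreover have "finite (S \<union> T)" "S \<union> T \<subseteq> aff_pos g P" using S T by auto
  ultimately show ?thesis unfolding aff_Q_plus_def
    by (intro CollectI exI[of _ "S \<union> T"] exI[of _ "\<lambda>\<gamma>. c' \<gamma> + d' \<gamma>"]) simp
qed

lemma Q_scl: "a \<in> Q \<Longrightarrow> scl (of_nat k) a \<in> Q"
  by (induction k) (simp_all add: scl_zero Q_0 scl_of_nat_Suc Q_add del: of_nat_Suc)

lemma Q_nonneg: "a \<in> Q \<Longrightarrow> H a \<ge> 0"
proof -
  assume "a \<in> Q"
  then obtain S c where S: "a = (\<Sum>\<gamma>\<in>S. scl (of_nat (c \<gamma> :: nat)) \<gamma>)" "S \<subseteq> aff_pos g P"
    unfolding aff_Q_plus_def by blast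
  show ?thesis unfolding S(1) H_sum H_scl using S(2) H_pos by (intro sum_nonneg mult_nonneg_nonneg) (auto intro: less_imp_le)
qed

lemma H_min: obtains c where "c > 0" "\<And>\<gamma>. \<gamma> \<in> aff_pos g P \<Longrightarrow> H \<gamma> \<ge> c"
proof -
  define c where "c = Min (insert 1 (H ` {\<gamma> \<in> aff_pos g P. H \<gamma> \<le> 1}))"
  have f: "finite (insert 1 (H ` {\<gamma> \<in> aff_pos g P. H \<gamma> \<le> 1}))" using H_fin[of 1] by simp
  have "c > 0" unfolding c_def using f H_pos by (subst Min_gr_iff) auto
  moreover have "H \<gamma> \<ge> c" if "\<gamma> \<in> aff_pos g P" for \<gamma>
  proof (cases "H \<gamma> \<le> 1")
    case True then show ?thesis unfolding c_def using f that by (intro Min_le) auto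
  next
    case False
    have "c \<le> 1" unfolding c_def using f by (intro Min_le) auto
    then show ?thesis using False by simp
  qed
  ultimately show thesis using that by blast
qed

text \<open>
  Only finitely many elements of the positive cone lie below a given height, since the heights of the
  positive affine roots have a positive minimum.
\<close>

lemma Q_finite: "finite {a \<in> Q. H a \<le> B}"
proof -
  obtain c where c: "c > 0" "\<And>\<gamma>. \<gamma> \<in> aff_pos g P \<Longrightarrow> H \<gamma> \<ge> c" using H_min by blast
  define F where "F = {\<gamma> \<in> aff_pos g P. H \<gamma> \<le> B}"
  have F: "finite F" unfolding F_def by (rule H_fin)
  define N where "N = nat \<lfloor>B / c\<rfloor>"
  have "{a \<in> Q. H a \<le> B} \<subseteq> (\<lambda>d. \<Sum>\<gamma>\<in>F. scl (of_nat (d \<gamma>)) \<gamma>) ` PiE F (\<lambda>_. {..N})"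
  proof
    fix a assume "a \<in> {a \<in> Q. H a \<le> B}"
    then obtain S d where S: "a = (\<Sum>\<gamma>\<in>S. scl (of_nat (d \<gamma> :: nat)) \<gamma>)" "finite S" "S \<subseteq> aff_pos g P" and B: "H a \<le> B"
      unfolding aff_Q_plus_def by blast
    have Ha: "H a = (\<Sum>\<gamma>\<in>S. real (d \<gamma>) * H \<gamma>)" unfolding S(1) by (simp add: H_sum H_scl)
    have le: "real (d \<gamma>) * H \<gamma> \<le> B" if "\<gamma> \<in> S" for \<gamma>
    proof -
      have "real (d x) * H x \<ge> 0" if "x \<in> S" for x
        using H_pos[of x] S(3) that by (intro mult_nonneg_nonneg) (auto intro: less_imp_le)
      then have "real (d \<gamma>) * H \<gamma> \<le> (\<Sum>\<gamma>\<in>S. real (d \<gamma>) * H \<gamma>)"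
        using that S(2) by (intro member_le_sum) auto
      then show ?thesis using Ha B by linarith
    qed
    define d' where "d' = (\<lambda>\<gamma>\<in>F. if \<gamma> \<in> S then d \<gamma> else 0)"
    have out: "d \<gamma> = 0" if "\<gamma> \<in> S" "\<gamma> \<notin> F" for \<gamma>
    proof (rule ccontr)
      assume "d \<gamma> \<noteq> 0"
      then have "1 * H \<gamma> \<le> real (d \<gamma>) * H \<gamma>" using that(1) S(3) H_pos[of \<gamma>] by (intro mult_right_mono) (auto intro: less_imp_le)
      then show False using le[OF that(1)] that S by (auto simp: F_def)
    qed
    have "a = (\<Sum>\<gamma>\<in>F. scl (of_nat (d' \<gamma>)) \<gamma>)"
    proof -
      have "a = (\<Sum>\<gamma>\<in>S \<inter> F. scl (of_nat (d \<gamma>)) \<gamma>)" unfolding S(1)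
        using S by (intro sum.mono_neutral_right) (auto simp: out scl_zero)
      also have "\<dots> = (\<Sum>\<gamma>\<in>F. scl (of_nat (d' \<gamma>)) \<gamma>)"
        using F by (intro sum.mono_neutral_cong_left) (auto simp: d'_def scl_zero)
      finally show ?thesis .
    qed
    moreover have "d' \<in> PiE F (\<lambda>_. {..N})"
    proof (rule PiE_I)
      fix \<gamma> assume g: "\<gamma> \<in> F"
      show "d' \<gamma> \<in> {..N}"
      proof (cases "\<gamma> \<in> S")
        case True
        have "real (d \<gamma>) * c \<le> real (d \<gamma>) * H \<gamma>" using c(2)[of \<gamma>] g by (intro mult_left_mono) (auto simp: F_def)
        then have "real (d \<gamma>) \<le> B / c" using le[OF True] c(1) by (simp add: field_simps)
        then show ?thesis using True g unfolding N_def d'_def by (simp add: le_nat_iff le_floor_iff)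
      qed (use g in \<open>simp add: d'_def\<close>)
    qed (simp add: d'_def)
    ultimately show "a \<in> (\<lambda>d. \<Sum>\<gamma>\<in>F. scl (of_nat (d \<gamma>)) \<gamma>) ` PiE F (\<lambda>_. {..N})" by blast
  qed
  then show ?thesis by (rule finite_subset) (intro finite_imageI finite_PiE F, simp)
qed

lemma carrier_iff: "b \<in> carrier R \<longleftrightarrow> (\<exists>L. finite L \<and> L \<subseteq> aff_weights g \<and>
   (\<forall>\<nu>. b \<nu> \<noteq> 0 \<longrightarrow> (\<exists>l\<in>L. \<exists>\<gamma>\<in>Q. \<nu> = l - \<gamma>)))"
proof -
  have "{\<nu>. b \<nu> \<noteq> 0} \<subseteq> (\<Union>l\<in>L. {l - \<gamma> | \<gamma>. \<gamma> \<in> Q}) \<longleftrightarrow> (\<forall>\<nu>. b \<nu> \<noteq> 0 \<longrightarrow> (\<exists>l\<in>L. \<exists>\<gamma>\<in>Q. \<nu> = l - \<gamma>))" for L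
    by blast
  then show ?thesis unfolding fsum_ring_def by simp
qed

text \<open>
  Finitely many terms above any height, as in a Novikov ring.
\<close>

definition nov :: "fsum \<Rightarrow> bool" where
  "nov b \<longleftrightarrow> (\<forall>B. finite {\<nu>. b \<nu> \<noteq> 0 \<and> B \<le> H \<nu>})"

text \<open>
  Members of the algebra have finitely many terms above any given height. This weaker property is the
  one that is preserved by coefficientwise sums over the translation group.
\<close>

lemma carrier_nov:
  assumes "b \<in> carrier R" shows "nov b"
  unfolding nov_def
proof
  fix B
  obtain L where L: "finite L" "\<And>\<nu>. b \<nu> \<noteq> 0 \<Longrightarrow> \<exists>l\<in>L. \<exists>\<gamma>\<in>Q. \<nu> = l - \<gamma>"
    using assms unfolding carrier_iff by blast
  have "{\<nu>. b \<nu> \<noteq> 0 \<and> B \<le> H \<nu>} \<subseteq> (\<Union>l\<in>L. (\<lambda>\<gamma>. l - \<gamma>) ` {\<gamma> \<in> Q. H \<gamma> \<le> H l - B})"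
  proof
    fix \<nu> assume n: "\<nu> \<in> {\<nu>. b \<nu> \<noteq> 0 \<and> B \<le> H \<nu>}"
    then obtain l \<gamma> where "l \<in> L" "\<gamma> \<in> Q" "\<nu> = l - \<gamma>" using L(2) by blast
    moreover have "\<gamma> \<in> {\<gamma> \<in> Q. H \<gamma> \<le> H l - B}" using n \<open>\<gamma> \<in> Q\<close> unfolding \<open>\<nu> = l - \<gamma>\<close> by (simp add: H_diff)
    ultimately show "\<nu> \<in> (\<Union>l\<in>L. (\<lambda>\<gamma>. l - \<gamma>) ` {\<gamma> \<in> Q. H \<gamma> \<le> H l - B})" by blast
  qed
  then show "finite {\<nu>. b \<nu> \<noteq> 0 \<and> B \<le> H \<nu>}"
    by (rule finite_subset) (use L(1) Q_finite in blast)
qed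

lemma nov_bound:
  assumes "nov b" obtains U where "\<And>\<nu>. b \<nu> \<noteq> 0 \<Longrightarrow> H \<nu> \<le> U"
proof -
  let ?S = "{\<nu>. b \<nu> \<noteq> 0 \<and> 0 \<le> H \<nu>}"
  have f: "finite (insert 0 (H ` ?S))" using assms by (simp add: nov_def)
  have "H \<nu> \<le> Max (insert 0 (H ` ?S))" if "b \<nu> \<noteq> 0" for \<nu>
  proof (cases "0 \<le> H \<nu>")
    case True then show ?thesis using f that by (intro Max_ge) auto
  next
    case False
    have "0 \<le> Max (insert 0 (H ` ?S))" using f by (intro Max_ge) auto
    then show ?thesis using False by linarith
  qed
  then show thesis using that by blast
qed

lemma nov_pairs:
  assumes "nov a" "nov b"
  shows "finite {(\<mu>, \<kappa>). a \<mu> \<noteq> 0 \<and> b \<kappa> \<noteq> 0 \<and> B \<le> H \<mu> + H \<kappa>}"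
proof -
  obtain U where U: "\<And>\<nu>. a \<nu> \<noteq> 0 \<Longrightarrow> H \<nu> \<le> U" using nov_bound[OF assms(1)] by blast
  obtain V where V: "\<And>\<nu>. b \<nu> \<noteq> 0 \<Longrightarrow> H \<nu> \<le> V" using nov_bound[OF assms(2)] by blast
  have "{(\<mu>, \<kappa>). a \<mu> \<noteq> 0 \<and> b \<kappa> \<noteq> 0 \<and> B \<le> H \<mu> + H \<kappa>} \<subseteq>
    {\<nu>. a \<nu> \<noteq> 0 \<and> B - V \<le> H \<nu>} \<times> {\<nu>. b \<nu> \<noteq> 0 \<and> B - U \<le> H \<nu>}"
    using U V by (fastforce)
  then show ?thesis
    by (rule finite_subset) (use assms in \<open>auto simp: nov_def\<close>)
qed

lemma fmult_index_finite:
  assumes "nov a" "nov b" shows "finite {\<mu>. a \<mu> \<noteq> 0 \<and> b (\<nu> - \<mu>) \<noteq> 0}"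
proof -
  have "{\<mu>. a \<mu> \<noteq> 0 \<and> b (\<nu> - \<mu>) \<noteq> 0} \<subseteq> fst ` {(\<mu>, \<kappa>). a \<mu> \<noteq> 0 \<and> b \<kappa> \<noteq> 0 \<and> H \<nu> \<le> H \<mu> + H \<kappa>}"
    by (force simp: H_diff image_iff)
  then show ?thesis by (rule finite_subset) (rule finite_imageI[OF nov_pairs[OF assms]])
qed

lemma fmult_nonzero: "fmult a b \<nu> \<noteq> 0 \<Longrightarrow> \<exists>\<mu>. a \<mu> \<noteq> 0 \<and> b (\<nu> - \<mu>) \<noteq> 0"
proof (rule ccontr)
  assume "fmult a b \<nu> \<noteq> 0" "\<not> (\<exists>\<mu>. a \<mu> \<noteq> 0 \<and> b (\<nu> - \<mu>) \<noteq> 0)"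
  then have "{\<mu>. a \<mu> \<noteq> 0 \<and> b (\<nu> - \<mu>) \<noteq> 0} = {}" by blast
  then have "fmult a b \<nu> = 0" by (simp only: fmult_def sum.empty)
  then show False using \<open>fmult a b \<nu> \<noteq> 0\<close> by simp
qed

lemma fmult_cong_set:
  assumes "finite S" "{\<mu>. a \<mu> \<noteq> 0 \<and> b (\<nu> - \<mu>) \<noteq> 0} \<subseteq> S"
  shows "fmult a b \<nu> = (\<Sum>\<mu>\<in>S. a \<mu> * b (\<nu> - \<mu>))"
  unfolding fmult_def using assms by (intro sum.mono_neutral_left) auto

lemma fmult_comm: "fmult a b = fmult b a"
proof
  fix \<nu>
  show "fmult a b \<nu> = fmult b a \<nu>" unfolding fmult_def
    by (rule sum.reindex_bij_witness[of _ "\<lambda>\<mu>. \<nu> - \<mu>" "\<lambda>\<mu>. \<nu> - \<mu>"]) (auto simp: mult.commute)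
qed

lemma fmult_triple:
  assumes "nov a" "nov b" "nov c"
  shows "fmult (fmult a b) c \<nu> = (\<Sum>(\<mu>,\<kappa>,l) | a \<mu> \<noteq> 0 \<and> b \<kappa> \<noteq> 0 \<and> c l \<noteq> 0 \<and> \<mu> + \<kappa> + l = \<nu>. a \<mu> * b \<kappa> * c l)"
proof -
  let ?M = "\<lambda>\<xi>. {\<mu>. a \<mu> \<noteq> 0 \<and> b (\<xi> - \<mu>) \<noteq> 0}"
  let ?T = "{(\<mu>,\<kappa>,l). a \<mu> \<noteq> 0 \<and> b \<kappa> \<noteq> 0 \<and> c l \<noteq> 0 \<and> \<mu> + \<kappa> + l = \<nu>}"
  obtain U where U: "\<And>\<nu>. c \<nu> \<noteq> 0 \<Longrightarrow> H \<nu> \<le> U" using nov_bound[OF assms(3)] by blast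
  define X where "X = {\<xi>. (\<exists>\<mu>. \<mu> \<in> ?M \<xi>) \<and> c (\<nu> - \<xi>) \<noteq> 0}"
  have X: "finite X"
  proof (rule finite_subset)
    show "X \<subseteq> (\<lambda>(\<mu>,\<kappa>). \<mu> + \<kappa>) ` {(\<mu>, \<kappa>). a \<mu> \<noteq> 0 \<and> b \<kappa> \<noteq> 0 \<and> H \<nu> - U \<le> H \<mu> + H \<kappa>}"
    proof
      fix \<xi> assume "\<xi> \<in> X"
      then obtain \<mu> where m: "a \<mu> \<noteq> 0" "b (\<xi> - \<mu>) \<noteq> 0" "c (\<nu> - \<xi>) \<noteq> 0" by (auto simp: X_def)
      then have "(\<mu>, \<xi> - \<mu>) \<in> {(\<mu>, \<kappa>). a \<mu> \<noteq> 0 \<and> b \<kappa> \<noteq> 0 \<and> H \<nu> - U \<le> H \<mu> + H \<kappa>}" using U[of "\<nu> - \<xi>"] by (simp add: H_diff)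
      moreover have "\<xi> = (\<lambda>(\<mu>,\<kappa>). \<mu> + \<kappa>) (\<mu>, \<xi> - \<mu>)" by simp
      ultimately show "\<xi> \<in> (\<lambda>(\<mu>,\<kappa>). \<mu> + \<kappa>) ` {(\<mu>, \<kappa>). a \<mu> \<noteq> 0 \<and> b \<kappa> \<noteq> 0 \<and> H \<nu> - U \<le> H \<mu> + H \<kappa>}" by blast
    qed
    show "finite ((\<lambda>(\<mu>,\<kappa>). \<mu> + \<kappa>) ` {(\<mu>, \<kappa>). a \<mu> \<noteq> 0 \<and> b \<kappa> \<noteq> 0 \<and> H \<nu> - U \<le> H \<mu> + H \<kappa>})"
      by (rule finite_imageI[OF nov_pairs[OF assms(1,2)]])
  qed
  have "fmult (fmult a b) c \<nu> = (\<Sum>\<xi>\<in>X. fmult a b \<xi> * c (\<nu> - \<xi>))"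
    using X fmult_nonzero by (intro fmult_cong_set) (auto simp: X_def)
  also have "\<dots> = (\<Sum>\<xi>\<in>X. \<Sum>\<mu>\<in>?M \<xi>. a \<mu> * b (\<xi> - \<mu>) * c (\<nu> - \<xi>))"
    unfolding fmult_def by (simp add: sum_distrib_right)
  also have "\<dots> = (\<Sum>(\<xi>,\<mu>)\<in>Sigma X ?M. a \<mu> * b (\<xi> - \<mu>) * c (\<nu> - \<xi>))"
    using X fmult_index_finite[OF assms(1,2)] by (intro sum.Sigma) auto
  also have "\<dots> = (\<Sum>(\<mu>,\<kappa>,l)\<in>?T. a \<mu> * b \<kappa> * c l)"
    by (rule sum.reindex_bij_witness[of _ "\<lambda>(\<mu>,\<kappa>,l). (\<mu> + \<kappa>, \<mu>)" "\<lambda>(\<xi>,\<mu>). (\<mu>, \<xi> - \<mu>, \<nu> - \<xi>)"])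
       (auto simp: X_def algebra_simps)
  finally show ?thesis by (simp add: case_prod_unfold)
qed

lemma fmult_assoc:
  assumes "nov a" "nov b" "nov c"
  shows "fmult (fmult a b) c = fmult a (fmult b c)"
proof
  fix \<nu>
  have "fmult a (fmult b c) \<nu> = fmult (fmult b c) a \<nu>" by (simp add: fmult_comm)
  also have "\<dots> = fmult (fmult a b) c \<nu>"
    unfolding fmult_triple[OF assms] fmult_triple[OF assms(2,3,1)]
    by (rule sum.reindex_bij_witness[of _ "\<lambda>(\<mu>,\<kappa>,l). (\<kappa>,l,\<mu>)" "\<lambda>(\<kappa>,l,\<mu>). (\<mu>,\<kappa>,l)"]) (auto simp: algebra_simps)
  finally show "fmult (fmult a b) c \<nu> = fmult a (fmult b c) \<nu>" by simp
qed

lemma fmult_one: "fmult (fexp 0) b = b"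
proof
  fix \<nu>
  have "fmult (fexp 0) b \<nu> = (\<Sum>\<mu>\<in>{0}. fexp 0 \<mu> * b (\<nu> - \<mu>))"
    by (rule fmult_cong_set) (auto simp: fexp_def)
  then show "fmult (fexp 0) b \<nu> = b \<nu>" by (simp add: fexp_def)
qed

lemma fmult_add_right:
  assumes "nov a" "nov b" "nov c"
  shows "fmult a (b + c) = fmult a b + fmult a c"
proof
  fix \<nu>
  let ?S = "{\<mu>. a \<mu> \<noteq> 0 \<and> b (\<nu> - \<mu>) \<noteq> 0} \<union> {\<mu>. a \<mu> \<noteq> 0 \<and> c (\<nu> - \<mu>) \<noteq> 0}"
  have f: "finite ?S" using fmult_index_finite assms by simp
  have "fmult a (b + c) \<nu> = (\<Sum>\<mu>\<in>?S. a \<mu> * (b + c) (\<nu> - \<mu>))" by (rule fmult_cong_set[OF f]) auto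
  moreover have "fmult a b \<nu> = (\<Sum>\<mu>\<in>?S. a \<mu> * b (\<nu> - \<mu>))" by (rule fmult_cong_set[OF f]) auto
  moreover have "fmult a c \<nu> = (\<Sum>\<mu>\<in>?S. a \<mu> * c (\<nu> - \<mu>))" by (rule fmult_cong_set[OF f]) auto
  ultimately show "fmult a (b + c) \<nu> = (fmult a b + fmult a c) \<nu>"
    by (simp add: sum.distrib algebra_simps)
qed

lemma fmult_carrier:
  assumes "a \<in> carrier R" "b \<in> carrier R" shows "fmult a b \<in> carrier R"
proof -
  obtain L where L: "finite L" "L \<subseteq> aff_weights g" "\<And>\<nu>. a \<nu> \<noteq> 0 \<Longrightarrow> \<exists>l\<in>L. \<exists>\<gamma>\<in>Q. \<nu> = l - \<gamma>"
    using assms(1) unfolding carrier_iff by blast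
  obtain M where M: "finite M" "M \<subseteq> aff_weights g" "\<And>\<nu>. b \<nu> \<noteq> 0 \<Longrightarrow> \<exists>l\<in>M. \<exists>\<gamma>\<in>Q. \<nu> = l - \<gamma>"
    using assms(2) unfolding carrier_iff by blast
  show ?thesis unfolding carrier_iff
  proof (intro exI[of _ "(\<lambda>(l,m). l + m) ` (L \<times> M)"] conjI allI impI)
    show "finite ((\<lambda>(l,m). l + m) ` (L \<times> M))" using L M by simp
    show "(\<lambda>(l,m). l + m) ` (L \<times> M) \<subseteq> aff_weights g" using L(2) M(2) by (auto simp: aff_weights_def subset_iff)
    fix \<nu> assume "fmult a b \<nu> \<noteq> 0"
    then obtain \<mu> where "a \<mu> \<noteq> 0" "b (\<nu> - \<mu>) \<noteq> 0" using fmult_nonzero by blast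
    then obtain l \<gamma> m \<gamma>' where x: "l \<in> L" "\<gamma> \<in> Q" "\<mu> = l - \<gamma>" "m \<in> M" "\<gamma>' \<in> Q" "\<nu> - \<mu> = m - \<gamma>'"
      using L(3) M(3) by meson
    have "\<nu> = \<mu> + (\<nu> - \<mu>)" by simp
    also have "\<dots> = (l + m) - (\<gamma> + \<gamma>')" unfolding x(6) unfolding x(3) by simp
    finally show "\<exists>l\<in>(\<lambda>(l,m). l + m) ` (L \<times> M). \<exists>\<gamma>\<in>Q. \<nu> = l - \<gamma>"
      using x Q_add by blast
  qed
qed

lemma fexp_carrier: "l \<in> aff_weights g \<Longrightarrow> fexp l \<in> carrier R"
  unfolding carrier_iff by (rule exI[of _ "{l}"]) (use Q_0 in \<open>force simp: fexp_def\<close>)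

lemma aff_weights_0: "0 \<in> aff_weights g" by (simp add: aff_weights_def)

lemma R_simps: "monoid.mult R = fmult" "one R = fexp 0"
  by (simp_all add: fsum_ring_def)

lemma R_comm_monoid: "comm_monoid R"
proof (rule comm_monoidI)
  show "\<And>x y. x \<in> carrier R \<Longrightarrow> y \<in> carrier R \<Longrightarrow> x \<otimes>\<^bsub>R\<^esub> y \<in> carrier R" by (simp add: R_simps fmult_carrier)
  show "\<one>\<^bsub>R\<^esub> \<in> carrier R" by (simp add: R_simps fexp_carrier aff_weights_0)
  show "\<And>x y z. x \<in> carrier R \<Longrightarrow> y \<in> carrier R \<Longrightarrow> z \<in> carrier R \<Longrightarrow> x \<otimes>\<^bsub>R\<^esub> y \<otimes>\<^bsub>R\<^esub> z = x \<otimes>\<^bsub>R\<^esub> (y \<otimes>\<^bsub>R\<^esub> z)"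
    by (simp add: R_simps fmult_assoc carrier_nov)
  show "\<And>x. x \<in> carrier R \<Longrightarrow> \<one>\<^bsub>R\<^esub> \<otimes>\<^bsub>R\<^esub> x = x" by (simp add: R_simps fmult_one)
  show "\<And>x y. x \<in> carrier R \<Longrightarrow> y \<in> carrier R \<Longrightarrow> x \<otimes>\<^bsub>R\<^esub> y = y \<otimes>\<^bsub>R\<^esub> x" by (simp add: R_simps fmult_comm)
qed

lemma carrier_supp:
  assumes "a \<in> carrier R" "b \<in> carrier R" "\<And>\<nu>. c \<nu> \<noteq> 0 \<Longrightarrow> a \<nu> \<noteq> 0 \<or> b \<nu> \<noteq> 0"
  shows "c \<in> carrier R"
proof -
  obtain L where L: "finite L" "L \<subseteq> aff_weights g" "\<And>\<nu>. a \<nu> \<noteq> 0 \<Longrightarrow> \<exists>l\<in>L. \<exists>\<gamma>\<in>Q. \<nu> = l - \<gamma>"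
    using assms(1) unfolding carrier_iff by blast
  obtain M where M: "finite M" "M \<subseteq> aff_weights g" "\<And>\<nu>. b \<nu> \<noteq> 0 \<Longrightarrow> \<exists>l\<in>M. \<exists>\<gamma>\<in>Q. \<nu> = l - \<gamma>"
    using assms(2) unfolding carrier_iff by blast
  have "\<exists>l\<in>L \<union> M. \<exists>\<gamma>\<in>Q. \<nu> = l - \<gamma>" if "c \<nu> \<noteq> 0" for \<nu>
    using assms(3)[OF that] L(3)[of \<nu>] M(3)[of \<nu>] by (elim disjE) blast+
  then show ?thesis unfolding carrier_iff using L(1,2) M(1,2) by (intro exI[of _ "L \<union> M"]) simp
qed

end

section \<open>Evaluation at characters\<close>

locale evaluation = height +
  fixes chi :: "weight \<Rightarrow> complex" and \<Lambda> :: "weight set"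
  assumes chi_add: "chi (a + b) = chi a * chi b" and chi_nz: "chi a \<noteq> 0"
    and chi_small: "\<gamma> \<in> aff_pos g P \<Longrightarrow> norm (chi (- \<gamma>)) < 1"
    and Lam_0: "0 \<in> \<Lambda>" and Lam_diff: "a \<in> \<Lambda> \<Longrightarrow> b \<in> \<Lambda> \<Longrightarrow> a - b \<in> \<Lambda>"
begin

lemma chi_0: "chi 0 = 1" using chi_add[of 0 0] chi_nz[of 0] by simp

lemma chi_uminus: "chi (- a) = 1 / chi a"
  using chi_add[of a "- a"] chi_nz[of a] chi_0 by (simp add: field_simps)

lemma chi_diff: "chi (a - b) = chi a / chi b"
  using chi_add[of a "- b"] by (simp add: chi_uminus)

lemma chi_scl: "chi (scl (of_nat k) a) = chi a ^ k"
proof (induction k)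
  case 0 show ?case unfolding of_nat_0 scl_zero chi_0 by simp
next
  case (Suc k) show ?case unfolding scl_of_nat_Suc chi_add Suc by simp
qed

lemma Lam_uminus: "a \<in> \<Lambda> \<Longrightarrow> - a \<in> \<Lambda>" using Lam_diff[OF Lam_0, of a] by simp
lemma Lam_add: "a \<in> \<Lambda> \<Longrightarrow> b \<in> \<Lambda> \<Longrightarrow> a + b \<in> \<Lambda>" using Lam_diff[of a "- b"] Lam_uminus[of b] by simp
lemma Lam_scl: "a \<in> \<Lambda> \<Longrightarrow> scl (of_nat k) a \<in> \<Lambda>"
proof (induction k)
  case 0 show ?case unfolding of_nat_0 scl_zero by (rule Lam_0)
next
  case (Suc k) then show ?case unfolding scl_of_nat_Suc by (intro Lam_add) auto
qed

definition trm :: "fsum \<Rightarrow> weight \<Rightarrow> complex" where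
  "trm a \<nu> = of_rat (a \<nu>) * chi \<nu>"

definition ev :: "fsum \<Rightarrow> complex" where
  "ev a = (\<Sum>\<^sub>\<infinity>\<nu>. trm a \<nu>)"

definition nm :: "fsum \<Rightarrow> real" where
  "nm a = (\<Sum>\<^sub>\<infinity>\<nu>. norm (trm a \<nu>))"

definition abl :: "fsum \<Rightarrow> bool" where
  "abl a \<longleftrightarrow> (\<lambda>\<nu>. norm (trm a \<nu>)) summable_on UNIV"

text \<open>
  Members of the algebra whose evaluation converges absolutely and whose weights lie in a fixed group.
\<close>

definition good :: "fsum \<Rightarrow> bool" where
  "good a \<longleftrightarrow> a \<in> carrier R \<and> abl a \<and> (\<forall>\<nu>. a \<nu> \<noteq> 0 \<longrightarrow> \<nu> \<in> \<Lambda>)"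

lemma nm_nonneg: "nm a \<ge> 0" unfolding nm_def by (rule infsum_nonneg) simp

lemma fmult_trm:
  assumes "nov a" "nov b"
  shows "(\<Sum>\<^sub>\<infinity>\<mu>. trm a \<mu> * trm b (\<nu> - \<mu>)) = trm (fmult a b) \<nu>"
proof -
  let ?S = "{\<mu>. a \<mu> \<noteq> 0 \<and> b (\<nu> - \<mu>) \<noteq> 0}"
  have "(\<Sum>\<^sub>\<infinity>\<mu>. trm a \<mu> * trm b (\<nu> - \<mu>)) = (\<Sum>\<^sub>\<infinity>\<mu>\<in>?S. trm a \<mu> * trm b (\<nu> - \<mu>))"
    by (rule infsum_cong_neutral) (auto simp: trm_def)
  also have "\<dots> = (\<Sum>\<mu>\<in>?S. trm a \<mu> * trm b (\<nu> - \<mu>))"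
    by (rule infsum_finite) (rule fmult_index_finite[OF assms])
  also have "\<dots> = (\<Sum>\<mu>\<in>?S. of_rat (a \<mu> * b (\<nu> - \<mu>)) * chi \<nu>)"
    by (rule sum.cong) (use chi_nz in \<open>auto simp: trm_def of_rat_mult chi_diff\<close>)
  also have "\<dots> = trm (fmult a b) \<nu>"
    unfolding trm_def fmult_def by (simp add: of_rat_sum sum_distrib_right)
  finally show ?thesis .
qed

lemma ev_fmult:
  assumes "nov a" "nov b" "abl a" "abl b"
  shows "abl (fmult a b)" "ev (fmult a b) = ev a * ev b" "nm (fmult a b) \<le> nm a * nm b"
proof -
  note c = convolution[OF assms(3,4)[unfolded abl_def], unfolded fmult_trm[OF assms(1,2)]]
  show a: "abl (fmult a b)" unfolding abl_def by (rule c(4))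
  show "ev (fmult a b) = ev a * ev b" unfolding ev_def by (rule c(5))
  have "nm (fmult a b) \<le> (\<Sum>\<^sub>\<infinity>m. \<Sum>\<^sub>\<infinity>k. norm (trm a k * trm b (m - k)))"
    unfolding nm_def
  proof (rule infsum_mono)
    show "norm (trm (fmult a b) m) \<le> (\<Sum>\<^sub>\<infinity>k. norm (trm a k * trm b (m - k)))" for m
      unfolding fmult_trm[OF assms(1,2), symmetric] by (rule norm_infsum_bound) (rule c(1))
  qed (use a c(2) in \<open>auto simp: abl_def\<close>)
  then show "nm (fmult a b) \<le> nm a * nm b" using c(3) by (simp add: nm_def)
qed

lemma abl_add:
  assumes "abl a" "abl b"
  shows "abl (a + b)" "ev (a + b) = ev a + ev b" "nm (a + b) \<le> nm a + nm b"
proof -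
  have e: "trm (a + b) \<nu> = trm a \<nu> + trm b \<nu>" for \<nu>
    by (simp add: trm_def plus_fun_apply of_rat_add algebra_simps)
  have s: "(\<lambda>\<nu>. norm (trm a \<nu>) + norm (trm b \<nu>)) summable_on UNIV"
    using assms by (auto simp: abl_def intro!: summable_on_add)
  show 1: "abl (a + b)" unfolding abl_def e
    by (rule summable_on_comparison_test[OF s]) (auto intro: norm_triangle_ineq)
  show "ev (a + b) = ev a + ev b" unfolding ev_def e
    by (rule infsum_add) (rule abs_summable_summable, use assms in \<open>simp add: abl_def\<close>)+
  have "nm (a + b) \<le> (\<Sum>\<^sub>\<infinity>\<nu>. norm (trm a \<nu>) + norm (trm b \<nu>))" unfolding nm_def e
    by (rule infsum_mono) (use 1 s in \<open>auto simp: abl_def e norm_triangle_ineq\<close>)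
  also have "\<dots> = nm a + nm b" unfolding nm_def by (rule infsum_add) (use assms in \<open>auto simp: abl_def\<close>)
  finally show "nm (a + b) \<le> nm a + nm b" .
qed

lemma abl_scl:
  assumes "abl a"
  shows "abl (scl c a)" "ev (scl c a) = of_rat c * ev a" "nm (scl c a) = norm (of_rat c :: complex) * nm a"
proof -
  have e: "trm (scl c a) \<nu> = of_rat c * trm a \<nu>" for \<nu>
    by (simp add: trm_def scl_def of_rat_mult)
  show "abl (scl c a)" using assms unfolding abl_def e norm_mult by (rule summable_on_cmult_right)
  show "ev (scl c a) = of_rat c * ev a" unfolding ev_def e by (rule infsum_cmult_right')
  show "nm (scl c a) = norm (of_rat c :: complex) * nm a" unfolding nm_def e norm_mult by (rule infsum_cmult_right')
qed

lemma abl_fexp: "abl (fexp l)" "ev (fexp l) = chi l" "nm (fexp l) = norm (chi l)"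
proof -
  have e: "trm (fexp l) \<nu> = (if \<nu> = l then chi l else 0)" for \<nu> by (auto simp: trm_def fexp_def)
  have "(\<lambda>\<nu>. norm (trm (fexp l) \<nu>)) summable_on UNIV \<longleftrightarrow> (\<lambda>\<nu>. norm (trm (fexp l) \<nu>)) summable_on {l}"
    by (rule summable_on_cong_neutral) (auto simp: e)
  then show "abl (fexp l)" unfolding abl_def by simp
  have "ev (fexp l) = (\<Sum>\<^sub>\<infinity>\<nu>\<in>{l}. trm (fexp l) \<nu>)" unfolding ev_def by (rule infsum_cong_neutral) (auto simp: e)
  then show "ev (fexp l) = chi l" by (simp add: e)
  have "nm (fexp l) = (\<Sum>\<^sub>\<infinity>\<nu>\<in>{l}. norm (trm (fexp l) \<nu>))" unfolding nm_def by (rule infsum_cong_neutral) (auto simp: e)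
  then show "nm (fexp l) = norm (chi l)" by (simp add: e)
qed

lemma good_fmult:
  assumes "good a" "good b"
  shows "good (fmult a b)" "ev (fmult a b) = ev a * ev b" "nm (fmult a b) \<le> nm a * nm b"
proof -
  have n: "nov a" "nov b" "abl a" "abl b" using assms carrier_nov by (auto simp: good_def)
  show "ev (fmult a b) = ev a * ev b" "nm (fmult a b) \<le> nm a * nm b" using ev_fmult[OF n] by auto
  have "\<nu> \<in> \<Lambda>" if "fmult a b \<nu> \<noteq> 0" for \<nu>
  proof -
    obtain \<mu> where "a \<mu> \<noteq> 0" "b (\<nu> - \<mu>) \<noteq> 0" using fmult_nonzero[OF \<open>fmult a b \<nu> \<noteq> 0\<close>] by blast
    then have "\<mu> \<in> \<Lambda>" "\<nu> - \<mu> \<in> \<Lambda>" using assms by (auto simp: good_def)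
    from Lam_add[OF this] show ?thesis by simp
  qed
  then show "good (fmult a b)" using ev_fmult(1)[OF n] assms fmult_carrier by (simp add: good_def)
qed

lemma good_add: "good a \<Longrightarrow> good b \<Longrightarrow> good (a + b)"
  unfolding good_def using abl_add(1) carrier_supp[of a b "a + b"] by (metis add_0 plus_fun_apply)

lemma good_scl: "good a \<Longrightarrow> good (scl c a)"
  unfolding good_def using abl_scl(1) carrier_supp[of a a "scl c a"] by (metis mult_zero_right scl_def)

lemma good_fexp: "l \<in> aff_weights g \<Longrightarrow> l \<in> \<Lambda> \<Longrightarrow> good (fexp l)"
  using fexp_carrier abl_fexp(1) by (auto simp: good_def fexp_def)

lemma good_one: "good (fexp 0)" using good_fexp aff_weights_0 Lam_0 by blast

lemma good_finprod:
  assumes "finite A" "\<And>x. x \<in> A \<Longrightarrow> good (F x)"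
  shows "good (finprod R F A) \<and> ev (finprod R F A) = (\<Prod>x\<in>A. ev (F x)) \<and> nm (finprod R F A) \<le> (\<Prod>x\<in>A. nm (F x))"
  using assms
proof (induction A rule: finite_induct)
  case empty
  interpret comm_monoid R by (rule R_comm_monoid)
  show ?case by (simp add: R_simps good_one abl_fexp chi_0)
next
  case (insert x A)
  interpret comm_monoid R by (rule R_comm_monoid)
  have c: "F \<in> A \<rightarrow> carrier R" "F x \<in> carrier R" using insert.prems by (auto simp: good_def)
  have IH: "good (finprod R F A)" "ev (finprod R F A) = (\<Prod>x\<in>A. ev (F x))" "nm (finprod R F A) \<le> (\<Prod>x\<in>A. nm (F x))"
    using insert.IH insert.prems by auto
  have e: "finprod R F (insert x A) = fmult (F x) (finprod R F A)"
    using finprod_insert[OF insert.hyps(1,2) c] by (simp add: R_simps)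
  have g: "good (F x)" using insert.prems by simp
  have "nm (F x) * nm (finprod R F A) \<le> nm (F x) * (\<Prod>x\<in>A. nm (F x))"
    using IH(3) nm_nonneg by (intro mult_left_mono) auto
  then show ?case unfolding e using good_fmult[OF g IH(1)] IH(2) insert.hyps by (auto simp del: plus_fun_apply)
qed

lemma good_pow:
  assumes "good a"
  shows "good (a [^]\<^bsub>R\<^esub> (n::nat)) \<and> ev (a [^]\<^bsub>R\<^esub> n) = ev a ^ n \<and> nm (a [^]\<^bsub>R\<^esub> n) \<le> nm a ^ n"
proof (induction n)
  case 0
  show ?case by (simp add: R_simps good_one abl_fexp chi_0)
next
  case (Suc n)
  have e: "a [^]\<^bsub>R\<^esub> Suc n = fmult (a [^]\<^bsub>R\<^esub> n) a" by (simp add: R_simps)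
  have "nm (a [^]\<^bsub>R\<^esub> n) * nm a \<le> nm a ^ n * nm a" using Suc nm_nonneg by (intro mult_right_mono) auto
  then show ?case unfolding e using good_fmult[of "a [^]\<^bsub>R\<^esub> n" a] Suc assms by (auto simp: mult.commute)
qed

lemma good_geom:
  assumes "\<gamma> \<in> aff_pos g P" "\<gamma> \<in> \<Lambda>" "c = 1 \<or> c = -1"
  shows "good (geom c \<gamma>)" "ev (geom c \<gamma>) = 1 / (1 - of_rat c * chi (- \<gamma>))" "nm (geom c \<gamma>) = 1 / (1 - norm (chi (- \<gamma>)))"
    "\<And>\<nu>. geom c \<gamma> \<nu> \<noteq> 0 \<Longrightarrow> - \<nu> \<in> Q"
    "\<And>\<nu>. geom c \<gamma> \<nu> \<noteq> 0 \<Longrightarrow> \<exists>k. \<nu> = - scl (of_nat k) \<gamma>" "geom c \<gamma> 0 = 1"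
proof -
  define f where "f k = - scl (of_nat k) \<gamma>" for k
  have inj: "inj f"
  proof
    fix k l assume "f k = f l"
    then have "H (f k) = H (f l)" by simp
    then show "k = l" using H_pos[OF assms(1)] by (simp add: f_def H_uminus H_scl)
  qed
  have gf: "geom c \<gamma> (f k) = c ^ k" for k
  proof -
    have "{l. f k = - scl (of_nat l) \<gamma>} = {k}" using inj by (auto simp: inj_def f_def)
    then show ?thesis unfolding geom_def by simp
  qed
  have g0: "geom c \<gamma> \<nu> = 0" if "\<nu> \<notin> range f" for \<nu>
  proof -
    have "{l. \<nu> = - scl (of_nat l) \<gamma>} = {}" using that by (auto simp: f_def)
    then show ?thesis unfolding geom_def by simp
  qed
  show ex: "\<exists>k. \<nu> = - scl (of_nat k) \<gamma>" if "geom c \<gamma> \<nu> \<noteq> 0" for \<nu>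
  proof -
    have "\<nu> \<in> range f" using g0 that by blast
    then show ?thesis unfolding f_def by blast
  qed
  show supp: "- \<nu> \<in> Q" if nz: "geom c \<gamma> \<nu> \<noteq> 0" for \<nu>
  proof -
    obtain k where k: "\<nu> = - scl (of_nat k) \<gamma>" using ex[OF nz] by blast
    have "- \<nu> = scl (of_nat k) \<gamma>" unfolding k by simp
    then show ?thesis using Q_scl[OF Q_gen[OF assms(1)]] by simp
  qed
  show "geom c \<gamma> 0 = 1" using gf[of 0] by (simp add: f_def scl_zero)
  let ?x = "chi (- \<gamma>)"
  have chif: "chi (f k) = ?x ^ k" for k by (simp add: f_def chi_uminus chi_scl power_one_over)
  have nx: "norm ?x < 1" by (rule chi_small[OF assms(1)])
  have nc: "norm (of_rat c :: complex) = 1" using assms(3) by auto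
  have tf: "trm (geom c \<gamma>) (f k) = (of_rat c * ?x) ^ k" for k
    by (simp add: trm_def gf chif of_rat_power power_mult_distrib)
  have n1: "norm (of_rat c * ?x) < 1" using nx nc by (simp add: norm_mult)
  have sm: "(\<lambda>k. norm ((of_rat c * ?x) ^ k)) summable_on UNIV"
    using n1 by (subst summable_on_UNIV_nonneg_real_iff) (auto simp: norm_power intro!: summable_geometric)
  have "(\<lambda>\<nu>. norm (trm (geom c \<gamma>) \<nu>)) summable_on range f"
    using summable_on_reindex[of f UNIV "\<lambda>\<nu>. norm (trm (geom c \<gamma>) \<nu>)"] inj sm by (simp add: o_def tf)
  moreover have "(\<lambda>\<nu>. norm (trm (geom c \<gamma>) \<nu>)) summable_on range f \<longleftrightarrow> (\<lambda>\<nu>. norm (trm (geom c \<gamma>) \<nu>)) summable_on UNIV"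
    by (rule summable_on_cong_neutral) (auto simp: trm_def g0)
  ultimately have a: "abl (geom c \<gamma>)" by (simp add: abl_def)
  have "geom c \<gamma> \<in> carrier R" unfolding carrier_iff
  proof (intro exI[of _ "{0}"] conjI allI impI)
    fix \<nu> assume "geom c \<gamma> \<nu> \<noteq> 0"
    then show "\<exists>l\<in>{0}. \<exists>\<gamma>\<in>Q. \<nu> = l - \<gamma>" using supp[of \<nu>] by (intro bexI[of _ 0] bexI[of _ "- \<nu>"]) auto
  qed (auto simp: aff_weights_0)
  then show "good (geom c \<gamma>)" using a ex Lam_scl[OF assms(2)] Lam_uminus unfolding good_def by metis
  have "ev (geom c \<gamma>) = (\<Sum>\<^sub>\<infinity>\<nu>\<in>range f. trm (geom c \<gamma>) \<nu>)" unfolding ev_def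
    by (rule infsum_cong_neutral) (auto simp: trm_def g0)
  also have "\<dots> = (\<Sum>\<^sub>\<infinity>k. (of_rat c * ?x) ^ k)"
    using infsum_reindex[of f UNIV "trm (geom c \<gamma>)"] inj by (simp add: o_def tf)
  also have "\<dots> = (\<Sum>k. (of_rat c * ?x) ^ k)"
    by (rule sums_unique[OF has_sum_imp_sums[OF has_sum_infsum[OF abs_summable_summable[OF sm]]]])
  also have "\<dots> = 1 / (1 - of_rat c * ?x)" by (rule suminf_geometric[OF n1])
  finally show "ev (geom c \<gamma>) = 1 / (1 - of_rat c * chi (- \<gamma>))" .
  have "nm (geom c \<gamma>) = (\<Sum>\<^sub>\<infinity>\<nu>\<in>range f. norm (trm (geom c \<gamma>) \<nu>))" unfolding nm_def
    by (rule infsum_cong_neutral) (auto simp: trm_def g0)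
  also have "\<dots> = (\<Sum>\<^sub>\<infinity>k. norm ((of_rat c * ?x) ^ k))"
    using infsum_reindex[of f UNIV "\<lambda>\<nu>. norm (trm (geom c \<gamma>) \<nu>)"] inj by (simp add: o_def tf)
  also have "\<dots> = (\<Sum>k. norm ((of_rat c * ?x) ^ k))"
    by (rule sums_unique[OF has_sum_imp_sums[OF has_sum_infsum[OF sm]]])
  also have "\<dots> = (\<Sum>k. norm ?x ^ k)" using nc by (simp add: norm_power norm_mult)
  also have "\<dots> = 1 / (1 - norm ?x)" using nx by (intro suminf_geometric) simp
  finally show "nm (geom c \<gamma>) = 1 / (1 - norm (chi (- \<gamma>)))" .
qed

end

context evaluation
begin

lemma trm_diff: "trm (a - b) \<nu> = trm a \<nu> - trm b \<nu>"
  by (simp add: trm_def of_rat_diff algebra_simps)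

lemma good_diff: "good a \<Longrightarrow> good b \<Longrightarrow> good (a - b)"
proof -
  assume a: "good a" and b: "good b"
  have e: "a - b = a + scl (-1) b" by (rule ext) (simp add: scl_def)
  show "good (a - b)" unfolding e by (rule good_add[OF a good_scl[OF b]])
qed

lemma ev_diff: "good a \<Longrightarrow> good b \<Longrightarrow> ev (a - b) = ev a - ev b"
  "good a \<Longrightarrow> good b \<Longrightarrow> nm (a - b) \<le> nm a + nm b"
proof -
  assume a: "good a" and b: "good b"
  have e: "a - b = a + scl (-1) b" by (rule ext) (simp add: scl_def)
  have l: "abl a" "abl b" using a b by (auto simp: good_def)
  show "ev (a - b) = ev a - ev b" unfolding e using abl_add(2)[OF l(1) abl_scl(1)[OF l(2)], of "-1"] abl_scl(2)[OF l(2), of "-1"] by simp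
  show "nm (a - b) \<le> nm a + nm b" unfolding e using abl_add(3)[OF l(1) abl_scl(1)[OF l(2)], of "-1"] abl_scl(3)[OF l(2), of "-1"] by simp
qed

lemma norm_ev_le: "abl a \<Longrightarrow> norm (ev a) \<le> nm a"
  unfolding ev_def nm_def abl_def by (rule norm_infsum_bound)

lemma partial_nm: "abl a \<Longrightarrow> finite X \<Longrightarrow> (\<Sum>\<nu>\<in>X. norm (trm a \<nu>)) \<le> nm a"
  unfolding nm_def abl_def by (rule finite_sum_le_infsum) auto

text \<open>
  The partial products form a Cauchy sequence in the weighted \<open>l\<^sup>1\<close> norm, and every
  coefficient is eventually constant because the factors differ from one only at ever lower heights.
  Finitely many factors may have terms outside the negative cone.
\<close>

lemma inf_prod_good:
  assumes gF: "\<And>k. k \<ge> 1 \<Longrightarrow> good (F k)"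
    and tail: "\<And>k \<nu>. k > K0 \<Longrightarrow> F k \<nu> \<noteq> 0 \<Longrightarrow> - \<nu> \<in> Q"
    and c: "c > 0" and dec: "\<And>k \<nu>. k \<ge> 1 \<Longrightarrow> (F k - fexp 0) \<nu> \<noteq> 0 \<Longrightarrow> H \<nu> \<le> C - c * real k"
    and sm: "summable (\<lambda>k. nm (F (Suc k) - fexp 0))"
  shows "good (inf_prod g P F)" "(\<lambda>N. \<Prod>k=1..N. ev (F k)) \<longlonglongrightarrow> ev (inf_prod g P F)"
proof -
  interpret comm_monoid R by (rule R_comm_monoid)
  define p where "p N = finprod R F {1..N}" for N
  define G where "G k = F k - fexp 0" for k
  have gp: "good (p N)" "ev (p N) = (\<Prod>k=1..N. ev (F k))" for N
    using good_finprod[of "{1..N}" F] gF by (auto simp: p_def)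
  have gG: "good (G k)" if "k \<ge> 1" for k unfolding G_def using gF[OF that] good_one by (rule good_diff)
  have nv: "nov a" if "good a" for a using that carrier_nov by (simp add: good_def)
  have FG: "F k = fexp 0 + G k" for k unfolding G_def by simp
  have pS: "p (Suc N) = fmult (p N) (F (Suc N))" for N
  proof -
    have "p (Suc N) = finprod R F (insert (Suc N) {1..N})" unfolding p_def by (rule arg_cong[where f="finprod R F"]) auto
    also have "\<dots> = F (Suc N) \<otimes>\<^bsub>R\<^esub> finprod R F {1..N}"
      by (rule finprod_insert) (use gF in \<open>auto simp: good_def\<close>)
    finally show ?thesis by (simp add: R_simps fmult_comm p_def)
  qed
  define d where "d N = fmult (p N) (G (Suc N))" for N
  have gd: "good (d N)" "nm (d N) \<le> nm (p N) * nm (G (Suc N))" for N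
    unfolding d_def using good_fmult[OF gp(1) gG, of "Suc N"] by auto
  have pd: "p (Suc N) = p N + d N" for N
  proof -
    have "p (Suc N) = fmult (p N) (fexp 0 + G (Suc N))" unfolding pS using FG by simp
    also have "\<dots> = fmult (p N) (fexp 0) + d N" unfolding d_def
      by (rule fmult_add_right) (use nv[OF gp(1)] nv[OF good_one] nv[OF gG] in auto)
    also have "fmult (p N) (fexp 0) = p N" by (subst fmult_comm) (rule fmult_one)
    finally show ?thesis .
  qed
  obtain L where L: "finite L" "L \<subseteq> aff_weights g" "\<And>\<nu>. p K0 \<nu> \<noteq> 0 \<Longrightarrow> \<exists>l\<in>L. \<exists>\<gamma>\<in>Q. \<nu> = l - \<gamma>"
    using gp(1)[of K0] unfolding good_def carrier_iff by blast
  have inL: "\<exists>l\<in>L. \<exists>\<gamma>\<in>Q. \<nu> = l - \<gamma>" if "N \<ge> K0" "p N \<nu> \<noteq> 0" for N \<nu>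
    using that
  proof (induction N arbitrary: \<nu> rule: dec_induct)
    case base then show ?case using L(3) by blast
  next
    case (step N)
    obtain \<mu> where m: "p N \<mu> \<noteq> 0" "F (Suc N) (\<nu> - \<mu>) \<noteq> 0" using fmult_nonzero step.prems unfolding pS by blast
    obtain l \<gamma> where l: "l \<in> L" "\<gamma> \<in> Q" "\<mu> = l - \<gamma>" using step.IH[OF m(1)] by blast
    have "- (\<nu> - \<mu>) \<in> Q" by (rule tail[OF _ m(2)]) (use step.hyps in simp)
    from Q_add[OF l(2) this] have "\<gamma> + - (\<nu> - \<mu>) \<in> Q" .
    moreover have "\<nu> = l - (\<gamma> + - (\<nu> - \<mu>))" unfolding l(3) by simp
    ultimately show ?case using l(1) by blast
  qed
  define U where "U = (\<Sum>l\<in>L. \<bar>H l\<bar>)"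
  have HU: "H \<nu> \<le> U" if h: "N \<ge> K0" "p N \<nu> \<noteq> 0" for N \<nu>
  proof -
    obtain l \<gamma> where l: "l \<in> L" "\<gamma> \<in> Q" "\<nu> = l - \<gamma>" using inL[OF h] by blast
    have "H \<nu> \<le> H l" unfolding l(3) H_diff using Q_nonneg[OF l(2)] by simp
    also have "\<dots> \<le> \<bar>H l\<bar>" by simp
    also have "\<dots> \<le> U" unfolding U_def by (rule member_le_sum[OF l(1)]) (use L(1) in auto)
    finally show ?thesis .
  qed
  have dH: "H \<nu> \<le> U + C - c * real (Suc N)" if h: "N \<ge> K0" "d N \<nu> \<noteq> 0" for N \<nu>
  proof -
    obtain \<mu> where m: "p N \<mu> \<noteq> 0" "G (Suc N) (\<nu> - \<mu>) \<noteq> 0" using fmult_nonzero h(2) unfolding d_def by blast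
    have "H (\<nu> - \<mu>) \<le> C - c * real (Suc N)" by (rule dec[OF _ m(2)[unfolded G_def]]) simp
    then show ?thesis using HU[OF h(1) m(1)] unfolding H_diff by linarith
  qed
  have stable: "\<exists>NB\<ge>K0. \<forall>N\<ge>NB. \<forall>\<nu>. H \<nu> \<ge> B \<longrightarrow> p N \<nu> = p NB \<nu>" for B
  proof -
    define NB where "NB = max K0 (nat \<lceil>(U + C - B) / c\<rceil>)"
    have "p N \<nu> = p NB \<nu>" if "N \<ge> NB" "H \<nu> \<ge> B" for N \<nu>
      using that(1)
    proof (induction N rule: dec_induct)
      case (step N)
      have "real N \<ge> (U + C - B) / c" using step.hyps(1) unfolding NB_def by linarith
      then have "c * real N \<ge> U + C - B" using c by (simp add: field_simps)
      then have "U + C - c * real (Suc N) < B" using c by (simp add: algebra_simps)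
      moreover have "N \<ge> K0" using step.hyps(1) by (simp add: NB_def)
      ultimately have "d N \<nu> = 0" using dH[of N \<nu>] that(2) by force
      then show ?case using step.IH unfolding pd by simp
    qed simp
    moreover have "NB \<ge> K0" by (simp add: NB_def)
    ultimately show ?thesis by blast
  qed
  define pinf where "pinf = inf_prod g P F"
  have pinf: "pinf \<nu> = x" if "\<forall>\<^sub>F N in sequentially. p N \<nu> = x" for \<nu> x
    unfolding pinf_def Defs.inf_prod_def
  proof (rule the_equality)
    show "\<forall>\<^sub>F N in sequentially. finprod R F {1..N} \<nu> = x" using that unfolding p_def .
    fix y assume "\<forall>\<^sub>F N in sequentially. finprod R F {1..N} \<nu> = y"
    then have "\<forall>\<^sub>F N in sequentially. p N \<nu> = x \<and> p N \<nu> = y" using that unfolding p_def by (rule eventually_conj[rotated])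
    then have "\<forall>\<^sub>F N::nat in sequentially. x = y" by (rule eventually_mono) auto
    then show "y = x" by simp
  qed
  have pst: "\<exists>NB\<ge>K0. \<forall>N\<ge>NB. \<forall>\<nu>. H \<nu> \<ge> B \<longrightarrow> pinf \<nu> = p N \<nu>" for B
  proof -
    obtain NB where NB: "NB \<ge> K0" "\<And>N \<nu>. N \<ge> NB \<Longrightarrow> H \<nu> \<ge> B \<Longrightarrow> p N \<nu> = p NB \<nu>" using stable by blast
    have h: "pinf \<nu> = p NB \<nu>" if "H \<nu> \<ge> B" for \<nu>
    proof (rule pinf)
      show "\<forall>\<^sub>F N in sequentially. p N \<nu> = p NB \<nu>"
        unfolding eventually_sequentially using NB(2)[of _ \<nu>] that by blast
    qed
    have "\<forall>N\<ge>NB. \<forall>\<nu>. H \<nu> \<ge> B \<longrightarrow> pinf \<nu> = p N \<nu>"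
      using trans[OF h NB(2)[symmetric]] by blast
    then show ?thesis using NB(1) by blast
  qed
  have pfin: "\<exists>N1\<ge>M. \<forall>\<nu>\<in>X. pinf \<nu> = p N1 \<nu>" if fX: "finite X" for X M
  proof -
    define B where "B = - (\<Sum>\<nu>\<in>X. \<bar>H \<nu>\<bar>)"
    have B: "H \<nu> \<ge> B" if "\<nu> \<in> X" for \<nu>
    proof -
      have "\<bar>H \<nu>\<bar> \<le> (\<Sum>\<nu>\<in>X. \<bar>H \<nu>\<bar>)" using that fX by (intro member_le_sum) auto
      then show ?thesis unfolding B_def by linarith
    qed
    obtain NB where "\<forall>N\<ge>NB. \<forall>\<nu>. H \<nu> \<ge> B \<longrightarrow> pinf \<nu> = p N \<nu>" using pst by blast
    then have "\<forall>\<nu>\<in>X. pinf \<nu> = p (max M NB) \<nu>" using B by simp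
    then show ?thesis by (intro exI[of _ "max M NB"]) simp
  qed
  have pinf_supp: "(\<exists>l\<in>L. \<exists>\<gamma>\<in>Q. \<nu> = l - \<gamma>) \<and> \<nu> \<in> \<Lambda>" if "pinf \<nu> \<noteq> 0" for \<nu>
  proof -
    obtain N where "N \<ge> K0" "pinf \<nu> = p N \<nu>" using pfin[of "{\<nu>}" K0] by blast
    then show ?thesis using that inL[of N \<nu>] gp(1)[of N] by (auto simp: good_def)
  qed
  have pinf_car: "pinf \<in> carrier R" unfolding carrier_iff using L(1,2) pinf_supp by blast
  define a where "a k = nm (G (Suc k))" for k
  have a0: "a k \<ge> 0" for k unfolding a_def by (rule nm_nonneg)
  have sa: "summable a" using sm unfolding a_def G_def .
  define M where "M = exp (suminf a)"
  have nmp: "nm (p N) \<le> exp (\<Sum>k<N. a k)" for N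
  proof (induction N)
    case 0
    have "nm (p 0) \<le> (\<Prod>x\<in>{1..0}. nm (F x))" unfolding p_def by (rule good_finprod[THEN conjunct2, THEN conjunct2]) auto
    then show ?case by simp
  next
    case (Suc N)
    have f: "nm (F (Suc N)) \<le> exp (a N)"
    proof -
      have "nm (F (Suc N)) \<le> nm (fexp 0) + nm (G (Suc N))" unfolding FG
        using abl_add(3)[OF abl_fexp(1), of "G (Suc N)" 0] gG[of "Suc N"] by (simp add: good_def)
      also have "\<dots> = 1 + a N" by (simp add: abl_fexp chi_0 a_def)
      also have "\<dots> \<le> exp (a N)" by (rule exp_ge_add_one_self)
      finally show ?thesis .
    qed
    have "nm (p (Suc N)) \<le> nm (p N) * nm (F (Suc N))" unfolding pS using good_fmult(3)[OF gp(1) gF] by simp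
    also have "\<dots> \<le> exp (\<Sum>k<N. a k) * exp (a N)" using Suc f nm_nonneg by (intro mult_mono) auto
    finally show ?case by (simp add: exp_add)
  qed
  have nmpM: "nm (p N) \<le> M" for N
  proof -
    have "exp (\<Sum>k<N. a k) \<le> M" unfolding M_def using a0 sa by (simp add: sum_le_suminf)
    then show ?thesis using nmp[of N] by linarith
  qed
  define t where "t N = M * (\<Sum>k. a (k + N))" for N
  have Mpos: "M > 0" by (simp add: M_def)
  define rr where "rr i j = nm (p i - p j)" for i j
  have rr0: "rr N N = 0" for N
  proof -
    have "trm (p N - p N) \<nu> = 0" for \<nu> unfolding trm_diff by simp
    then show ?thesis unfolding rr_def nm_def by simp
  qed
  have rrS: "rr (Suc i) j \<le> rr i j + M * a i" for i j
  proof -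
    have e: "p (Suc i) - p j = (p i - p j) + d i" unfolding pd by (rule ext) simp
    have "nm ((p i - p j) + d i) \<le> nm (p i - p j) + nm (d i)"
      using good_diff[OF gp(1)[of i] gp(1)[of j]] gd(1)[of i] by (intro abl_add(3)) (simp_all only: good_def)
    moreover have "nm (p i) * nm (G (Suc i)) \<le> M * a i" unfolding a_def using nmpM nm_nonneg by (intro mult_right_mono) auto
    ultimately show ?thesis unfolding rr_def e using gd(2)[of i] by linarith
  qed
  have diff: "rr N' N \<le> M * (\<Sum>k=N..<N'. a k)" if "N' \<ge> N" for N N'
    using that
  proof (induction N' rule: dec_induct)
    case base show ?case using rr0 by simp
  next
    case (step i)
    then show ?case using rrS[of i N] by (simp add: algebra_simps)
  qed
  have diff': "nm (p N' - p N) \<le> t N" if "N' \<ge> N" for N N'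
  proof -
    have "(\<Sum>k=N..<N'. a k) = (\<Sum>k<N'-N. a (k + N))"
      by (rule sum.reindex_bij_witness[of _ "\<lambda>k. k + N" "\<lambda>k. k - N"]) auto
    also have "\<dots> \<le> (\<Sum>k. a (k + N))"
      using sa a0 by (intro sum_le_suminf) (auto simp: summable_iff_shift)
    finally have "M * (\<Sum>k=N..<N'. a k) \<le> t N" unfolding t_def using Mpos by (intro mult_left_mono) auto
    then show ?thesis using diff[OF that] unfolding rr_def by linarith
  qed
  have fs: "(\<Sum>\<nu>\<in>X. norm (trm (pinf - p N) \<nu>)) \<le> t N" if fX: "finite X" for X N
  proof -
    obtain N' where N': "N' \<ge> N" "\<forall>\<nu>\<in>X. pinf \<nu> = p N' \<nu>" using pfin[OF fX] by blast
    have "(\<Sum>\<nu>\<in>X. norm (trm (pinf - p N) \<nu>)) = (\<Sum>\<nu>\<in>X. norm (trm (p N' - p N) \<nu>))"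
      by (rule sum.cong) (use N'(2) in \<open>auto simp: trm_def\<close>)
    also have "\<dots> \<le> nm (p N' - p N)"
      using good_diff[OF gp(1) gp(1)] fX by (intro partial_nm) (auto simp: good_def)
    also have "\<dots> \<le> t N" by (rule diff'[OF N'(1)])
    finally show ?thesis .
  qed
  have ar: "abl (pinf - p N)" for N
    unfolding abl_def by (rule nonneg_bdd_above_summable_on) (use fs in \<open>auto simp: bdd_above_def\<close>)
  have nr: "nm (pinf - p N) \<le> t N" for N
    unfolding nm_def by (rule infsum_le_finite_sums) (use ar[of N] fs in \<open>auto simp: abl_def\<close>)
  have pe: "pinf = p N + (pinf - p N)" for N by simp
  have ap: "abl pinf" by (subst pe[of 0]) (intro abl_add(1) ar, use gp(1)[of 0] in \<open>simp add: good_def\<close>)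
  show "good (inf_prod g P F)" using ap pinf_car pinf_supp unfolding good_def pinf_def[symmetric] by blast
  have evp: "ev pinf = ev (p N) + ev (pinf - p N)" for N
    by (subst pe[of N]) (rule abl_add(2), use gp(1)[of N] ar[of N] in \<open>simp_all add: good_def\<close>)
  have t0: "t \<longlonglongrightarrow> 0"
  proof -
    have "(\<lambda>N. \<Sum>k. a (k + N)) \<longlonglongrightarrow> 0" using suminf_exist_split2[OF sa] .
    then show ?thesis unfolding t_def using tendsto_mult_right_zero by blast
  qed
  have "(\<lambda>N. ev (p N)) \<longlonglongrightarrow> ev pinf"
  proof (rule LIM_zero_cancel, rule Lim_null_comparison[OF always_eventually t0], rule allI)
    fix N
    have "norm (ev (p N) - ev pinf) = norm (ev (pinf - p N))" using evp[of N] by (simp add: norm_minus_commute)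
    also have "\<dots> \<le> t N" using norm_ev_le[OF ar] nr[of N] by (meson order_trans)
    finally show "norm (ev (p N) - ev pinf) \<le> t N" .
  qed
  then show "(\<lambda>N. \<Prod>k=1..N. ev (F k)) \<longlonglongrightarrow> ev (inf_prod g P F)" unfolding gp(2) pinf_def .
qed

text \<open>
  Absolute summability over pairs of a translation and a weight permits the exchange of the two sums.
\<close>

lemma coeff_sum_ev:
  assumes g: "\<And>w. w \<in> T \<Longrightarrow> good (t w)" and cf: "coeff_finite T t" and sm: "(\<lambda>w. nm (t w)) summable_on T"
  shows "abl (coeff_sum T t)" "\<And>\<nu>. coeff_sum T t \<nu> \<noteq> 0 \<Longrightarrow> \<nu> \<in> \<Lambda>"
    "ev (coeff_sum T t) = (\<Sum>\<^sub>\<infinity>w\<in>T. ev (t w))"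
proof -
  have S: "(\<lambda>p. norm (trm (t (fst p)) (snd p))) summable_on T \<times> UNIV"
    by (rule Infinite_Sum.abs_summable_on_Sigma_iff[THEN iffD2])
       (use g sm nm_nonneg in \<open>auto simp: good_def abl_def nm_def[symmetric]\<close>)
  have bij: "bij_betw prod.swap (UNIV \<times> T) (T \<times> UNIV)" by (rule bij_betw_byWitness[where f'=prod.swap]) auto
  have S': "(\<lambda>p. norm (trm (t (snd p)) (fst p))) summable_on UNIV \<times> T"
    using summable_on_reindex_bij_betw[OF bij, of "\<lambda>p. norm (trm (t (fst p)) (snd p))"] S by simp
  have e: "trm (coeff_sum T t) \<nu> = (\<Sum>\<^sub>\<infinity>w\<in>T. trm (t w) \<nu>)" for \<nu>
  proof -
    have f: "finite {w \<in> T. t w \<nu> \<noteq> 0}" using cf by (simp add: coeff_finite_def)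
    have "(\<Sum>\<^sub>\<infinity>w\<in>T. trm (t w) \<nu>) = (\<Sum>\<^sub>\<infinity>w\<in>{w \<in> T. t w \<nu> \<noteq> 0}. trm (t w) \<nu>)"
      by (rule infsum_cong_neutral) (auto simp: trm_def)
    also have "\<dots> = (\<Sum>w\<in>{w \<in> T. t w \<nu> \<noteq> 0}. trm (t w) \<nu>)" by (rule infsum_finite[OF f])
    finally show ?thesis unfolding coeff_sum_def trm_def by (simp add: of_rat_sum sum_distrib_right)
  qed
  note A = Infinite_Sum.abs_summable_on_Sigma_iff[THEN iffD1, OF S']
  have A1: "(\<lambda>\<nu>. \<Sum>\<^sub>\<infinity>w\<in>T. norm (trm (t w) \<nu>)) summable_on UNIV" using A by (simp add: infsum_nonneg)
  show "abl (coeff_sum T t)" unfolding abl_def e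
    by (rule summable_on_comparison_test[OF A1]) (use A in \<open>auto intro!: norm_infsum_bound\<close>)
  have "ev (coeff_sum T t) = (\<Sum>\<^sub>\<infinity>\<nu>. \<Sum>\<^sub>\<infinity>w\<in>T. trm (t w) \<nu>)" unfolding ev_def e ..
  also have "\<dots> = (\<Sum>\<^sub>\<infinity>p\<in>UNIV\<times>T. trm (t (snd p)) (fst p))"
    using infsum_Sigma_banach[OF abs_summable_summable[OF S']] by simp
  also have "\<dots> = (\<Sum>\<^sub>\<infinity>p\<in>T\<times>UNIV. trm (t (fst p)) (snd p))"
    using infsum_reindex_bij_betw[OF bij, of "\<lambda>p. trm (t (fst p)) (snd p)"] by simp
  also have "\<dots> = (\<Sum>\<^sub>\<infinity>w\<in>T. ev (t w))"
    using infsum_Sigma_banach[OF abs_summable_summable[OF S]] by (simp add: ev_def)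
  finally show "ev (coeff_sum T t) = (\<Sum>\<^sub>\<infinity>w\<in>T. ev (t w))" .
  show "\<nu> \<in> \<Lambda>" if "coeff_sum T t \<nu> \<noteq> 0" for \<nu>
  proof -
    have "\<exists>w. w \<in> T \<and> t w \<nu> \<noteq> 0"
    proof (rule ccontr)
      assume "\<not> ?thesis"
      then have "{w. w \<in> T \<and> t w \<nu> \<noteq> 0} = {}" by blast
      then show False using that unfolding coeff_sum_def by (simp only: sum.empty)
    qed
    then show ?thesis using g by (auto simp: good_def)
  qed
qed

end

context height
begin

definition chr :: "real \<Rightarrow> weight \<Rightarrow> complex" where
  "chr s \<nu> = of_real (exp (s * H \<nu>))"

text \<open>
  If \<open>b\<close> is not zero, it has a term of greatest height, unique by injectivity. For large
  \<open>s\<close> this term dominates all the others together.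
\<close>

lemma ev_injective:
  assumes nov: "nov b" and inj: "inj_on H {\<nu>. b \<nu> \<noteq> 0}"
    and sm: "\<And>s. s \<ge> 1 \<Longrightarrow> (\<lambda>\<nu>. norm (of_rat (b \<nu>) * chr s \<nu>)) summable_on UNIV"
    and zero: "\<And>s. s \<ge> 1 \<Longrightarrow> (\<Sum>\<^sub>\<infinity>\<nu>. of_rat (b \<nu>) * chr s \<nu>) = 0"
  shows "b \<nu> = 0"
proof (rule ccontr)
  assume b1: "b \<nu> \<noteq> 0"
  let ?S = "{\<nu>. b \<nu> \<noteq> 0}"
  have f: "finite {\<nu>. b \<nu> \<noteq> 0 \<and> B \<le> H \<nu>}" for B using nov by (simp add: nov_def)
  obtain \<nu>0 where n0: "b \<nu>0 \<noteq> 0" "H \<nu> \<le> H \<nu>0" "\<And>\<mu>. b \<mu> \<noteq> 0 \<Longrightarrow> H \<nu> \<le> H \<mu> \<Longrightarrow> H \<mu> \<le> H \<nu>0"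
  proof -
    let ?M = "Max (H ` {\<mu>. b \<mu> \<noteq> 0 \<and> H \<nu> \<le> H \<mu>})"
    have "?M \<in> H ` {\<mu>. b \<mu> \<noteq> 0 \<and> H \<nu> \<le> H \<mu>}" using f b1 by (intro Max_in) auto
    then obtain \<nu>0 where "\<nu>0 \<in> {\<mu>. b \<mu> \<noteq> 0 \<and> H \<nu> \<le> H \<mu>}" "H \<nu>0 = ?M" by auto
    moreover have "H \<mu> \<le> ?M" if "b \<mu> \<noteq> 0" "H \<nu> \<le> H \<mu>" for \<mu> using f that by (intro Max_ge) auto
    ultimately show thesis using that[of \<nu>0] by auto
  qed
  have lt: "H \<mu> < H \<nu>0" if "b \<mu> \<noteq> 0" "\<mu> \<noteq> \<nu>0" for \<mu>
  proof -
    have "H \<mu> \<le> H \<nu>0" using n0(2) n0(3)[OF that(1)] by linarith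
    moreover have "H \<mu> \<noteq> H \<nu>0" using inj that n0(1) by (auto simp: inj_on_def)
    ultimately show ?thesis by simp
  qed
  define d where "d = Min (insert 1 ((\<lambda>\<mu>. H \<nu>0 - H \<mu>) ` ({\<mu>. b \<mu> \<noteq> 0 \<and> H \<nu>0 - 1 \<le> H \<mu>} - {\<nu>0})))"
  have fd: "finite (insert 1 ((\<lambda>\<mu>. H \<nu>0 - H \<mu>) ` ({\<mu>. b \<mu> \<noteq> 0 \<and> H \<nu>0 - 1 \<le> H \<mu>} - {\<nu>0})))" using f by simp
  have d0: "d > 0" unfolding d_def using fd lt by (subst Min_gr_iff) auto
  have d1: "d \<le> 1" unfolding d_def using fd by (intro Min_le) auto
  have gap: "H \<mu> - H \<nu>0 \<le> - d" if "b \<mu> \<noteq> 0" "\<mu> \<noteq> \<nu>0" for \<mu>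
  proof (cases "H \<nu>0 - 1 \<le> H \<mu>")
    case True
    then have "d \<le> H \<nu>0 - H \<mu>" unfolding d_def using fd that by (intro Min_le) auto
    then show ?thesis by simp
  qed (use d1 in linarith)
  define K where "K = (\<Sum>\<^sub>\<infinity>\<mu>. norm (of_rat (b \<mu>) * chr 1 \<mu>)) * exp (- H \<nu>0)"
  have main: "norm (of_rat (b \<nu>0) :: complex) \<le> K * exp (- ((s - 1) * d))" if s: "s \<ge> 1" for s
  proof -
    let ?f = "\<lambda>\<mu>. of_rat (b \<mu>) * chr s \<mu>"
    have sf: "?f summable_on A" for A using summable_on_subset_banach[OF abs_summable_summable[OF sm[OF s]]] by simp
    have sf': "(\<lambda>\<mu>. norm (?f \<mu>)) summable_on A" for A using summable_on_subset_banach[OF sm[OF s]] by simp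
    have "0 = (\<Sum>\<^sub>\<infinity>\<mu>\<in>insert \<nu>0 (UNIV - {\<nu>0}). ?f \<mu>)" using zero[OF s] by (simp add: insert_UNIV)
    also have "\<dots> = ?f \<nu>0 + (\<Sum>\<^sub>\<infinity>\<mu>\<in>UNIV - {\<nu>0}. ?f \<mu>)" by (rule infsum_insert[OF sf]) simp
    finally have "norm (?f \<nu>0) = norm (\<Sum>\<^sub>\<infinity>\<mu>\<in>UNIV - {\<nu>0}. ?f \<mu>)"
      by (metis add_eq_0_iff norm_minus_cancel)
    also have "\<dots> \<le> (\<Sum>\<^sub>\<infinity>\<mu>\<in>UNIV - {\<nu>0}. norm (?f \<mu>))" by (rule norm_infsum_bound[OF sf'])
    also have "\<dots> \<le> (\<Sum>\<^sub>\<infinity>\<mu>\<in>UNIV - {\<nu>0}. norm (of_rat (b \<mu>) * chr 1 \<mu>) * exp ((s - 1) * (H \<nu>0 - d)))"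
    proof (rule infsum_mono[OF sf'])
      show "(\<lambda>\<mu>. norm (of_rat (b \<mu>) * chr 1 \<mu>) * exp ((s - 1) * (H \<nu>0 - d))) summable_on UNIV - {\<nu>0}"
        using summable_on_subset_banach[OF sm[of 1]] by (intro summable_on_cmult_left) auto
      fix \<mu> assume m: "\<mu> \<in> UNIV - {\<nu>0}"
      show "norm (?f \<mu>) \<le> norm (of_rat (b \<mu>) * chr 1 \<mu>) * exp ((s - 1) * (H \<nu>0 - d))"
      proof (cases "b \<mu> = 0")
        case False
        have "(s - 1) * H \<mu> \<le> (s - 1) * (H \<nu>0 - d)" using gap[OF False] m s by (intro mult_left_mono) auto
        then have "exp (s * H \<mu>) \<le> exp (H \<mu>) * exp ((s - 1) * (H \<nu>0 - d))"
          by (simp add: exp_add[symmetric] algebra_simps)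
        then have "norm (of_rat (b \<mu>) :: complex) * exp (s * H \<mu>) \<le> norm (of_rat (b \<mu>) :: complex) * (exp (H \<mu>) * exp ((s - 1) * (H \<nu>0 - d)))"
          by (rule mult_left_mono) simp
        then show ?thesis by (simp add: norm_mult chr_def mult.assoc)
      qed simp
    qed
    also have "\<dots> = (\<Sum>\<^sub>\<infinity>\<mu>\<in>UNIV - {\<nu>0}. norm (of_rat (b \<mu>) * chr 1 \<mu>)) * exp ((s - 1) * (H \<nu>0 - d))"
      by (rule infsum_cmult_left')
    also have "\<dots> \<le> (\<Sum>\<^sub>\<infinity>\<mu>. norm (of_rat (b \<mu>) * chr 1 \<mu>)) * exp ((s - 1) * (H \<nu>0 - d))"
      using sm[of 1] summable_on_subset_banach[OF sm[of 1]] by (intro mult_right_mono infsum_mono2) auto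
    finally have "norm (of_rat (b \<nu>0) :: complex) * exp (s * H \<nu>0) \<le> (\<Sum>\<^sub>\<infinity>\<mu>. norm (of_rat (b \<mu>) * chr 1 \<mu>)) * exp ((s - 1) * (H \<nu>0 - d))"
      by (simp add: norm_mult chr_def)
    then have "norm (of_rat (b \<nu>0) :: complex) * exp (s * H \<nu>0) * exp (- (s * H \<nu>0)) \<le> (\<Sum>\<^sub>\<infinity>\<mu>. norm (of_rat (b \<mu>) * chr 1 \<mu>)) * exp ((s - 1) * (H \<nu>0 - d)) * exp (- (s * H \<nu>0))"
      by (rule mult_right_mono) simp
    also have "\<dots> = K * exp (- ((s - 1) * d))" unfolding K_def mult.assoc exp_add[symmetric] by (simp add: algebra_simps)
    also have "norm (of_rat (b \<nu>0) :: complex) * exp (s * H \<nu>0) * exp (- (s * H \<nu>0)) = norm (of_rat (b \<nu>0) :: complex)"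
      by (simp add: mult.assoc exp_add[symmetric])
    finally show ?thesis .
  qed
  have "(\<lambda>n. K * exp (- (real n * d))) \<longlonglongrightarrow> 0" using d0 by real_asymp
  moreover have "norm (of_rat (b \<nu>0) :: complex) \<le> K * exp (- (real n * d))" for n
    using main[of "1 + real n"] by simp
  ultimately have "norm (of_rat (b \<nu>0) :: complex) \<le> 0" by (intro LIMSEQ_le_const) auto
  then show False using n0(1) by simp
qed

end

section \<open>Roots and half-systems\<close>

text \<open>
  The coordinates are perturbed one at a time; each time only countably many values have to be
  avoided.
\<close>

lemma generic_perturbation:
  fixes h0 :: "'a \<Rightarrow> real"
  assumes "finite C" "e > 0"
  shows "\<exists>h. (\<forall>c\<in>C. \<bar>h c - h0 c\<bar> < e) \<and>
     (\<forall>k :: 'a \<Rightarrow> int. (\<Sum>c\<in>C. of_int (k c) * h c) = 0 \<longrightarrow> (\<forall>c\<in>C. k c = 0))"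
  using assms(1)
proof (induction C rule: finite_induct)
  case empty show ?case by simp
next
  case (insert a C)
  obtain h where h: "\<forall>c\<in>C. \<bar>h c - h0 c\<bar> < e"
    "\<forall>k :: 'a \<Rightarrow> int. (\<Sum>c\<in>C. of_int (k c) * h c) = 0 \<longrightarrow> (\<forall>c\<in>C. k c = 0)"
    using insert.IH by (elim exE conjE) (rule that)
  define B where "B = (\<lambda>(k :: 'a \<Rightarrow> int, l :: int). - (\<Sum>c\<in>C. of_int (k c) * h c) / of_int l) ` (PiE C (\<lambda>_. UNIV) \<times> UNIV)"
  have "countable B" unfolding B_def using insert by (intro countable_image countable_SIGMA countable_PiE) auto
  moreover have "uncountable {h0 a - e<..<h0 a + e}" using assms(2) by (simp add: uncountable_open_interval)
  ultimately have "\<not> {h0 a - e<..<h0 a + e} \<subseteq> B" using countable_subset by blast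
  then obtain x where x: "x \<in> {h0 a - e<..<h0 a + e}" "x \<notin> B" by blast
  have sm: "(\<Sum>c\<in>C. of_int (k c) * (h(a := x)) c) = (\<Sum>c\<in>C. of_int (k c) * h c)" for k
    using insert by (intro sum.cong) auto
  show ?case
  proof (intro exI[of _ "h(a := x)"] conjI allI impI)
    show "\<forall>c\<in>insert a C. \<bar>(h(a := x)) c - h0 c\<bar> < e" using h(1) x(1) by (auto simp: abs_less_iff)
    fix k :: "'a \<Rightarrow> int" assume k: "(\<Sum>c\<in>insert a C. of_int (k c) * (h(a := x)) c) = 0"
    then have eq: "of_int (k a) * x + (\<Sum>c\<in>C. of_int (k c) * h c) = 0" using insert sm by simp
    have ka: "k a = 0"
    proof (rule ccontr)
      assume "k a \<noteq> 0"
      then have "x = - (\<Sum>c\<in>C. of_int (k c) * h c) / of_int (k a)" using eq by (simp add: field_simps)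
      also have "\<dots> = (\<lambda>(k :: 'a \<Rightarrow> int, l :: int). - (\<Sum>c\<in>C. of_int (k c) * h c) / of_int l) (restrict k C, k a)" by simp
      finally have "x \<in> B" unfolding B_def by (rule image_eqI) auto
      then show False using x(2) by simp
    qed
    then show "\<forall>c\<in>insert a C. k c = 0" using spec[OF h(2), of k] eq by simp
  qed
qed

text \<open>
  Up to sign, a root is a triple of two coordinates and a relative sign; twice a coordinate arises
  from equal coordinates.
\<close>

definition rt :: "coord \<times> coord \<times> real \<Rightarrow> weight" where
  "rt t = unit_weight (fst t) + scl (of_real (snd (snd t))) (unit_weight (fst (snd t)))"

fun coord_index :: "coord \<Rightarrow> nat" where
  "coord_index (CEps i) = 2 * i"
| "coord_index (CDlt i) = 2 * i + 1"
| "coord_index CImag = 0"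
| "coord_index CLevel = 0"

fun before :: "coord \<Rightarrow> coord \<Rightarrow> bool" where
  "before (CEps i) (CEps j) = (i \<le> j)"
| "before (CEps i) (CDlt j) = True"
| "before (CDlt i) (CDlt j) = (i \<le> j)"
| "before _ _ = False"

definition valid :: "coord \<times> coord \<times> real \<Rightarrow> bool" where
  "valid t \<longleftrightarrow> before (fst t) (fst (snd t)) \<and> snd (snd t) \<in> {1, -1} \<and> (fst t = fst (snd t) \<longrightarrow> snd (snd t) = 1)"

lemma before_antisym: "before c d \<Longrightarrow> before d c \<Longrightarrow> c = d"
  by (cases c; cases d) auto

lemma rt_apply: "rt (c, d, b) i = (if i = c then 1 else 0) + (if i = d then of_real b else 0)"
  by (simp add: rt_def scl_def unit_weight_def)

lemma rt_support: "valid (c, d, b) \<Longrightarrow> rt (c, d, b) i \<noteq> 0 \<longleftrightarrow> i = c \<or> i = d"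
  by (auto simp: rt_apply valid_def)

text \<open>
  A root determines its two coordinates by its support and its sign by the first of them.
\<close>

lemma rt_eqD:
  assumes v: "valid t" "valid t'" and e: "rt t = rt t' \<or> rt t = - rt t'"
  shows "t = t' \<and> rt t \<noteq> - rt t'"
proof -
  obtain c d b c' d' b' where t: "t = (c, d, b)" "t' = (c', d', b')" by (cases t; cases t') auto
  have ne: "rt t i \<noteq> 0 \<longleftrightarrow> rt t' i \<noteq> 0" for i using e by auto
  have s: "{c, d} = {c', d'}" using ne rt_support v unfolding t by blast
  have cd: "before c d" "before c' d'" using v by (auto simp: valid_def t)
  have "c = c' \<and> d = d'"
  proof (cases "c = c'")
    case True then show ?thesis using s by (auto simp: doubleton_eq_iff)
  next
    case False then have "c = d'" "d = c'" using s by (auto simp: doubleton_eq_iff)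
    then show ?thesis using cd before_antisym[of c d] by simp
  qed
  then have cd': "c' = c" "d' = d" by auto
  have n: "rt t \<noteq> - rt t'"
  proof
    assume "rt t = - rt t'"
    then have "rt t c = - rt t' c" by simp
    then show False using v unfolding t cd' by (auto simp: rt_apply valid_def split: if_splits)
  qed
  then have "rt t d = rt t' d" using e by auto
  then have "b = b'" unfolding t cd' by (simp add: rt_apply)
  then show ?thesis using n t cd' by simp
qed

fun even_half :: "superalgebra \<Rightarrow> (coord \<times> coord \<times> real) set" where
  "even_half (GL n) = (\<lambda>(k, i). (CEps (Suc i), CEps (Suc k), -1)) ` (SIGMA k:{..<n}. {..<k})
     \<union> (\<lambda>(k, i). (CDlt (Suc i), CDlt (Suc k), -1)) ` (SIGMA k:{..<n}. {..<k})"
| "even_half (OSP n) = ((\<lambda>(k, i). (CEps (Suc i), CEps (Suc k), 1)) ` (SIGMA k:{..<Suc n}. {..<k})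
     \<union> (\<lambda>(k, i). (CEps (Suc i), CEps (Suc k), -1)) ` (SIGMA k:{..<Suc n}. {..<k}))
     \<union> (((\<lambda>(k, i). (CDlt (Suc i), CDlt (Suc k), 1)) ` (SIGMA k:{..<n}. {..<k})
     \<union> (\<lambda>(k, i). (CDlt (Suc i), CDlt (Suc k), -1)) ` (SIGMA k:{..<n}. {..<k}))
     \<union> (\<lambda>i. (CDlt (Suc i), CDlt (Suc i), 1)) ` {..<n})"
| "even_half (D21 a) = {}"

fun odd_half :: "superalgebra \<Rightarrow> (coord \<times> coord \<times> real) set" where
  "odd_half (GL n) = (\<lambda>(i, j). (CEps (Suc i), CDlt (Suc j), -1)) ` ({..<n} \<times> {..<n})"
| "odd_half (OSP n) = (\<lambda>(i, j). (CEps (Suc i), CDlt (Suc j), 1)) ` ({..<Suc n} \<times> {..<n})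
     \<union> (\<lambda>(i, j). (CEps (Suc i), CDlt (Suc j), -1)) ` ({..<Suc n} \<times> {..<n})"
| "odd_half (D21 a) = {}"

definition classical :: "superalgebra \<Rightarrow> bool" where
  "classical g \<longleftrightarrow> (\<exists>n. g = GL n \<or> g = OSP n)"

lemma even_half_valid: "t \<in> even_half g \<Longrightarrow> valid t"
  and odd_half_valid: "t \<in> odd_half g \<Longrightarrow> valid t"
  by (cases g; auto simp: valid_def)+

lemma half_finite [simp]: "finite (even_half g)" "finite (odd_half g)"
  by (cases g; simp)+

lemma half_coords:
  "(c, d, b) \<in> even_half g \<union> odd_half g \<Longrightarrow>
     c \<in> CEps ` {1..eps_dim g} \<union> CDlt ` {1..dlt_dim g} \<and> d \<in> CEps ` {1..eps_dim g} \<union> CDlt ` {1..dlt_dim g}"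
  by (cases g) auto

lemma pm_rt:
  "unit_weight c + unit_weight d = rt (c, d, 1)" "unit_weight c - unit_weight d = rt (c, d, -1)"
  by (rule ext, simp add: rt_apply unit_weight_def)+

lemma uminus_rt_minus: "rt (d, c, -1) = - rt (c, d, -1)"
  by (rule ext) (simp add: rt_apply)

lemma ex_Suc_iff: "(\<exists>i. i \<in> {1..n} \<and> A i) \<longleftrightarrow> (\<exists>i<n. A (Suc i))"
proof -
  have "{1..n} = Suc ` {..<n}" by (simp add: image_Suc_lessThan)
  then show ?thesis by auto
qed

lemma uminus_image_iff: "x \<in> uminus ` A \<longleftrightarrow> - x \<in> A" for x :: weight
proof
  assume "- x \<in> A" then show "x \<in> uminus ` A" by (intro image_eqI[of _ _ "- x"]) simp_all
qed auto

lemma rt_image_iff: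
  "x \<in> rt ` (\<lambda>(k, i). f k i) ` (SIGMA k:{..<n}. {..<k}) \<longleftrightarrow> (\<exists>k<n. \<exists>i<k. x = rt (f k i))"
  "x \<in> rt ` (\<lambda>(i, j). f i j) ` ({..<m} \<times> {..<n}) \<longleftrightarrow> (\<exists>i<m. \<exists>j<n. x = rt (f i j))"
  "x \<in> rt ` f' ` {..<n} \<longleftrightarrow> (\<exists>i<n. x = rt (f' i))"
  unfolding image_image by (auto simp: image_iff)

lemma uminus_eq_iff: "- x = v \<longleftrightarrow> x = - v" for x v :: weight by auto

lemma ex_distinct_iff: "(\<exists>i<n. \<exists>j<n. i \<noteq> j \<and> A i j) \<longleftrightarrow> (\<exists>k<n. \<exists>i<k. A i k \<or> A k i)" for n :: nat
proof
  assume "\<exists>i<n. \<exists>j<n. i \<noteq> j \<and> A i j"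
  then obtain i j where "i < n" "j < n" "i < j \<or> j < i" "A i j" by (auto simp: neq_iff)
  then show "\<exists>k<n. \<exists>i<k. A i k \<or> A k i" by blast
next
  assume "\<exists>k<n. \<exists>i<k. A i k \<or> A k i"
  then obtain k i where "k < n" "i < k" "A i k \<or> A k i" by blast
  moreover from this have "i < n" "i \<noteq> k" "k \<noteq> i" by auto
  ultimately show "\<exists>i<n. \<exists>j<n. i \<noteq> j \<and> A i j" by blast
qed

lemma scl_pm: "scl 1 v = (v :: weight)" "scl (- 1) v = (- v :: weight)" by (rule ext, simp add: scl_def)+

lemma signed_pair:
  "(\<exists>s\<in>{1, -1::complex}. \<exists>t\<in>{1, -1::complex}. x = scl s (unit_weight c) + scl t (unit_weight d)) \<longleftrightarrow>
   x = rt (c, d, 1) \<or> x = rt (c, d, -1) \<or> - x = rt (c, d, 1) \<or> - x = rt (c, d, -1)"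
proof -
  have "- x = v \<longleftrightarrow> x = - v" for v by auto
  moreover have "rt (c, d, 1) = scl 1 (unit_weight c) + scl 1 (unit_weight d)" "rt (c, d, -1) = scl 1 (unit_weight c) + scl (-1) (unit_weight d)"
    "- rt (c, d, 1) = scl (-1) (unit_weight c) + scl (-1) (unit_weight d)" "- rt (c, d, -1) = scl (-1) (unit_weight c) + scl 1 (unit_weight d)"
    unfolding pm_rt[symmetric] scl_pm by simp_all
  ultimately show ?thesis by auto
qed

lemma signed_pair_union:
  fixes U :: "nat \<Rightarrow> coord"
  shows "{scl s (unit_weight (U i)) + scl t (unit_weight (U j)) | (s::complex) t i j.
        s \<in> {1, -1} \<and> t \<in> {1, -1} \<and> i \<in> {1..n} \<and> j \<in> {1..n} \<and> i < j}
   = (let S = rt ` ((\<lambda>(k, i). (U (Suc i), U (Suc k), 1)) ` (SIGMA k:{..<n}. {..<k})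
     \<union> (\<lambda>(k, i). (U (Suc i), U (Suc k), -1)) ` (SIGMA k:{..<n}. {..<k})) in S \<union> uminus ` S)" (is "?L = ?R")
proof (rule Set.set_eqI)
  fix x
  have "x \<in> ?L \<longleftrightarrow> (\<exists>k<n. \<exists>i<k. \<exists>s\<in>{1, -1::complex}. \<exists>t\<in>{1, -1::complex}. x = scl s (unit_weight (U (Suc i))) + scl t (unit_weight (U (Suc k))))"
  proof
    assume "x \<in> ?L"
    then obtain s t i j where h: "x = scl s (unit_weight (U i)) + scl t (unit_weight (U j))" "s \<in> {1, -1::complex}" "t \<in> {1, -1::complex}"
       "i \<in> {1..n}" "j \<in> {1..n}" "i < j" by blast
    obtain i' j' where ij: "i = Suc i'" "j = Suc j'" using h(4,5) by (cases i; cases j) auto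
    have "i' < j'" "j' < n" using h ij by auto
    then show "\<exists>k<n. \<exists>i<k. \<exists>s\<in>{1, -1::complex}. \<exists>t\<in>{1, -1::complex}. x = scl s (unit_weight (U (Suc i))) + scl t (unit_weight (U (Suc k)))"
      using h(1-3) unfolding ij by blast
  next
    assume "\<exists>k<n. \<exists>i<k. \<exists>s\<in>{1, -1::complex}. \<exists>t\<in>{1, -1::complex}. x = scl s (unit_weight (U (Suc i))) + scl t (unit_weight (U (Suc k)))"
    then obtain k i s t where "k < n" "i < k" "s \<in> {1, -1::complex}" "t \<in> {1, -1::complex}" "x = scl s (unit_weight (U (Suc i))) + scl t (unit_weight (U (Suc k)))" by blast
    moreover from this have "Suc i \<in> {1..n}" "Suc k \<in> {1..n}" "Suc i < Suc k" by auto
    ultimately show "x \<in> ?L" by blast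
  qed
  also have "\<dots> \<longleftrightarrow> (\<exists>k<n. \<exists>i<k. x = rt (U (Suc i), U (Suc k), 1) \<or> x = rt (U (Suc i), U (Suc k), -1) \<or> - x = rt (U (Suc i), U (Suc k), 1) \<or> - x = rt (U (Suc i), U (Suc k), -1))"
    unfolding signed_pair ..
  also have "\<dots> \<longleftrightarrow> x \<in> ?R" unfolding Let_def Un_iff uminus_image_iff image_Un rt_image_iff by blast
  finally show "x \<in> ?L \<longleftrightarrow> x \<in> ?R" .
qed

lemma sum_pm_iff: "s \<in> {1, -1} \<Longrightarrow> x = scl s (v :: weight) \<Longrightarrow> x = v \<or> - x = v"
  by (auto simp: scl_pm)

lemma even_roots_half: "classical g \<Longrightarrow> even_roots g = rt ` even_half g \<union> uminus ` rt ` even_half g"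
proof -
  have osp: "even_roots (OSP n) = rt ` even_half (OSP n) \<union> uminus ` rt ` even_half (OSP n)" for n
  proof -
    have D: "{scl s (scl 2 (dlt i)) | (s::complex) i. s \<in> {1, -1} \<and> i \<in> {1..n}} = rt ` (\<lambda>i. (CDlt (Suc i), CDlt (Suc i), 1)) ` {..<n} \<union> uminus ` rt ` (\<lambda>i. (CDlt (Suc i), CDlt (Suc i), 1)) ` {..<n}" (is "?A = ?B")
    proof (rule Set.set_eqI)
      fix x
      have two: "scl 2 (dlt i) = rt (CDlt i, CDlt i, 1)" for i by (rule ext) (simp add: rt_apply scl_def unit_weight_def)
      have "x \<in> ?A \<longleftrightarrow> (\<exists>i\<in>{1..n}. \<exists>s\<in>{1, -1::complex}. x = scl s (rt (CDlt i, CDlt i, 1)))"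
        unfolding two by blast
      also have "\<dots> \<longleftrightarrow> (\<exists>i\<in>{1..n}. x = rt (CDlt i, CDlt i, 1) \<or> - x = rt (CDlt i, CDlt i, 1))"
        by (simp add: scl_pm minus_equation_iff[of x] eq_commute[of _ x])
      also have "\<dots> \<longleftrightarrow> (\<exists>i<n. x = rt (CDlt (Suc i), CDlt (Suc i), 1) \<or> - x = rt (CDlt (Suc i), CDlt (Suc i), 1))"
        unfolding Bex_def ex_Suc_iff ..
      also have "\<dots> \<longleftrightarrow> x \<in> ?B" unfolding Un_iff uminus_image_iff rt_image_iff by blast
      finally show "x \<in> ?A \<longleftrightarrow> x \<in> ?B" .
    qed
    show ?thesis
      unfolding even_roots.simps even_roots_OSP_def even_half.simps Suc_eq_plus1[symmetric] D
        signed_pair_union[of CEps] signed_pair_union[of CDlt] Let_def image_Un by blast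
  qed
  have gl: "even_roots (GL n) = rt ` even_half (GL n) \<union> uminus ` rt ` even_half (GL n)" for n
  proof -
    have D: "{unit_weight (U i) - unit_weight (U j) | i j. i \<in> {1..n} \<and> j \<in> {1..n} \<and> i \<noteq> j}
      = rt ` (\<lambda>(k, i). (U (Suc i), U (Suc k), -1)) ` (SIGMA k:{..<n}. {..<k}) \<union> uminus ` rt ` (\<lambda>(k, i). (U (Suc i), U (Suc k), -1)) ` (SIGMA k:{..<n}. {..<k})" (is "?A = ?B") for U :: "nat \<Rightarrow> coord"
    proof (rule Set.set_eqI)
      fix x
      have "x \<in> ?A \<longleftrightarrow> (\<exists>i<n. \<exists>j<n. i \<noteq> j \<and> x = rt (U (Suc i), U (Suc j), -1))"
      proof
        assume "x \<in> ?A"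
        then obtain i j where h: "i \<in> {1..n}" "j \<in> {1..n}" "i \<noteq> j" "x = rt (U i, U j, -1)" unfolding pm_rt by blast
        obtain i' j' where ij: "i = Suc i'" "j = Suc j'" using h(1,2) by (cases i; cases j) auto
        have "i' < n" "j' < n" "i' \<noteq> j'" using h ij by auto
        then show "\<exists>i<n. \<exists>j<n. i \<noteq> j \<and> x = rt (U (Suc i), U (Suc j), -1)" using h(4) unfolding ij by blast
      next
        assume "\<exists>i<n. \<exists>j<n. i \<noteq> j \<and> x = rt (U (Suc i), U (Suc j), -1)"
        then obtain i j where "i < n" "j < n" "i \<noteq> j" "x = rt (U (Suc i), U (Suc j), -1)" by blast
        moreover from this have "Suc i \<in> {1..n}" "Suc j \<in> {1..n}" "Suc i \<noteq> Suc j" by auto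
        ultimately show "x \<in> ?A" unfolding pm_rt by blast
      qed
      also have "\<dots> \<longleftrightarrow> (\<exists>k<n. \<exists>i<k. x = rt (U (Suc i), U (Suc k), -1) \<or> - x = rt (U (Suc i), U (Suc k), -1))" (is "?l = ?r")
      proof -
        have e: "- x = rt (c, d, -1) \<longleftrightarrow> x = rt (d, c, -1)" for c d unfolding uminus_rt_minus[of d c] by (rule uminus_eq_iff)
        show ?thesis unfolding e ex_distinct_iff ..
      qed
      also have "\<dots> \<longleftrightarrow> x \<in> ?B" unfolding Un_iff uminus_image_iff rt_image_iff by blast
      finally show "x \<in> ?A \<longleftrightarrow> x \<in> ?B" .
    qed
    show ?thesis unfolding even_roots.simps even_half.simps D image_Un by blast
  qed
  assume "classical g" then show ?thesis unfolding classical_def by (elim exE disjE) (simp_all only: osp gl)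
qed

lemma odd_roots_half: "classical g \<Longrightarrow> odd_roots g = rt ` odd_half g \<union> uminus ` rt ` odd_half g"
proof -
  have osp: "odd_roots (OSP n) = rt ` odd_half (OSP n) \<union> uminus ` rt ` odd_half (OSP n)" for n
  proof (rule Set.set_eqI)
    fix x
    have "x \<in> odd_roots (OSP n) \<longleftrightarrow> (\<exists>i<Suc n. \<exists>j<n. \<exists>s\<in>{1, -1::complex}. \<exists>t\<in>{1, -1::complex}. x = scl s (eps (Suc i)) + scl t (dlt (Suc j)))"
    proof
      assume "x \<in> odd_roots (OSP n)"
      then obtain s t i j where h: "x = scl s (eps i) + scl t (dlt j)" "s \<in> {1, -1::complex}" "t \<in> {1, -1::complex}" "i \<in> {1..n+1}" "j \<in> {1..n}"
        unfolding odd_roots.simps odd_roots_OSP_def by blast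
      obtain i' j' where ij: "i = Suc i'" "j = Suc j'" using h(4,5) by (cases i; cases j) auto
      have "i' < Suc n" "j' < n" using h ij by auto
      then show "\<exists>i<Suc n. \<exists>j<n. \<exists>s\<in>{1, -1::complex}. \<exists>t\<in>{1, -1::complex}. x = scl s (eps (Suc i)) + scl t (dlt (Suc j))"
        using h(1-3) unfolding ij by blast
    next
      assume "\<exists>i<Suc n. \<exists>j<n. \<exists>s\<in>{1, -1::complex}. \<exists>t\<in>{1, -1::complex}. x = scl s (eps (Suc i)) + scl t (dlt (Suc j))"
      then obtain i j s t where "i < Suc n" "j < n" "s \<in> {1, -1::complex}" "t \<in> {1, -1::complex}" "x = scl s (eps (Suc i)) + scl t (dlt (Suc j))" by blast
      moreover from this have "Suc i \<in> {1..n+1}" "Suc j \<in> {1..n}" by auto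
      ultimately show "x \<in> odd_roots (OSP n)" unfolding odd_roots.simps odd_roots_OSP_def by blast
    qed
    also have "\<dots> \<longleftrightarrow> x \<in> rt ` odd_half (OSP n) \<union> uminus ` rt ` odd_half (OSP n)"
      unfolding signed_pair odd_half.simps image_Un Un_iff uminus_image_iff rt_image_iff by blast
    finally show "x \<in> odd_roots (OSP n) \<longleftrightarrow> x \<in> rt ` odd_half (OSP n) \<union> uminus ` rt ` odd_half (OSP n)" .
  qed
  have gl: "odd_roots (GL n) = rt ` odd_half (GL n) \<union> uminus ` rt ` odd_half (GL n)" for n
  proof (rule Set.set_eqI)
    fix x
    have "x \<in> odd_roots (GL n) \<longleftrightarrow> (\<exists>i<n. \<exists>j<n. x = rt (CEps (Suc i), CDlt (Suc j), -1) \<or> - x = rt (CEps (Suc i), CDlt (Suc j), -1))"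
    proof
      assume "x \<in> odd_roots (GL n)"
      then obtain s i j where h: "x = scl s (eps i - dlt j)" "s \<in> {1, -1::complex}" "i \<in> {1..n}" "j \<in> {1..n}"
        unfolding odd_roots.simps by blast
      obtain i' j' where ij: "i = Suc i'" "j = Suc j'" using h(3,4) by (cases i; cases j) auto
      have "i' < n" "j' < n" using h ij by auto
      then show "\<exists>i<n. \<exists>j<n. x = rt (CEps (Suc i), CDlt (Suc j), -1) \<or> - x = rt (CEps (Suc i), CDlt (Suc j), -1)"
        using sum_pm_iff[OF h(2,1)] unfolding pm_rt ij by blast
    next
      assume "\<exists>i<n. \<exists>j<n. x = rt (CEps (Suc i), CDlt (Suc j), -1) \<or> - x = rt (CEps (Suc i), CDlt (Suc j), -1)"
      then obtain i j where h: "i < n" "j < n" "x = rt (CEps (Suc i), CDlt (Suc j), -1) \<or> - x = rt (CEps (Suc i), CDlt (Suc j), -1)" by blast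
      then have "\<exists>s\<in>{1, -1::complex}. x = scl s (rt (CEps (Suc i), CDlt (Suc j), -1))" unfolding uminus_eq_iff by (auto simp: scl_pm)
      then obtain s where "s \<in> {1, -1::complex}" "x = scl s (eps (Suc i) - dlt (Suc j))" unfolding pm_rt by blast
      moreover have "Suc i \<in> {1..n}" "Suc j \<in> {1..n}" using h by auto
      ultimately show "x \<in> odd_roots (GL n)" unfolding odd_roots.simps by blast
    qed
    also have "\<dots> \<longleftrightarrow> x \<in> rt ` odd_half (GL n) \<union> uminus ` rt ` odd_half (GL n)"
      unfolding odd_half.simps Un_iff uminus_image_iff rt_image_iff by blast
    finally show "x \<in> odd_roots (GL n) \<longleftrightarrow> x \<in> rt ` odd_half (GL n) \<union> uminus ` rt ` odd_half (GL n)" .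
  qed
  assume "classical g" then show ?thesis unfolding classical_def by (elim exE disjE) (simp_all only: osp gl)
qed

section \<open>Products over positive roots\<close>

lemma prod_symmetric_set:
  fixes F :: "weight \<Rightarrow> 'a :: comm_monoid_mult"
  assumes "finite S" "\<And>t. t \<in> S \<Longrightarrow> valid t"
  shows "(\<Prod>\<alpha>\<in>rt ` S \<union> uminus ` rt ` S. F \<alpha>) = (\<Prod>t\<in>S. F (rt t) * F (- rt t))"
proof -
  have inj: "inj_on rt S" using rt_eqD assms(2) by (auto simp: inj_on_def)
  have d: "rt ` S \<inter> uminus ` rt ` S = {}" using rt_eqD assms(2) by fastforce
  have inj': "inj_on (\<lambda>t. - rt t) S" using inj by (auto simp: inj_on_def)
  have "(\<Prod>\<alpha>\<in>rt ` S \<union> uminus ` rt ` S. F \<alpha>) = (\<Prod>\<alpha>\<in>rt ` S. F \<alpha>) * (\<Prod>\<alpha>\<in>(\<lambda>t. - rt t) ` S. F \<alpha>)"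
    using assms(1) d by (subst prod.union_disjoint) (auto simp: image_image)
  also have "\<dots> = (\<Prod>t\<in>S. F (rt t)) * (\<Prod>t\<in>S. F (- rt t))"
    by (simp add: prod.reindex[OF inj] prod.reindex[OF inj'])
  finally show ?thesis by (simp add: prod.distrib)
qed

text \<open>
  Any choice of positive roots picks one root of each pair, so products over it and over the standard
  half-system correspond.
\<close>

lemma half_choice_bij:
  assumes "\<And>t. t \<in> S \<Longrightarrow> valid t" and one: "\<And>t. t \<in> S \<Longrightarrow> (rt t \<in> P) \<noteq> (- rt t \<in> P)"
  shows "bij_betw (\<lambda>t. if rt t \<in> P then rt t else - rt t) S (P \<inter> (rt ` S \<union> uminus ` rt ` S))"
  unfolding bij_betw_def
proof
  show "inj_on (\<lambda>t. if rt t \<in> P then rt t else - rt t) S"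
  proof (rule inj_onI)
    fix t t' assume t: "t \<in> S" "t' \<in> S" and e: "(if rt t \<in> P then rt t else - rt t) = (if rt t' \<in> P then rt t' else - rt t')"
    then have "rt t = rt t' \<or> rt t = - rt t'" by (auto simp: uminus_eq_iff split: if_splits)
    then show "t = t'" using rt_eqD assms(1) t by blast
  qed
  show "(\<lambda>t. if rt t \<in> P then rt t else - rt t) ` S = P \<inter> (rt ` S \<union> uminus ` rt ` S)"
    using one by (fastforce simp: image_iff)
qed

text \<open>
  The translations of both kinds in coordinates: \<open>u\<close> names the family of coordinates that
  the lattice shifts, and \<open>m\<close> is the shift.
\<close>

definition twist :: "(nat \<Rightarrow> coord) \<Rightarrow> nat \<Rightarrow> (nat \<Rightarrow> int) \<Rightarrow> weight \<Rightarrow> weight" where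
  "twist u n m l = l - scl (\<Sum>i<n. of_int (m i) * l (u (Suc i))) im_root"

definition cds :: "superalgebra \<Rightarrow> coord set" where
  "cds g = insert CImag (CEps ` {1..eps_dim g} \<union> CDlt ` {1..dlt_dim g})"

lemma finite_cds [simp]: "finite (cds g)" by (simp add: cds_def)

text \<open>A classical superalgebra with a height function in general position.\<close>

locale datum =
  fixes g :: superalgebra and P :: "weight set" and h :: "coord \<Rightarrow> real"
  assumes classical: "classical g"
    and P_def: "P = {\<alpha> \<in> roots g. pairing g h \<alpha> > 0}"
    and regular_h: "\<And>\<alpha>. \<alpha> \<in> roots g \<Longrightarrow> pairing g h \<alpha> \<noteq> 0"
    and small_h: "\<And>\<alpha>. \<alpha> \<in> roots g \<Longrightarrow> \<bar>pairing g h \<alpha>\<bar> < h CImag"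
    and imag_pos: "h CImag > 0"
    and independent: "\<And>k :: coord \<Rightarrow> int. (\<Sum>c\<in>cds g. of_int (k c) * h c) = 0 \<Longrightarrow> c \<in> cds g \<Longrightarrow> k c = 0"
begin

abbreviation "N \<equiv> h CImag"

definition H :: "weight \<Rightarrow> real" where
  "H \<nu> = pairing g h \<nu> + N * Re (\<nu> CImag)"

lemma H_sum_cds: "H \<nu> = (\<Sum>c\<in>cds g. h c * Re (\<nu> c))"
proof -
  have "(\<Sum>c\<in>cds g. h c * Re (\<nu> c)) = N * Re (\<nu> CImag) + (\<Sum>c\<in>CEps ` {1..eps_dim g} \<union> CDlt ` {1..dlt_dim g}. h c * Re (\<nu> c))"
    unfolding cds_def by (rule sum.insert) auto
  also have "(\<Sum>c\<in>CEps ` {1..eps_dim g} \<union> CDlt ` {1..dlt_dim g}. h c * Re (\<nu> c)) = pairing g h \<nu>"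
    unfolding pairing_def by (subst sum.union_disjoint) (auto simp: sum.reindex inj_on_def)
  finally show ?thesis unfolding H_def by simp
qed

lemma H_plus: "H (a + b) = H a + H b"
  unfolding H_sum_cds by (simp add: sum.distrib algebra_simps)

lemma H_real_scl: "H (scl (of_real r) a) = r * H a"
  unfolding H_sum_cds by (simp add: scl_def sum_distrib_left mult_ac)

lemma H_unit: "c \<in> cds g \<Longrightarrow> H (unit_weight c) = h c"
proof -
  assume c: "c \<in> cds g"
  have "H (unit_weight c) = (\<Sum>c'\<in>cds g. if c' = c then h c else 0)"
    unfolding H_sum_cds by (rule sum.cong) (auto simp: unit_weight_def)
  then show ?thesis using c by simp
qed

lemma H_im: "H im_root = N" by (rule H_unit) (simp add: cds_def)

lemma rt_im: "valid t \<Longrightarrow> rt t CImag = 0"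
  by (cases t; cases "fst t"; cases "fst (snd t)") (auto simp: rt_apply valid_def)

lemmas even_roots_eq = even_roots_half[OF classical]
lemmas odd_roots_eq = odd_roots_half[OF classical]

lemma roots_cases: "\<alpha> \<in> roots g \<longleftrightarrow> (\<exists>t\<in>even_half g \<union> odd_half g. \<alpha> = rt t \<or> \<alpha> = - rt t)"
  unfolding roots_def even_roots_eq odd_roots_eq by blast

lemma roots_uminus: "\<alpha> \<in> roots g \<Longrightarrow> - \<alpha> \<in> roots g"
  unfolding roots_cases by auto

lemma roots_finite: "finite (roots g)"
  unfolding roots_def even_roots_eq odd_roots_eq by simp

lemma roots_im: "\<alpha> \<in> roots g \<Longrightarrow> \<alpha> CImag = 0"
  unfolding roots_cases using rt_im even_half_valid odd_half_valid by fastforce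

lemma H_root: "\<alpha> \<in> roots g \<Longrightarrow> H \<alpha> = pairing g h \<alpha>"
  by (simp add: H_def roots_im)

lemma H_root_nz: "\<alpha> \<in> roots g \<Longrightarrow> H \<alpha> \<noteq> 0" and H_root_small: "\<alpha> \<in> roots g \<Longrightarrow> \<bar>H \<alpha>\<bar> < N"
  and P_iff: "\<alpha> \<in> P \<longleftrightarrow> \<alpha> \<in> roots g \<and> H \<alpha> > 0"
  using regular_h small_h by (auto simp: H_root P_def)

lemma H_0': "H 0 = 0" using H_plus[of 0 0] by simp
lemma H_minus: "H (- a) = - H a" using H_plus[of a "- a"] H_0' by simp

lemma H_kdelta: "H (kdelta k) = real k * N"
  using H_real_scl[of "real k" im_root] by (simp add: H_im)

lemma aff_pos_cases:
  "\<gamma> \<in> aff_pos g P \<longleftrightarrow> \<gamma> \<in> P \<or> (\<exists>\<alpha> k. \<gamma> = \<alpha> + kdelta k \<and> \<alpha> \<in> roots g \<and> k \<ge> 1) \<or> (\<exists>k. \<gamma> = kdelta k \<and> k \<ge> 1)"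
  unfolding aff_pos_def by blast

sublocale height g P H
proof
  show "H (a + b) = H a + H b" for a b by (rule H_plus)
  show "H \<gamma> > 0" if "\<gamma> \<in> aff_pos g P" for \<gamma>
    using that unfolding aff_pos_cases
  proof (elim disjE exE conjE)
    assume "\<gamma> \<in> P" then show ?thesis by (simp add: P_iff)
  next
    fix \<alpha> k assume g: "\<gamma> = \<alpha> + kdelta k" "\<alpha> \<in> roots g" "(k::nat) \<ge> 1"
    have "1 * N \<le> real k * N" using g(3) imag_pos by (intro mult_right_mono) auto
    then show ?thesis unfolding g(1) H_plus H_kdelta using H_root_small[OF g(2)] by linarith
  next
    fix k assume "\<gamma> = kdelta k" "k \<ge> 1" then show ?thesis using imag_pos by (simp add: H_kdelta)
  qed
  show "finite {\<gamma> \<in> aff_pos g P. H \<gamma> \<le> B}" for B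
  proof (rule finite_subset)
    show "{\<gamma> \<in> aff_pos g P. H \<gamma> \<le> B} \<subseteq> (\<lambda>(\<alpha>, k). \<alpha> + kdelta k) ` ((insert 0 (roots g)) \<times> {..nat \<lfloor>(B + N) / N\<rfloor>})"
    proof
      fix \<gamma> assume g: "\<gamma> \<in> {\<gamma> \<in> aff_pos g P. H \<gamma> \<le> B}"
      have "\<exists>\<alpha> k. \<gamma> = \<alpha> + kdelta k \<and> \<alpha> \<in> insert 0 (roots g)"
      proof -
        have "\<gamma> = \<gamma> + kdelta 0" by (simp add: scl_zero)
        moreover have "kdelta k = 0 + kdelta k" for k by simp
        ultimately show ?thesis using g unfolding mem_Collect_eq aff_pos_cases P_iff by blast
      qed
      then obtain \<alpha> k where a: "\<gamma> = \<alpha> + kdelta k" "\<alpha> \<in> insert 0 (roots g)" by blast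
      have "H \<alpha> \<ge> - N" using a(2) H_root_small[of \<alpha>] imag_pos by (auto simp: H_0')
      moreover have "H \<alpha> + real k * N \<le> B" using g unfolding a(1) by (simp add: H_plus H_kdelta)
      ultimately have "real k \<le> (B + N) / N" using imag_pos by (simp add: field_simps)
      then have "k \<le> nat \<lfloor>(B + N) / N\<rfloor>" by (simp add: le_nat_iff le_floor_iff)
      then show "\<gamma> \<in> (\<lambda>(\<alpha>, k). \<alpha> + kdelta k) ` ((insert 0 (roots g)) \<times> {..nat \<lfloor>(B + N) / N\<rfloor>})"
        using a by force
    qed
  qed (use roots_finite in simp)
qed

lemma roots_P: "\<alpha> \<in> roots g \<Longrightarrow> (\<alpha> \<in> P) \<noteq> (- \<alpha> \<in> P)"
  using H_root_nz[of \<alpha>] roots_uminus[of \<alpha>] by (auto simp: P_iff H_minus)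

text \<open>The Weyl vector need not be an integral combination of the coordinates.\<close>

definition Lam :: "weight set" where
  "Lam = {\<nu>. (\<forall>c. c \<notin> cds g \<longrightarrow> \<nu> c = 0) \<and> (\<forall>c. \<exists>k::int. \<nu> c = of_int k / 2)}"

lemma Lam_inj: "inj_on H Lam"
proof (rule inj_onI)
  fix a b assume ab: "a \<in> Lam" "b \<in> Lam" and e: "H a = H b"
  obtain k where k: "\<And>c. a c = of_int (k c :: int) / 2" using ab(1) unfolding Lam_def by (simp add: choice_iff) metis
  obtain l where l: "\<And>c. b c = of_int (l c :: int) / 2" using ab(2) unfolding Lam_def by (simp add: choice_iff) metis
  have "(\<Sum>c\<in>cds g. of_int (k c - l c) * h c) = 2 * (H a - H b)"
    unfolding H_sum_cds by (simp add: k l sum_subtractf sum_distrib_left algebra_simps)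
  then have z: "k c - l c = 0" if "c \<in> cds g" for c
    using independent[of "\<lambda>c. k c - l c" c] that e by simp
  show "a = b"
  proof
    fix c show "a c = b c" using z[of c] ab by (cases "c \<in> cds g") (auto simp: k l Lam_def)
  qed
qed

lemma Lam_zero: "0 \<in> Lam" unfolding Lam_def by (auto intro: exI[of _ 0])

lemma Lam_minus: "a \<in> Lam \<Longrightarrow> b \<in> Lam \<Longrightarrow> a - b \<in> Lam"
proof -
  assume a: "a \<in> Lam" and b: "b \<in> Lam"
  have "\<exists>k::int. (a - b) c = of_int k / 2" for c
  proof -
    obtain k l :: int where "a c = of_int k / 2" "b c = of_int l / 2" using a b unfolding Lam_def by blast
    then have "(a - b) c = of_int (k - l) / 2" by (simp only: fun_diff_def of_int_diff diff_divide_distrib)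
    then show ?thesis by blast
  qed
  then show ?thesis using a b unfolding Lam_def by auto
qed

lemma Lam_plus: "a \<in> Lam \<Longrightarrow> b \<in> Lam \<Longrightarrow> a + b \<in> Lam"
  using Lam_minus[OF _ Lam_minus[OF Lam_zero]] by force

lemma Lam_unit: "c \<in> cds g \<Longrightarrow> unit_weight c \<in> Lam"
proof -
  have "\<exists>k::int. unit_weight c d = of_int k / 2" for d
    by (rule exI[of _ "if d = c then 2 else 0"]) (simp add: unit_weight_def)
  then show "c \<in> cds g \<Longrightarrow> unit_weight c \<in> Lam" unfolding Lam_def by (auto simp: unit_weight_def)
qed

lemma half_cds: "(c, d, b) \<in> even_half g \<union> odd_half g \<Longrightarrow> c \<in> cds g \<and> d \<in> cds g"
  using half_coords[of c d b g] by (auto simp: cds_def)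

lemma valid_half: "t \<in> even_half g \<union> odd_half g \<Longrightarrow> valid t"
  using even_half_valid odd_half_valid by blast

lemma Lam_rt: "t \<in> even_half g \<union> odd_half g \<Longrightarrow> rt t \<in> Lam"
proof -
  assume t: "t \<in> even_half g \<union> odd_half g"
  obtain c d b where e: "t = (c, d, b)" by (cases t) auto
  have "b = 1 \<or> b = -1" using valid_half[OF t] by (auto simp: valid_def e)
  then have "rt t = unit_weight c + unit_weight d \<or> rt t = unit_weight c - unit_weight d" unfolding pm_rt e by auto
  then show ?thesis using half_cds[of c d b] t Lam_unit Lam_plus Lam_minus unfolding e by metis
qed

lemma Lam_root: "\<alpha> \<in> roots g \<Longrightarrow> \<alpha> \<in> Lam"
  unfolding roots_cases using Lam_rt Lam_minus[OF Lam_zero] by force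

lemma Lam_im: "im_root \<in> Lam" by (rule Lam_unit) (simp add: cds_def)

lemma Lam_imscl: "scl (of_int k / 2) im_root \<in> Lam"
  unfolding Lam_def scl_def unit_weight_def cds_def by (auto intro: exI[of _ k] exI[of _ 0])

lemma Lam_aff_weights: "Lam \<subseteq> aff_weights g"
  unfolding Lam_def aff_weights_def cds_def by auto

lemma H_rt: "(c, d, b) \<in> even_half g \<union> odd_half g \<Longrightarrow> H (rt (c, d, b)) = h c + b * h d"
  using half_cds[of c d b] by (simp add: rt_def H_plus H_real_scl H_unit)

lemma even_root_root: "\<alpha> \<in> even_roots g \<Longrightarrow> \<alpha> \<in> roots g" and odd_root_root: "\<alpha> \<in> odd_roots g \<Longrightarrow> \<alpha> \<in> roots g"
  by (simp_all add: roots_def)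

lemma prod_pos_even: "(\<Prod>\<alpha>\<in>pos_even g P. F \<alpha>) = (\<Prod>t\<in>even_half g. F (if rt t \<in> P then rt t else - rt t))"
  and prod_pos_odd: "(\<Prod>\<alpha>\<in>pos_odd g P. F \<alpha>) = (\<Prod>t\<in>odd_half g. F (if rt t \<in> P then rt t else - rt t))"
  for F :: "weight \<Rightarrow> 'a :: comm_monoid_mult"
  unfolding pos_even_def even_roots_eq pos_odd_def odd_roots_eq
  by (rule prod.reindex_bij_betw[OF half_choice_bij, symmetric];
      use valid_half roots_P roots_cases in blast)+

lemma sum_pos_even: "(\<Sum>\<alpha>\<in>pos_even g P. F \<alpha>) = (\<Sum>t\<in>even_half g. F (if rt t \<in> P then rt t else - rt t))"
  and sum_pos_odd: "(\<Sum>\<alpha>\<in>pos_odd g P. F \<alpha>) = (\<Sum>t\<in>odd_half g. F (if rt t \<in> P then rt t else - rt t))"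
  for F :: "weight \<Rightarrow> 'a :: comm_monoid_add"
  unfolding pos_even_def even_roots_eq pos_odd_def odd_roots_eq
  by (rule sum.reindex_bij_betw[OF half_choice_bij, symmetric];
      use valid_half roots_P roots_cases in blast)+

end

section \<open>Expansion and evaluation of the translated denominators\<close>

definition sh :: "real \<Rightarrow> complex" where "sh x = of_real (exp (x / 2) - exp (- x / 2))"
definition ch :: "real \<Rightarrow> complex" where "ch x = of_real (exp (x / 2) + exp (- x / 2))"

lemma sh_uminus: "sh (- x) = - sh x" by (simp add: sh_def)
lemma ch_uminus: "ch (- x) = ch x" by (simp add: ch_def add.commute)
lemma ch_nz: "ch x \<noteq> 0"
proof -
  have "exp (x / 2) + exp (- x / 2) > 0" by (intro add_pos_pos) simp_all
  then show ?thesis unfolding ch_def by (metis less_irrefl of_real_eq_0_iff)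
qed

lemma sum_coordinate: "sum f A c = (\<Sum>x\<in>A. f x c)" for f :: "'b \<Rightarrow> weight"
  by (induction A rule: infinite_finite_induct) auto

context datum
begin

definition mm :: "(nat \<Rightarrow> coord) \<Rightarrow> nat \<Rightarrow> (nat \<Rightarrow> int) \<Rightarrow> coord \<Rightarrow> int" where
  "mm u n m c = (\<Sum>i<n. if u (Suc i) = c then m i else 0)"

definition hm :: "(nat \<Rightarrow> coord) \<Rightarrow> nat \<Rightarrow> (nat \<Rightarrow> int) \<Rightarrow> coord \<Rightarrow> real" where
  "hm u n m c = h c - N * of_int (mm u n m c)"

lemma twist_H: "H (twist u n m l) = H l - N * (\<Sum>i<n. of_int (m i) * Re (l (u (Suc i))))"
proof -
  have "H (scl c im_root) = N * Re c" for c
    by (simp add: H_def pairing_def scl_def unit_weight_def)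
  then show ?thesis unfolding twist_def H_diff by simp
qed

lemma twist_plus: "twist u n m (a + b) = twist u n m a + twist u n m b"
  by (rule ext) (simp add: twist_def scl_def sum.distrib algebra_simps)

lemma twist_uminus: "twist u n m (- a) = - twist u n m a"
  by (rule ext) (simp add: twist_def scl_def sum_negf)

lemma twist_H_sum: "H (twist u n m (sum f A)) = (\<Sum>x\<in>A. H (twist u n m (f x)))"
proof -
  have z: "twist u n m 0 = 0" using twist_plus[of u n m 0 0] by simp
  have "twist u n m (sum f A) = (\<Sum>x\<in>A. twist u n m (f x))"
    by (induction A rule: infinite_finite_induct) (simp_all only: sum.infinite sum.empty sum.insert z twist_plus not_False_eq_True)
  then show ?thesis by (simp add: H_sum)
qed

lemma twist_H_half: "H (twist u n m (scl (1/2) l)) = H (twist u n m l) / 2"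
proof -
  have a: "H (scl (1/2) l) = H l / 2" using H_real_scl[of "1/2" l] by simp
  have b: "Re (scl (1/2) l c) = Re (l c) / 2" for c by (simp add: scl_def)
  show ?thesis unfolding twist_H a b by (simp add: sum_distrib_left sum_divide_distrib diff_divide_distrib)
qed

lemma twist_H_rho: "H (twist u n m (rho g P)) =
   ((\<Sum>\<alpha>\<in>pos_even g P. H (twist u n m \<alpha>)) - (\<Sum>\<beta>\<in>pos_odd g P. H (twist u n m \<beta>))) / 2"
proof -
  have "twist u n m (a - b) = twist u n m a - twist u n m b" for a b
    using twist_plus[of u n m a "- b"] by (simp add: twist_uminus)
  then show ?thesis unfolding rho_def twist_H_half by (simp add: H_diff twist_H_sum)
qed

lemma twist_rt:
  assumes "valid (c, d, b)"
  shows "\<exists>k::int. twist u n m (rt (c, d, b)) = rt (c, d, b) + scl (of_int k) im_root"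
    and "(\<Sum>i<n. of_int (m i) * Re (rt (c, d, b) (u (Suc i)))) = of_int (mm u n m c) + b * of_int (mm u n m d)"
proof -
  have b: "b = 1 \<or> b = -1" using assms by (auto simp: valid_def)
  then obtain b' :: int where b': "b = of_int b'" by (metis of_int_1 of_int_minus)
  have "(\<Sum>i<n. of_int (m i) * rt (c, d, b) (u (Suc i))) = of_int (\<Sum>i<n. m i * ((if u (Suc i) = c then 1 else 0) + (if u (Suc i) = d then b' else 0)))"
    unfolding of_int_sum by (rule sum.cong) (auto simp: rt_apply b')
  then obtain k :: int where "(\<Sum>i<n. of_int (m i) * rt (c, d, b) (u (Suc i))) = of_int k" by blast
  then have "twist u n m (rt (c, d, b)) = rt (c, d, b) + scl (of_int (- k)) im_root"
    unfolding twist_def by (intro ext) (simp add: scl_def)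
  then show "\<exists>k::int. twist u n m (rt (c, d, b)) = rt (c, d, b) + scl (of_int k) im_root" by blast
  have "(\<Sum>i<n. of_int (m i) * Re (rt (c, d, b) (u (Suc i)))) = (\<Sum>i<n. of_int (if u (Suc i) = c then m i else 0) + b * of_int (if u (Suc i) = d then m i else 0))"
    by (rule sum.cong) (auto simp: rt_apply algebra_simps)
  then show "(\<Sum>i<n. of_int (m i) * Re (rt (c, d, b) (u (Suc i)))) = of_int (mm u n m c) + b * of_int (mm u n m d)"
    unfolding mm_def of_int_sum by (simp add: sum.distrib sum_distrib_left)
qed

lemma twist_H_rt: "(c, d, b) \<in> even_half g \<union> odd_half g \<Longrightarrow> H (twist u n m (rt (c, d, b))) = hm u n m c + b * hm u n m d"
  unfolding twist_H twist_rt(2)[OF valid_half] H_rt hm_def by (simp add: algebra_simps)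

lemma twist_root: "\<alpha> \<in> roots g \<Longrightarrow> \<exists>k::int. twist u n m \<alpha> = \<alpha> + scl (of_int k) im_root"
proof -
  assume "\<alpha> \<in> roots g"
  then obtain t where t: "t \<in> even_half g \<union> odd_half g" "\<alpha> = rt t \<or> \<alpha> = - rt t" unfolding roots_cases by blast
  obtain k :: int where k: "twist u n m (rt t) = rt t + scl (of_int k) im_root"
    using twist_rt(1)[of "fst t" "fst (snd t)" "snd (snd t)" u n m] valid_half[OF t(1)] by auto
  have "twist u n m (- rt t) = - rt t + scl (of_int (- k)) im_root"
    unfolding twist_uminus k by (rule ext) (simp add: scl_def)
  then show ?thesis using t(2) k by blast
qed

lemma twist_aff:
  assumes "\<alpha> \<in> roots g"
  shows "twist u n m \<alpha> \<in> aff_pos g P \<or> - twist u n m \<alpha> \<in> aff_pos g P"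
proof -
  obtain k :: int where k: "twist u n m \<alpha> = \<alpha> + scl (of_int k) im_root" using twist_root[OF assms] by blast
  consider "k = 0" | "k \<ge> 1" | "k \<le> -1" by linarith
  then show ?thesis
  proof cases
    case 1
    then have "twist u n m \<alpha> = \<alpha>" unfolding k by (simp add: scl_zero)
    then show ?thesis using roots_P[OF assms] by (auto simp: aff_pos_cases)
  next
    case 2
    then have "twist u n m \<alpha> = \<alpha> + kdelta (nat k)" "nat k \<ge> 1" unfolding k by (simp_all add: of_nat_nat)
    then show ?thesis using assms unfolding aff_pos_cases by blast
  next
    case 3
    have "- twist u n m \<alpha> = - \<alpha> + kdelta (nat (- k))" unfolding k using 3 by (intro ext) (simp add: scl_def of_nat_nat)
    moreover have "nat (- k) \<ge> 1" using 3 by simp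
    ultimately show ?thesis using roots_uminus[OF assms] unfolding aff_pos_cases by blast
  qed
qed

lemma Lam_twist: "l \<in> Lam \<Longrightarrow> twist u n m l \<in> Lam"
proof -
  assume l: "l \<in> Lam"
  then obtain k where k: "\<And>c. l c = of_int (k c :: int) / 2" unfolding Lam_def by (simp add: choice_iff) metis
  have "(\<Sum>i<n. of_int (m i) * l (u (Suc i))) = of_int (\<Sum>i<n. m i * k (u (Suc i))) / 2"
    by (simp add: k sum_divide_distrib)
  then have "twist u n m l = l - scl (of_int (\<Sum>i<n. m i * k (u (Suc i))) / 2) im_root" by (simp only: twist_def)
  then show ?thesis by (simp only: Lam_minus[OF l Lam_imscl])
qed

lemma root_Ints: "\<alpha> \<in> roots g \<Longrightarrow> \<alpha> c \<in> \<int>"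
  unfolding roots_cases
proof (elim bexE disjE)
  fix t assume t: "t \<in> even_half g \<union> odd_half g"
  obtain c' d b where e: "t = (c', d, b)" by (cases t) auto
  have "b = 1 \<or> b = -1" using valid_half[OF t] by (auto simp: valid_def e)
  then have r: "rt t c \<in> \<int>" unfolding e rt_apply by auto
  then show "\<alpha> c \<in> \<int>" if "\<alpha> = rt t" using that by simp
  show "\<alpha> c \<in> \<int>" if "\<alpha> = - rt t" using that r by simp
qed

lemma Lam_rho: "rho g P \<in> Lam"
proof -
  have sub: "pos_even g P \<subseteq> roots g" "pos_odd g P \<subseteq> roots g"
    by (auto simp: pos_even_def pos_odd_def even_root_root odd_root_root)
  have "((\<Sum>\<alpha>\<in>pos_even g P. \<alpha>) - (\<Sum>\<alpha>\<in>pos_odd g P. \<alpha>)) c \<in> \<int>" for c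
    unfolding minus_apply sum_coordinate using sub root_Ints by (intro Ints_diff Ints_sum) auto
  then have "\<exists>k::int. rho g P c = of_int k / 2" for c
    unfolding rho_def scl_def by (metis Ints_cases mult.commute times_divide_eq_right mult_1_right)
  moreover have "rho g P c = 0" if "c \<notin> cds g" for c
  proof -
    have "\<alpha> c = 0" if "\<alpha> \<in> roots g" for \<alpha> using Lam_root[OF that] \<open>c \<notin> cds g\<close> by (simp add: Lam_def)
    then have "((\<Sum>\<alpha>\<in>pos_even g P. \<alpha>) - (\<Sum>\<alpha>\<in>pos_odd g P. \<alpha>)) c = 0"
      unfolding minus_apply sum_coordinate using sub by (subst (1 2) sum.neutral) auto
    then show ?thesis unfolding rho_def scl_def by simp
  qed
  ultimately show ?thesis unfolding Lam_def by blast
qed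

text \<open>The common growth exponent of the expanded terms of the sum.\<close>

definition expo :: "(nat \<Rightarrow> coord) \<Rightarrow> nat \<Rightarrow> (nat \<Rightarrow> int) \<Rightarrow> real" where
  "expo u n m = ((\<Sum>(c,d,b)\<in>even_half g. \<bar>hm u n m c + b * hm u n m d\<bar>) - (\<Sum>(c,d,b)\<in>odd_half g. \<bar>hm u n m c + b * hm u n m d\<bar>)) / 2"

lemma expo_eq: "expo u n m = ((\<Sum>\<alpha>\<in>pos_even g P. \<bar>H (twist u n m \<alpha>)\<bar>) - (\<Sum>\<beta>\<in>pos_odd g P. \<bar>H (twist u n m \<beta>)\<bar>)) / 2"
proof -
  have a: "\<bar>H (twist u n m (if X then rt t else - rt t))\<bar> = \<bar>H (twist u n m (rt t))\<bar>" for X t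
    by (simp add: twist_uminus H_uminus)
  have "(\<Sum>(c,d,b)\<in>S. \<bar>hm u n m c + b * hm u n m d\<bar>) = (\<Sum>t\<in>S. \<bar>H (twist u n m (rt t))\<bar>)" if "S \<subseteq> even_half g \<union> odd_half g" for S
    using that by (intro sum.cong) (auto simp: twist_H_rt subset_iff)
  then show ?thesis unfolding sum_pos_even sum_pos_odd a expo_def by simp
qed

definition val :: "(coord \<Rightarrow> real) \<Rightarrow> complex" where
  "val k = (\<Prod>(c,d,b)\<in>even_half g. sh (k c + b * k d)) / (\<Prod>(c,d,b)\<in>odd_half g. ch (k c + b * k d))"

definition sg :: complex where
  "sg = (\<Prod>t\<in>even_half g. if rt t \<in> P then 1 else -1)"

end

locale character = datum +
  fixes s :: real
  assumes s1: "s \<ge> 1"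

sublocale character \<subseteq> evaluation g P H "chr s" Lam
proof
  show "chr s (a + b) = chr s a * chr s b" for a b by (simp add: chr_def H_plus exp_add algebra_simps)
  show "chr s a \<noteq> 0" for a by (simp add: chr_def)
  show "norm (chr s (- \<gamma>)) < 1" if "\<gamma> \<in> aff_pos g P" for \<gamma>
    using H_pos[OF that] s1 by (simp add: chr_def H_uminus)
  show "0 \<in> Lam" by (rule Lam_zero)
  show "a - b \<in> Lam" if "a \<in> Lam" "b \<in> Lam" for a b using that by (rule Lam_minus)
qed

context character
begin

text \<open>
  The four quantities that are tracked along products: convergence, greatest height, norm and value.
\<close>

definition bdd :: "fsum \<Rightarrow> real \<Rightarrow> real \<Rightarrow> complex \<Rightarrow> bool" where
  "bdd a e c z \<longleftrightarrow> good a \<and> (\<forall>\<nu>. a \<nu> \<noteq> 0 \<longrightarrow> H \<nu> \<le> e) \<and> nm a \<le> c \<and> ev a = z"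

lemma bdd_fmult:
  assumes "bdd a e c z" "bdd a' e' c' z'" shows "bdd (fmult a a') (e + e') (c * c') (z * z')"
proof -
  have "H \<nu> \<le> e + e'" if nz: "fmult a a' \<nu> \<noteq> 0" for \<nu>
  proof -
    obtain \<mu> where "a \<mu> \<noteq> 0" "a' (\<nu> - \<mu>) \<noteq> 0" using fmult_nonzero[OF nz] by blast
    then have "H \<mu> \<le> e" "H (\<nu> - \<mu>) \<le> e'" using assms by (auto simp: bdd_def)
    then show ?thesis by (simp add: H_diff)
  qed
  moreover have "nm a * nm a' \<le> c * c'" using assms nm_nonneg[of a'] nm_nonneg[of a] unfolding bdd_def by (intro mult_mono) linarith+
  ultimately show ?thesis using assms good_fmult[of a a'] unfolding bdd_def by auto
qed

lemma bdd_one: "bdd (fexp 0) 0 1 1"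
  using good_one abl_fexp[of 0] chi_0 by (auto simp: bdd_def fexp_def H_0 split: if_splits)

lemma bdd_finprod:
  assumes "finite A" "\<And>x. x \<in> A \<Longrightarrow> bdd (F x) (e x) (c x) (z x)"
  shows "bdd (finprod R F A) (\<Sum>x\<in>A. e x) (\<Prod>x\<in>A. c x) (\<Prod>x\<in>A. z x)"
proof -
  interpret comm_monoid R by (rule R_comm_monoid)
  show ?thesis using assms
  proof (induction A rule: finite_induct)
    case empty
    show ?case using bdd_one unfolding finprod_empty sum.empty prod.empty by (simp add: R_simps)
  next
    case (insert x A)
    have "finprod R F (insert x A) = F x \<otimes>\<^bsub>R\<^esub> finprod R F A"
      by (rule finprod_insert) (use insert in \<open>auto simp: bdd_def good_def\<close>)
    then show ?case using insert bdd_fmult[of "F x" "e x" "c x" "z x" "finprod R F A"]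
      by (simp add: R_simps)
  qed
qed

lemma bdd_even:
  assumes "\<gamma> \<in> Lam"
  shows "bdd (fexp 0 - fexp (- \<gamma>)) ((\<bar>H \<gamma>\<bar> - H \<gamma>) / 2) (2 * exp (s * ((\<bar>H \<gamma>\<bar> - H \<gamma>) / 2))) (1 - chr s (- \<gamma>))"
proof -
  have l: "- \<gamma> \<in> Lam" by (rule Lam_uminus[OF assms])
  have gf: "good (fexp (- \<gamma>))" using good_fexp[OF _ l] Lam_aff_weights l by blast
  have "nm (fexp 0 - fexp (- \<gamma>)) \<le> 1 + exp (- (s * H \<gamma>))"
    using ev_diff(2)[OF good_one gf] abl_fexp(3)[of 0] abl_fexp(3)[of "- \<gamma>"] chi_0 by (simp add: chr_def H_uminus H_0)
  also have "\<dots> \<le> 2 * exp (s * ((\<bar>H \<gamma>\<bar> - H \<gamma>) / 2))"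
  proof -
    have "exp 0 \<le> exp (s * ((\<bar>H \<gamma>\<bar> - H \<gamma>) / 2))" using s1 unfolding exp_le_cancel_iff by (intro mult_nonneg_nonneg) auto
    moreover have "s * (- H \<gamma>) \<le> s * ((\<bar>H \<gamma>\<bar> - H \<gamma>) / 2)" using s1 by (intro mult_left_mono) auto
    then have "exp (- (s * H \<gamma>)) \<le> exp (s * ((\<bar>H \<gamma>\<bar> - H \<gamma>) / 2))" by simp
    ultimately show ?thesis unfolding exp_zero by linarith
  qed
  finally have n: "nm (fexp 0 - fexp (- \<gamma>)) \<le> 2 * exp (s * ((\<bar>H \<gamma>\<bar> - H \<gamma>) / 2))" .
  have "H \<nu> \<le> (\<bar>H \<gamma>\<bar> - H \<gamma>) / 2" if "(fexp 0 - fexp (- \<gamma>)) \<nu> \<noteq> 0" for \<nu>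
  proof -
    have "\<nu> = 0 \<or> \<nu> = - \<gamma>" using that by (auto simp: fexp_def split: if_splits)
    then show ?thesis by (auto simp: H_0 H_uminus)
  qed
  then show ?thesis unfolding bdd_def using good_diff[OF good_one gf] n ev_diff(1)[OF good_one gf] abl_fexp(2)[of 0] abl_fexp(2)[of "- \<gamma>"] chi_0
    by simp
qed

lemma bdd_geom:
  assumes "\<gamma> \<in> aff_pos g P" "\<gamma> \<in> Lam" "\<And>\<gamma>. \<gamma> \<in> aff_pos g P \<Longrightarrow> k \<le> H \<gamma>" "k > 0"
  shows "bdd (geom (-1) \<gamma>) 0 (1 / (1 - exp (- (s * k)))) (1 / (1 + chr s (- \<gamma>)))"
proof -
  note gg = good_geom[OF assms(1,2), of "-1", simplified]
  have "exp (- (s * H \<gamma>)) \<le> exp (- (s * k))" "exp (- (s * k)) < 1" using assms s1 by (auto intro!: mult_left_mono)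
  then have "1 / (1 - exp (- (s * H \<gamma>))) \<le> 1 / (1 - exp (- (s * k)))" by (intro divide_left_mono) auto
  moreover have "H \<nu> \<le> 0" if "geom (-1) \<gamma> \<nu> \<noteq> 0" for \<nu> using Q_nonneg[OF gg(4)[OF that]] by (simp add: H_uminus)
  ultimately show ?thesis unfolding bdd_def using gg(1-3) by (simp add: chr_def H_uminus)
qed

lemma bdd_odd:
  assumes "\<gamma> \<in> aff_pos g P \<or> - \<gamma> \<in> aff_pos g P" "\<gamma> \<in> Lam" "\<And>\<gamma>. \<gamma> \<in> aff_pos g P \<Longrightarrow> k \<le> H \<gamma>" "k > 0"
  shows "bdd (inv_one_plus g P \<gamma>) ((H \<gamma> - \<bar>H \<gamma>\<bar>) / 2) (1 / (1 - exp (- (s * k))) * exp (s * ((H \<gamma> - \<bar>H \<gamma>\<bar>) / 2))) (1 / (1 + chr s (- \<gamma>)))"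
proof (cases "\<gamma> \<in> aff_pos g P")
  case True
  then show ?thesis using bdd_geom[OF True assms(2-4)] H_pos[OF True] by (simp add: inv_one_plus_def)
next
  case False
  then have a: "- \<gamma> \<in> aff_pos g P" using assms(1) by blast
  have l: "- \<gamma> \<in> Lam" by (rule Lam_uminus[OF assms(2)])
  have n: "H \<gamma> < 0" using H_pos[OF a] by (simp add: H_uminus)
  have f: "bdd (fexp \<gamma>) (H \<gamma>) (exp (s * H \<gamma>)) (chr s \<gamma>)"
    using good_fexp[of \<gamma>] Lam_aff_weights assms(2) abl_fexp[of \<gamma>] by (auto simp: bdd_def fexp_def chr_def split: if_splits)
  have e: "inv_one_plus g P \<gamma> = fmult (fexp \<gamma>) (geom (-1) (- \<gamma>))" using False by (simp add: inv_one_plus_def R_simps)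
  have z: "chr s \<gamma> * (1 / (1 + chr s \<gamma>)) = 1 / (1 + chr s (- \<gamma>))"
  proof -
    have "1 + chr s \<gamma> = of_real (1 + exp (s * H \<gamma>))" by (simp add: chr_def)
    moreover have "1 + exp (s * H \<gamma>) \<noteq> 0" using exp_gt_zero[of "s * H \<gamma>"] by linarith
    ultimately have "1 + chr s \<gamma> \<noteq> 0" by (metis of_real_eq_0_iff)
    then show ?thesis using chi_nz[of \<gamma>] by (simp add: chi_uminus field_simps)
  qed
  have "(H \<gamma> - \<bar>H \<gamma>\<bar>) / 2 = H \<gamma> + 0" using n by simp
  then show ?thesis using bdd_fmult[OF f bdd_geom[OF a l assms(3,4)]] unfolding e minus_minus z by (simp only: mult.commute add_0_right)
qed

lemma chr_real: "chr s (- \<gamma>) = of_real (exp (- (s * H \<gamma>)))" by (simp add: chr_def H_uminus)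

text \<open>
  One induction over the product yields the value, a bound for the norm and a bound for the heights,
  with the same exponent in both bounds.
\<close>

lemma transl_den_bdd:
  assumes k: "\<And>\<gamma>. \<gamma> \<in> aff_pos g P \<Longrightarrow> k \<le> H \<gamma>" "k > 0"
  shows "bdd (transl_den g P (twist u n m)) (expo u n m)
     (2 ^ card (even_half g) * (1 / (1 - exp (- (s * k)))) ^ card (odd_half g) * exp (s * expo u n m))
     (sg * val (\<lambda>c. s * hm u n m c))"
proof -
  let ?w = "twist u n m"
  let ?C = "1 / (1 - exp (- (s * k)))"
  have P0: "\<And>\<alpha>. \<alpha> \<in> pos_even g P \<Longrightarrow> \<alpha> \<in> roots g" and P1: "\<And>\<alpha>. \<alpha> \<in> pos_odd g P \<Longrightarrow> \<alpha> \<in> roots g"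
    by (auto simp: pos_even_def pos_odd_def even_root_root odd_root_root)
  have fin: "finite (pos_even g P)" "finite (pos_odd g P)" using P0 P1 finite_subset[OF _ roots_finite] by blast+
  have r: "bdd (fexp (?w (rho g P))) (H (?w (rho g P))) (exp (s * H (?w (rho g P)))) (chr s (?w (rho g P)))"
    using good_fexp[of "?w (rho g P)"] Lam_aff_weights Lam_twist[OF Lam_rho] abl_fexp[of "?w (rho g P)"]
    by (auto simp: bdd_def fexp_def chr_def split: if_splits)
  have B0: "bdd (finprod R (\<lambda>\<alpha>. fexp 0 - fexp (- ?w \<alpha>)) (pos_even g P)) (\<Sum>\<alpha>\<in>pos_even g P. (\<bar>H (?w \<alpha>)\<bar> - H (?w \<alpha>)) / 2)
     (\<Prod>\<alpha>\<in>pos_even g P. 2 * exp (s * ((\<bar>H (?w \<alpha>)\<bar> - H (?w \<alpha>)) / 2))) (\<Prod>\<alpha>\<in>pos_even g P. 1 - chr s (- ?w \<alpha>))"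
    by (rule bdd_finprod[OF fin(1)], rule bdd_even, rule Lam_twist[OF Lam_root[OF P0]])
  have B1: "bdd (finprod R (\<lambda>\<beta>. inv_one_plus g P (?w \<beta>)) (pos_odd g P)) (\<Sum>\<beta>\<in>pos_odd g P. (H (?w \<beta>) - \<bar>H (?w \<beta>)\<bar>) / 2)
     (\<Prod>\<beta>\<in>pos_odd g P. ?C * exp (s * ((H (?w \<beta>) - \<bar>H (?w \<beta>)\<bar>) / 2))) (\<Prod>\<beta>\<in>pos_odd g P. 1 / (1 + chr s (- ?w \<beta>)))"
    by (rule bdd_finprod[OF fin(2)], rule bdd_odd[OF twist_aff[OF P1] Lam_twist[OF Lam_root[OF P1]] k])
  note B = bdd_fmult[OF bdd_fmult[OF r B0] B1]
  have E: "H (?w (rho g P)) + (\<Sum>\<alpha>\<in>pos_even g P. (\<bar>H (?w \<alpha>)\<bar> - H (?w \<alpha>)) / 2) + (\<Sum>\<beta>\<in>pos_odd g P. (H (?w \<beta>) - \<bar>H (?w \<beta>)\<bar>) / 2) = expo u n m"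
    unfolding twist_H_rho expo_eq sum_divide_distrib[symmetric] sum_subtractf by (simp add: field_simps)
  have card0: "(\<Prod>\<alpha>\<in>pos_even g P. 2 :: real) = 2 ^ card (even_half g)" unfolding prod_pos_even by simp
  have card1: "(\<Prod>\<alpha>\<in>pos_odd g P. ?C) = ?C ^ card (odd_half g)" unfolding prod_pos_odd by simp
  have C: "exp (s * H (?w (rho g P))) * (\<Prod>\<alpha>\<in>pos_even g P. 2 * exp (s * ((\<bar>H (?w \<alpha>)\<bar> - H (?w \<alpha>)) / 2)))
     * (\<Prod>\<beta>\<in>pos_odd g P. ?C * exp (s * ((H (?w \<beta>) - \<bar>H (?w \<beta>)\<bar>) / 2)))
     = 2 ^ card (even_half g) * ?C ^ card (odd_half g) * exp (s * expo u n m)"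
    unfolding prod.distrib card0 card1 exp_sum[OF fin(1), symmetric] exp_sum[OF fin(2), symmetric] E[symmetric] distrib_left exp_add sum_distrib_left
    by (simp only: mult_ac)
  have ev: "1 - chr s (- \<gamma>) = of_real (exp (- (s * H \<gamma> / 2))) * sh (s * H \<gamma>)" for \<gamma>
  proof -
    have "1 - exp (- (x :: real)) = exp (- (x / 2)) * (exp (x / 2) - exp (- x / 2))" for x
      by (simp add: right_diff_distrib flip: exp_add)
    then have "complex_of_real (1 - exp (- (s * H \<gamma>))) = of_real (exp (- (s * H \<gamma> / 2)) * (exp (s * H \<gamma> / 2) - exp (- (s * H \<gamma>) / 2)))"
      by (simp only:)
    then show ?thesis unfolding chr_real sh_def of_real_mult of_real_diff of_real_1 .
  qed
  have od: "1 / (1 + chr s (- \<gamma>)) = of_real (exp (s * H \<gamma> / 2)) / ch (s * H \<gamma>)" for \<gamma>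
  proof -
    have "1 + exp (- (x :: real)) = exp (- (x / 2)) * (exp (x / 2) + exp (- x / 2))" for x
      by (simp add: distrib_left flip: exp_add)
    then have "complex_of_real (1 + exp (- (s * H \<gamma>))) = of_real (exp (- (s * H \<gamma> / 2)) * (exp (s * H \<gamma> / 2) + exp (- (s * H \<gamma>) / 2)))"
      by (simp only:)
    then have e: "1 + chr s (- \<gamma>) = of_real (exp (- (s * H \<gamma> / 2))) * ch (s * H \<gamma>)"
      unfolding chr_real ch_def of_real_mult of_real_add of_real_1 .
    have i: "complex_of_real (exp (- (s * H \<gamma> / 2))) = inverse (of_real (exp (s * H \<gamma> / 2)))" by (simp only: exp_minus of_real_inverse)
    show ?thesis unfolding e i by (simp only: divide_inverse inverse_mult_distrib inverse_inverse_eq mult_1_left)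
  qed
  have one: "chr s (?w (rho g P)) * (\<Prod>\<alpha>\<in>pos_even g P. of_real (exp (- (s * H (?w \<alpha>) / 2)))) * (\<Prod>\<beta>\<in>pos_odd g P. of_real (exp (s * H (?w \<beta>) / 2))) = 1"
  proof -
    have "exp (s * H (?w (rho g P))) * (\<Prod>\<alpha>\<in>pos_even g P. exp (- (s * H (?w \<alpha>) / 2))) * (\<Prod>\<beta>\<in>pos_odd g P. exp (s * H (?w \<beta>) / 2)) = 1"
    proof -
      have p0: "(\<Prod>\<alpha>\<in>pos_even g P. exp (- (s * H (?w \<alpha>) / 2))) = exp (- (s * (\<Sum>\<alpha>\<in>pos_even g P. H (?w \<alpha>)) / 2))"
        unfolding exp_sum[OF fin(1), symmetric] by (simp only: sum_negf sum_divide_distrib sum_distrib_left)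
      have p1: "(\<Prod>\<beta>\<in>pos_odd g P. exp (s * H (?w \<beta>) / 2)) = exp (s * (\<Sum>\<beta>\<in>pos_odd g P. H (?w \<beta>)) / 2)"
        unfolding exp_sum[OF fin(2), symmetric] by (simp only: sum_divide_distrib sum_distrib_left)
      have "s * ((A - B) / 2) + - (s * A / 2) + s * B / 2 = 0" for A B :: real by (simp add: field_simps)
      then show ?thesis unfolding p0 p1 twist_H_rho exp_add[symmetric] by (simp only: exp_zero)
    qed
    then have "complex_of_real (exp (s * H (?w (rho g P))) * (\<Prod>\<alpha>\<in>pos_even g P. exp (- (s * H (?w \<alpha>) / 2))) * (\<Prod>\<beta>\<in>pos_odd g P. exp (s * H (?w \<beta>) / 2))) = of_real 1" by (rule arg_cong)
    then show ?thesis unfolding of_real_mult of_real_prod of_real_1 chr_def .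
  qed
  have mH: "s * H (?w (- \<alpha>)) = - (s * H (?w \<alpha>))" for \<alpha> by (simp add: twist_uminus H_uminus)
  have "chr s (?w (rho g P)) * (\<Prod>\<alpha>\<in>pos_even g P. 1 - chr s (- ?w \<alpha>)) * (\<Prod>\<beta>\<in>pos_odd g P. 1 / (1 + chr s (- ?w \<beta>)))
    = (chr s (?w (rho g P)) * (\<Prod>\<alpha>\<in>pos_even g P. of_real (exp (- (s * H (?w \<alpha>) / 2)))) * (\<Prod>\<beta>\<in>pos_odd g P. of_real (exp (s * H (?w \<beta>) / 2))))
      * ((\<Prod>\<alpha>\<in>pos_even g P. sh (s * H (?w \<alpha>))) / (\<Prod>\<beta>\<in>pos_odd g P. ch (s * H (?w \<beta>))))"
    unfolding ev od prod.distrib prod_dividef by simp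
  also have "\<dots> = (\<Prod>\<alpha>\<in>pos_even g P. sh (s * H (?w \<alpha>))) / (\<Prod>\<beta>\<in>pos_odd g P. ch (s * H (?w \<beta>)))" unfolding one by simp
  also have "(\<Prod>\<alpha>\<in>pos_even g P. sh (s * H (?w \<alpha>))) = sg * (\<Prod>(c,d,b)\<in>even_half g. sh (s * hm u n m c + b * (s * hm u n m d)))"
    unfolding prod_pos_even sg_def prod.distrib[symmetric]
  proof (rule prod.cong[OF refl], clarify)
    fix c d b assume t: "(c, d, b) \<in> even_half g"
    have "s * H (?w (rt (c, d, b))) = s * hm u n m c + b * (s * hm u n m d)" using twist_H_rt[of c d b u n m] t by (simp add: algebra_simps)
    then show "sh (s * H (?w (if rt (c, d, b) \<in> P then rt (c, d, b) else - rt (c, d, b)))) = (if rt (c, d, b) \<in> P then 1 else - 1) * sh (s * hm u n m c + b * (s * hm u n m d))"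
      by (cases "rt (c, d, b) \<in> P") (simp_all only: if_True if_False mH sh_uminus mult_1_left mult_minus1 simp_thms)
  qed
  also have "(\<Prod>\<beta>\<in>pos_odd g P. ch (s * H (?w \<beta>))) = (\<Prod>(c,d,b)\<in>odd_half g. ch (s * hm u n m c + b * (s * hm u n m d)))"
    unfolding prod_pos_odd
  proof (rule prod.cong[OF refl], clarify)
    fix c d b assume t: "(c, d, b) \<in> odd_half g"
    have "s * H (?w (rt (c, d, b))) = s * hm u n m c + b * (s * hm u n m d)" using twist_H_rt[of c d b u n m] t by (simp add: algebra_simps)
    then show "ch (s * H (?w (if rt (c, d, b) \<in> P then rt (c, d, b) else - rt (c, d, b)))) = ch (s * hm u n m c + b * (s * hm u n m d))"
      by (cases "rt (c, d, b) \<in> P") (simp_all only: if_True if_False mH ch_uminus mult_1_left mult_minus1 simp_thms)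
  qed
  finally have V: "chr s (?w (rho g P)) * (\<Prod>\<alpha>\<in>pos_even g P. 1 - chr s (- ?w \<alpha>)) * (\<Prod>\<beta>\<in>pos_odd g P. 1 / (1 + chr s (- ?w \<beta>)))
     = sg * val (\<lambda>c. s * hm u n m c)" unfolding val_def times_divide_eq_right .
  have T: "transl_den g P ?w = fmult (fmult (fexp (?w (rho g P))) (finprod R (\<lambda>\<alpha>. fexp 0 - fexp (- ?w \<alpha>)) (pos_even g P))) (finprod R (\<lambda>\<beta>. inv_one_plus g P (?w \<beta>)) (pos_odd g P))"
    unfolding transl_den_def by (simp add: R_simps)
  show ?thesis using B unfolding E C V T .
qed

end

section \<open>Sums over the translation group\<close>

context comm_monoid_set
begin

lemma triangle:
  assumes "\<And>k i k' i'. p k i = p k' i' \<Longrightarrow> k = k' \<and> i = i'"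
  shows "F w ((\<lambda>(k, i). p k i) ` (SIGMA k:{..<n::nat}. {..<k})) = F (\<lambda>k. F (\<lambda>i. w (p k i)) {..<k}) {..<n}"
proof -
  have inj: "inj_on (\<lambda>(k, i). p k i) (SIGMA k:{..<n::nat}. {..<k})" using assms by (auto simp: inj_on_def)
  have "F w ((\<lambda>(k, i). p k i) ` (SIGMA k:{..<n::nat}. {..<k})) = F (case_prod (\<lambda>k i. w (p k i))) (SIGMA k:{..<n::nat}. {..<k})"
    unfolding reindex[OF inj] by (rule cong) auto
  also have "\<dots> = F (\<lambda>k. F (\<lambda>i. w (p k i)) {..<k}) {..<n}" by (rule Sigma[symmetric]) auto
  finally show ?thesis .
qed

lemma rectangle:
  assumes "\<And>k i k' i'. p k i = p k' i' \<Longrightarrow> k = k' \<and> i = i'"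
  shows "F w ((\<lambda>(i, j). p i j) ` ({..<m::nat} \<times> {..<n::nat})) = F (\<lambda>i. F (\<lambda>j. w (p i j)) {..<n}) {..<m}"
proof -
  have inj: "inj_on (\<lambda>(i, j). p i j) ({..<m} \<times> {..<n})" using assms by (auto simp: inj_on_def)
  have "F w ((\<lambda>(i, j). p i j) ` ({..<m} \<times> {..<n})) = F (case_prod (\<lambda>i j. w (p i j))) ({..<m} \<times> {..<n})"
    unfolding reindex[OF inj] by (rule cong) auto
  also have "\<dots> = F (\<lambda>i. F (\<lambda>j. w (p i j)) {..<n}) {..<m}" by (rule cartesian_product[symmetric])
  finally show ?thesis .
qed

lemma triangles:
  "F w ((\<lambda>(k, i). (CEps (Suc i), CEps (Suc k), b)) ` (SIGMA k:{..<n::nat}. {..<k})) = F (\<lambda>k. F (\<lambda>i. w (CEps (Suc i), CEps (Suc k), b)) {..<k}) {..<n}"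
  "F w ((\<lambda>(k, i). (CDlt (Suc i), CDlt (Suc k), b)) ` (SIGMA k:{..<n::nat}. {..<k})) = F (\<lambda>k. F (\<lambda>i. w (CDlt (Suc i), CDlt (Suc k), b)) {..<k}) {..<n}"
  "F w ((\<lambda>(i, j). (CEps (Suc i), CDlt (Suc j), b)) ` ({..<m::nat} \<times> {..<n})) = F (\<lambda>i. F (\<lambda>j. w (CEps (Suc i), CDlt (Suc j), b)) {..<n}) {..<m}"
  by (rule triangle, simp, rule triangle, simp, rule rectangle, simp)

lemma even_half_GL:
  "F w (even_half (GL n)) = F (\<lambda>k. F (\<lambda>i. w (CEps (Suc i), CEps (Suc k), -1)) {..<k}) {..<n}
     \<^bold>* F (\<lambda>k. F (\<lambda>i. w (CDlt (Suc i), CDlt (Suc k), -1)) {..<k}) {..<n}"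
proof -
  have "F w (even_half (GL n)) = F w ((\<lambda>(k, i). (CEps (Suc i), CEps (Suc k), -1)) ` (SIGMA k:{..<n}. {..<k}))
    \<^bold>* F w ((\<lambda>(k, i). (CDlt (Suc i), CDlt (Suc k), -1)) ` (SIGMA k:{..<n}. {..<k}))"
    unfolding even_half.simps by (rule union_disjoint) auto
  then show ?thesis by (simp only: triangles)
qed

lemma odd_half_GL:
  "F w (odd_half (GL n)) = F (\<lambda>i. F (\<lambda>j. w (CEps (Suc i), CDlt (Suc j), -1)) {..<n}) {..<n}"
  by (simp only: odd_half.simps triangles)

lemma even_half_OSP:
  "F w (even_half (OSP n)) = F (\<lambda>k. F (\<lambda>i. w (CEps (Suc i), CEps (Suc k), 1) \<^bold>* w (CEps (Suc i), CEps (Suc k), -1)) {..<k}) {..<Suc n}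
     \<^bold>* (F (\<lambda>k. F (\<lambda>i. w (CDlt (Suc i), CDlt (Suc k), 1) \<^bold>* w (CDlt (Suc i), CDlt (Suc k), -1)) {..<k}) {..<n}
     \<^bold>* F (\<lambda>i. w (CDlt (Suc i), CDlt (Suc i), 1)) {..<n})"
proof -
  let ?A = "\<lambda>u b n. (\<lambda>(k, i). (u (Suc i) :: coord, u (Suc k) :: coord, b :: real)) ` (SIGMA k:{..<n}. {..<k})"
  have "F w (even_half (OSP n)) = (F w (?A CEps 1 (Suc n)) \<^bold>* F w (?A CEps (-1) (Suc n)))
     \<^bold>* ((F w (?A CDlt 1 n) \<^bold>* F w (?A CDlt (-1) n)) \<^bold>* F w ((\<lambda>i. (CDlt (Suc i), CDlt (Suc i), 1)) ` {..<n}))"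
    unfolding even_half.simps
    by (subst union_disjoint, simp, simp, force, subst union_disjoint, simp, simp, force,
        subst union_disjoint, simp, simp, force, subst union_disjoint, simp, simp, force, rule refl)
  moreover have "F w ((\<lambda>i. (CDlt (Suc i), CDlt (Suc i), 1)) ` {..<n}) = F (\<lambda>i. w (CDlt (Suc i), CDlt (Suc i), 1)) {..<n}"
    by (subst reindex) (auto simp: inj_on_def o_def)
  ultimately show ?thesis by (simp only: distrib triangles)
qed

lemma odd_half_OSP:
  "F w (odd_half (OSP n)) = F (\<lambda>i. F (\<lambda>j. w (CEps (Suc i), CDlt (Suc j), 1) \<^bold>* w (CEps (Suc i), CDlt (Suc j), -1)) {..<n}) {..<Suc n}"
proof -
  let ?A = "\<lambda>b. (\<lambda>(i, j). (CEps (Suc i), CDlt (Suc j), b :: real)) ` ({..<Suc n} \<times> {..<n})"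
  have "F w (odd_half (OSP n)) = F w (?A 1) \<^bold>* F w (?A (-1))"
    unfolding odd_half.simps by (rule union_disjoint) auto
  then show ?thesis by (simp only: distrib triangles)
qed

end

lemma triangle_sum:
  fixes x :: "nat \<Rightarrow> real"
  shows "(\<Sum>k<n. \<Sum>i<k. x i + x k) + (\<Sum>i<n. x i) = real n * (\<Sum>i<n. x i)"
  by (induction n) (simp_all add: sum.distrib algebra_simps)

lemma halves_bound:
  fixes a a' b b' c c' x :: real
  assumes "c - c' \<le> - x" "a \<le> b + c" "c' \<le> a' + b'"
  shows "(a - a') / 2 \<le> (b + b') / 2 - x / 2"
proof -
  have "a - a' \<le> b + b' - x" using assms by linarith
  then have "(a - a') / 2 \<le> (b + b' - x) / 2" by (rule divide_right_mono) simp
  then show ?thesis by (simp only: diff_divide_distrib)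
qed

text \<open>
  The lattice of a translation group is that of the \<open>\<delta>\<close> or, for
  \<open>gl(n|n)\<close> only, of the \<open>\<epsilon>\<close>.
\<close>

definition admissible :: "superalgebra \<Rightarrow> (nat \<Rightarrow> coord) \<Rightarrow> nat \<Rightarrow> bool" where
  "admissible g u n \<longleftrightarrow> (g = OSP n \<and> u = CDlt) \<or> (g = GL n \<and> (u = CDlt \<or> u = CEps))"

abbreviation "shifts (n::nat) \<equiv> PiE {0..<n} (\<lambda>_. UNIV :: int set)"

lemma shifts_level_finite: "finite {m \<in> shifts n. (\<Sum>i<n. \<bar>real_of_int (m i)\<bar>) \<le> B}"
proof (rule finite_subset)
  show "{m \<in> shifts n. (\<Sum>i<n. \<bar>real_of_int (m i)\<bar>) \<le> B} \<subseteq> PiE {0..<n} (\<lambda>_. {- \<lceil>B\<rceil>..\<lceil>B\<rceil>})"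
  proof
    fix m assume m: "m \<in> {m \<in> shifts n. (\<Sum>i<n. \<bar>real_of_int (m i)\<bar>) \<le> B}"
    have "m i \<in> {- \<lceil>B\<rceil>..\<lceil>B\<rceil>}" if "i < n" for i
    proof -
      have "\<bar>real_of_int (m i)\<bar> \<le> (\<Sum>i<n. \<bar>real_of_int (m i)\<bar>)" using that by (intro member_le_sum) auto
      then have "\<bar>real_of_int (m i)\<bar> \<le> B" using m by simp
      then have "real_of_int \<bar>m i\<bar> \<le> of_int \<lceil>B\<rceil>" using le_of_int_ceiling[of B] unfolding of_int_abs by (rule order_trans)
      then have "\<bar>m i\<bar> \<le> \<lceil>B\<rceil>" by (simp only: of_int_le_iff)
      then show ?thesis unfolding atLeastAtMost_iff by linarith
    qed
    then show "m \<in> PiE {0..<n} (\<lambda>_. {- \<lceil>B\<rceil>..\<lceil>B\<rceil>})" using m by (auto simp: PiE_def)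
  qed
qed (intro finite_PiE; simp)

lemma shifts_exp_summable:
  assumes "a > 0"
  shows "(\<lambda>m. exp (- (a * (\<Sum>i<n. \<bar>real_of_int (m i)\<bar>)))) summable_on shifts n"
proof -
  have s: "(\<lambda>x::int. norm (exp (- (a * \<bar>real_of_int x\<bar>)))) summable_on UNIV"
  proof (rule summable_on_int_bound[where r="exp (- a)" and K=1])
    fix x :: int
    have "\<bar>real_of_int x\<bar> = real (nat \<bar>x\<bar>)" by simp
    then show "norm (exp (- (a * \<bar>real_of_int x\<bar>))) \<le> 1 * exp (- a) ^ nat \<bar>x\<bar>"
      by (simp add: exp_of_nat_mult[symmetric] mult.commute)
  qed (use assms in auto)
  have "(\<lambda>m. norm (\<Prod>i\<in>{0..<n}. exp (- (a * \<bar>real_of_int (m i)\<bar>)))) summable_on shifts n"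
    using abs_summable_on_prod_PiE[of "{0..<n}" "\<lambda>_. UNIV" "\<lambda>_ x. exp (- (a * \<bar>real_of_int x\<bar>))"] s
    unfolding abs_summable_equivalent[symmetric] by auto
  moreover have "norm (\<Prod>i\<in>{0..<n}. exp (- (a * \<bar>real_of_int (m i)\<bar>))) = exp (- (a * (\<Sum>i<n. \<bar>real_of_int (m i)\<bar>)))" for m
    by (simp add: exp_sum[symmetric] sum_negf sum_distrib_left atLeast0LessThan prod_nonneg)
  ultimately show ?thesis by simp
qed

context datum
begin

lemma mm_simps [simp]:
  "mm CDlt n m (CDlt (Suc i)) = (if i < n then m i else 0)" "mm CDlt n m (CEps j) = 0"
  "mm CEps n m (CEps (Suc i)) = (if i < n then m i else 0)" "mm CEps n m (CDlt j) = 0"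
  by (simp_all add: mm_def)

text \<open>
  By the triangle inequality the even roots contribute at most \<open>n - 1\<close> (for
  \<open>gl(n|n)\<close>) or \<open>2 n\<close> (for \<open>D(n+1|n)\<close>) times the size of the
  translation, whereas the odd roots contribute exactly \<open>n\<close> or \<open>2 (n + 1)\<close>
  times that size.
\<close>

lemma mm_growth:
  assumes "admissible g u n"
  shows "(\<Sum>(c,d,b)\<in>even_half g. \<bar>of_int (mm u n m c) + b * of_int (mm u n m d)\<bar>)
       - (\<Sum>(c,d,b)\<in>odd_half g. \<bar>of_int (mm u n m c) + b * of_int (mm u n m d)\<bar>) \<le> - (\<Sum>i<n. \<bar>real_of_int (m i)\<bar>)"
proof -
  let ?x = "\<lambda>i. \<bar>real_of_int (m i)\<bar>"
  have tri: "(\<Sum>k<n. \<Sum>i<k. \<bar>real_of_int (m i) - of_int (m k)\<bar>) \<le> (\<Sum>k<n. \<Sum>i<k. ?x i + ?x k)"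
    by (intro sum_mono) linarith
  have tri2: "(\<Sum>k<n. \<Sum>i<k. \<bar>real_of_int (m i) + of_int (m k)\<bar> + \<bar>real_of_int (m i) - of_int (m k)\<bar>) \<le> (\<Sum>k<n. \<Sum>i<k. 2 * (?x i + ?x k))"
  proof (intro sum_mono)
    have "\<bar>a + b\<bar> + \<bar>a - b\<bar> \<le> 2 * (\<bar>a\<bar> + \<bar>b\<bar>)" for a b :: real
      by (rule order_trans[OF add_mono[OF abs_triangle_ineq abs_triangle_ineq4]]) simp
    then show "\<bar>real_of_int (m i) + of_int (m k)\<bar> + \<bar>real_of_int (m i) - of_int (m k)\<bar> \<le> 2 * (?x i + ?x k)" for i k .
  qed
  have tri3: "(\<Sum>k<n. \<Sum>i<k. 2 * (?x i + ?x k)) = 2 * (\<Sum>k<n. \<Sum>i<k. ?x i + ?x k)" by (simp only: sum_distrib_left)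
  note ts = triangle_sum[of ?x n]
  have rn: "(\<Sum>k<n. \<Sum>i<k. f (if i < n then a i else z) (if k < n then a k else z)) = (\<Sum>k<n. \<Sum>i<k. f (a i) (a k))" for f :: "int \<Rightarrow> int \<Rightarrow> real" and a z
    by (intro sum.cong) auto
  from assms consider "g = OSP n" "u = CDlt" | "g = GL n" "u = CDlt" | "g = GL n" "u = CEps" unfolding admissible_def by blast
  then show ?thesis
  proof cases
    case 1
    have "(\<Sum>(c,d,b)\<in>even_half g. \<bar>of_int (mm u n m c) + b * of_int (mm u n m d)\<bar>) = (\<Sum>k<n. \<Sum>i<k. \<bar>real_of_int (m i) + of_int (m k)\<bar> + \<bar>real_of_int (m i) - of_int (m k)\<bar>) + (\<Sum>i<n. 2 * ?x i)"
      unfolding 1 sum.even_half_OSP using rn[of "\<lambda>x y. \<bar>real_of_int x + of_int y\<bar> + \<bar>real_of_int x - of_int y\<bar>" m 0]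
      by (simp add: abs_mult flip: mult_2)
    moreover have "(\<Sum>(c,d,b)\<in>odd_half g. \<bar>of_int (mm u n m c) + b * of_int (mm u n m d)\<bar>) = 2 * (\<Sum>i<n. ?x i) + 2 * (real n * (\<Sum>i<n. ?x i))"
      unfolding 1 sum.odd_half_OSP by (simp add: sum_distrib_left[symmetric] algebra_simps flip: mult_2)
    moreover have "(\<Sum>i<n. 2 * ?x i) = 2 * (\<Sum>i<n. ?x i)" by (simp only: sum_distrib_left)
    moreover have "(\<Sum>i<n. ?x i) \<ge> 0" by (intro sum_nonneg) auto
    ultimately show ?thesis using tri2 tri3 ts by linarith
  next
    case 2
    have "(\<Sum>(c,d,b)\<in>even_half g. \<bar>of_int (mm u n m c) + b * of_int (mm u n m d)\<bar>) = (\<Sum>k<n. \<Sum>i<k. \<bar>real_of_int (m i) - of_int (m k)\<bar>)"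
      unfolding 2 sum.even_half_GL using rn[of "\<lambda>x y. \<bar>real_of_int x - of_int y\<bar>" m 0] by simp
    moreover have "(\<Sum>(c,d,b)\<in>odd_half g. \<bar>of_int (mm u n m c) + b * of_int (mm u n m d)\<bar>) = real n * (\<Sum>i<n. ?x i)"
      unfolding 2 sum.odd_half_GL by simp
    ultimately show ?thesis using tri ts by linarith
  next
    case 3
    have "(\<Sum>(c,d,b)\<in>even_half g. \<bar>of_int (mm u n m c) + b * of_int (mm u n m d)\<bar>) = (\<Sum>k<n. \<Sum>i<k. \<bar>real_of_int (m i) - of_int (m k)\<bar>)"
      unfolding 3 sum.even_half_GL using rn[of "\<lambda>x y. \<bar>real_of_int x - of_int y\<bar>" m 0] by simp
    moreover have "(\<Sum>(c,d,b)\<in>odd_half g. \<bar>of_int (mm u n m c) + b * of_int (mm u n m d)\<bar>) = real n * (\<Sum>i<n. ?x i)"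
      unfolding 3 sum.odd_half_GL by (simp add: sum_distrib_left)
    ultimately show ?thesis using tri ts by linarith
  qed
qed

definition base :: real where
  "base = ((\<Sum>(c,d,b)\<in>even_half g. \<bar>h c + b * h d\<bar>) + (\<Sum>(c,d,b)\<in>odd_half g. \<bar>h c + b * h d\<bar>)) / 2"

lemma expo_growth:
  assumes "admissible g u n"
  shows "expo u n m \<le> base - N / 2 * (\<Sum>i<n. \<bar>real_of_int (m i)\<bar>)"
proof -
  let ?a = "\<lambda>c d b. \<bar>hm u n m c + b * hm u n m d\<bar>" and ?b = "\<lambda>c d b. \<bar>h c + b * h d\<bar>"
    and ?c = "\<lambda>c d b. \<bar>of_int (mm u n m c) + b * of_int (mm u n m d)\<bar>"
  have p: "\<bar>?a c d b - N * ?c c d b\<bar> \<le> ?b c d b" for c d b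
  proof -
    have "hm u n m c + b * hm u n m d = (h c + b * h d) - N * (of_int (mm u n m c) + b * of_int (mm u n m d))"
      by (simp add: hm_def algebra_simps)
    moreover have "N * ?c c d b = \<bar>N * (of_int (mm u n m c) + b * of_int (mm u n m d))\<bar>" using imag_pos by (simp add: abs_mult)
    ultimately show ?thesis by linarith
  qed
  have e: "(\<Sum>(c,d,b)\<in>even_half g. ?a c d b) \<le> (\<Sum>(c,d,b)\<in>even_half g. ?b c d b) + N * (\<Sum>(c,d,b)\<in>even_half g. ?c c d b)"
    unfolding sum_distrib_left sum.distrib[symmetric]
  proof (rule sum_mono, clarify)
    fix c d b
    have "\<bar>?a c d b - N * ?c c d b\<bar> \<le> ?b c d b" by (rule p)
    then show "?a c d b \<le> ?b c d b + N * ?c c d b" by linarith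
  qed
  have o: "N * (\<Sum>(c,d,b)\<in>odd_half g. ?c c d b) \<le> (\<Sum>(c,d,b)\<in>odd_half g. ?a c d b) + (\<Sum>(c,d,b)\<in>odd_half g. ?b c d b)"
    unfolding sum_distrib_left sum.distrib[symmetric]
  proof (rule sum_mono, clarify)
    fix c d b
    have "\<bar>?a c d b - N * ?c c d b\<bar> \<le> ?b c d b" by (rule p)
    then show "N * ?c c d b \<le> ?a c d b + ?b c d b" by linarith
  qed
  have "N * ((\<Sum>(c,d,b)\<in>even_half g. ?c c d b) - (\<Sum>(c,d,b)\<in>odd_half g. ?c c d b)) \<le> N * (- (\<Sum>i<n. \<bar>real_of_int (m i)\<bar>))"
    using mm_growth[OF assms, of m] imag_pos by (intro mult_left_mono) auto
  then have "N * (\<Sum>(c,d,b)\<in>even_half g. ?c c d b) - N * (\<Sum>(c,d,b)\<in>odd_half g. ?c c d b) \<le> - (N * (\<Sum>i<n. \<bar>real_of_int (m i)\<bar>))"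
    by (simp only: right_diff_distrib mult_minus_right)
  from halves_bound[OF this e o] show ?thesis unfolding expo_def base_def times_divide_eq_left .
qed

lemma twist_inj:
  assumes "admissible g u n" shows "inj_on (twist u n) (shifts n)"
proof (rule inj_onI)
  fix m m' assume m: "m \<in> shifts n" "m' \<in> shifts n" and e: "twist u n m = twist u n m'"
  have ui: "u = CDlt \<or> u = CEps" using assms by (auto simp: admissible_def)
  have v: "twist u n m (unit_weight (u (Suc i))) CImag = - of_int (m i)" if "i < n" for i m
  proof -
    have "(\<Sum>j<n. of_int (m j) * unit_weight (u (Suc i)) (u (Suc j))) = (\<Sum>j<n. if j = i then complex_of_int (m i) else 0)"
      using ui by (intro sum.cong) (auto simp: unit_weight_def)
    then have "(\<Sum>j<n. of_int (m j) * unit_weight (u (Suc i)) (u (Suc j))) = complex_of_int (m i)" using that by simp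
    then show ?thesis using ui by (auto simp: twist_def scl_def unit_weight_def)
  qed
  show "m = m'"
  proof (rule PiE_ext[OF m])
    fix i assume "i \<in> {0..<n}"
    then have "- complex_of_int (m i) = - of_int (m' i)" using v[of i m] v[of i m'] e by simp
    then show "m i = m' i" by simp
  qed
qed

end

context character
begin

text \<open>
  The growth estimate shows at once that only finitely many translations reach a given height and that
  the norms are summable.
\<close>

lemma transl_sum:
  assumes adm: "admissible g u n" and M: "M \<subseteq> shifts n"
  shows "\<And>w. w \<in> twist u n ` M \<Longrightarrow> good (transl_den g P w)"
    and "coeff_finite (twist u n ` M) (transl_den g P)"
    and "nov (coeff_sum (twist u n ` M) (transl_den g P))"
    and "abl (coeff_sum (twist u n ` M) (transl_den g P))"
    and "\<And>\<nu>. coeff_sum (twist u n ` M) (transl_den g P) \<nu> \<noteq> 0 \<Longrightarrow> \<nu> \<in> Lam"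
    and "ev (coeff_sum (twist u n ` M) (transl_den g P)) = sg * (\<Sum>\<^sub>\<infinity>m\<in>M. val (\<lambda>c. s * hm u n m c))"
proof -
  let ?t = "transl_den g P" and ?T = "twist u n ` M"
  obtain k where k: "k > 0" "\<And>\<gamma>. \<gamma> \<in> aff_pos g P \<Longrightarrow> H \<gamma> \<ge> k" using H_min by blast
  define C where "C = 2 ^ card (even_half g) * (1 / (1 - exp (- (s * k)))) ^ card (odd_half g) * exp (s * base)"
  have B: "bdd (?t (twist u n m)) (expo u n m) (2 ^ card (even_half g) * (1 / (1 - exp (- (s * k)))) ^ card (odd_half g) * exp (s * expo u n m))
     (sg * val (\<lambda>c. s * hm u n m c))" for m by (rule transl_den_bdd) (use k in auto)
  show good: "good (?t w)" if w: "w \<in> ?T" for w using w B unfolding bdd_def by auto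
  have Hb: "H \<nu> \<le> base - N / 2 * (\<Sum>i<n. \<bar>real_of_int (m i)\<bar>)" if nz: "?t (twist u n m) \<nu> \<noteq> 0" for m \<nu>
    using B[of m] nz expo_growth[OF adm, of m] unfolding bdd_def by (meson order_trans)
  define L where "L B = {m \<in> shifts n. (\<Sum>i<n. \<bar>real_of_int (m i)\<bar>) \<le> (base - B) * 2 / N}" for B
  have L: "finite (L B)" for B unfolding L_def by (rule shifts_level_finite)
  have inL: "m \<in> L B" if "m \<in> M" "?t (twist u n m) \<nu> \<noteq> 0" "B \<le> H \<nu>" for m B \<nu>
    using Hb[OF that(2)] that M imag_pos unfolding L_def by (auto simp: field_simps)
  show cf: "coeff_finite ?T ?t" unfolding coeff_finite_def
  proof
    fix \<nu>
    have "{w \<in> ?T. ?t w \<nu> \<noteq> 0} \<subseteq> twist u n ` L (H \<nu>)" using inL[OF _ _ order_refl] by blast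
    then show "finite {w \<in> ?T. ?t w \<nu> \<noteq> 0}" by (rule finite_subset) (intro finite_imageI L)
  qed
  have nvt: "nov (?t (twist u n m))" for m using B[of m] carrier_nov unfolding bdd_def good_def by blast
  show "nov (coeff_sum ?T ?t)" unfolding nov_def
  proof
    fix B
    have "{\<nu>. coeff_sum ?T ?t \<nu> \<noteq> 0 \<and> B \<le> H \<nu>} \<subseteq> (\<Union>m\<in>L B. {\<nu>. ?t (twist u n m) \<nu> \<noteq> 0 \<and> B \<le> H \<nu>})"
    proof
      fix \<nu> assume n: "\<nu> \<in> {\<nu>. coeff_sum ?T ?t \<nu> \<noteq> 0 \<and> B \<le> H \<nu>}"
      have "\<exists>w. w \<in> ?T \<and> ?t w \<nu> \<noteq> 0"
      proof (rule ccontr)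
        assume "\<not> ?thesis"
        then have "{w. w \<in> ?T \<and> ?t w \<nu> \<noteq> 0} = {}" by blast
        moreover have "coeff_sum ?T ?t \<nu> \<noteq> 0" using n by simp
        ultimately show False unfolding coeff_sum_def by (simp only: sum.empty)
      qed
      then obtain m where m: "m \<in> M" "?t (twist u n m) \<nu> \<noteq> 0" by blast
      then show "\<nu> \<in> (\<Union>m\<in>L B. {\<nu>. ?t (twist u n m) \<nu> \<noteq> 0 \<and> B \<le> H \<nu>})" using inL[OF m, of B] n by blast
    qed
    then show "finite {\<nu>. coeff_sum ?T ?t \<nu> \<noteq> 0 \<and> B \<le> H \<nu>}"
      by (rule finite_subset) (use L nvt in \<open>simp add: nov_def\<close>)
  qed
  have inj: "inj_on (twist u n) M" using twist_inj[OF adm] M by (rule inj_on_subset)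
  have sM: "(\<lambda>m. nm (?t (twist u n m))) summable_on M"
  proof (rule summable_on_comparison_test)
    have "(\<lambda>m. exp (- (s * N / 2 * (\<Sum>i<n. \<bar>real_of_int (m i)\<bar>)))) summable_on shifts n"
      using s1 imag_pos by (intro shifts_exp_summable) auto
    then show "(\<lambda>m. C * exp (- (s * N / 2 * (\<Sum>i<n. \<bar>real_of_int (m i)\<bar>)))) summable_on M"
      by (intro summable_on_cmult_right summable_on_subset_banach[OF _ M])
    fix m
    have "s * expo u n m \<le> s * (base - N / 2 * (\<Sum>i<n. \<bar>real_of_int (m i)\<bar>))" using expo_growth[OF adm] s1 by (intro mult_left_mono) auto
    then have "exp (s * expo u n m) \<le> exp (s * base) * exp (- (s * N / 2 * (\<Sum>i<n. \<bar>real_of_int (m i)\<bar>)))"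
      unfolding exp_add[symmetric] exp_le_cancel_iff by (simp add: algebra_simps)
    moreover have "2 ^ card (even_half g) * (1 / (1 - exp (- (s * k)))) ^ card (odd_half g) \<ge> 0"
      using s1 k(1) by (intro mult_nonneg_nonneg zero_le_power) auto
    ultimately have "2 ^ card (even_half g) * (1 / (1 - exp (- (s * k)))) ^ card (odd_half g) * exp (s * expo u n m)
       \<le> 2 ^ card (even_half g) * (1 / (1 - exp (- (s * k)))) ^ card (odd_half g) * (exp (s * base) * exp (- (s * N / 2 * (\<Sum>i<n. \<bar>real_of_int (m i)\<bar>))))"
      by (rule mult_left_mono)
    moreover have "nm (?t (twist u n m)) \<le> 2 ^ card (even_half g) * (1 / (1 - exp (- (s * k)))) ^ card (odd_half g) * exp (s * expo u n m)"
      using B[of m] unfolding bdd_def by blast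
    ultimately show "nm (?t (twist u n m)) \<le> C * exp (- (s * N / 2 * (\<Sum>i<n. \<bar>real_of_int (m i)\<bar>)))"
      unfolding C_def mult.assoc by (rule order_trans[rotated])
  qed (rule nm_nonneg)
  then have sm: "(\<lambda>w. nm (?t w)) summable_on ?T" using summable_on_reindex[OF inj, of "\<lambda>w. nm (?t w)"] by (simp add: o_def)
  have E3: "ev (coeff_sum ?T ?t) = (\<Sum>\<^sub>\<infinity>w\<in>?T. ev (?t w))" by (rule coeff_sum_ev(3)[OF good cf sm])
  show "abl (coeff_sum ?T ?t)" by (rule coeff_sum_ev(1)[OF good cf sm])
  show "\<nu> \<in> Lam" if nz: "coeff_sum ?T ?t \<nu> \<noteq> 0" for \<nu> by (rule coeff_sum_ev(2)[OF good cf sm nz])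
  have "ev (coeff_sum ?T ?t) = (\<Sum>\<^sub>\<infinity>m\<in>M. ev (?t (twist u n m)))" unfolding E3 infsum_reindex[OF inj] by (simp add: o_def)
  also have "\<dots> = (\<Sum>\<^sub>\<infinity>m\<in>M. sg * val (\<lambda>c. s * hm u n m c))" using B by (simp add: bdd_def)
  also have "\<dots> = sg * (\<Sum>\<^sub>\<infinity>m\<in>M. val (\<lambda>c. s * hm u n m c))" by (rule infsum_cmult_right')
  finally show "ev (coeff_sum ?T ?t) = sg * (\<Sum>\<^sub>\<infinity>m\<in>M. val (\<lambda>c. s * hm u n m c))" .
qed

end

section \<open>Evaluation of the affine denominator\<close>

context character
begin

text \<open>
  For constant term one, the norm of the remaining terms is the norm of the whole less one, so
  multiplicativity of the norm bounds products of such sums.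
\<close>

lemma nm_minus_one:
  assumes "good a" "a 0 = 1" shows "nm (a - fexp 0) = nm a - 1"
proof -
  have e: "norm (trm a \<nu>) = norm (trm (a - fexp 0) \<nu>) + norm (trm (fexp 0) \<nu>)" for \<nu>
    using assms(2) by (cases "\<nu> = 0") (simp_all add: trm_def fexp_def)
  have "nm a = nm (a - fexp 0) + nm (fexp 0)"
    unfolding nm_def e using good_diff[OF assms(1) good_one] good_one by (intro infsum_add) (auto simp: good_def abl_def)
  then show ?thesis using abl_fexp(3)[of 0] chi_0 by simp
qed

text \<open>
  Sums with constant term one and all other terms in the negative cone at height at most \<open>-
  d\<close>.
\<close>

definition unip :: "real \<Rightarrow> real \<Rightarrow> fsum \<Rightarrow> bool" where
  "unip d c a \<longleftrightarrow> d > 0 \<and> good a \<and> a 0 = 1 \<and> (\<forall>\<nu>. a \<nu> \<noteq> 0 \<longrightarrow> - \<nu> \<in> Q \<and> (\<nu> = 0 \<or> H \<nu> \<le> - d)) \<and> nm a \<le> c"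

lemma unip_fmult:
  assumes "unip d c a" "unip d c' b" shows "unip d (c * c') (fmult a b)"
proof -
  have d: "d > 0" using assms by (simp add: unip_def)
  have one: "{\<mu>. a \<mu> \<noteq> 0 \<and> b (0 - \<mu>) \<noteq> 0} = {0}"
  proof -
    have "\<mu> = 0" if h: "a \<mu> \<noteq> 0" "b (0 - \<mu>) \<noteq> 0" for \<mu>
    proof (rule ccontr)
      assume n: "\<mu> \<noteq> 0"
      then have "H \<mu> \<le> - d" using assms(1) h(1) by (auto simp: unip_def)
      moreover have "0 - \<mu> \<noteq> 0" using n by simp
      then have "H (0 - \<mu>) \<le> - d" using assms(2) h(2) unfolding unip_def by blast
      moreover have "H (0 - \<mu>) = - H \<mu>" unfolding H_diff H_0 by simp
      ultimately show False using d by linarith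
    qed
    then show ?thesis using assms by (auto simp: unip_def)
  qed
  have "fmult a b 0 = 1" unfolding fmult_def one using assms by (simp add: unip_def)
  moreover have "- \<nu> \<in> Q \<and> (\<nu> = 0 \<or> H \<nu> \<le> - d)" if nz: "fmult a b \<nu> \<noteq> 0" for \<nu>
  proof -
    obtain \<mu> where m: "a \<mu> \<noteq> 0" "b (\<nu> - \<mu>) \<noteq> 0" using fmult_nonzero[OF nz] by blast
    have a: "- \<mu> \<in> Q" "\<mu> = 0 \<or> H \<mu> \<le> - d" using assms(1) m(1) by (auto simp: unip_def)
    have b: "- (\<nu> - \<mu>) \<in> Q" "\<nu> - \<mu> = 0 \<or> H (\<nu> - \<mu>) \<le> - d" using assms(2) m(2) unfolding unip_def by blast+
    have "- \<nu> = - \<mu> + - (\<nu> - \<mu>)" by simp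
    then have q: "- \<nu> \<in> Q" using Q_add[OF a(1) b(1)] by simp
    have e: "H \<nu> = H \<mu> + H (\<nu> - \<mu>)" unfolding H_diff by simp
    have z: "\<nu> - \<mu> = 0 \<Longrightarrow> H (\<nu> - \<mu>) = 0" "\<mu> = 0 \<Longrightarrow> H \<mu> = 0" by (simp_all only: H_0)
    consider "\<mu> = 0" "\<nu> - \<mu> = 0" | "H \<mu> \<le> - d" "H (\<nu> - \<mu>) \<le> 0" | "H \<mu> \<le> 0" "H (\<nu> - \<mu>) \<le> - d"
      using a(2) b(2) z d by linarith
    then have "\<nu> = 0 \<or> H \<nu> \<le> - d"
    proof cases
      case 1 then have "\<nu> = 0" by (simp only: diff_0_right)
      then show ?thesis ..
    qed (use e in linarith)+
    then show ?thesis using q by blast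
  qed
  moreover have "nm (fmult a b) \<le> c * c'"
  proof -
    have "nm a * nm b \<le> c * c'" using assms nm_nonneg[of a] nm_nonneg[of b] unfolding unip_def by (intro mult_mono) linarith+
    then show ?thesis using good_fmult(3)[of a b] assms by (simp add: unip_def)
  qed
  ultimately show ?thesis using assms good_fmult(1)[of a b] unfolding unip_def by blast
qed

lemma unip_one: "d > 0 \<Longrightarrow> unip d 1 (fexp 0)"
  unfolding unip_def using good_one abl_fexp(3)[of 0] chi_0 Q_0 by (auto simp: fexp_def)

lemma unip_finprod:
  assumes "d > 0" "finite A" "\<And>x. x \<in> A \<Longrightarrow> unip d c (F x)"
  shows "unip d (c ^ card A) (finprod R F A)"
proof -
  interpret comm_monoid R by (rule R_comm_monoid)
  show ?thesis using assms(2,3)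
  proof (induction A rule: finite_induct)
    case empty
    show ?case using unip_one[OF assms(1)] unfolding finprod_empty card.empty by (simp add: R_simps)
  next
    case (insert x A)
    have "F y \<in> carrier R" if "y \<in> insert x A" for y using insert.prems(1)[OF that] by (simp add: unip_def good_def)
    then have e: "finprod R F (insert x A) = F x \<otimes>\<^bsub>R\<^esub> finprod R F A"
      by (intro finprod_insert) (use insert.hyps in auto)
    have "unip d (c * c ^ card A) (fmult (F x) (finprod R F A))" by (rule unip_fmult) (use insert in auto)
    then show ?case unfolding e using insert.hyps by (simp add: R_simps)
  qed
qed

lemma unip_pow:
  assumes "unip d c a" shows "unip d (c ^ n) (a [^]\<^bsub>R\<^esub> (n::nat))"
proof -
  interpret comm_monoid R by (rule R_comm_monoid)
  have d: "d > 0" using assms by (simp add: unip_def)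
  show ?thesis
  proof (induction n)
    case 0
    have "a [^]\<^bsub>R\<^esub> (0::nat) = \<one>\<^bsub>R\<^esub>" by (rule nat_pow_0)
    then show ?case using unip_one[OF d] by (simp add: R_simps)
  next
    case (Suc n)
    have "a [^]\<^bsub>R\<^esub> (Suc n) = a [^]\<^bsub>R\<^esub> n \<otimes>\<^bsub>R\<^esub> a" by (rule nat_pow_Suc)
    then show ?case using unip_fmult[OF Suc assms] by (simp add: R_simps mult.commute)
  qed
qed

lemma unip_even:
  assumes "\<gamma> \<in> aff_pos g P" "\<gamma> \<in> Lam" "d > 0" "d \<le> H \<gamma>"
  shows "unip d (1 + exp (- (s * H \<gamma>))) (fexp 0 - fexp (- \<gamma>))"
proof -
  have gf: "good (fexp (- \<gamma>))" using good_fexp Lam_uminus[OF assms(2)] Lam_aff_weights by blast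
  have n: "- \<gamma> \<noteq> 0" using assms(3,4) H_uminus[of \<gamma>] H_0 by (metis minus_zero neg_equal_iff_equal not_le)
  have "- \<nu> \<in> Q \<and> (\<nu> = 0 \<or> H \<nu> \<le> - d)" if nz: "(fexp 0 - fexp (- \<gamma>)) \<nu> \<noteq> 0" for \<nu>
  proof -
    have "\<nu> = 0 \<or> \<nu> = - \<gamma>" using nz by (auto simp: fexp_def split: if_splits)
    then show ?thesis using Q_0 Q_gen[OF assms(1)] assms(4) by (auto simp: H_uminus)
  qed
  moreover have "(fexp 0 - fexp (- \<gamma>)) 0 = 1" using n by (auto simp: fexp_def)
  moreover have "nm (fexp 0 - fexp (- \<gamma>)) \<le> 1 + exp (- (s * H \<gamma>))"
    using ev_diff(2)[OF good_one gf] abl_fexp(3)[of 0] abl_fexp(3)[of "- \<gamma>"] chi_0 by (simp add: chr_def H_uminus H_0)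
  ultimately show ?thesis using good_diff[OF good_one gf] assms(3) unfolding unip_def by blast
qed

lemma unip_geom:
  assumes "\<gamma> \<in> aff_pos g P" "\<gamma> \<in> Lam" "d > 0" "d \<le> H \<gamma>" "c = 1 \<or> c = -1"
  shows "unip d (1 / (1 - exp (- (s * H \<gamma>)))) (geom c \<gamma>)"
proof -
  note gg = good_geom[OF assms(1,2,5)]
  have "\<nu> = 0 \<or> H \<nu> \<le> - d" if nz: "geom c \<gamma> \<nu> \<noteq> 0" for \<nu>
  proof -
    obtain k where k: "\<nu> = - scl (of_nat k) \<gamma>" using gg(5)[OF nz] by blast
    show ?thesis
    proof (cases "k = 0")
      case True then show ?thesis unfolding k by (simp add: scl_zero)
    next
      case False
      then have "1 * H \<gamma> \<le> real k * H \<gamma>" using assms(3,4) by (intro mult_right_mono) auto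
      then show ?thesis unfolding k by (simp add: H_uminus H_scl) (use assms in linarith)
    qed
  qed
  then show ?thesis unfolding unip_def using gg(1,3,4,6) assms(3) by (simp add: chr_def H_uminus)
qed

definition rootbound :: real where
  "rootbound = Max (insert 0 ((\<lambda>\<alpha>. \<bar>H \<alpha>\<bar>) ` roots g))"

lemma rootbound: "0 \<le> rootbound" "rootbound < N" "\<alpha> \<in> roots g \<Longrightarrow> \<bar>H \<alpha>\<bar> \<le> rootbound"
proof -
  have f: "finite (insert 0 ((\<lambda>\<alpha>. \<bar>H \<alpha>\<bar>) ` roots g))" using roots_finite by simp
  show "0 \<le> rootbound" unfolding rootbound_def using f by (intro Max_ge) auto
  show "rootbound < N" unfolding rootbound_def using f H_root_small imag_pos by (subst Max_less_iff) auto
  show "\<alpha> \<in> roots g \<Longrightarrow> \<bar>H \<alpha>\<bar> \<le> rootbound" unfolding rootbound_def using f by (intro Max_ge) auto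
qed

definition qr :: real where "qr = exp (- (s * N))"

lemma qr: "0 < qr" "qr < 1" using s1 imag_pos by (simp_all add: qr_def)

definition q :: complex where "q = of_real qr"

lemma q_kdelta: "chr s (- kdelta k) = q ^ k"
proof -
  have "exp (s * - (real k * N)) = qr ^ k" unfolding qr_def exp_of_nat_mult[symmetric] by (simp add: mult_ac)
  then show ?thesis by (simp add: chr_def H_uminus H_kdelta q_def)
qed

definition fac :: real where "fac = exp (s * rootbound) / (1 - exp (s * rootbound) * qr)"

lemma fac_pos: "exp (s * rootbound) * qr < 1" "fac \<ge> 0"
proof -
  have "s * rootbound < s * N" using rootbound(2) s1 by simp
  then show *: "exp (s * rootbound) * qr < 1" unfolding qr_def exp_add[symmetric] by simp
  show "fac \<ge> 0" unfolding fac_def using * by (intro divide_nonneg_nonneg) auto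
qed

lemma factor_bounds:
  assumes "k \<ge> 1" "real k * N - rootbound \<le> H \<gamma>"
  shows "real k * N - rootbound > 0" "1 + exp (- (s * H \<gamma>)) \<le> 1 + fac * qr ^ k" "1 / (1 - exp (- (s * H \<gamma>))) \<le> 1 + fac * qr ^ k"
proof -
  let ?e = "exp (s * rootbound)" and ?x = "exp (- (s * H \<gamma>))"
  have "1 * N \<le> real k * N" using assms(1) imag_pos by (intro mult_right_mono) auto
  then show "real k * N - rootbound > 0" using rootbound(2) by linarith
  have "s * (real k * N - rootbound) \<le> s * H \<gamma>" using assms(2) s1 by (intro mult_left_mono) auto
  then have x: "?x \<le> ?e * qr ^ k" unfolding qr_def exp_of_nat_mult[symmetric] exp_add[symmetric] exp_le_cancel_iff by (simp add: algebra_simps)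
  have k1: "qr ^ k \<le> qr ^ 1" using qr assms(1) by (intro power_decreasing) auto
  then have "?e * qr ^ k \<le> ?e * qr" by simp
  then have x1: "?x \<le> ?e * qr" using x by linarith
  have ek: "?e * qr ^ k \<le> fac * qr ^ k"
  proof (rule mult_right_mono)
    have "?e / 1 \<le> ?e / (1 - ?e * qr)" using fac_pos(1) qr by (intro divide_left_mono) auto
    then show "?e \<le> fac" by (simp add: fac_def)
  qed (use qr in simp)
  then show "1 + ?x \<le> 1 + fac * qr ^ k" using x by linarith
  have "1 - ?x \<noteq> 0" using x1 fac_pos(1) by linarith
  then have "1 / (1 - ?x) = 1 + ?x / (1 - ?x)" by (simp add: field_simps)
  also have "?x / (1 - ?x) \<le> (?e * qr ^ k) / (1 - ?e * qr)" using x x1 fac_pos(1) qr by (intro frac_le) auto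
  also have "\<dots> = fac * qr ^ k" by (simp add: fac_def)
  finally show "1 / (1 - ?x) \<le> 1 + fac * qr ^ k" by simp
qed

lemma unip_mono: "unip d c a \<Longrightarrow> c \<le> c' \<Longrightarrow> unip d c' a" by (auto simp: unip_def)

lemma shifted_root:
  assumes "\<alpha> \<in> roots g" "k \<ge> 1"
  shows "\<alpha> + kdelta k \<in> aff_pos g P" "\<alpha> + kdelta k \<in> Lam" "real k * N - rootbound \<le> H (\<alpha> + kdelta k)" "chr s (- (\<alpha> + kdelta k)) = q ^ k * chr s (- \<alpha>)"
proof -
  show "\<alpha> + kdelta k \<in> aff_pos g P" using assms unfolding aff_pos_cases by blast
  show "\<alpha> + kdelta k \<in> Lam" by (intro Lam_plus Lam_root assms Lam_scl Lam_im)
  show "real k * N - rootbound \<le> H (\<alpha> + kdelta k)" using rootbound(3)[OF assms(1)] by (simp add: H_plus H_kdelta abs_le_iff)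
  have "- (\<alpha> + kdelta k) = - \<alpha> + - kdelta k" by simp
  then show "chr s (- (\<alpha> + kdelta k)) = q ^ k * chr s (- \<alpha>)" by (simp only: chi_add q_kdelta mult.commute)
qed

lemma imag_root:
  assumes "k \<ge> 1"
  shows "kdelta k \<in> aff_pos g P" "kdelta k \<in> Lam" "real k * N - rootbound \<le> H (kdelta k)"
  using assms rootbound(1) by (auto simp: aff_pos_cases H_kdelta intro: Lam_scl Lam_im)

text \<open>
  The norm of the \<open>k\<close>-th factor exceeds one by at most a multiple of the
  \<open>k\<close>-th power of the value of \<open>q\<close>.
\<close>

lemma inf_prod_unip:
  assumes "\<And>k. k \<ge> 1 \<Longrightarrow> unip (real k * N - rootbound) ((1 + fac * qr ^ k) ^ p) (F k)"
  shows "good (inf_prod g P F)" "(\<lambda>N. \<Prod>k=1..N. ev (F k)) \<longlonglongrightarrow> ev (inf_prod g P F)"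
proof -
  have pw: "(1 + x) ^ p - 1 \<le> real p * x * (1 + x) ^ p" if "x \<ge> 0" for x :: real and p
  proof (induction p)
    case 0 show ?case by simp
  next
    case (Suc p)
    have "(1 + x) ^ Suc p - 1 = ((1 + x) ^ p - 1) + x * (1 + x) ^ p" by (simp add: algebra_simps)
    also have "\<dots> \<le> real (Suc p) * x * (1 + x) ^ p" using Suc by (simp add: algebra_simps)
    also have "\<dots> \<le> real (Suc p) * x * (1 + x) ^ Suc p" using that by (intro mult_left_mono power_increasing) auto
    finally show ?case .
  qed
  have u: "good (F k)" "F k 0 = 1" "\<And>\<nu>. F k \<nu> \<noteq> 0 \<Longrightarrow> - \<nu> \<in> Q" "\<And>\<nu>. F k \<nu> \<noteq> 0 \<Longrightarrow> \<nu> = 0 \<or> H \<nu> \<le> - (real k * N - rootbound)" "nm (F k) \<le> (1 + fac * qr ^ k) ^ p" if "k \<ge> 1" for k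
    using assms[OF that] unfolding unip_def by blast+
  have dec: "H \<nu> \<le> rootbound - N * real k" if "k \<ge> 1" "(F k - fexp 0) \<nu> \<noteq> 0" for k \<nu>
  proof -
    have "\<nu> \<noteq> 0" using that(2) u(2)[OF that(1)] by (auto simp: fexp_def)
    moreover from this have "F k \<nu> \<noteq> 0" using that(2) by (simp add: fexp_def)
    ultimately show ?thesis using u(4)[OF that(1)] by (fastforce simp: mult.commute)
  qed
  have sm: "summable (\<lambda>k. nm (F (Suc k) - fexp 0))"
  proof (rule summable_comparison_test')
    show "summable (\<lambda>k. real p * fac * (1 + fac) ^ p * qr * qr ^ k)" using qr by (intro summable_mult summable_geometric) auto
    fix k :: nat
    have q1: "fac * qr ^ Suc k \<le> fac * 1" using qr fac_pos(2) by (intro mult_left_mono power_le_one) auto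
    have q0: "fac * qr ^ Suc k \<ge> 0" using qr fac_pos(2) by simp
    have "nm (F (Suc k) - fexp 0) \<le> (1 + fac * qr ^ Suc k) ^ p - 1" using nm_minus_one[OF u(1,2)] u(5)[of "Suc k"] by simp
    also have "\<dots> \<le> real p * (fac * qr ^ Suc k) * (1 + fac * qr ^ Suc k) ^ p" by (rule pw[OF q0])
    also have "\<dots> \<le> real p * (fac * qr ^ Suc k) * (1 + fac) ^ p" using q0 q1 by (intro mult_left_mono power_mono) auto
    also have "\<dots> = real p * fac * (1 + fac) ^ p * qr * qr ^ k" by simp
    finally show "norm (nm (F (Suc k) - fexp 0)) \<le> real p * fac * (1 + fac) ^ p * qr * qr ^ k" using nm_nonneg by simp
  qed
  have tail: "- \<nu> \<in> Q" if "k > 0" "F k \<nu> \<noteq> 0" for k \<nu> using u(3)[of k \<nu>] that by simp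
  show "good (inf_prod g P F)" "(\<lambda>N. \<Prod>k=1..N. ev (F k)) \<longlonglongrightarrow> ev (inf_prod g P F)"
    by (rule inf_prod_good[of F 0 N rootbound, OF u(1) tail imag_pos dec sm]; assumption)+
qed

sublocale nome q
  by unfold_locales (use qr in \<open>auto simp: q_def\<close>)

end

context character
begin

lemma neg_regular: "x > 0 \<Longrightarrow> regular (- of_real x)"
proof -
  assume x: "x > 0"
  have "q powi k \<noteq> - of_real x" for k
  proof
    assume "q powi k = - of_real x"
    then have "complex_of_real (qr powi k) = of_real (- x)" by (simp add: q_def)
    then have "qr powi k = - x" by (simp only: of_real_eq_iff)
    moreover have "qr powi k > 0" using qr by (simp add: zero_less_power_int)
    ultimately show False using x by simp
  qed
  then show ?thesis using x by (simp add: regular_def)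
qed

lemma poch_regular_nz: "regular z \<Longrightarrow> poch q (q * z) \<noteq> 0"
proof (rule poch_nz)
  fix k assume "regular z"
  then have "q powi int (Suc k) * z \<noteq> 1" by (rule regular_powi)
  then show "q ^ k * (q * z) \<noteq> 1" unfolding power_int_of_nat by (simp add: mult_ac)
qed

lemma prod_limit:
  assumes "finite A"
  shows "(\<lambda>N. \<Prod>k=1..N. \<Prod>\<alpha>\<in>A. 1 - q ^ k * z \<alpha>) \<longlonglongrightarrow> (\<Prod>\<alpha>\<in>A. poch q (q * z \<alpha>))"
proof -
  have "(\<lambda>N. \<Prod>\<alpha>\<in>A. \<Prod>k=1..N. 1 - q ^ k * z \<alpha>) \<longlonglongrightarrow> (\<Prod>\<alpha>\<in>A. poch q (q * z \<alpha>))"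
    by (intro tendsto_prod poch_lim_q)
  moreover have "(\<Prod>\<alpha>\<in>A. \<Prod>k=1..N. 1 - q ^ k * z \<alpha>) = (\<Prod>k=1..N. \<Prod>\<alpha>\<in>A. 1 - q ^ k * z \<alpha>)" for N by (rule prod.swap)
  ultimately show ?thesis by simp
qed

lemma even_finite: "finite (even_roots g)" and odd_finite: "finite (odd_roots g)"
  using roots_finite by (simp_all add: roots_def)

lemma imag_prod: "(\<lambda>N. \<Prod>k=1..N. 1 - q ^ k) \<longlonglongrightarrow> poch q q"
  using poch_lim_q[of 1] by simp

lemma even_factor:
  assumes "k \<ge> 1"
  shows "unip (real k * N - rootbound) ((1 + fac * qr ^ k) ^ (Defs.rank g + card (even_roots g)))
     (fmult ((fexp 0 - fexp (- kdelta k)) [^]\<^bsub>R\<^esub> Defs.rank g) (finprod R (\<lambda>\<alpha>. fexp 0 - fexp (- (\<alpha> + kdelta k))) (even_roots g)))" (is "unip ?d ?c ?F")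
    and "ev (fmult ((fexp 0 - fexp (- kdelta k)) [^]\<^bsub>R\<^esub> Defs.rank g) (finprod R (\<lambda>\<alpha>. fexp 0 - fexp (- (\<alpha> + kdelta k))) (even_roots g)))
      = (1 - q ^ k) ^ Defs.rank g * (\<Prod>\<alpha>\<in>even_roots g. 1 - q ^ k * chr s (- \<alpha>))"
proof -
  note I = imag_root[OF assms] and S = shifted_root[OF even_root_root assms]
  have d: "real k * N - rootbound > 0" by (rule factor_bounds(1)[OF assms I(3)])
  have u0: "unip ?d (1 + fac * qr ^ k) (fexp 0 - fexp (- kdelta k))"
    by (rule unip_mono[OF unip_even[OF I(1,2) d I(3)] factor_bounds(2)[OF assms I(3)]])
  have u1: "unip ?d (1 + fac * qr ^ k) (fexp 0 - fexp (- (\<alpha> + kdelta k)))" if "\<alpha> \<in> even_roots g" for \<alpha>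
    by (rule unip_mono[OF unip_even[OF S(1,2)[OF that] d S(3)[OF that]] factor_bounds(2)[OF assms S(3)[OF that]]])
  show "unip ?d ?c ?F" unfolding power_add by (rule unip_fmult[OF unip_pow[OF u0] unip_finprod[OF d even_finite u1]])
  have g0: "good (fexp 0 - fexp (- kdelta k))" "\<And>\<alpha>. \<alpha> \<in> even_roots g \<Longrightarrow> good (fexp 0 - fexp (- (\<alpha> + kdelta k)))"
    using u0 u1 by (auto simp: unip_def)
  have e: "ev (fexp 0 - fexp (- \<gamma>)) = 1 - chr s (- \<gamma>)" if "\<gamma> \<in> Lam" for \<gamma>
    using bdd_even[OF that] by (simp add: bdd_def)
  have ev1: "ev (finprod R (\<lambda>\<alpha>. fexp 0 - fexp (- (\<alpha> + kdelta k))) (even_roots g)) = (\<Prod>\<alpha>\<in>even_roots g. 1 - q ^ k * chr s (- \<alpha>))"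
    and gf: "good (finprod R (\<lambda>\<alpha>. fexp 0 - fexp (- (\<alpha> + kdelta k))) (even_roots g))"
    using good_finprod[OF even_finite, of "\<lambda>\<alpha>. fexp 0 - fexp (- (\<alpha> + kdelta k))"] g0(2) e[OF S(2)] S(4) by (simp_all cong: prod.cong)
  show "ev ?F = (1 - q ^ k) ^ Defs.rank g * (\<Prod>\<alpha>\<in>even_roots g. 1 - q ^ k * chr s (- \<alpha>))"
    using good_pow[OF g0(1), of "Defs.rank g"] good_fmult(2)[OF _ gf] e[OF I(2)] ev1 by (simp add: q_kdelta)
qed

lemma even_inf_prod:
  defines "F \<equiv> \<lambda>k. fmult ((fexp 0 - fexp (- kdelta k)) [^]\<^bsub>R\<^esub> Defs.rank g) (finprod R (\<lambda>\<alpha>. fexp 0 - fexp (- (\<alpha> + kdelta k))) (even_roots g))"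
  shows "good (inf_prod g P F)" "ev (inf_prod g P F) = poch q q ^ Defs.rank g * (\<Prod>t\<in>even_half g. theta_reg q (chr s (rt t)))"
proof -
  have U1: "unip (real k * N - rootbound) ((1 + fac * qr ^ k) ^ (Defs.rank g + card (even_roots g))) (F k)" if "k \<ge> 1" for k
    unfolding F_def by (rule even_factor(1)[OF that])
  show "good (inf_prod g P F)" by (rule inf_prod_unip(1)[OF U1])
  have "(\<Prod>k=1..M. ev (F k)) = (\<Prod>k=1..M. 1 - q ^ k) ^ Defs.rank g * (\<Prod>k=1..M. \<Prod>\<alpha>\<in>even_roots g. 1 - q ^ k * chr s (- \<alpha>))" for M
    unfolding F_def prod_power_distrib prod.distrib[symmetric] by (rule prod.cong[OF refl], rule even_factor(2)) simp
  then have "(\<lambda>M. \<Prod>k=1..M. ev (F k)) \<longlonglongrightarrow> poch q q ^ Defs.rank g * (\<Prod>\<alpha>\<in>even_roots g. poch q (q * chr s (- \<alpha>)))"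
    using tendsto_mult[OF tendsto_power[OF imag_prod] prod_limit[OF even_finite]] by simp
  then have "ev (inf_prod g P F) = poch q q ^ Defs.rank g * (\<Prod>\<alpha>\<in>even_roots g. poch q (q * chr s (- \<alpha>)))"
    using inf_prod_unip(2)[OF U1] LIMSEQ_unique by blast
  also have "(\<Prod>\<alpha>\<in>even_roots g. poch q (q * chr s (- \<alpha>))) = (\<Prod>t\<in>even_half g. theta_reg q (chr s (rt t)))"
    unfolding even_roots_eq by (subst prod_symmetric_set) (auto simp: even_half_valid theta_reg_def chi_uminus mult.commute)
  finally show "ev (inf_prod g P F) = poch q q ^ Defs.rank g * (\<Prod>t\<in>even_half g. theta_reg q (chr s (rt t)))" .
qed

lemma odd_inf_prod:
  defines "F \<equiv> \<lambda>k. finprod R (\<lambda>\<alpha>. geom (-1) (\<alpha> + kdelta k)) (odd_roots g)"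
  shows "good (inf_prod g P F)" "ev (inf_prod g P F) = 1 / (\<Prod>t\<in>odd_half g. theta_reg q (- chr s (rt t)))"
proof -
  have U: "unip (real k * N - rootbound) ((1 + fac * qr ^ k) ^ card (odd_roots g)) (F k)
     \<and> ev (F k) = 1 / (\<Prod>\<alpha>\<in>odd_roots g. 1 - q ^ k * (- chr s (- \<alpha>)))" if k: "k \<ge> 1" for k
  proof -
    note S = shifted_root[OF odd_root_root k]
    have d: "real k * N - rootbound > 0" by (rule factor_bounds(1)[OF k imag_root(3)[OF k]])
    have u1: "unip (real k * N - rootbound) (1 + fac * qr ^ k) (geom (-1) (\<alpha> + kdelta k))" if "\<alpha> \<in> odd_roots g" for \<alpha>
      by (rule unip_mono[OF unip_geom[OF S(1,2)[OF that] d S(3)[OF that]] factor_bounds(3)[OF k S(3)[OF that]]]) simp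
    have "good (geom (-1) (\<alpha> + kdelta k))" if "\<alpha> \<in> odd_roots g" for \<alpha> using u1[OF that] by (simp add: unip_def)
    moreover have "ev (geom (-1) (\<alpha> + kdelta k)) = 1 / (1 - q ^ k * (- chr s (- \<alpha>)))" if "\<alpha> \<in> odd_roots g" for \<alpha>
      using good_geom(2)[OF S(1,2)[OF that], of "-1"] S(4)[OF that] by simp
    ultimately have "ev (F k) = (\<Prod>\<alpha>\<in>odd_roots g. 1 / (1 - q ^ k * (- chr s (- \<alpha>))))"
      unfolding F_def using good_finprod[OF odd_finite, of "\<lambda>\<alpha>. geom (-1) (\<alpha> + kdelta k)"] by (simp cong: prod.cong)
    then show ?thesis using unip_finprod[OF d odd_finite u1] unfolding F_def by (simp add: prod_dividef)
  qed
  have U1: "unip (real k * N - rootbound) ((1 + fac * qr ^ k) ^ card (odd_roots g)) (F k)" if "k \<ge> 1" for k using U[OF that] by blast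
  show "good (inf_prod g P F)" by (rule inf_prod_unip(1)[OF U1])
  have nz: "poch q (q * - chr s \<nu>) \<noteq> 0" for \<nu> unfolding chr_def by (intro poch_regular_nz neg_regular) simp
  have "(\<Prod>k=1..M. ev (F k)) = 1 / (\<Prod>k=1..M. \<Prod>\<alpha>\<in>odd_roots g. 1 - q ^ k * (- chr s (- \<alpha>)))" for M
  proof -
    have "(\<Prod>k=1..M. ev (F k)) = (\<Prod>k=1..M. 1 / (\<Prod>\<alpha>\<in>odd_roots g. 1 - q ^ k * (- chr s (- \<alpha>))))"
      by (rule prod.cong[OF refl], rule conjunct2[OF U]) simp
    then show ?thesis by (simp only: prod_dividef prod.neutral_const)
  qed
  moreover have n0: "(\<Prod>\<alpha>\<in>odd_roots g. poch q (q * - chr s (- \<alpha>))) \<noteq> 0"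
    unfolding prod_zero_iff[OF odd_finite] using nz by blast
  have "(\<lambda>M. 1 / (\<Prod>k=1..M. \<Prod>\<alpha>\<in>odd_roots g. 1 - q ^ k * (- chr s (- \<alpha>)))) \<longlonglongrightarrow> 1 / (\<Prod>\<alpha>\<in>odd_roots g. poch q (q * - chr s (- \<alpha>)))"
    by (rule tendsto_divide[OF tendsto_const prod_limit[OF odd_finite] n0])
  ultimately have lim: "(\<lambda>M. \<Prod>k=1..M. ev (F k)) \<longlonglongrightarrow> 1 / (\<Prod>\<alpha>\<in>odd_roots g. poch q (q * - chr s (- \<alpha>)))"
    by (simp only:)
  have "ev (inf_prod g P F) = 1 / (\<Prod>\<alpha>\<in>odd_roots g. poch q (q * - chr s (- \<alpha>)))"
    by (rule LIMSEQ_unique[OF inf_prod_unip(2)[OF U1] lim])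
  also have "(\<Prod>\<alpha>\<in>odd_roots g. poch q (q * - chr s (- \<alpha>))) = (\<Prod>t\<in>odd_half g. theta_reg q (- chr s (rt t)))"
    unfolding odd_roots_eq by (subst prod_symmetric_set) (auto simp: odd_half_valid theta_reg_def chi_uminus mult.commute)
  finally show "ev (inf_prod g P F) = 1 / (\<Prod>t\<in>odd_half g. theta_reg q (- chr s (rt t)))" .
qed

text \<open>
  The untranslated term of the sum is the finite denominator itself, so its value is a special case of
  that of a translated one.
\<close>

lemma finite_denominator:
  "good (den_R0 g P)" "good (den_R1_inv g P)"
  "chr s (rho g P) * ev (den_R0 g P) * ev (den_R1_inv g P) = sg * val (\<lambda>c. s * h c)"
proof -
  interpret comm_monoid R by (rule R_comm_monoid)
  have P0: "\<And>\<alpha>. \<alpha> \<in> pos_even g P \<Longrightarrow> \<alpha> \<in> roots g" and P1: "\<And>\<alpha>. \<alpha> \<in> pos_odd g P \<Longrightarrow> \<alpha> \<in> roots g \<and> \<alpha> \<in> aff_pos g P"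
    by (auto simp: pos_even_def pos_odd_def even_root_root odd_root_root aff_pos_def)
  have fin: "finite (pos_even g P)" "finite (pos_odd g P)" using P0 P1 finite_subset[OF _ roots_finite] by blast+
  have b0: "good (fexp 0 - fexp (- \<alpha>))" if "\<alpha> \<in> pos_even g P" for \<alpha>
    using bdd_even[OF Lam_root[OF P0[OF that]]] by (simp add: bdd_def)
  have b1: "good (geom (-1) \<beta>)" if "\<beta> \<in> pos_odd g P" for \<beta>
    by (rule good_geom(1)) (use P1[OF that] Lam_root in auto)
  show g0: "good (den_R0 g P)" unfolding den_R0_def using good_finprod[OF fin(1), of "\<lambda>\<alpha>. fexp 0 - fexp (- \<alpha>)"] b0 by blast
  show g1: "good (den_R1_inv g P)" unfolding den_R1_inv_def using good_finprod[OF fin(2), of "geom (-1)"] b1 by blast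
  have gr: "good (fexp (rho g P))" using good_fexp[OF _ Lam_rho] Lam_aff_weights Lam_rho by blast
  obtain k where k: "k > 0" "\<And>\<gamma>. \<gamma> \<in> aff_pos g P \<Longrightarrow> H \<gamma> \<ge> k" using H_min by blast
  have id: "twist CDlt 0 (\<lambda>_. 0) = (\<lambda>l. l)" by (intro ext) (simp add: twist_def scl_def)
  have hm: "hm CDlt 0 (\<lambda>_. 0) c = h c" for c by (simp add: hm_def mm_def)
  have "ev (transl_den g P (\<lambda>l. l)) = sg * val (\<lambda>c. s * h c)"
    using transl_den_bdd[OF k(2,1), of CDlt 0 "\<lambda>_. 0"] unfolding id hm by (simp add: bdd_def)
  moreover have "finprod R (\<lambda>\<beta>. inv_one_plus g P \<beta>) (pos_odd g P) = den_R1_inv g P"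
    unfolding den_R1_inv_def by (rule finprod_cong') (use b1 P1 in \<open>auto simp: inv_one_plus_def good_def\<close>)
  then have "transl_den g P (\<lambda>l. l) = fmult (fmult (fexp (rho g P)) (den_R0 g P)) (den_R1_inv g P)"
    unfolding transl_den_def den_R0_def by (simp add: R_simps)
  ultimately show "chr s (rho g P) * ev (den_R0 g P) * ev (den_R1_inv g P) = sg * val (\<lambda>c. s * h c)"
    using good_fmult(2)[OF good_fmult(1)[OF gr g0] g1] good_fmult(2)[OF gr g0] abl_fexp(2)[of "rho g P"] by simp
qed

definition thetas :: complex where
  "thetas = (\<Prod>t\<in>even_half g. theta_reg q (chr s (rt t))) / (\<Prod>t\<in>odd_half g. theta_reg q (- chr s (rt t)))"

lemma affine_denominator:
  "good (fmult (aff_den g P) (fexp (rho g P)))"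
  "ev (fmult (aff_den g P) (fexp (rho g P))) = sg * val (\<lambda>c. s * h c) * (poch q q ^ Defs.rank g * thetas)"
proof -
  note E = even_inf_prod and O = odd_inf_prod and D = finite_denominator
  have gr: "good (fexp (rho g P))" using good_fexp[OF _ Lam_rho] Lam_aff_weights Lam_rho by blast
  have a0: "good (aff_den_R0 g P)" "ev (aff_den_R0 g P) = ev (den_R0 g P) * (poch q q ^ Defs.rank g * (\<Prod>t\<in>even_half g. theta_reg q (chr s (rt t))))"
    unfolding aff_den_R0_def R_simps using good_fmult[OF D(1) E(1)] E(2) by simp_all
  have a1: "good (aff_den_R1_inv g P)" "ev (aff_den_R1_inv g P) = ev (den_R1_inv g P) * (1 / (\<Prod>t\<in>odd_half g. theta_reg q (- chr s (rt t))))"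
    unfolding aff_den_R1_inv_def R_simps using good_fmult[OF D(2) O(1)] O(2) by simp_all
  have a: "good (aff_den g P)" "ev (aff_den g P) = ev (aff_den_R0 g P) * ev (aff_den_R1_inv g P)"
    unfolding aff_den_def R_simps using good_fmult[OF a0(1) a1(1)] by simp_all
  show "good (fmult (aff_den g P) (fexp (rho g P)))" by (rule good_fmult(1)[OF a(1) gr])
  have "ev (fmult (aff_den g P) (fexp (rho g P))) = (chr s (rho g P) * ev (den_R0 g P) * ev (den_R1_inv g P)) * (poch q q ^ Defs.rank g * thetas)"
    using good_fmult(2)[OF a(1) gr] a(2) a0(2) a1(2) abl_fexp(2)[of "rho g P"] by (simp add: thetas_def)
  then show "ev (fmult (aff_den g P) (fexp (rho g P))) = sg * val (\<lambda>c. s * h c) * (poch q q ^ Defs.rank g * thetas)"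
    unfolding D(3) .
qed

text \<open>The constant sign \<open>sg\<close> has been cancelled on both sides.\<close>

definition evaluated :: "(nat \<Rightarrow> coord) \<Rightarrow> nat \<Rightarrow> (nat \<Rightarrow> int) set \<Rightarrow> bool" where
  "evaluated u n M \<longleftrightarrow> good (f_factor g P) \<and>
     (\<Sum>\<^sub>\<infinity>m\<in>M. val (\<lambda>c. s * hm u n m c)) = val (\<lambda>c. s * h c) * (poch q q ^ Defs.rank g * thetas) * ev (f_factor g P)"

lemma evaluated_difference:
  assumes "admissible g u n" "M \<subseteq> shifts n" "evaluated u n M"
  defines "b \<equiv> fmult (fmult (aff_den g P) (fexp (rho g P))) (f_factor g P) - coeff_sum (twist u n ` M) (transl_den g P)"
  shows "good (fmult (fmult (aff_den g P) (fexp (rho g P))) (f_factor g P))"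
    "(\<lambda>\<nu>. norm (of_rat (b \<nu>) * chr s \<nu>)) summable_on UNIV" "(\<Sum>\<^sub>\<infinity>\<nu>. of_rat (b \<nu>) * chr s \<nu>) = 0"
proof -
  let ?L = "fmult (fmult (aff_den g P) (fexp (rho g P))) (f_factor g P)" and ?S = "coeff_sum (twist u n ` M) (transl_den g P)"
  note T = transl_sum[OF assms(1,2)] and A = affine_denominator
  have f: "good (f_factor g P)" using assms(3) by (simp add: evaluated_def)
  show gL: "good ?L" by (rule good_fmult(1)[OF A(1) f])
  have "ev ?L = ev ?S" using good_fmult(2)[OF A(1) f] A(2) T(6) assms(3) by (simp add: evaluated_def mult_ac)
  moreover have e: "b = ?L + scl (-1) ?S" unfolding b_def by (rule ext) (simp add: scl_def)
  have l: "abl ?L" using gL by (simp add: good_def)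
  note S = abl_scl[OF T(4), of "-1"]
  ultimately have "abl b \<and> ev b = 0" unfolding e using abl_add(1,2)[OF l S(1)] S(2) by simp
  then show "(\<lambda>\<nu>. norm (of_rat (b \<nu>) * chr s \<nu>)) summable_on UNIV" "(\<Sum>\<^sub>\<infinity>\<nu>. of_rat (b \<nu>) * chr s \<nu>) = 0"
    by (simp_all add: abl_def ev_def trm_def)
qed

end

context datum
begin

lemma characterI: "s \<ge> 1 \<Longrightarrow> character g P h s"
  by unfold_locales

text \<open>
  Equality of the values for all \<open>s \<ge> 1\<close> implies equality of the formal sums.
  Membership of the coefficientwise sum in the algebra is then inherited from the product side.
\<close>

lemma identity_from_evaluations:
  assumes adm: "admissible g u n" and M: "M \<subseteq> shifts n"
    and ev: "\<And>s. s \<ge> 1 \<Longrightarrow> character.evaluated g P h s u n M"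
  shows "denominator_identity g P (twist u n ` M)"
proof -
  let ?L = "fmult (fmult (aff_den g P) (fexp (rho g P))) (f_factor g P)" and ?S = "coeff_sum (twist u n ` M) (transl_den g P)"
  interpret c: character g P h 1 by (rule characterI) simp
  note T = c.transl_sum[OF adm M] and D = c.evaluated_difference[OF adm M ev[of 1, simplified]]
  have L: "nov ?L" "\<And>\<nu>. ?L \<nu> \<noteq> 0 \<Longrightarrow> \<nu> \<in> Lam" "?L \<in> carrier R" using D(1) carrier_nov by (auto simp: c.good_def)
  have nz: "?L \<nu> \<noteq> 0 \<or> ?S \<nu> \<noteq> 0" if "(?L - ?S) \<nu> \<noteq> 0" for \<nu> using that by auto
  have nb: "nov (?L - ?S)" unfolding nov_def
  proof
    fix B
    have "{\<nu>. (?L - ?S) \<nu> \<noteq> 0 \<and> B \<le> H \<nu>} \<subseteq> {\<nu>. ?L \<nu> \<noteq> 0 \<and> B \<le> H \<nu>} \<union> {\<nu>. ?S \<nu> \<noteq> 0 \<and> B \<le> H \<nu>}" using nz by blast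
    then show "finite {\<nu>. (?L - ?S) \<nu> \<noteq> 0 \<and> B \<le> H \<nu>}"
      by (rule finite_subset) (use L(1) T(3) in \<open>simp add: nov_def\<close>)
  qed
  have inj: "inj_on H {\<nu>. (?L - ?S) \<nu> \<noteq> 0}"
    by (rule inj_on_subset[OF Lam_inj]) (use nz L(2) T(5) in blast)
  have "(?L - ?S) \<nu> = 0" for \<nu>
  proof (rule ev_injective[OF nb inj])
    fix s :: real assume s: "s \<ge> 1"
    interpret d: character g P h s by (rule characterI[OF s])
    show "(\<lambda>\<nu>. norm (of_rat ((?L - ?S) \<nu>) * chr s \<nu>)) summable_on UNIV" by (rule d.evaluated_difference(2)[OF adm M ev[OF s]])
    show "(\<Sum>\<^sub>\<infinity>\<nu>. of_rat ((?L - ?S) \<nu>) * chr s \<nu>) = 0" by (rule d.evaluated_difference(3)[OF adm M ev[OF s]])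
  qed
  then have eq: "?L = ?S" by (intro ext) simp
  show ?thesis unfolding denominator_identity_def R_simps
    using T(1,2) L(3) eq by (auto simp: c.good_def)
qed

end

section \<open>The general linear case\<close>

lemma neg_one_power_cases: "(-1) ^ n = (1::rat) \<or> (-1) ^ n = (-1::rat)"
  by (cases "even n") auto

context character
begin

lemma chr_unit: "c \<in> cds g \<Longrightarrow> chr s (unit_weight c) = of_real (exp (s * h c))"
  by (simp add: chr_def H_unit)

lemma chr_rt:
  assumes "c \<in> cds g" "d \<in> cds g"
  shows "chr s (rt (c, d, 1)) = of_real (exp (s * h c)) * of_real (exp (s * h d))"
    "chr s (rt (c, d, -1)) = of_real (exp (s * h c)) / of_real (exp (s * h d))"
  unfolding pm_rt[symmetric] chi_add chi_diff chr_unit[OF assms(1)] chr_unit[OF assms(2)] by (rule refl)+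

text \<open>
  A coincidence of the value of a character with a power of \<open>q\<close> would be an integral
  relation between the values of the height function on the coordinates.
\<close>

lemma generic_regular:
  assumes "\<And>c. \<nu> c \<in> \<int>" "c0 \<in> cds g" "c0 \<noteq> CImag" "\<nu> c0 \<noteq> 0"
  shows "regular (chr s \<nu>)"
proof -
  have "\<forall>c. \<exists>k::int. \<nu> c = of_int k" using assms(1) by (metis Ints_cases)
  then obtain k where k: "\<And>c. \<nu> c = of_int (k c :: int)" by metis
  have "q powi l \<noteq> chr s \<nu>" for l
  proof
    assume "q powi l = chr s \<nu>"
    then have "complex_of_real (qr powi l) = of_real (exp (s * H \<nu>))" by (simp add: q_def chr_def)
    then have e: "qr powi l = exp (s * H \<nu>)" by (simp only: of_real_eq_iff)
    have "qr powi l = exp (of_int l * - (s * N))" unfolding qr_def by (rule exp_power_int)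
    then have "of_int l * - (s * N) = s * H \<nu>" using e by simp
    then have "s * (H \<nu> + of_int l * N) = 0" by (simp add: algebra_simps)
    then have z: "H \<nu> + of_int l * N = 0" using s1 by simp
    define k' where "k' c = k c + (if c = CImag then l else 0)" for c
    have "(\<Sum>c\<in>cds g. of_int (k' c) * h c) = (\<Sum>c\<in>cds g. h c * Re (\<nu> c) + (if c = CImag then of_int l * N else 0))"
      by (rule sum.cong) (auto simp: k'_def k algebra_simps)
    also have "\<dots> = H \<nu> + of_int l * N" unfolding sum.distrib H_sum_cds by (simp add: cds_def)
    finally have "k' c0 = 0" using independent[of k' c0] assms(2) z by simp
    then show False using assms(3,4) by (simp add: k'_def k)
  qed
  then show ?thesis unfolding regular_def using chi_nz by blast
qed

lemma f_factor_OSP: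
  assumes "g = OSP n"
  shows "good (f_factor g P)" "ev (f_factor g P) = 1 / poch q q"
proof -
  have e: "f_factor g P = inf_prod g P (\<lambda>k. geom 1 (kdelta k))" unfolding assms by simp
  have U: "unip (real k * N - rootbound) ((1 + fac * qr ^ k) ^ 1) (geom 1 (kdelta k))" if k: "k \<ge> 1" for k
    using unip_mono[OF unip_geom[OF imag_root(1,2)[OF k] factor_bounds(1)[OF k imag_root(3)[OF k]] imag_root(3)[OF k]] factor_bounds(3)[OF k imag_root(3)[OF k]], of 1] by simp
  show "good (f_factor g P)" unfolding e by (rule inf_prod_unip(1)[OF U])
  have "(\<Prod>k=1..M. ev (geom 1 (kdelta k))) = 1 / (\<Prod>k=1..M. 1 - q ^ k)" for M
  proof -
    have "(\<Prod>k=1..M. ev (geom 1 (kdelta k))) = (\<Prod>k=1..M. 1 / (1 - q ^ k))"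
      using good_geom(2)[OF imag_root(1,2), of _ 1] by (intro prod.cong) (auto simp: q_kdelta)
    then show ?thesis by (simp only: prod_dividef prod.neutral_const)
  qed
  then have "(\<lambda>M. \<Prod>k=1..M. ev (geom 1 (kdelta k))) \<longlonglongrightarrow> 1 / poch q q"
    using tendsto_divide[OF tendsto_const imag_prod poch_q_nz, of 1] by simp
  moreover have "(\<lambda>M. \<Prod>k=1..M. ev (geom 1 (kdelta k))) \<longlonglongrightarrow> ev (inf_prod g P (\<lambda>k. geom 1 (kdelta k)))" by (rule inf_prod_unip(2)[OF U])
  ultimately show "ev (f_factor g P) = 1 / poch q q" unfolding e by (rule LIMSEQ_unique[rotated])
qed

lemma geom_square_prod:
  "good (inf_prod g P (\<lambda>k. geom 1 (kdelta k) [^]\<^bsub>R\<^esub> (2::nat)))"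
  "ev (inf_prod g P (\<lambda>k. geom 1 (kdelta k) [^]\<^bsub>R\<^esub> (2::nat))) = 1 / poch q q ^ 2"
proof -
  have U: "unip (real k * N - rootbound) ((1 + fac * qr ^ k) ^ 2) (geom 1 (kdelta k) [^]\<^bsub>R\<^esub> (2::nat))" if k: "k \<ge> 1" for k
    by (rule unip_pow, rule unip_mono[OF unip_geom[OF imag_root(1,2)[OF k] factor_bounds(1)[OF k imag_root(3)[OF k]] imag_root(3)[OF k]] factor_bounds(3)[OF k imag_root(3)[OF k]]]) simp
  show "good (inf_prod g P (\<lambda>k. geom 1 (kdelta k) [^]\<^bsub>R\<^esub> (2::nat)))" by (rule inf_prod_unip(1)[OF U])
  have "(\<Prod>k=1..M. ev (geom 1 (kdelta k) [^]\<^bsub>R\<^esub> (2::nat))) = 1 / (\<Prod>k=1..M. 1 - q ^ k) ^ 2" for M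
  proof -
    have "(\<Prod>k=1..M. ev (geom 1 (kdelta k) [^]\<^bsub>R\<^esub> (2::nat))) = (\<Prod>k=1..M. (1 / (1 - q ^ k)) ^ 2)"
    proof (rule prod.cong[OF refl])
      fix k assume "k \<in> {1..M}"
      then have k: "k \<ge> 1" by simp
      note gg = good_geom[OF imag_root(1,2)[OF k], of 1]
      show "ev (geom 1 (kdelta k) [^]\<^bsub>R\<^esub> (2::nat)) = (1 / (1 - q ^ k)) ^ 2"
        using good_pow[OF gg(1), of 2] gg(2) by (simp add: q_kdelta)
    qed
    then show ?thesis by (simp only: prod_dividef prod.neutral_const power_one power_divide prod_power_distrib)
  qed
  then have "(\<lambda>M. \<Prod>k=1..M. ev (geom 1 (kdelta k) [^]\<^bsub>R\<^esub> (2::nat))) \<longlonglongrightarrow> 1 / poch q q ^ 2"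
    using tendsto_divide[OF tendsto_const tendsto_power[OF imag_prod, of 2], of 1] poch_q_nz by simp
  moreover have "(\<lambda>M. \<Prod>k=1..M. ev (geom 1 (kdelta k) [^]\<^bsub>R\<^esub> (2::nat))) \<longlonglongrightarrow> ev (inf_prod g P (\<lambda>k. geom 1 (kdelta k) [^]\<^bsub>R\<^esub> (2::nat)))" by (rule inf_prod_unip(2)[OF U])
  ultimately show "ev (inf_prod g P (\<lambda>k. geom 1 (kdelta k) [^]\<^bsub>R\<^esub> (2::nat))) = 1 / poch q q ^ 2" by (rule LIMSEQ_unique[rotated])
qed

text \<open>
  Each of the roots is compensated by one copy of the imaginary root.
\<close>

lemma kdelta_minus_roots:
  assumes "finite A" "\<And>i. i \<in> A \<Longrightarrow> f i \<in> roots g" "k \<ge> card A"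
  shows "kdelta k - sum f A \<in> Q"
  using assms
proof (induction A arbitrary: k rule: finite_induct)
  case empty
  have "im_root \<in> Q" using Q_gen[OF imag_root(1)[of 1]] by (simp add: scl_pm)
  then show ?case using Q_scl by simp
next
  case (insert a A)
  then have k: "k - 1 \<ge> card A" "k \<ge> 1" by auto
  have "- f a + kdelta 1 \<in> Q" by (rule Q_gen, rule shifted_root(1)[OF roots_uminus]) (use insert in auto)
  moreover have "kdelta (k - 1) - sum f A \<in> Q" by (rule insert.IH) (use insert.prems k in auto)
  moreover have "kdelta k - sum f (insert a A) = (- f a + kdelta 1) + (kdelta (k - 1) - sum f A)"
  proof -
    have "kdelta k = kdelta 1 + kdelta (k - 1)" using k(2) by (intro ext) (simp add: scl_def of_nat_diff algebra_simps)
    then show ?thesis using insert by simp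
  qed
  ultimately show ?case by (simp only: Q_add)
qed

text \<open>
  The first \<open>card A\<close> factors may leave the negative cone; all later ones stay in it.
\<close>

lemma shifted_factor_prod:
  assumes A: "finite A" "\<And>i. i \<in> A \<Longrightarrow> f i \<in> roots g" and c: "c = 1 \<or> c = (-1::rat)"
  shows "good (inf_prod g P (\<lambda>k. fexp 0 - scl c (fexp (sum f A - kdelta k))))"
    "ev (inf_prod g P (\<lambda>k. fexp 0 - scl c (fexp (sum f A - kdelta k)))) = poch q (q * (of_rat c * chr s (sum f A)))"
proof -
  define F where "F k = fexp 0 - scl c (fexp (sum f A - kdelta k))" for k
  have UL: "sum f A \<in> Lam" using A
    by (induction A rule: finite_induct) (use Lam_zero Lam_plus Lam_root in auto)
  have UkL: "sum f A - kdelta k \<in> Lam" for k by (rule Lam_minus[OF UL Lam_scl[OF Lam_im]])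
  have gf: "good (fexp (sum f A - kdelta k))" for k using good_fexp[OF _ UkL] Lam_aff_weights UkL by blast
  have gF: "good (F k)" for k unfolding F_def by (rule good_diff[OF good_one good_scl[OF gf]])
  have lf: "abl (fexp (sum f A - kdelta k))" for k by (rule abl_fexp(1))
  have ch: "chr s (sum f A - kdelta k) = chr s (sum f A) * q ^ k" for k
    unfolding diff_conv_add_uminus[of "sum f A"] chi_add q_kdelta ..
  have evF: "ev (F k) = 1 - q ^ k * (of_rat c * chr s (sum f A))" for k
    unfolding F_def ev_diff(1)[OF good_one good_scl[OF gf]] abl_scl(2)[OF lf] abl_fexp(2) ch chi_0 by (simp add: mult_ac)
  have e: "F k - fexp 0 = scl (- c) (fexp (sum f A - kdelta k))" for k unfolding F_def by (rule ext) (simp add: scl_def)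
  have nc: "norm (of_rat (- c) :: complex) = 1" using c by auto
  have n: "nm (F (Suc k) - fexp 0) = norm (chr s (sum f A)) * qr * qr ^ k" for k
    unfolding e abl_scl(3)[OF lf] abl_fexp(3) ch nc norm_mult norm_power using qr by (simp add: q_def)
  have tail: "- \<nu> \<in> Q" if h: "k > card A" "F k \<nu> \<noteq> 0" for k \<nu>
  proof -
    have q: "kdelta k - sum f A \<in> Q" by (rule kdelta_minus_roots[OF A]) (use h(1) in auto)
    have "\<nu> = 0 \<or> \<nu> = sum f A - kdelta k" using h(2) by (auto simp: F_def fexp_def scl_def split: if_splits)
    then show ?thesis
    proof
      assume "\<nu> = 0" then show ?thesis by (simp only: minus_zero Q_0)
    next
      assume "\<nu> = sum f A - kdelta k" then show ?thesis using q by (simp only: minus_diff_eq)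
    qed
  qed
  have dec: "H \<nu> \<le> H (sum f A) - N * real k" if h: "k \<ge> 1" "(F k - fexp 0) \<nu> \<noteq> 0" for k \<nu>
  proof -
    have "\<nu> = sum f A - kdelta k" using h(2) unfolding e by (auto simp: fexp_def scl_def split: if_splits)
    then show ?thesis by (simp only: H_diff H_kdelta mult.commute)
  qed
  have sm: "summable (\<lambda>k. nm (F (Suc k) - fexp 0))" unfolding n using qr by (intro summable_mult summable_geometric) auto
  note I = inf_prod_good[of F "card A" N "H (sum f A)", OF gF tail imag_pos dec sm]
  have F: "(\<lambda>k. fexp 0 - scl c (fexp (sum f A - kdelta k))) = F" by (rule ext) (simp only: F_def)
  show "good (inf_prod g P (\<lambda>k. fexp 0 - scl c (fexp (sum f A - kdelta k))))" unfolding F by (rule I(1))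
  have "(\<lambda>M. \<Prod>k=1..M. ev (F k)) \<longlonglongrightarrow> poch q (q * (of_rat c * chr s (sum f A)))"
    unfolding evF by (rule poch_lim_q)
  moreover have "(\<lambda>M. \<Prod>k=1..M. ev (F k)) \<longlonglongrightarrow> ev (inf_prod g P F)" by (rule I(2))
  ultimately show "ev (inf_prod g P (\<lambda>k. fexp 0 - scl c (fexp (sum f A - kdelta k)))) = poch q (q * (of_rat c * chr s (sum f A)))"
    unfolding F by (rule LIMSEQ_unique[rotated])
qed

text \<open>
  The first two products combine to the regularised theta function at the signed supertrace.
\<close>

lemma f_factor_GL:
  assumes "g = GL n"
  shows "good (f_factor g P)" "ev (f_factor g P) = theta_reg q ((-1) ^ n * chr s (str n)) / poch q q ^ 2"
proof -
  let ?c = "(-1) ^ n :: rat"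
  have r: "eps i - dlt i \<in> roots g" if "i \<in> {1..n}" for i
  proof -
    have "scl 1 (eps i - dlt i) \<in> odd_roots g" unfolding assms odd_roots.simps using that by blast
    then show ?thesis unfolding scl_pm by (rule odd_root_root)
  qed
  have r': "- (eps i - dlt i) \<in> roots g" if "i \<in> {1..n}" for i by (rule roots_uminus[OF r[OF that]])
  have m: "- str n = (\<Sum>i\<in>{1..n}. - (eps i - dlt i))" unfolding str_def by (rule sum_negf[symmetric])
  let ?A = "inf_prod g P (\<lambda>k. fexp 0 - scl ?c (fexp (str n - kdelta k)))" and ?B = "inf_prod g P (\<lambda>k. fexp 0 - scl ?c (fexp (- str n - kdelta k)))"
    and ?C = "inf_prod g P (\<lambda>k. geom 1 (kdelta k) [^]\<^bsub>R\<^esub> (2::nat))"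
  have A: "good ?A" "ev ?A = poch q (q * (of_rat ?c * chr s (str n)))" unfolding str_def
    by (rule shifted_factor_prod[OF finite_atLeastAtMost _ neg_one_power_cases], erule r)+
  have B: "good ?B" "ev ?B = poch q (q * (of_rat ?c * chr s (- str n)))" unfolding m
    by (rule shifted_factor_prod[OF finite_atLeastAtMost _ neg_one_power_cases], erule r')+
  have e: "f_factor g P = fmult (fmult ?A ?B) ?C" unfolding R_simps(1)[symmetric] unfolding assms by (simp only: f_factor.simps)
  note gg = good_fmult[OF good_fmult(1)[OF A(1) B(1)] geom_square_prod(1)]
  show "good (f_factor g P)" unfolding e by (rule gg(1))
  have c: "of_rat ?c = ((-1) ^ n :: complex)" by (simp add: of_rat_power)
  have "(-1) ^ n * chr s (- str n) = 1 / ((-1) ^ n * chr s (str n))" unfolding chi_uminus by (cases "even n") simp_all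
  then show "ev (f_factor g P) = theta_reg q ((-1) ^ n * chr s (str n)) / poch q q ^ 2"
    unfolding e gg(2) good_fmult(2)[OF A(1) B(1)] A(2) B(2) geom_square_prod(2) c theta_reg_def by simp
qed

end

text \<open>
  The value of the denominator of \<open>gl(n|n)\<close> in logarithmic variables.
\<close>

definition gv :: "nat \<Rightarrow> (nat \<Rightarrow> real) \<Rightarrow> (nat \<Rightarrow> real) \<Rightarrow> complex" where
  "gv n a d = (\<Prod>k<n. \<Prod>i<k. sh (a i - a k) * sh (d i - d k)) / (\<Prod>i<n. \<Prod>j<n. ch (a i - d j))"

lemma gv_sym: "gv n a d = gv n d a"
proof -
  have "(\<Prod>i<n. \<Prod>j<n. ch (a i - d j)) = (\<Prod>j<n. \<Prod>i<n. ch (d j - a i))"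
    using ch_uminus[of "a i - d j" for i j] by (subst prod.swap) simp
  then show ?thesis unfolding gv_def by (simp only: mult.commute)
qed

lemma gv_cong: "(\<And>i. i < n \<Longrightarrow> a i = a' i) \<Longrightarrow> (\<And>i. i < n \<Longrightarrow> d i = d' i) \<Longrightarrow> gv n a d = gv n a' d'"
  unfolding gv_def by (intro arg_cong2[where f="(/)"] prod.cong refl) auto

lemma sh_ch_half:
  "sh (u - v) = of_real (exp (u / 2)) / of_real (exp (v / 2)) - of_real (exp (v / 2)) / of_real (exp (u / 2))"
  "ch (u - v) = of_real (exp (u / 2)) / of_real (exp (v / 2)) + of_real (exp (v / 2)) / of_real (exp (u / 2))"
  by (simp_all add: sh_def ch_def diff_divide_distrib exp_diff)

context character
begin

text \<open>
  Passing to the square roots \<open>X\<close> and \<open>Y\<close> of the variables turns every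
  factor \<open>1 - z\<close> into a hyperbolic sine or cosine times a monomial. The monomials cancel
  except on the diagonal.
\<close>

lemma gv_ndet:
  "gv n a d * (\<Prod>i<n. of_real (exp ((a i - d i) / 2))) = ndet n (\<lambda>i j. phi (- of_real (exp (d i)) / of_real (exp (a j))))"
proof -
  define X where "X i = complex_of_real (exp (a i / 2))" for i
  define Y where "Y i = complex_of_real (exp (d i / 2))" for i
  have nz: "X i \<noteq> 0" "Y i \<noteq> 0" for i by (simp_all add: X_def Y_def)
  define c where "c i = - (Y i * Y i)" for i
  define b where "b i = X i * X i" for i
  have sq: "exp u = exp (u / 2) * exp (u / 2)" for u :: real by (simp flip: exp_add)
  have cb: "- complex_of_real (exp (d i)) = c i" "complex_of_real (exp (a i)) = b i" for i
    unfolding c_def b_def X_def Y_def of_real_mult[symmetric] sq[symmetric] by simp_all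
  have S: "sh (a i - a k) = X i / X k - X k / X i" "sh (d i - d k) = Y i / Y k - Y k / Y i" "ch (a i - d k) = X i / Y k + Y k / X i" for i k
    unfolding sh_ch_half X_def Y_def by (rule refl)+
  have C0: "X i / Y k + Y k / X i \<noteq> 0" for i k using ch_nz[of "a i - d k"] unfolding S .
  have f1: "1 - c i / c k = - (Y i / Y k) * (Y i / Y k - Y k / Y i)" for i k using nz by (simp add: c_def field_simps)
  have f2: "1 - b k / b i = X k / X i * (X i / X k - X k / X i)" for i k using nz by (simp add: b_def field_simps)
  have f3: "1 - c i / b k = Y i / X k * (X k / Y i + Y i / X k)" for i k using nz by (simp add: b_def c_def field_simps)
  have f4: "c k / b k = - (Y k * Y k / (X k * X k))" for k by (simp add: b_def c_def)
  have pair: "c k / b k * ((1 - c i / c k) * (1 - b k / b i) / ((1 - c i / b k) * (1 - c k / b i)))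
     = sh (a i - a k) * sh (d i - d k) / (ch (a i - d k) * ch (a k - d i))" for i k
  proof -
    have "- (Y k * Y k / (X k * X k)) * (- (Y i / Y k) * T * (X k / X i * U) / (Y i / X k * V * (Y k / X i * W))) = U * T / (W * V)" for T U V W
      using nz by (simp add: field_simps)
    then show ?thesis unfolding f1 f2 f3 f4 S .
  qed
  have diag: "1 / (1 - c i / b i) = X i / Y i / ch (a i - d i)" for i 
  proof -
    have "1 / (Y i / X i * W) = X i / Y i / W" for W by simp
    then show ?thesis unfolding f3 S .
  qed
  have "ndet n (\<lambda>i j. phi (c i / b j)) = (\<Prod>k<n. (c k / b k) ^ k) * frob (\<lambda>z. 1 - z) n c b"
  proof (rule ndet_phi)
    show "c i / b j \<noteq> 1" for i j using f3[of i j] nz C0[of j i] by auto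
  qed (use nz in \<open>simp_all add: c_def b_def\<close>)
  also have "(\<Prod>k<n. (c k / b k) ^ k) = (\<Prod>k<n. \<Prod>i<k. c k / b k)" by simp
  also have "\<dots> * frob (\<lambda>z. 1 - z) n c b = (\<Prod>i<n. 1 / (1 - c i / b i)) * (\<Prod>k<n. \<Prod>i<k. c k / b k * ((1 - c i / c k) * (1 - b k / b i) / ((1 - c i / b k) * (1 - c k / b i))))"
    unfolding frob_def prod.distrib by (simp only: mult_ac)
  also have "\<dots> = (\<Prod>i<n. X i / Y i) * gv n a d"
    unfolding pair diag gv_def prod_square_split[of "\<lambda>i j. ch (a i - d j)"] prod_dividef by simp
  also have "(\<Prod>i<n. X i / Y i) = (\<Prod>i<n. of_real (exp ((a i - d i) / 2)))"
    by (simp add: X_def Y_def diff_divide_distrib exp_diff)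
  finally show ?thesis unfolding cb by (simp only: mult.commute)
qed

text \<open>
  The monomial prefactor is invariant under translations of total degree zero.
\<close>

lemma gv_sum:
  assumes n: "n \<ge> 1" and reg: "regular (\<Prod>i<n. - of_real (exp (d i)) / of_real (exp (a i)))"
  shows "(\<Sum>\<^sub>\<infinity>m\<in>{m \<in> shifts n. (\<Sum>i<n. m i) = 0}. gv n a (\<lambda>i. d i - s * N * of_int (m i)))
    = gv n a d * ((poch q q ^ 2) ^ (n - 1) * theta_reg q (\<Prod>i<n. - of_real (exp (d i)) / of_real (exp (a i)))
       * wfac n (\<lambda>i. - of_real (exp (d i))) (\<lambda>i. of_real (exp (a i))))"
proof -
  let ?M = "{m \<in> shifts n. (\<Sum>i<n. m i) = 0}"
  define c where "c i = - complex_of_real (exp (d i))" for i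
  define b where "b i = complex_of_real (exp (a i))" for i
  define E where "E = (\<Prod>i<n. complex_of_real (exp ((a i - d i) / 2)))"
  have E0: "E \<noteq> 0" by (simp add: E_def)
  have qm: "- complex_of_real (exp (d i - s * N * of_int (k::int))) = q powi k * c i" for i k
  proof -
    have "exp (d i - s * N * of_int k) = qr powi k * exp (d i)"
      unfolding qr_def exp_power_int exp_add[symmetric] by (simp add: algebra_simps)
    then show ?thesis by (simp add: c_def q_def)
  qed
  have g: "gv n a (\<lambda>i. d i - s * N * of_int (m i)) = ndet n (\<lambda>i j. phi (q powi (m i) * (c i / b j))) * (1 / E)" if m: "m \<in> ?M" for m
  proof -
    have "(\<Prod>i<n. exp ((a i - (d i - s * N * of_int (m i))) / 2)) = (\<Prod>i<n. exp ((a i - d i) / 2))"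
    proof -
      have "(\<Sum>i<n. real_of_int (m i)) = 0" using m unfolding of_int_sum[symmetric] by simp
      then have "(\<Sum>i<n. (a i - (d i - s * N * of_int (m i))) / 2) = (\<Sum>i<n. (a i - d i) / 2) + s * N / 2 * 0"
        by (simp add: sum_subtractf sum.distrib sum_distrib_left[symmetric] sum_divide_distrib[symmetric])
      then show ?thesis by (simp add: exp_sum[symmetric])
    qed
    then have "(\<Prod>i<n. complex_of_real (exp ((a i - (d i - s * N * of_int (m i))) / 2))) = E"
      unfolding E_def of_real_prod[symmetric] by (simp only:)
    then have "gv n a (\<lambda>i. d i - s * N * of_int (m i)) * E = ndet n (\<lambda>i j. phi (q powi (m i) * (c i / b j)))"
      using gv_ndet[of n a "\<lambda>i. d i - s * N * of_int (m i)"] unfolding qm b_def by simp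
    then show ?thesis using E0 by (simp add: field_simps)
  qed
  have g0: "gv n a d * E = ndet n (\<lambda>i j. phi (c i / b j))" unfolding E_def c_def b_def by (rule gv_ndet)
  have "(\<Sum>\<^sub>\<infinity>m\<in>?M. gv n a (\<lambda>i. d i - s * N * of_int (m i))) = (\<Sum>\<^sub>\<infinity>m\<in>?M. ndet n (\<lambda>i j. phi (q powi (m i) * (c i / b j))) * (1 / E))"
    by (rule infsum_cong[OF g])
  also have "\<dots> = (\<Sum>\<^sub>\<infinity>m\<in>?M. ndet n (\<lambda>i j. phi (q powi (m i) * (c i / b j)))) * (1 / E)" by (rule infsum_cmult_left')
  also have "(\<Sum>\<^sub>\<infinity>m\<in>?M. ndet n (\<lambda>i j. phi (q powi (m i) * (c i / b j)))) = ndet n (\<lambda>i j. phi (c i / b j)) * (poch q q ^ 2) ^ (n - 1) * theta_reg q (\<Prod>i<n. c i / b i) * wfac n c b"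
  proof (rule sum_zero_translations[OF n])
    show "c i \<noteq> 0" "b i \<noteq> 0" for i by (simp_all add: c_def b_def)
    show "regular (c i / b j)" for i j
      using neg_regular[of "exp (d i) / exp (a j)"] by (simp add: c_def b_def)
    show "regular (\<Prod>i<n. c i / b i)" using reg unfolding c_def b_def .
  qed
  finally show ?thesis unfolding g0[symmetric] c_def[symmetric] b_def[symmetric] using E0
    unfolding c_def[abs_def, symmetric] b_def[abs_def, symmetric] by simp
qed

lemma thetas_GL:
  assumes g: "g = GL n"
  defines "x \<equiv> \<lambda>i. complex_of_real (exp (s * h (CEps (Suc i))))" and "y \<equiv> \<lambda>i. complex_of_real (exp (s * h (CDlt (Suc i))))"
  shows "wfac n (\<lambda>i. - y i) x = thetas" "wfac n (\<lambda>i. - x i) y = thetas"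
proof -
  have cd: "CEps (Suc i) \<in> cds g" "CDlt (Suc i) \<in> cds g" if "i < n" for i using that by (auto simp: cds_def g)
  have th: "thetas = (\<Prod>k<n. \<Prod>i<k. theta_reg q (x i / x k)) * (\<Prod>k<n. \<Prod>i<k. theta_reg q (y i / y k)) / (\<Prod>i<n. \<Prod>j<n. theta_reg q (- (x i / y j)))"
  proof -
    have e: "(\<Prod>t\<in>even_half g. theta_reg q (chr s (rt t))) = (\<Prod>k<n. \<Prod>i<k. theta_reg q (x i / x k)) * (\<Prod>k<n. \<Prod>i<k. theta_reg q (y i / y k))"
      unfolding g prod.even_half_GL unfolding g[symmetric] x_def y_def
      by (intro arg_cong2[where f="(*)"] prod.cong refl) (use cd in \<open>simp_all add: chr_rt\<close>)
    have o: "(\<Prod>t\<in>odd_half g. theta_reg q (- chr s (rt t))) = (\<Prod>i<n. \<Prod>j<n. theta_reg q (- (x i / y j)))"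
      unfolding g prod.odd_half_GL unfolding g[symmetric] x_def y_def
      by (intro prod.cong refl) (use cd in \<open>simp_all add: chr_rt\<close>)
    show ?thesis unfolding thetas_def e o ..
  qed
  have inv: "theta_reg q (u / v) = theta_reg q (v / u)" "theta_reg q (- (u / v)) = theta_reg q (- (v / u))" for u v
    using theta_reg_inverse[of "v / u"] theta_reg_inverse[of "- (v / u)"] by simp_all
  have sw: "(\<Prod>i<n. \<Prod>j<n. theta_reg q (- (y i / x j))) = (\<Prod>i<n. \<Prod>j<n. theta_reg q (- (x i / y j)))"
    by (subst prod.swap) (simp only: inv(2)[of "y _"])
  have "wfac n (\<lambda>i. - y i) x = (\<Prod>k<n. \<Prod>i<k. theta_reg q (y i / y k)) * (\<Prod>k<n. \<Prod>i<k. theta_reg q (x k / x i)) / (\<Prod>i<n. \<Prod>j<n. theta_reg q (- (y i / x j)))"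
    unfolding wfac_def by (simp add: prod.distrib)
  also have "\<dots> = thetas" unfolding th sw using inv(1)[of "x k" "x i" for k i] by (simp add: mult.commute)
  finally show "wfac n (\<lambda>i. - y i) x = thetas" .
  have "wfac n (\<lambda>i. - x i) y = (\<Prod>k<n. \<Prod>i<k. theta_reg q (x i / x k)) * (\<Prod>k<n. \<Prod>i<k. theta_reg q (y k / y i)) / (\<Prod>i<n. \<Prod>j<n. theta_reg q (- (x i / y j)))"
    unfolding wfac_def by (simp add: prod.distrib)
  also have "\<dots> = thetas" unfolding th using inv(1)[of "y k" "y i" for k i] by simp
  finally show "wfac n (\<lambda>i. - x i) y = thetas" .
qed

lemma val_GL: "g = GL n \<Longrightarrow> val k = gv n (\<lambda>i. k (CEps (Suc i))) (\<lambda>i. k (CDlt (Suc i)))"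
  unfolding val_def gv_def by (simp only: prod.even_half_GL prod.odd_half_GL prod.distrib split mult_minus1 add_uminus_conv_diff)

lemma evaluated_GL:
  assumes g: "g = GL n" and n: "n \<ge> 1" and u: "u = CDlt \<or> u = CEps"
  shows "evaluated u n {m \<in> shifts n. (\<Sum>i<n. m i) = 0}"
proof -
  let ?M = "{m \<in> shifts n. (\<Sum>i<n. m i) = 0}"
  define a where "a i = s * h (CEps (Suc i))" for i
  define d where "d i = s * h (CDlt (Suc i))" for i
  note f = f_factor_GL[OF g]
  have cd: "CEps (Suc i) \<in> cds g" "CDlt (Suc i) \<in> cds g" if "i < n" for i using that by (auto simp: cds_def g)
  have str': "str n c = (\<Sum>i\<in>{1..n}. (if c = CEps i then 1 else 0) - (if c = CDlt i then 1 else 0))" for c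
    unfolding str_def sum_coordinate by (rule sum.cong) (auto simp: unit_weight_def)
  have chstr: "chr s (str n) = (\<Prod>i<n. of_real (exp (a i)) / of_real (exp (d i)))"
  proof -
    have "chr s (sum f A) = (\<Prod>x\<in>A. chr s (f x))" for f :: "nat \<Rightarrow> weight" and A
      by (induction A rule: infinite_finite_induct) (simp_all only: sum.infinite prod.infinite sum.empty prod.empty sum.insert prod.insert chi_0 chi_add not_False_eq_True)
    then have "chr s (str n) = (\<Prod>i\<in>{1..n}. chr s (eps i - dlt i))" unfolding str_def .
    also have "\<dots> = (\<Prod>i<n. chr s (eps (Suc i) - dlt (Suc i)))" by (rule prod.reindex_bij_witness[of _ Suc "\<lambda>i. i - 1"]) auto
    also have "\<dots> = (\<Prod>i<n. of_real (exp (a i)) / of_real (exp (d i)))"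
      by (rule prod.cong[OF refl]) (use cd in \<open>simp add: chi_diff chr_unit a_def d_def\<close>)
    finally show ?thesis .
  qed
  have sg: "(\<Prod>i<n. - x i / y i) = (-1) ^ n * (\<Prod>i<n. x i / y i)" for x y :: "nat \<Rightarrow> complex"
  proof -
    have "(\<Prod>i<n. - x i / y i) = (\<Prod>i<n. -1 * (x i / y i))" by simp
    then show ?thesis unfolding prod.distrib by simp
  qed
  have A1: "(\<Prod>i<n. - of_real (exp (a i)) / of_real (exp (d i))) = (-1) ^ n * chr s (str n)" unfolding sg chstr ..
  have A2: "(\<Prod>i<n. - of_real (exp (d i)) / of_real (exp (a i))) = 1 / ((-1) ^ n * chr s (str n))"
    unfolding sg chstr by (cases "even n") (simp_all add: prod_dividef)
  have r1: "regular ((-1) ^ n * chr s (str n))"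
  proof (cases "even n")
    case True
    have "regular (chr s (str n))"
    proof (rule generic_regular[where ?c0.0="CEps 1"])
      show "str n c \<in> \<int>" for c unfolding str' by (intro Ints_sum) auto
      show "str n (CEps 1) \<noteq> 0" unfolding str' using n by simp
    qed (use n g in \<open>auto simp: cds_def\<close>)
    then show ?thesis using True by simp
  next
    case False
    then show ?thesis using neg_regular[of "exp (s * H (str n))"] by (simp add: chr_def)
  qed
  have r2: "regular (1 / ((-1) ^ n * chr s (str n)))" by (rule regular_inverse[OF r1])
  have poch: "poch q q ^ rank' * (1 / poch q q ^ 2) = (poch q q ^ 2) ^ (n - 1)" if "rank' = 2 * n" for rank'
  proof -
    have "rank' = 2 * (n - 1) + 2" using that n by simp
    then have "poch q q ^ rank' = (poch q q ^ 2) ^ (n - 1) * poch q q ^ 2" by (simp only: power_add power_mult)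
    then show ?thesis using poch_q_nz by simp
  qed
  have rk: "Defs.rank g = 2 * n" by (simp add: g)
  have v0: "val (\<lambda>c. s * h c) = gv n a d" unfolding val_GL[OF g] a_def d_def ..
  have thetas_eq: "wfac n (\<lambda>i. - of_real (exp (d i))) (\<lambda>i. of_real (exp (a i))) = thetas" "wfac n (\<lambda>i. - of_real (exp (a i))) (\<lambda>i. of_real (exp (d i))) = thetas"
    using thetas_GL[OF g] unfolding a_def d_def by simp_all
  have "(\<Sum>\<^sub>\<infinity>m\<in>?M. val (\<lambda>c. s * hm u n m c)) = gv n a d * ((poch q q ^ 2) ^ (n - 1) * theta_reg q ((-1) ^ n * chr s (str n)) * thetas)"
    using u
  proof
    assume u: "u = CDlt"
    have "val (\<lambda>c. s * hm u n m c) = gv n a (\<lambda>i. d i - s * N * of_int (m i))" for m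
      unfolding val_GL[OF g] u by (rule gv_cong) (simp_all add: hm_def a_def d_def algebra_simps)
    then show ?thesis using gv_sum[OF n, of d a] r2 unfolding A2 thetas_eq theta_reg_inverse by simp
  next
    assume u: "u = CEps"
    have "val (\<lambda>c. s * hm u n m c) = gv n d (\<lambda>i. a i - s * N * of_int (m i))" for m
      unfolding val_GL[OF g] u gv_sym[of n d] by (rule gv_cong) (simp_all add: hm_def a_def d_def algebra_simps)
    then show ?thesis using gv_sum[OF n, of a d] r1 unfolding A1 thetas_eq gv_sym[of n a d] by simp
  qed
  then show ?thesis unfolding evaluated_def using f(1) unfolding f(2) v0 poch[OF rk, symmetric] by (simp add: mult_ac)
qed

end

section \<open>The orthosymplectic case\<close>

lemma sh_tr: "sh (u + v) * sh (u - v) = tr (of_real (exp u)) - tr (of_real (exp v))"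
  and ch_tr: "ch (u + v) * ch (u - v) = tr (of_real (exp u)) + tr (of_real (exp v))"
  and sh_double: "sh (u + u) = of_real (exp u) - 1 / of_real (exp u)"
proof -
  define X where "X = complex_of_real (exp (u / 2))"
  define Y where "Y = complex_of_real (exp (v / 2))"
  have nz: "X \<noteq> 0" "Y \<noteq> 0" by (simp_all add: X_def Y_def)
  have sq: "complex_of_real (exp w) = of_real (exp (w / 2)) * of_real (exp (w / 2))" for w by (simp flip: of_real_mult exp_add)
  have inv: "complex_of_real (exp (- w / 2)) = 1 / of_real (exp (w / 2))" for w by (simp add: exp_minus inverse_eq_divide)
  have p: "sh (u + v) = X * Y - 1 / (X * Y)" "ch (u + v) = X * Y + 1 / (X * Y)"
    using sh_ch_half[of u "- v"] unfolding inv X_def[symmetric] Y_def[symmetric] by (simp_all add: mult.commute)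
  have m: "sh (u - v) = X / Y - Y / X" "ch (u - v) = X / Y + Y / X" unfolding sh_ch_half X_def Y_def by (rule refl)+
  have e: "complex_of_real (exp u) = X * X" "complex_of_real (exp v) = Y * Y" unfolding sq[of u] sq[of v] X_def Y_def by (rule refl)+
  show "sh (u + v) * sh (u - v) = tr (of_real (exp u)) - tr (of_real (exp v))"
    unfolding p m e tr_def using nz by (simp add: field_simps)
  show "ch (u + v) * ch (u - v) = tr (of_real (exp u)) + tr (of_real (exp v))"
    unfolding p m e tr_def using nz by (simp add: field_simps)
  show "sh (u + u) = of_real (exp u) - 1 / of_real (exp u)"
    by (simp add: sh_def exp_minus inverse_eq_divide)
qed

lemma prod_triangle_Suc:
  fixes f :: "nat \<Rightarrow> nat \<Rightarrow> complex"
  shows "(\<Prod>k<Suc n. \<Prod>i<k. f i k) = (\<Prod>k<n. f 0 (Suc k)) * (\<Prod>k<n. \<Prod>i<k. f (Suc i) (Suc k))"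
  by (simp add: prod.lessThan_Suc_shift prod.distrib del: prod.lessThan_Suc)

context character
begin

lemma nb_cong:
  assumes e: "\<And>i. i < n \<Longrightarrow> y i = y' i"
  shows "nb n x0 z y = nb n x0 z y'"
proof -
  have 1: "(\<Prod>i<n. (y i - 1 / y i) / (tr x0 + tr (y i))) = (\<Prod>i<n. (y' i - 1 / y' i) / (tr x0 + tr (y' i)))"
    by (rule prod.cong[OF refl]) (simp add: e)
  have 2: "(\<Prod>i<n. 1 / (tr (z i) + tr (y i))) = (\<Prod>i<n. 1 / (tr (z i) + tr (y' i)))"
    by (rule prod.cong[OF refl]) (simp add: e)
  have 3: "(\<Prod>k<n. \<Prod>i<k. (tr (y k) - tr (y i)) * (tr (z k) - tr (z i)) / ((tr (z k) + tr (y i)) * (tr (z i) + tr (y k))))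
    = (\<Prod>k<n. \<Prod>i<k. (tr (y' k) - tr (y' i)) * (tr (z k) - tr (z i)) / ((tr (z k) + tr (y' i)) * (tr (z i) + tr (y' k))))"
  proof (rule prod.cong[OF refl], rule prod.cong[OF refl])
    fix k i assume "k \<in> {..<n}" "i \<in> {..<k}"
    then have "y k = y' k" "y i = y' i" using e[of k] e[of i] by simp_all
    then show "(tr (y k) - tr (y i)) * (tr (z k) - tr (z i)) / ((tr (z k) + tr (y i)) * (tr (z i) + tr (y k)))
      = (tr (y' k) - tr (y' i)) * (tr (z k) - tr (z i)) / ((tr (z k) + tr (y' i)) * (tr (z i) + tr (y' k)))" by (simp only:)
  qed
  show ?thesis unfolding nb_def 1 2 3 ..
qed

text \<open>
  The roots with the same pair of coordinates and opposite signs combine to differences and sums of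
  \<open>x + 1 / x\<close>.
\<close>

lemma val_OSP:
  assumes g: "g = OSP n"
  shows "val k = (-1) ^ n * nb n (of_real (exp (k (CEps (Suc 0))))) (\<lambda>j. of_real (exp (k (CEps (Suc (Suc j)))))) (\<lambda>i. of_real (exp (k (CDlt (Suc i)))))"
proof -
  define X where "X i = complex_of_real (exp (k (CEps (Suc i))))" for i
  define y where "y i = complex_of_real (exp (k (CDlt (Suc i))))" for i
  let ?z = "\<lambda>j. X (Suc j)"
  have V: "val k = (\<Prod>k<Suc n. \<Prod>i<k. tr (X i) - tr (X k)) * ((\<Prod>k<n. \<Prod>i<k. tr (y i) - tr (y k)) * (\<Prod>i<n. y i - 1 / y i)) / (\<Prod>i<Suc n. \<Prod>j<n. tr (X i) + tr (y j))"
    unfolding val_def unfolding g prod.even_half_OSP prod.odd_half_OSP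
    by (simp only: split mult_1_left mult_minus1 add_uminus_conv_diff sh_tr ch_tr sh_double X_def y_def)
  have sgn: "(\<Prod>k<n. tr (X 0) - tr (?z k)) = (-1) ^ n * (\<Prod>k<n. tr (?z k) - tr (X 0))"
  proof -
    have "(\<Prod>k<n. tr (X 0) - tr (?z k)) = (\<Prod>k<n. -1 * (tr (?z k) - tr (X 0)))" by (rule prod.cong) auto
    then show ?thesis unfolding prod.distrib by simp
  qed
  have pair: "(\<Prod>k<n. \<Prod>i<k. tr (?z i) - tr (?z k)) * (\<Prod>k<n. \<Prod>i<k. tr (y i) - tr (y k)) = (\<Prod>k<n. \<Prod>i<k. (tr (y k) - tr (y i)) * (tr (?z k) - tr (?z i)))"
    unfolding prod.distrib[symmetric] by (intro prod.cong refl) (simp add: algebra_simps)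
  have D: "(\<Prod>i<Suc n. \<Prod>j<n. tr (X i) + tr (y j)) = (\<Prod>j<n. tr (X 0) + tr (y j)) * ((\<Prod>i<n. tr (?z i) + tr (y i)) * (\<Prod>k<n. \<Prod>i<k. (tr (?z k) + tr (y i)) * (tr (?z i) + tr (y k))))"
    unfolding prod.lessThan_Suc_shift prod_square_split[of "\<lambda>i j. tr (?z i) + tr (y j)"] by (simp only: mult.commute)
  have "val k = (-1) ^ n * (\<Prod>k<n. tr (?z k) - tr (X 0)) * ((\<Prod>k<n. \<Prod>i<k. tr (?z i) - tr (?z k)) * (\<Prod>k<n. \<Prod>i<k. tr (y i) - tr (y k))) * (\<Prod>i<n. y i - 1 / y i)
     / ((\<Prod>j<n. tr (X 0) + tr (y j)) * ((\<Prod>i<n. tr (?z i) + tr (y i)) * (\<Prod>k<n. \<Prod>i<k. (tr (?z k) + tr (y i)) * (tr (?z i) + tr (y k)))))"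
    unfolding V prod_triangle_Suc sgn D by (simp only: mult_ac)
  also have "\<dots> = (-1) ^ n * nb n (X 0) ?z y"
    unfolding pair nb_def prod_dividef prod.neutral_const by (simp add: mult_ac)
  finally show ?thesis unfolding X_def y_def .
qed

lemma thetas_OSP:
  assumes g: "g = OSP n"
  defines "X \<equiv> \<lambda>i. complex_of_real (exp (s * h (CEps (Suc i))))" and "y \<equiv> \<lambda>i. complex_of_real (exp (s * h (CDlt (Suc i))))"
  shows "poch q q ^ Defs.rank g * thetas * (1 / poch q q) =
    ((\<Prod>i<n. poch q q ^ 2 * theta_reg q (y i * y i) / (theta_reg q (- y i / X 0) * theta_reg q (- (X 0 * y i)))) *
     (\<Prod>j<n. theta_reg q (X (Suc j) * X 0) * theta_reg q (X (Suc j) / X 0)) *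
     ((\<Prod>i<n. 1 / (theta_reg q (- y i / X (Suc i)) * theta_reg q (- (X (Suc i) * y i)))) *
      (\<Prod>k<n. \<Prod>i<k. theta_reg q (y k * y i) * theta_reg q (y k / y i) * theta_reg q (X (Suc k) * X (Suc i)) * theta_reg q (X (Suc k) / X (Suc i))
         / (theta_reg q (- y i / X (Suc k)) * theta_reg q (- (X (Suc k) * y i)) * theta_reg q (- y k / X (Suc i)) * theta_reg q (- (X (Suc i) * y k))))))"
proof -
  let ?t = "theta_reg q"
  have cd: "CEps (Suc i) \<in> cds g" if "i < Suc n" for i using that by (auto simp: cds_def g)
  have cd': "CDlt (Suc i) \<in> cds g" if "i < n" for i using that by (auto simp: cds_def g)
  have e: "(\<Prod>t\<in>even_half g. ?t (chr s (rt t))) = (\<Prod>k<Suc n. \<Prod>i<k. ?t (X i * X k) * ?t (X i / X k)) * ((\<Prod>k<n. \<Prod>i<k. ?t (y i * y k) * ?t (y i / y k)) * (\<Prod>i<n. ?t (y i * y i)))"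
    unfolding g prod.even_half_OSP unfolding g[symmetric] X_def y_def
    by (intro arg_cong2[where f="(*)"] prod.cong refl) (use cd cd' in \<open>simp_all add: chr_rt\<close>)
  have o: "(\<Prod>t\<in>odd_half g. ?t (- chr s (rt t))) = (\<Prod>i<Suc n. \<Prod>j<n. ?t (- (X i * y j)) * ?t (- (X i / y j)))"
    unfolding g prod.odd_half_OSP unfolding g[symmetric] X_def y_def
    by (intro prod.cong refl) (use cd cd' in \<open>simp_all add: chr_rt\<close>)
  have inv: "?t (u / v) = ?t (v / u)" "?t (- u / v) = ?t (- (v / u))" for u v
    using theta_reg_inverse[of "v / u"] theta_reg_inverse[of "- (v / u)"] by simp_all
  define A where "A = (\<Prod>k<n. ?t (X 0 * X (Suc k)) * ?t (X 0 / X (Suc k)))"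
  define B where "B = (\<Prod>k<n. \<Prod>i<k. ?t (X (Suc i) * X (Suc k)) * ?t (X (Suc i) / X (Suc k)))"
  define C where "C = (\<Prod>k<n. \<Prod>i<k. ?t (y i * y k) * ?t (y i / y k))"
  define D where "D = (\<Prod>i<n. ?t (y i * y i))"
  define E where "E = (\<Prod>j<n. ?t (- (X 0 * y j)) * ?t (- (X 0 / y j)))"
  define F where "F = (\<Prod>i<n. ?t (- (X (Suc i) * y i)) * ?t (- (X (Suc i) / y i)))"
  define G where "G = (\<Prod>k<n. \<Prod>i<k. (?t (- (X (Suc i) * y k)) * ?t (- (X (Suc i) / y k))) * (?t (- (X (Suc k) * y i)) * ?t (- (X (Suc k) / y i))))"
  have T: "thetas = (A * B) * (C * D) / (E * (F * G))"
    unfolding thetas_def e o prod_triangle_Suc[of "\<lambda>i k. ?t (X i * X k) * ?t (X i / X k)"]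
      prod.lessThan_Suc_shift[of "\<lambda>i. \<Prod>j<n. ?t (- (X i * y j)) * ?t (- (X i / y j))"]
      prod_square_split[of "\<lambda>i j. ?t (- (X (Suc i) * y j)) * ?t (- (X (Suc i) / y j))"]
      A_def B_def C_def D_def E_def F_def G_def by (simp only: comp_def mult_ac)
  have r1: "(\<Prod>i<n. poch q q ^ 2 * ?t (y i * y i) / (?t (- y i / X 0) * ?t (- (X 0 * y i)))) = (poch q q ^ 2) ^ n * D / E"
    unfolding inv(2)[of "y _" "X 0"] D_def E_def prod_dividef prod.distrib by (simp add: mult_ac)
  have r2: "(\<Prod>j<n. ?t (X (Suc j) * X 0) * ?t (X (Suc j) / X 0)) = A"
    unfolding A_def by (rule prod.cong[OF refl]) (simp only: inv(1)[of "X (Suc _)" "X 0"] mult.commute)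
  have r3: "(\<Prod>i<n. 1 / (?t (- y i / X (Suc i)) * ?t (- (X (Suc i) * y i)))) = 1 / F"
    unfolding inv(2)[of "y _" "X (Suc _)"] F_def prod_dividef by (simp add: mult.commute)
  have r4: "(\<Prod>k<n. \<Prod>i<k. ?t (y k * y i) * ?t (y k / y i) * ?t (X (Suc k) * X (Suc i)) * ?t (X (Suc k) / X (Suc i))
         / (?t (- y i / X (Suc k)) * ?t (- (X (Suc k) * y i)) * ?t (- y k / X (Suc i)) * ?t (- (X (Suc i) * y k)))) = C * B / G"
    unfolding C_def B_def G_def prod.distrib[symmetric] prod_dividef[symmetric]
  proof (intro prod.cong refl)
    fix k i
    show "?t (y k * y i) * ?t (y k / y i) * ?t (X (Suc k) * X (Suc i)) * ?t (X (Suc k) / X (Suc i))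
         / (?t (- y i / X (Suc k)) * ?t (- (X (Suc k) * y i)) * ?t (- y k / X (Suc i)) * ?t (- (X (Suc i) * y k)))
      = ?t (y i * y k) * ?t (y i / y k) * (?t (X (Suc i) * X (Suc k)) * ?t (X (Suc i) / X (Suc k)))
         / (?t (- (X (Suc i) * y k)) * ?t (- (X (Suc i) / y k)) * (?t (- (X (Suc k) * y i)) * ?t (- (X (Suc k) / y i))))"
      unfolding inv(2)[of "y i" "X (Suc k)"] inv(2)[of "y k" "X (Suc i)"] inv(1)[of "y k" "y i"] inv(1)[of "X (Suc k)" "X (Suc i)"]
        mult.commute[of "y k" "y i"] mult.commute[of "X (Suc k)" "X (Suc i)"]
      by (simp only: mult_ac)
  qed
  have "poch q q ^ Defs.rank g * (1 / poch q q) = (poch q q ^ 2) ^ n" using poch_q_nz by (simp add: g power_mult)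
  then have "poch q q ^ Defs.rank g * thetas * (1 / poch q q) = (poch q q ^ 2) ^ n * thetas" by (simp add: mult_ac)
  then show ?thesis unfolding r1 r2 r3 r4 T by (simp add: mult_ac)
qed

lemma evaluated_OSP:
  assumes g: "g = OSP n" and n: "n \<ge> 1"
  shows "evaluated CDlt n (shifts n)"
proof -
  define X where "X i = complex_of_real (exp (s * h (CEps (Suc i))))" for i
  define y where "y i = complex_of_real (exp (s * h (CDlt (Suc i))))" for i
  note f = f_factor_OSP[OF g]
  have v0: "val (\<lambda>c. s * h c) = (-1) ^ n * nb n (X 0) (\<lambda>j. X (Suc j)) y" unfolding val_OSP[OF g] X_def y_def ..
  have v: "val (\<lambda>c. s * hm CDlt n m c) = (-1) ^ n * nb n (X 0) (\<lambda>j. X (Suc j)) (\<lambda>i. q powi (m i) * y i)" for m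
  proof -
    have yi: "complex_of_real (exp (s * hm CDlt n m (CDlt (Suc i)))) = q powi (m i) * y i" if "i < n" for i
    proof -
      have "exp (s * hm CDlt n m (CDlt (Suc i))) = qr powi (m i) * exp (s * h (CDlt (Suc i)))"
        unfolding qr_def exp_power_int exp_add[symmetric] using that by (simp add: hm_def algebra_simps)
      then show ?thesis by (simp add: y_def q_def)
    qed
    have x: "hm CDlt n m (CEps i) = h (CEps i)" for i by (simp add: hm_def)
    have c: "nb n (X 0) Z (\<lambda>i. of_real (exp (s * hm CDlt n m (CDlt (Suc i))))) = nb n (X 0) Z (\<lambda>i. q powi (m i) * y i)" for Z
      by (rule nb_cong) (rule yi)
    show ?thesis unfolding val_OSP[OF g] x unfolding X_def[symmetric] unfolding c ..
  qed
  have nz: "X i \<noteq> 0" "y i \<noteq> 0" for i by (simp_all add: X_def y_def)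
  have r: "regular (- y i / X j)" "regular (- (X j * y i))" for i j
    using neg_regular[of "exp (s * h (CDlt (Suc i))) / exp (s * h (CEps (Suc j)))"] neg_regular[of "exp (s * h (CEps (Suc j))) * exp (s * h (CDlt (Suc i)))"]
    by (simp_all add: X_def y_def)
  have r5: "regular (X (Suc j) * X 0)" if j: "j < n" for j
  proof -
    have cd: "CEps (Suc (Suc j)) \<in> cds g" "CEps (Suc 0) \<in> cds g" using j by (auto simp: cds_def g)
    have "regular (chr s (eps (Suc (Suc j)) + eps (Suc 0)))"
      by (rule generic_regular[where ?c0.0="CEps (Suc 0)"]) (use cd in \<open>auto simp: unit_weight_def\<close>)
    then show ?thesis unfolding chi_add chr_unit[OF cd(1)] chr_unit[OF cd(2)] X_def .
  qed
  have "(\<Sum>\<^sub>\<infinity>m\<in>shifts n. val (\<lambda>c. s * hm CDlt n m c)) = (-1) ^ n * (\<Sum>\<^sub>\<infinity>m\<in>shifts n. nb n (X 0) (\<lambda>j. X (Suc j)) (\<lambda>i. q powi (m i) * y i))"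
    unfolding v by (rule infsum_cmult_right')
  also have "(\<Sum>\<^sub>\<infinity>m\<in>shifts n. nb n (X 0) (\<lambda>j. X (Suc j)) (\<lambda>i. q powi (m i) * y i)) = nb n (X 0) (\<lambda>j. X (Suc j)) y * (poch q q ^ Defs.rank g * thetas * (1 / poch q q))"
    unfolding thetas_OSP[OF g] X_def[symmetric] y_def[symmetric] by (rule sum_all_translations) (use nz r r5 in auto)
  finally show ?thesis unfolding evaluated_def using f(1) unfolding f(2) v0 by (simp add: mult_ac)
qed

end

section \<open>Lattices, heights and the main theorem\<close>

lemma transl_dlt:
  assumes "dlt_dim g = n" "\<And>i. i < n \<Longrightarrow> \<mu> (CDlt (Suc i)) = of_int (m i)" "\<And>i. \<mu> (CEps i) = 0"
  shows "transl g \<mu> = twist CDlt n m"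
proof -
  have "form g l \<mu> = (\<Sum>i<n. of_int (m i) * l (CDlt (Suc i)))" for l
  proof -
    have "(\<Sum>i\<in>{1..n}. l (CDlt i) * \<mu> (CDlt i)) = (\<Sum>i<n. l (CDlt (Suc i)) * \<mu> (CDlt (Suc i)))"
      by (rule sum.reindex_bij_witness[of _ Suc "\<lambda>i. i - 1"]) auto
    then show ?thesis unfolding form_def assms(1,3) using assms(2) by (simp add: mult.commute)
  qed
  then show ?thesis unfolding transl_def twist_def by (intro ext) simp
qed

lemma transl_eps:
  assumes "eps_dim g = n" "\<And>i. i < n \<Longrightarrow> \<mu> (CEps (Suc i)) = - of_int (m i)" "\<And>i. \<mu> (CDlt i) = 0"
  shows "transl g \<mu> = twist CEps n m"
proof -
  have "form g l \<mu> = (\<Sum>i<n. of_int (m i) * l (CEps (Suc i)))" for l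
  proof -
    have "(\<Sum>i\<in>{1..n}. l (CEps i) * \<mu> (CEps i)) = (\<Sum>i<n. l (CEps (Suc i)) * \<mu> (CEps (Suc i)))"
      by (rule sum.reindex_bij_witness[of _ Suc "\<lambda>i. i - 1"]) auto
    then show ?thesis unfolding form_def assms(1,3) using assms(2) by (simp add: sum_negf mult.commute)
  qed
  then show ?thesis unfolding transl_def twist_def by (intro ext) simp
qed

lemma transl_OSP: "transl (OSP n) ` lattice_OSP n = twist CDlt n ` shifts n"
proof -
  define mu where "mu c = (\<Sum>i\<in>{1..n}. scl (of_int (c i)) (dlt i))" for c :: "nat \<Rightarrow> int"
  have t: "transl (OSP n) (mu c) = twist CDlt n m" if m: "\<And>i. i < n \<Longrightarrow> m i = c (Suc i)" for c m
  proof (rule transl_dlt)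
    show "mu c (CDlt (Suc i)) = of_int (m i)" if i: "i < n" for i
    proof -
      have "mu c (CDlt (Suc i)) = (\<Sum>j\<in>{1..n}. if j = Suc i then of_int (c (Suc i)) else 0)"
        unfolding mu_def sum_coordinate by (rule sum.cong) (auto simp: scl_def unit_weight_def)
      then show ?thesis using i m by simp
    qed
    show "mu c (CEps i) = 0" for i unfolding mu_def sum_coordinate by (simp add: scl_def unit_weight_def)
  qed simp
  have a: "lattice_OSP n = range mu" unfolding lattice_OSP_def mu_def by auto
  have b: "transl (OSP n) ` range mu \<subseteq> twist CDlt n ` shifts n"
  proof clarify
    fix c
    have e: "transl (OSP n) (mu c) = twist CDlt n (restrict (\<lambda>i. c (Suc i)) {0..<n})" by (rule t) simp
    show "transl (OSP n) (mu c) \<in> twist CDlt n ` shifts n" unfolding e by (rule imageI) auto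
  qed
  have c: "twist CDlt n ` shifts n \<subseteq> transl (OSP n) ` range mu"
  proof clarify
    fix m :: "nat \<Rightarrow> int"
    have "twist CDlt n m = transl (OSP n) (mu (\<lambda>i. m (i - 1)))" by (rule t[symmetric]) simp
    then show "twist CDlt n m \<in> transl (OSP n) ` range mu" by blast
  qed
  show ?thesis unfolding a by (rule subset_antisym[OF b c])
qed

text \<open>
  The coefficients in the basis of simple roots are the partial sums of the coordinates.
\<close>

lemma GL_lattice:
  fixes U :: "nat \<Rightarrow> coord" and sgn :: int
  assumes inj: "\<And>i j. U i = U j \<longleftrightarrow> i = j" and sgn: "sgn * sgn = 1"
    and t: "\<And>\<mu> m. (\<And>i. i < n \<Longrightarrow> \<mu> (U (Suc i)) = of_int (sgn * m i)) \<Longrightarrow> (\<And>c. c \<notin> range U \<Longrightarrow> \<mu> c = 0) \<Longrightarrow> f \<mu> = twist U n m"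
    and n: "n \<ge> 1"
  shows "f ` {\<Sum>i\<in>{1..<n}. scl (of_int (c i)) (unit_weight (U i) - unit_weight (U (i+1))) | c :: nat \<Rightarrow> int. True}
    = twist U n ` {m \<in> shifts n. (\<Sum>i<n. m i) = 0}"
proof -
  define mu where "mu c = (\<Sum>i\<in>{1..<n}. scl (of_int (c i)) (unit_weight (U i) - unit_weight (U (i+1))))" for c :: "nat \<Rightarrow> int"
  define c' where "c' c j = (if 1 \<le> j \<and> j < n then c j else 0)" for c :: "nat \<Rightarrow> int" and j
  have mu0: "mu c x = 0" if "x \<notin> range U" for c x
    using that unfolding mu_def sum_coordinate by (intro sum.neutral) (auto simp: scl_def unit_weight_def)
  have mu1: "mu c (U (Suc i)) = of_int (c' c (Suc i) - c' c i)" for c i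
  proof -
    have "mu c (U (Suc i)) = (\<Sum>j\<in>{1..<n}. (if j = Suc i then of_int (c (Suc i)) else 0) - (if j = i then of_int (c i) else 0))"
      unfolding mu_def sum_coordinate by (rule sum.cong) (auto simp: scl_def unit_weight_def inj)
    then show ?thesis by (simp add: sum_subtractf c'_def)
  qed
  have T: "f (mu c) = twist U n m" if m: "\<And>i. i < n \<Longrightarrow> sgn * m i = c' c (Suc i) - c' c i" for c m
    by (rule t) (use m mu0 in \<open>simp_all only: mu1\<close>)
  have "f ` range mu \<subseteq> twist U n ` {m \<in> shifts n. (\<Sum>i<n. m i) = 0}"
  proof clarify
    fix c
    let ?m = "restrict (\<lambda>i. sgn * (c' c (Suc i) - c' c i)) {0..<n}"
    have "f (mu c) = twist U n ?m" by (rule T) (simp add: sgn mult.assoc[symmetric])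
    moreover have "(\<Sum>i<n. ?m i) = 0"
    proof -
      have "(\<Sum>i<n. ?m i) = sgn * (\<Sum>i<n. c' c (Suc i) - c' c i)" by (simp add: sum_distrib_left)
      also have "(\<Sum>i<n. c' c (Suc i) - c' c i) = 0" unfolding sum_lessThan_telescope by (simp add: c'_def)
      finally show ?thesis by simp
    qed
    ultimately show "f (mu c) \<in> twist U n ` {m \<in> shifts n. (\<Sum>i<n. m i) = 0}" by (intro image_eqI[of _ _ ?m]) auto
  qed
  moreover have "twist U n ` {m \<in> shifts n. (\<Sum>i<n. m i) = 0} \<subseteq> f ` range mu"
  proof clarify
    fix m :: "nat \<Rightarrow> int" assume z: "(\<Sum>i<n. m i) = 0"
    let ?c = "\<lambda>j. sgn * (\<Sum>k<j. m k)"
    have "c' ?c j = ?c j" if "j \<le> n" for j using that z by (cases "j = n") (auto simp: c'_def not_less_eq_eq Suc_le_eq)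
    then have "twist U n m = f (mu ?c)" by (intro T[symmetric]) (simp add: algebra_simps)
    then show "twist U n m \<in> f ` range mu" by blast
  qed
  moreover have "{\<Sum>i\<in>{1..<n}. scl (of_int (c i)) (unit_weight (U i) - unit_weight (U (i+1))) | c :: nat \<Rightarrow> int. True} = range mu"
    unfolding mu_def by auto
  ultimately show ?thesis by simp
qed

lemma transl_GL_dlt:
  assumes n: "n \<ge> 1"
  shows "transl (GL n) ` lattice_GL_dlt n = twist CDlt n ` {m \<in> shifts n. (\<Sum>i<n. m i) = 0}"
  unfolding lattice_GL_dlt_def
proof (rule GL_lattice[where U=CDlt and sgn="1" and f="transl (GL n)"])
  show "CDlt i = CDlt j \<longleftrightarrow> i = j" for i j by simp
  show "(1::int) * (1) = 1" by simp
  show "transl (GL n) \<mu> = twist CDlt n m"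
    if a: "\<And>i. i < n \<Longrightarrow> \<mu> (CDlt (Suc i)) = of_int ((1) * m i)" and b: "\<And>c. c \<notin> range CDlt \<Longrightarrow> \<mu> c = 0" for \<mu> m
  proof (rule transl_dlt)
    show "dlt_dim (GL n) = n" by simp
    show "\<mu> (CDlt (Suc i)) = of_int (m i)" if i: "i < n" for i using a[OF i] by simp
    show "\<mu> (CEps i) = 0" for i by (rule b) auto
  qed
qed (rule n)

lemma transl_GL_eps:
  assumes n: "n \<ge> 1"
  shows "transl (GL n) ` lattice_GL_eps n = twist CEps n ` {m \<in> shifts n. (\<Sum>i<n. m i) = 0}"
  unfolding lattice_GL_eps_def
proof (rule GL_lattice[where U=CEps and sgn="-1" and f="transl (GL n)"])
  show "CEps i = CEps j \<longleftrightarrow> i = j" for i j by simp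
  show "(-1::int) * (-1) = 1" by simp
  show "transl (GL n) \<mu> = twist CEps n m"
    if a: "\<And>i. i < n \<Longrightarrow> \<mu> (CEps (Suc i)) = of_int ((-1) * m i)" and b: "\<And>c. c \<notin> range CEps \<Longrightarrow> \<mu> c = 0" for \<mu> m
  proof (rule transl_eps)
    show "eps_dim (GL n) = n" by simp
    show "\<mu> (CEps (Suc i)) = - of_int (m i)" if i: "i < n" for i using a[OF i] by simp
    show "\<mu> (CDlt i) = 0" for i by (rule b) auto
  qed
qed (rule n)

text \<open>
  A small perturbation of the element that cuts out the positive roots keeps all signs, and the value
  on the imaginary root may be taken as large as necessary.
\<close>

lemma datum_exists:
  assumes cl: "classical g" and P: "positive_root_set g P"
  shows "\<exists>h. datum g P h"
proof -
  obtain h0 where h0: "\<And>\<alpha>. \<alpha> \<in> roots g \<Longrightarrow> pairing g h0 \<alpha> \<noteq> 0" "P = {\<alpha> \<in> roots g. pairing g h0 \<alpha> > 0}"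
    using P unfolding positive_root_set_def by blast
  have fin: "finite (roots g)" unfolding roots_def even_roots_half[OF cl] odd_roots_half[OF cl] by simp
  define S where "S \<alpha> = (\<Sum>i\<in>{1..eps_dim g}. \<bar>Re (\<alpha> (CEps i))\<bar>) + (\<Sum>i\<in>{1..dlt_dim g}. \<bar>Re (\<alpha> (CDlt i))\<bar>)" for \<alpha> :: weight
  have S0: "S \<alpha> \<ge> 0" for \<alpha> unfolding S_def by (intro add_nonneg_nonneg sum_nonneg) auto
  define E where "E = insert 1 ((\<lambda>\<alpha>. \<bar>pairing g h0 \<alpha>\<bar> / (S \<alpha> + 1)) ` roots g)"
  define e where "e = Min E"
  have E: "finite E" "E \<noteq> {}" using fin by (auto simp: E_def)
  have Epos: "x > 0" if "x \<in> E" for x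
  proof -
    have "\<bar>pairing g h0 \<alpha>\<bar> / (S \<alpha> + 1) > 0" if "\<alpha> \<in> roots g" for \<alpha>
      using h0(1)[OF that] S0[of \<alpha>] by (intro divide_pos_pos) auto
    then show ?thesis using that by (auto simp: E_def)
  qed
  have e0: "e > 0" unfolding e_def using Epos Min_in[OF E] by blast
  have e1: "e \<le> 1" unfolding e_def using E by (intro Min_le) (auto simp: E_def)
  have eS: "e * S \<alpha> < \<bar>pairing g h0 \<alpha>\<bar>" if a: "\<alpha> \<in> roots g" for \<alpha>
  proof -
    have "e \<le> \<bar>pairing g h0 \<alpha>\<bar> / (S \<alpha> + 1)" unfolding e_def using E a by (intro Min_le) (auto simp: E_def)
    then have "e * (S \<alpha> + 1) \<le> \<bar>pairing g h0 \<alpha>\<bar>" using S0[of \<alpha>] by (simp add: pos_le_divide_eq)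
    then show ?thesis using e0 by (simp add: algebra_simps)
  qed
  define B where "B = (\<Sum>\<alpha>\<in>roots g. 2 * \<bar>pairing g h0 \<alpha>\<bar>)"
  have B: "2 * \<bar>pairing g h0 \<alpha>\<bar> \<le> B" if "\<alpha> \<in> roots g" for \<alpha> unfolding B_def using that fin by (intro member_le_sum) auto
  have B0: "B \<ge> 0" unfolding B_def by (intro sum_nonneg) auto
  obtain h where h: "\<forall>c\<in>cds g. \<bar>h c - (h0(CImag := B + 2)) c\<bar> < e"
    "\<forall>k :: coord \<Rightarrow> int. (\<Sum>c\<in>cds g. of_int (k c) * h c) = 0 \<longrightarrow> (\<forall>c\<in>cds g. k c = 0)"
    using generic_perturbation[OF finite_cds e0, of g "h0(CImag := B + 2)"] by (elim exE conjE) (rule that)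
  have hc: "\<bar>h c - h0 c\<bar> \<le> e" if "c \<in> cds g" "c \<noteq> CImag" for c using h(1) that by fastforce
  have him: "h CImag > B + 1" using bspec[OF h(1), of CImag] e1 by (simp add: cds_def abs_less_iff)
  have d: "\<bar>pairing g h \<alpha> - pairing g h0 \<alpha>\<bar> \<le> e * S \<alpha>" for \<alpha>
  proof -
    have "pairing g h \<alpha> - pairing g h0 \<alpha> = (\<Sum>i\<in>{1..eps_dim g}. (h (CEps i) - h0 (CEps i)) * Re (\<alpha> (CEps i))) + (\<Sum>i\<in>{1..dlt_dim g}. (h (CDlt i) - h0 (CDlt i)) * Re (\<alpha> (CDlt i)))"
      unfolding pairing_def by (simp add: sum_subtractf left_diff_distrib)
    moreover have "\<bar>\<Sum>i\<in>{1..eps_dim g}. (h (CEps i) - h0 (CEps i)) * Re (\<alpha> (CEps i))\<bar> \<le> (\<Sum>i\<in>{1..eps_dim g}. e * \<bar>Re (\<alpha> (CEps i))\<bar>)"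
      by (rule order_trans[OF sum_abs], rule sum_mono, unfold abs_mult, rule mult_right_mono, rule hc) (auto simp: cds_def)
    moreover have "\<bar>\<Sum>i\<in>{1..dlt_dim g}. (h (CDlt i) - h0 (CDlt i)) * Re (\<alpha> (CDlt i))\<bar> \<le> (\<Sum>i\<in>{1..dlt_dim g}. e * \<bar>Re (\<alpha> (CDlt i))\<bar>)"
      by (rule order_trans[OF sum_abs], rule sum_mono, unfold abs_mult, rule mult_right_mono, rule hc) (auto simp: cds_def)
    ultimately show ?thesis unfolding S_def distrib_left sum_distrib_left by linarith
  qed
  have near: "\<bar>pairing g h \<alpha> - pairing g h0 \<alpha>\<bar> < \<bar>pairing g h0 \<alpha>\<bar>" if "\<alpha> \<in> roots g" for \<alpha>
    by (rule le_less_trans[OF d eS[OF that]])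
  have "datum g P h"
  proof
    show "classical g" by (rule cl)
    show "pairing g h \<alpha> \<noteq> 0" if "\<alpha> \<in> roots g" for \<alpha> using near[OF that] by auto
    have "pairing g h \<alpha> > 0 \<longleftrightarrow> pairing g h0 \<alpha> > 0" if "\<alpha> \<in> roots g" for \<alpha> using near[OF that] by linarith
    then show "P = {\<alpha> \<in> roots g. pairing g h \<alpha> > 0}" unfolding h0(2) by blast
    show "\<bar>pairing g h \<alpha>\<bar> < h CImag" if "\<alpha> \<in> roots g" for \<alpha> using near[OF that] B[OF that] him by linarith
    show "h CImag > 0" using him B0 by linarith
    show "k c = 0" if "(\<Sum>c\<in>cds g. of_int (k c) * h c) = 0" "c \<in> cds g" for k :: "coord \<Rightarrow> int" and c
      using h(2) that by blast
  qed
  then show ?thesis by blast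
qed

lemma identity_GL:
  assumes n: "n \<ge> 1" and P: "positive_root_set (GL n) P" and T: "T \<in> transl_groups (GL n)"
  shows "denominator_identity (GL n) P T"
proof -
  obtain h where "datum (GL n) P h" using datum_exists[OF _ P] by (auto simp: classical_def)
  then interpret datum "GL n" P h .
  obtain u where u: "u = CDlt \<or> u = CEps" "T = twist u n ` {m \<in> shifts n. (\<Sum>i<n. m i) = 0}"
    using T transl_GL_dlt[OF n] transl_GL_eps[OF n] by auto
  show ?thesis unfolding u(2)
  proof (rule identity_from_evaluations)
    show "admissible (GL n) u n" using u(1) by (auto simp: admissible_def)
    show "character.evaluated (GL n) P h s u n {m \<in> shifts n. (\<Sum>i<n. m i) = 0}" if "s \<ge> 1" for s
      by (rule character.evaluated_GL[OF characterI[OF that] refl n u(1)])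
  qed auto
qed

lemma identity_OSP:
  assumes n: "n \<ge> 1" and P: "positive_root_set (OSP n) P" and T: "T \<in> transl_groups (OSP n)"
  shows "denominator_identity (OSP n) P T"
proof -
  obtain h where "datum (OSP n) P h" using datum_exists[OF _ P] by (auto simp: classical_def)
  then interpret datum "OSP n" P h .
  have u: "T = twist CDlt n ` shifts n" using T by (simp add: transl_OSP)
  show ?thesis unfolding u
  proof (rule identity_from_evaluations)
    show "admissible (OSP n) CDlt n" by (auto simp: admissible_def)
    show "character.evaluated (OSP n) P h s CDlt n (shifts n)" if "s \<ge> 1" for s
      by (rule character.evaluated_OSP[OF characterI[OF that] refl n])
  qed auto
qed

lemma D21_eq_OSP:
  "positive_root_set (D21 a) P = positive_root_set (OSP 1) P"
  "transl_groups (D21 a) = transl_groups (OSP 1)"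
  "denominator_identity (D21 a) P T = denominator_identity (OSP 1) P T"
proof -
  have r: "roots (D21 a) = roots (OSP 1)" by (simp add: roots_def)
  have d: "eps_dim (D21 a) = eps_dim (OSP 1)" "dlt_dim (D21 a) = dlt_dim (OSP 1)" by simp_all
  have p: "pairing (D21 a) = pairing (OSP 1)" unfolding fun_eq_iff pairing_def d by blast
  show "positive_root_set (D21 a) P = positive_root_set (OSP 1) P" unfolding positive_root_set_def r p ..
  have t: "transl (D21 a) = transl (OSP 1)" unfolding fun_eq_iff transl_def form_def d by blast
  then show "transl_groups (D21 a) = transl_groups (OSP 1)" by simp
  have ap: "aff_pos (D21 a) P = aff_pos (OSP 1) P" unfolding aff_pos_def r ..
  have Q: "aff_Q_plus (D21 a) P = aff_Q_plus (OSP 1) P" unfolding aff_Q_plus_def ap ..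
  have w: "aff_weights (D21 a) = aff_weights (OSP 1)" unfolding aff_weights_def d ..
  have R: "fsum_ring (D21 a) P = fsum_ring (OSP 1) P" unfolding fsum_ring_def Q w ..
  have e: "even_roots (D21 a) = even_roots (OSP 1)" "odd_roots (D21 a) = odd_roots (OSP 1)" "Defs.rank (D21 a) = Defs.rank (OSP 1)" by simp_all
  have pe: "pos_even (D21 a) P = pos_even (OSP 1) P" "pos_odd (D21 a) P = pos_odd (OSP 1) P" unfolding pos_even_def pos_odd_def e by (rule refl)+
  have rho: "rho (D21 a) P = rho (OSP 1) P" unfolding rho_def pe ..
  have ip: "inf_prod (D21 a) P = inf_prod (OSP 1) P" unfolding fun_eq_iff Defs.inf_prod_def R by blast
  have io: "inv_one_plus (D21 a) P = inv_one_plus (OSP 1) P" unfolding fun_eq_iff inv_one_plus_def ap R by blast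
  have td: "transl_den (D21 a) P = transl_den (OSP 1) P" unfolding fun_eq_iff transl_den_def R rho pe io by blast
  have ad: "aff_den (D21 a) P = aff_den (OSP 1) P"
    unfolding aff_den_def aff_den_R0_def aff_den_R1_inv_def den_R0_def den_R1_inv_def R e pe ip ..
  have ff: "f_factor (D21 a) P = f_factor (OSP 1) P" by (simp add: ip)
  show "denominator_identity (D21 a) P T = denominator_identity (OSP 1) P T"
    unfolding denominator_identity_def td ad ff rho R ..
qed

theorem mainTheorem1:
  shows "(\<forall>n P T. n \<ge> 1 \<longrightarrow> positive_root_set (GL n) P \<longrightarrow> T \<in> transl_groups (GL n) \<longrightarrow>
            denominator_identity (GL n) P T) \<and>
         (\<forall>n P T. n \<ge> 1 \<longrightarrow> positive_root_set (OSP n) P \<longrightarrow> T \<in> transl_groups (OSP n) \<longrightarrow>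
            denominator_identity (OSP n) P T) \<and>
         (\<forall>a P T. a \<noteq> 0 \<longrightarrow> a \<noteq> -1 \<longrightarrow> positive_root_set (D21 a) P \<longrightarrow>
            T \<in> transl_groups (D21 a) \<longrightarrow> denominator_identity (D21 a) P T)"
proof (intro conjI allI impI)
  fix n P T assume "n \<ge> 1" "positive_root_set (GL n) P" "T \<in> transl_groups (GL n)"
  then show "denominator_identity (GL n) P T" by (rule identity_GL)
next
  fix n P T assume "n \<ge> 1" "positive_root_set (OSP n) P" "T \<in> transl_groups (OSP n)"
  then show "denominator_identity (OSP n) P T" by (rule identity_OSP)
next
  fix a P T assume "positive_root_set (D21 a) P" "T \<in> transl_groups (D21 a)"
  then have "positive_root_set (OSP 1) P" "T \<in> transl_groups (OSP 1)"
    unfolding D21_eq_OSP(1)[of a] D21_eq_OSP(2)[of a] .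
  then show "denominator_identity (D21 a) P T" unfolding D21_eq_OSP(3) by (rule identity_OSP[OF order_refl])
qed

end
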